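(* Let $T_{a,b,c}$ be a minuscule Dynkin diagram, i.e. $(a,b,c)$ is one of: $(s+1,1,n+1)$ with $n\ge2$, $1\le s\le n$, $r=n+2$; $(2,2,n)$ with $n\ge3$, $r=n+2$; $(2,3,3)$; $(2,4,3)$. Let $f$ be the normalized orthogonal projection of the $(-1)$-divisors of $X_{a,b,c}$ to $K^\perp\otimes\mathbb{R}$. Then the images under $f$ of the $(-1)$-divisors are precisely the vertices of a polytope which, up to similarity, is: - for $T_{s+1,1,n+1}$ (type $A_{r+s-1}$): the hypersimplex $\Delta(r-1,r+s)$; - for $T_{2,2,n}$ (type $D_r$): the demicube $\Phi(r)$; - for $T_{2,3,3}$ (type $E_6$): the Gosset polytope $2_{21}$; - for $T_{2,4,3}$ (type $E_7$): the Hess polytope $3_{21}$. Moreover the $(-1)$-divisors are in canonical bijection with the weights of the following representation of the semisimple Lie algebra with Dynkin diagram $T_{a,b,c}$: - $\bigwedge^{r-1}(\mathbb{C}^{r+s})$ of $\mathfrak{sl}_{r+s}$ for $T_{s+1,1,n+1}$; - the half-spin representation $S^+$ of $\mathfrak{so}_{2r}$ for $T_{2,2,n}$; - the $27$-dimensional irreducible representation $J$ of $\mathfrak{e}_6$ for $T_{2,3,3}$; - the $56$-dimensional irreducible representation $W$ of $\mathfrak{e}_7$ for $T_{2,4,3}$.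
   Context: Geometry. Let $a,b,c$ be positive integers with $a,c\ge2$, $a\le c$, and $c>2$ if $a=2$; put $r:=b+c$. $T_{a,b,c}$ is the T-shaped tree whose three arms have $a,b,c$ vertices, the central vertex being counted in each. $X_{a,b,c}$ is the blow-up of $(\mathbb{P}^{c-1})^{a-1}$ at $b+c$ general points. $\mathrm{Pic}(X_{a,b,c})$ is the free $\mathbb{Z}$-module with basis $H_1,\dots,H_{a-1},E_1,\dots,E_r$ and symmetric bilinear form $E_i\cdot E_j=-\delta_{ij}$, $H_i\cdot H_j=c-1-\delta_{ij}$, $H_i\cdot E_j=0$. The canonical class is $K=-c\sum_iH_i+(ac-a-c)\sum_jE_j$. The classes $\alpha_i=E_i-E_{i+1}$ ($1\le i\le r-1$), $\alpha_r=H_1-E_1-\dots-E_c$, $\alpha_{r+i}=H_{i+1}-H_i$ ($1\le i\le a-2$) are simple roots in $K^\perp$ of a root system with Dynkin diagram $T_{a,b,c}$. The Weyl group is generated by the reflections $D\mapsto D+(D\cdot\alpha_i)\alpha_i$. The $(-1)$-divisors are the elements of the Weyl orbit of $E_r$. The negative of the form makes $K^\perp\otimes\mathbb{R}$ Euclidean. With $\delta=bc+ac+ab-abc$, the orthogonal projection of a $(-1)$-divisor is $q(V)=V+\frac1\delta K$, and $f(V)=\left(1+\frac{ac-a-c}{\delta}\right)^{-1/2}q(V)$. Canonical bijection: let $\omega_i\in K^\perp\otimes\mathbb{Q}$ be defined by $\omega_i\cdot\alpha_j=\delta_{ij}$, and identify $K^\perp\otimes\mathbb{R}$ with the real span of the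 weights of the Lie algebra so that $\omega_i$ becomes the fundamental weight at the $i$-th node (with the diagram labelled so that the stated representation is the irreducible one of highest weight $\omega_{r-1}$). The bijection is $V\mapsto q(V)$; in particular $q(E_r)=\omega_{r-1}$. Polytopes: $\Delta(k,N)$ is the convex hull of the $0/1$ vectors in $\mathbb{R}^N$ with exactly $k$ ones. $\Phi(r)$ is the convex hull of the $0/1$ vectors in $\mathbb{R}^r$ with an even number of ones. $2_{21}$ and $3_{21}$ are the semiregular polytopes in Coxeter's notation $k_{21}$, of dimensions $6$ and $7$ with $27$ and $56$ vertices respectively. *)

theory Defs
  imports "HOL-Analysis.Analysis" "HOL-Analysis.Finite_Function_Topology"
begin

text \<open>
  Throughout, \<open>a\<close>, \<open>b\<close>, \<open>c\<close> are the parameters of the variety, which is blown up in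
  \<open>r = b + c\<close> points. Divisor classes are finitely supported integer vectors on the symbols
  \<open>Hcl i\<close> (pulled-back hyperplane classes) and \<open>Ecl j\<close> (exceptional classes); only the
  symbols in \<open>pic_basis a b c\<close> belong to the Picard group at hand.
\<close>

datatype pic_gen = Hcl nat | Ecl nat

definition pic_basis :: "nat \<Rightarrow> nat \<Rightarrow> nat \<Rightarrow> pic_gen set" where
  "pic_basis a b c = Hcl ` {1..a - 1} \<union> Ecl ` {1..b + c}"

fun pic_gram :: "nat \<Rightarrow> pic_gen \<Rightarrow> pic_gen \<Rightarrow> int" where
  "pic_gram c (Hcl i) (Hcl j) = int c - 1 - (if i = j then 1 else 0)"
| "pic_gram c (Ecl i) (Ecl j) = - (if i = j then 1 else 0)"
| "pic_gram c (Hcl i) (Ecl j) = 0"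
| "pic_gram c (Ecl i) (Hcl j) = 0"

definition pic_form ::
    "nat \<Rightarrow> (pic_gen \<Rightarrow>\<^sub>0 'k::comm_ring_1) \<Rightarrow> (pic_gen \<Rightarrow>\<^sub>0 'k) \<Rightarrow> 'k" where
  "pic_form c x y = (\<Sum>i\<in>Poly_Mapping.keys x. \<Sum>j\<in>Poly_Mapping.keys y.
     Poly_Mapping.lookup x i * Poly_Mapping.lookup y j * of_int (pic_gram c i j))"

abbreviation Hdiv :: "nat \<Rightarrow> (pic_gen \<Rightarrow>\<^sub>0 int)" where
  "Hdiv i \<equiv> Poly_Mapping.single (Hcl i) 1"

abbreviation Ediv :: "nat \<Rightarrow> (pic_gen \<Rightarrow>\<^sub>0 int)" where
  "Ediv j \<equiv> Poly_Mapping.single (Ecl j) 1"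

definition canonical_class :: "nat \<Rightarrow> nat \<Rightarrow> nat \<Rightarrow> (pic_gen \<Rightarrow>\<^sub>0 int)" where
  "canonical_class a b c =
     frag_cmul (- int c) (\<Sum>i=1..a - 1. Hdiv i)
     + frag_cmul (int (a * c) - int a - int c) (\<Sum>j=1..b + c. Ediv j)"

definition simple_root :: "nat \<Rightarrow> nat \<Rightarrow> nat \<Rightarrow> nat \<Rightarrow> (pic_gen \<Rightarrow>\<^sub>0 int)" where
  "simple_root a b c i =
     (if i < b + c then Ediv i - Ediv (i + 1)
      else if i = b + c then Hdiv 1 - (\<Sum>j=1..c. Ediv j)
      else Hdiv (i - (b + c) + 1) - Hdiv (i - (b + c)))"

definition nodes :: "nat \<Rightarrow> nat \<Rightarrow> nat \<Rightarrow> nat set" where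
  "nodes a b c = {1..a + b + c - 2}"

text \<open>
  The reflections are involutions, so closing up under them from \<open>E\<^sub>r\<close> produces exactly
  the orbit of \<open>E\<^sub>r\<close> under the Weyl group.
\<close>

inductive_set minus_one_divisors :: "nat \<Rightarrow> nat \<Rightarrow> nat \<Rightarrow> (pic_gen \<Rightarrow>\<^sub>0 int) set"
  for a b c :: nat where
  base: "Ediv (b + c) \<in> minus_one_divisors a b c"
| reflect: "\<lbrakk>D \<in> minus_one_divisors a b c; i \<in> nodes a b c\<rbrakk> \<Longrightarrow>
    D + frag_cmul (pic_form c D (simple_root a b c i)) (simple_root a b c i)
      \<in> minus_one_divisors a b c"

definition realify :: "(pic_gen \<Rightarrow>\<^sub>0 int) \<Rightarrow> (pic_gen \<Rightarrow>\<^sub>0 real)" where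
  "realify D = Poly_Mapping.map of_int D"

text \<open>\<open>K\<^sup>\<bottom> \<otimes> \<real>\<close>, Euclidean for the negative of the intersection form.\<close>

definition Kperp :: "nat \<Rightarrow> nat \<Rightarrow> nat \<Rightarrow> (pic_gen \<Rightarrow>\<^sub>0 real) set" where
  "Kperp a b c = {x. Poly_Mapping.keys x \<subseteq> pic_basis a b c \<and>
     pic_form c x (realify (canonical_class a b c)) = 0}"

definition Kperp_dist :: "nat \<Rightarrow> (pic_gen \<Rightarrow>\<^sub>0 real) \<Rightarrow> (pic_gen \<Rightarrow>\<^sub>0 real) \<Rightarrow> real" where
  "Kperp_dist c x y = sqrt (- pic_form c (x - y) (x - y))"

definition pic_delta :: "nat \<Rightarrow> nat \<Rightarrow> nat \<Rightarrow> real" where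
  "pic_delta a b c = real (b * c) + real (a * c) + real (a * b) - real (a * b * c)"

definition proj :: "nat \<Rightarrow> nat \<Rightarrow> nat \<Rightarrow> (pic_gen \<Rightarrow>\<^sub>0 int) \<Rightarrow> (pic_gen \<Rightarrow>\<^sub>0 real)" where
  "proj a b c V = realify V + (1 / pic_delta a b c) *\<^sub>R realify (canonical_class a b c)"

definition nproj :: "nat \<Rightarrow> nat \<Rightarrow> nat \<Rightarrow> (pic_gen \<Rightarrow>\<^sub>0 int) \<Rightarrow> (pic_gen \<Rightarrow>\<^sub>0 real)" where
  "nproj a b c V =
     (1 + (real (a * c) - real a - real c) / pic_delta a b c) powr (- 1 / 2) *\<^sub>R proj a b c V"

text \<open>
  \<open>omega a b c i\<close> is the vector dual to the \<open>i\<close>-th simple root. Since the form is definite on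
  \<open>Kperp\<close> and the simple roots are rational vectors spanning it, this vector is unique in
  \<open>K\<^sup>\<bottom> \<otimes> \<real>\<close> and lies in \<open>K\<^sup>\<bottom> \<otimes> \<rat>\<close>.
\<close>

definition omega :: "nat \<Rightarrow> nat \<Rightarrow> nat \<Rightarrow> nat \<Rightarrow> (pic_gen \<Rightarrow>\<^sub>0 real)" where
  "omega a b c i = (THE w. w \<in> Kperp a b c \<and>
     (\<forall>j\<in>nodes a b c. pic_form c w (realify (simple_root a b c j)) = (if i = j then 1 else 0)))"

text \<open>
  \<open>\<real>\<^sup>N\<close> is the space of vectors \<open>nat \<Rightarrow>\<^sub>0 real\<close> supported on \<open>{..<N}\<close>. The library norm on
  \<open>\<Rightarrow>\<^sub>0\<close> is the \<open>\<ell>\<^sup>1\<close> norm, hence the explicit Euclidean inner product and distance.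
\<close>

definition dotp :: "(nat \<Rightarrow>\<^sub>0 real) \<Rightarrow> (nat \<Rightarrow>\<^sub>0 real) \<Rightarrow> real" where
  "dotp x y = (\<Sum>i\<in>Poly_Mapping.keys x. Poly_Mapping.lookup x i * Poly_Mapping.lookup y i)"

definition euclid_dist :: "(nat \<Rightarrow>\<^sub>0 real) \<Rightarrow> (nat \<Rightarrow>\<^sub>0 real) \<Rightarrow> real" where
  "euclid_dist x y = sqrt (dotp (x - y) (x - y))"

definition zero_one :: "nat set \<Rightarrow> (nat \<Rightarrow>\<^sub>0 real)" where
  "zero_one I = (\<Sum>i\<in>I. Poly_Mapping.single i 1)"

definition hypersimplex :: "nat \<Rightarrow> nat \<Rightarrow> (nat \<Rightarrow>\<^sub>0 real) set" where
  "hypersimplex k N = convex hull (zero_one ` {I. I \<subseteq> {..<N} \<and> card I = k})"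

definition demicube :: "nat \<Rightarrow> (nat \<Rightarrow>\<^sub>0 real) set" where
  "demicube r = convex hull (zero_one ` {I. I \<subseteq> {..<r} \<and> even (card I)})"

text \<open>
  Coxeter's polytopes \<open>k\<^sub>2\<^sub>1\<close>: the vertices of \<open>4\<^sub>2\<^sub>1\<close> are the 240 roots of \<open>E\<^sub>8\<close> in Gosset's
  coordinates, and \<open>(k - 1)\<^sub>2\<^sub>1\<close> is the vertex figure of \<open>k\<^sub>2\<^sub>1\<close>, i.e. the convex hull of the
  vertices joined to a fixed vertex by an edge. Vertices of \<open>4\<^sub>2\<^sub>1\<close> have squared norm 2, and two of
  them are joined by an edge iff their inner product is 1. So \<open>3\<^sub>2\<^sub>1\<close> has as vertices the 56 roots
  adjacent to \<open>u\<close>, and \<open>2\<^sub>2\<^sub>1\<close> has as vertices the 27 roots adjacent to both of two adjacent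
  roots \<open>u\<close>, \<open>v\<close>. Here \<open>u = (1,1,0,\<dots>,0)\<close> and \<open>v = (1,0,1,0,\<dots>,0)\<close>.
\<close>

definition e8_roots :: "(nat \<Rightarrow>\<^sub>0 real) set" where
  "e8_roots =
     {Poly_Mapping.single i s + Poly_Mapping.single j t | i j s t.
        i < j \<and> j < 8 \<and> s \<in> {1, - 1} \<and> t \<in> {1, - 1}}
     \<union> {\<Sum>i<8. Poly_Mapping.single i (s i / 2) | s.
        (\<forall>i<8. s i \<in> {1, - 1}) \<and> (\<Prod>i<8. s i) = 1}"

definition gosset_3_21 :: "(nat \<Rightarrow>\<^sub>0 real) set" where
  "gosset_3_21 = convex hull {w \<in> e8_roots. dotp w (zero_one {0, 1}) = 1}"

definition gosset_2_21 :: "(nat \<Rightarrow>\<^sub>0 real) set" where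
  "gosset_2_21 = convex hull
     {w \<in> e8_roots. dotp w (zero_one {0, 1}) = 1 \<and> dotp w (zero_one {0, 2}) = 1}"

text \<open>
  Similarity of a subset of \<open>K\<^sup>\<bottom> \<otimes> \<real>\<close> with a subset of a coordinate space: a map of
  the ambient Euclidean spaces scaling all distances by a constant takes one onto the other.
\<close>

definition similar_polytope ::
    "nat \<Rightarrow> nat \<Rightarrow> nat \<Rightarrow> (pic_gen \<Rightarrow>\<^sub>0 real) set \<Rightarrow> (nat \<Rightarrow>\<^sub>0 real) set \<Rightarrow> bool" where
  "similar_polytope a b c P Q \<longleftrightarrow>
     (\<exists>\<phi> t. t > 0 \<and>
        (\<forall>x\<in>Kperp a b c. \<forall>y\<in>Kperp a b c. euclid_dist (\<phi> x) (\<phi> y) = t * Kperp_dist c x y) \<and>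
        \<phi> ` P = Q)"

definition images_are_vertices_of ::
    "nat \<Rightarrow> nat \<Rightarrow> nat \<Rightarrow> (nat \<Rightarrow>\<^sub>0 real) set \<Rightarrow> bool" where
  "images_are_vertices_of a b c Q \<longleftrightarrow>
     (\<exists>P. polytope P \<and> P \<subseteq> Kperp a b c \<and>
        nproj a b c ` minus_one_divisors a b c = {x. x extreme_point_of P} \<and>
        similar_polytope a b c P Q)"

text \<open>
  Vector spaces are subspaces of a type carrying a complex scalar multiplication; everything
  is finite-dimensional.
\<close>

definition fin_dim_space :: "(complex \<Rightarrow> 'v \<Rightarrow> 'v) \<Rightarrow> 'v::ab_group_add set \<Rightarrow> bool" where
  "fin_dim_space sc V \<longleftrightarrow> vector_space sc \<and> (\<exists>B. finite B \<and> V = module.span sc B)"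

record 'g lie_algebra =
  lscale :: "complex \<Rightarrow> 'g \<Rightarrow> 'g"
  lcarrier :: "'g set"
  lbracket :: "'g \<Rightarrow> 'g \<Rightarrow> 'g"

definition is_lie_algebra :: "'g::ab_group_add lie_algebra \<Rightarrow> bool" where
  "is_lie_algebra g \<longleftrightarrow>
     (let L = lcarrier g; br = lbracket g; sc = lscale g in
      fin_dim_space sc L \<and>
      (\<forall>x\<in>L. \<forall>y\<in>L. br x y \<in> L) \<and>
      (\<forall>x\<in>L. \<forall>y\<in>L. \<forall>z\<in>L. br (x + y) z = br x z + br y z \<and> br z (x + y) = br z x + br z y) \<and>
      (\<forall>k. \<forall>x\<in>L. \<forall>y\<in>L. br (sc k x) y = sc k (br x y) \<and> br x (sc k y) = sc k (br x y)) \<and>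
      (\<forall>x\<in>L. br x x = 0) \<and>
      (\<forall>x\<in>L. \<forall>y\<in>L. \<forall>z\<in>L. br x (br y z) + br y (br z x) + br z (br x y) = 0))"

record ('g, 'v) lie_module =
  mscale :: "complex \<Rightarrow> 'v \<Rightarrow> 'v"
  mcarrier :: "'v set"
  maction :: "'g \<Rightarrow> 'v \<Rightarrow> 'v"

definition is_lie_module ::
    "'g::ab_group_add lie_algebra \<Rightarrow> ('g, 'v::ab_group_add) lie_module \<Rightarrow> bool" where
  "is_lie_module g M \<longleftrightarrow>
     (let L = lcarrier g; V = mcarrier M; act = maction M in
      fin_dim_space (mscale M) V \<and>
      (\<forall>x\<in>L. \<forall>v\<in>V. act x v \<in> V) \<and>
      (\<forall>x\<in>L. \<forall>y\<in>L. \<forall>v\<in>V. act (x + y) v = act x v + act y v) \<and>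
      (\<forall>x\<in>L. \<forall>v\<in>V. \<forall>w\<in>V. act x (v + w) = act x v + act x w) \<and>
      (\<forall>k. \<forall>x\<in>L. \<forall>v\<in>V. act (lscale g k x) v = mscale M k (act x v) \<and>
                            act x (mscale M k v) = mscale M k (act x v)) \<and>
      (\<forall>x\<in>L. \<forall>y\<in>L. \<forall>v\<in>V. act (lbracket g x y) v = act x (act y v) - act y (act x v)))"

definition irreducible_module ::
    "'g lie_algebra \<Rightarrow> ('g, 'v::ab_group_add) lie_module \<Rightarrow> bool" where
  "irreducible_module g M \<longleftrightarrow> mcarrier M \<noteq> {0} \<and>
     (\<forall>U. module.subspace (mscale M) U \<and> U \<subseteq> mcarrier M \<and>
          (\<forall>x\<in>lcarrier g. \<forall>u\<in>U. maction M x u \<in> U) \<longrightarrow>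
        U = {0} \<or> U = mcarrier M)"

definition module_dim :: "('g, 'v::ab_group_add) lie_module \<Rightarrow> nat" where
  "module_dim M = vector_space.dim (mscale M) (mcarrier M)"

text \<open>
  The Dynkin diagram \<open>T\<^bsub>a,b,c\<^esub>\<close>, labelled like the simple roots \<open>simple_root a b c\<close>: nodes
  \<open>1, \<dots>, b + c - 1\<close> form a path, node \<open>c\<close> is the centre, and the remaining \<open>a - 1\<close> nodes
  \<open>b + c, \<dots>, a + b + c - 2\<close> form the third arm, attached to the centre through \<open>b + c\<close>.
\<close>

definition T_edge :: "nat \<Rightarrow> nat \<Rightarrow> nat \<Rightarrow> nat \<Rightarrow> nat \<Rightarrow> bool" where
  "T_edge a b c i j \<longleftrightarrow> i \<in> nodes a b c \<and> j \<in> nodes a b c \<and>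
     ((j = i + 1 \<and> j \<noteq> b + c) \<or> (i = j + 1 \<and> i \<noteq> b + c) \<or>
      (i = c \<and> j = b + c) \<or> (i = b + c \<and> j = c))"

definition T_cartan_matrix :: "nat \<Rightarrow> nat \<Rightarrow> nat \<Rightarrow> nat \<Rightarrow> nat \<Rightarrow> int" where
  "T_cartan_matrix a b c i j = (if i = j then 2 else if T_edge a b c i j then - 1 else 0)"

text \<open>
  \<open>chevalley_generators g I A e f h\<close>: the elements \<open>e i\<close>, \<open>f i\<close>, \<open>h i\<close> (\<open>i \<in> I\<close>) generate \<open>g\<close>,
  satisfy the Chevalley--Serre relations for the Cartan matrix \<open>A\<close>, and the \<open>h i\<close> are linearly
  independent. By Serre's theorem the Lie algebras having such generators for the Cartan matrix
  of a Dynkin diagram are exactly the semisimple Lie algebras with that Dynkin diagram, and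
  the span of the \<open>h i\<close> is then a Cartan subalgebra with simple coroots \<open>h i\<close>.
\<close>

definition chevalley_generators ::
    "'g::ab_group_add lie_algebra \<Rightarrow> nat set \<Rightarrow> (nat \<Rightarrow> nat \<Rightarrow> int) \<Rightarrow>
     (nat \<Rightarrow> 'g) \<Rightarrow> (nat \<Rightarrow> 'g) \<Rightarrow> (nat \<Rightarrow> 'g) \<Rightarrow> bool" where
  "chevalley_generators g I A e f h \<longleftrightarrow>
     (let L = lcarrier g; br = lbracket g; sc = lscale g in
      e ` I \<union> f ` I \<union> h ` I \<subseteq> L \<and>
      (\<forall>i\<in>I. \<forall>j\<in>I. br (h i) (h j) = 0 \<and>
         br (h i) (e j) = sc (of_int (A i j)) (e j) \<and>
         br (h i) (f j) = sc (- of_int (A i j)) (f j) \<and>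
         br (e i) (f j) = (if i = j then h i else 0)) \<and>
      (\<forall>i\<in>I. \<forall>j\<in>I. i \<noteq> j \<longrightarrow>
         (br (e i) ^^ nat (1 - A i j)) (e j) = 0 \<and>
         (br (f i) ^^ nat (1 - A i j)) (f j) = 0) \<and>
      (\<forall>k. (\<Sum>i\<in>I. sc (k i) (h i)) = 0 \<longrightarrow> (\<forall>i\<in>I. k i = 0)) \<and>
      (\<forall>S. module.subspace sc S \<and> S \<subseteq> L \<and> (\<forall>x\<in>S. \<forall>y\<in>S. br x y \<in> S) \<and>
           e ` I \<union> f ` I \<union> h ` I \<subseteq> S \<longrightarrow> S = L))"

definition cartan :: "'g::ab_group_add lie_algebra \<Rightarrow> nat set \<Rightarrow> (nat \<Rightarrow> 'g) \<Rightarrow> 'g set" where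
  "cartan g I h = module.span (lscale g) (h ` I)"

text \<open>Linear functionals on the Cartan subalgebra are extended by 0 outside of it.\<close>

definition cartan_dual ::
    "'g::ab_group_add lie_algebra \<Rightarrow> nat set \<Rightarrow> (nat \<Rightarrow> 'g) \<Rightarrow> ('g \<Rightarrow> complex) set" where
  "cartan_dual g I h =
     {l. (\<forall>x\<in>cartan g I h. \<forall>y\<in>cartan g I h. l (x + y) = l x + l y) \<and>
         (\<forall>k. \<forall>x\<in>cartan g I h. l (lscale g k x) = k * l x) \<and>
         (\<forall>x. x \<notin> cartan g I h \<longrightarrow> l x = 0)}"

text \<open>The real span of the weight lattice, i.e. of the fundamental weights.\<close>

definition real_weight_space ::
    "'g::ab_group_add lie_algebra \<Rightarrow> nat set \<Rightarrow> (nat \<Rightarrow> 'g) \<Rightarrow> ('g \<Rightarrow> complex) set" where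
  "real_weight_space g I h = {l \<in> cartan_dual g I h. \<forall>i\<in>I. l (h i) \<in> \<real>}"

definition weights ::
    "'g::ab_group_add lie_algebra \<Rightarrow> ('g, 'v::ab_group_add) lie_module \<Rightarrow>
     nat set \<Rightarrow> (nat \<Rightarrow> 'g) \<Rightarrow> ('g \<Rightarrow> complex) set" where
  "weights g M I h = {l \<in> cartan_dual g I h. \<exists>v\<in>mcarrier M. v \<noteq> 0 \<and>
     (\<forall>x\<in>cartan g I h. maction M x v = mscale M (l x) v)}"

text \<open>
  \<open>g\<close> has Dynkin diagram \<open>T\<^bsub>a,b,c\<^esub>\<close>, the Chevalley generators being labelled in such a way that
  the module \<open>M\<close> is irreducible with highest weight the fundamental weight of node \<open>r - 1\<close>.
\<close>

definition labelled_module ::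
    "nat \<Rightarrow> nat \<Rightarrow> nat \<Rightarrow> 'g::ab_group_add lie_algebra \<Rightarrow> ('g, 'v::ab_group_add) lie_module \<Rightarrow>
     (nat \<Rightarrow> 'g) \<Rightarrow> (nat \<Rightarrow> 'g) \<Rightarrow> (nat \<Rightarrow> 'g) \<Rightarrow> bool" where
  "labelled_module a b c g M e f h \<longleftrightarrow>
     is_lie_algebra g \<and>
     chevalley_generators g (nodes a b c) (T_cartan_matrix a b c) e f h \<and>
     is_lie_module g M \<and> irreducible_module g M \<and>
     (\<exists>v\<in>mcarrier M. v \<noteq> 0 \<and> (\<forall>i\<in>nodes a b c. maction M (e i) v = 0 \<and>
        maction M (h i) v = mscale M (if i = b + c - 1 then 1 else 0) v))"

text \<open>
  \<open>\<iota>\<close> is the linear isomorphism from \<open>K\<^sup>\<bottom> \<otimes> \<real>\<close> to the real span of the weights of \<open>g\<close> that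
  takes each \<open>omega a b c i\<close> to the \<open>i\<close>-th fundamental weight.
\<close>

definition canonical_identification ::
    "nat \<Rightarrow> nat \<Rightarrow> nat \<Rightarrow> 'g::ab_group_add lie_algebra \<Rightarrow> (nat \<Rightarrow> 'g) \<Rightarrow>
     ((pic_gen \<Rightarrow>\<^sub>0 real) \<Rightarrow> 'g \<Rightarrow> complex) \<Rightarrow> bool" where
  "canonical_identification a b c g h \<iota> \<longleftrightarrow>
     bij_betw \<iota> (Kperp a b c) (real_weight_space g (nodes a b c) h) \<and>
     (\<forall>x\<in>Kperp a b c. \<forall>y\<in>Kperp a b c. \<forall>z. \<iota> (x + y) z = \<iota> x z + \<iota> y z) \<and>
     (\<forall>t. \<forall>x\<in>Kperp a b c. \<forall>z. \<iota> (t *\<^sub>R x) z = of_real t * \<iota> x z) \<and>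
     (\<forall>i\<in>nodes a b c. \<forall>j\<in>nodes a b c. \<iota> (omega a b c i) (h j) = (if i = j then 1 else 0))"

definition canonical_weight_bijection ::
    "nat \<Rightarrow> nat \<Rightarrow> nat \<Rightarrow> 'g::ab_group_add lie_algebra \<Rightarrow> ('g, 'v::ab_group_add) lie_module \<Rightarrow>
     (nat \<Rightarrow> 'g) \<Rightarrow> bool" where
  "canonical_weight_bijection a b c g M h \<longleftrightarrow>
     proj a b c (Ediv (b + c)) = omega a b c (b + c - 1) \<and>
     (\<exists>\<iota>. canonical_identification a b c g h \<iota> \<and>
        bij_betw (\<lambda>V. \<iota> (proj a b c V)) (minus_one_divisors a b c) (weights g M (nodes a b c) h))"

definition cscale :: "complex \<Rightarrow> ('i \<Rightarrow>\<^sub>0 complex) \<Rightarrow> ('i \<Rightarrow>\<^sub>0 complex)" where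
  "cscale k x = Poly_Mapping.map (\<lambda>z. k * z) x"

text \<open>\<open>N \<times> N\<close> matrices are vectors \<open>nat \<times> nat \<Rightarrow>\<^sub>0 complex\<close> supported on \<open>{..<N} \<times> {..<N}\<close>.\<close>

type_synonym cmatrix = "nat \<times> nat \<Rightarrow>\<^sub>0 complex"

abbreviation entry :: "cmatrix \<Rightarrow> nat \<Rightarrow> nat \<Rightarrow> complex" where
  "entry X i j \<equiv> Poly_Mapping.lookup X (i, j)"

definition commutator :: "nat \<Rightarrow> cmatrix \<Rightarrow> cmatrix \<Rightarrow> cmatrix" where
  "commutator N X Y = (\<Sum>i<N. \<Sum>k<N. Poly_Mapping.single (i, k)
     (\<Sum>j<N. entry X i j * entry Y j k - entry Y i j * entry X j k))"

definition sl :: "nat \<Rightarrow> cmatrix lie_algebra" where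
  "sl N = \<lparr>lscale = cscale,
     lcarrier = {X. Poly_Mapping.keys X \<subseteq> {..<N} \<times> {..<N} \<and> (\<Sum>i<N. entry X i i) = 0},
     lbracket = commutator N\<rparr>"

text \<open>
  The special orthogonal Lie algebra of the form \<open>B\<close> on \<open>\<complex>\<^sup>2\<^sup>r\<close> with \<open>B (e\<^sub>i, e\<^sub>j) = 1\<close> if \<open>j\<close> is
  the partner \<open>i \<plusminus> r\<close> of \<open>i\<close> and 0 otherwise. The condition below reads
  \<open>B (X e\<^sub>j, e\<^sub>k) + B (e\<^sub>j, X e\<^sub>k) = 0\<close>.
\<close>

definition partner :: "nat \<Rightarrow> nat \<Rightarrow> nat" where
  "partner r i = (if i < r then i + r else i - r)"

definition so_even :: "nat \<Rightarrow> cmatrix lie_algebra" where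
  "so_even r = \<lparr>lscale = cscale,
     lcarrier = {X. Poly_Mapping.keys X \<subseteq> {..<2 * r} \<times> {..<2 * r} \<and>
       (\<forall>j<2 * r. \<forall>k<2 * r. entry X (partner r k) j + entry X (partner r j) k = 0)},
     lbracket = commutator (2 * r)\<rparr>"

text \<open>
  The exterior algebra of \<open>\<complex>\<^sup>N\<close> on the basis \<open>e\<^sub>I = e\<^bsub>i1\<^esub> \<and> \<dots> \<and> e\<^bsub>ik\<^esub>\<close> for
  \<open>I = {i1 < \<dots> < ik} \<subseteq> {..<N}\<close>, with left multiplication by \<open>e\<^sub>i\<close> and contraction with the dual
  basis vector of \<open>e\<^sub>i\<close>.
\<close>

definition wedge :: "nat \<Rightarrow> (nat set \<Rightarrow>\<^sub>0 complex) \<Rightarrow> (nat set \<Rightarrow>\<^sub>0 complex)" where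
  "wedge i \<psi> = (\<Sum>I\<in>Poly_Mapping.keys \<psi>. if i \<in> I then 0 else
     Poly_Mapping.single (insert i I) ((- 1) ^ card {j\<in>I. j < i} * Poly_Mapping.lookup \<psi> I))"

definition contract :: "nat \<Rightarrow> (nat set \<Rightarrow>\<^sub>0 complex) \<Rightarrow> (nat set \<Rightarrow>\<^sub>0 complex)" where
  "contract i \<psi> = (\<Sum>I\<in>Poly_Mapping.keys \<psi>. if i \<notin> I then 0 else
     Poly_Mapping.single (I - {i}) ((- 1) ^ card {j\<in>I. j < i} * Poly_Mapping.lookup \<psi> I))"

text \<open>
  A matrix \<open>X\<close> acts on the exterior algebra as the derivation extending its action on \<open>\<complex>\<^sup>N\<close>,
  i.e. as \<open>\<Sum>\<^sub>i\<^sub>j X\<^sub>i\<^sub>j wedge i \<circ> contract j\<close>.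
\<close>

definition exterior_power :: "nat \<Rightarrow> nat \<Rightarrow> (cmatrix, nat set \<Rightarrow>\<^sub>0 complex) lie_module" where
  "exterior_power k N = \<lparr>mscale = cscale,
     mcarrier = {\<psi>. Poly_Mapping.keys \<psi> \<subseteq> {I. I \<subseteq> {..<N} \<and> card I = k}},
     maction = (\<lambda>X \<psi>. \<Sum>i<N. \<Sum>j<N. cscale (entry X i j) (wedge i (contract j \<psi>)))\<rparr>"

text \<open>
  The spin representation on the exterior algebra of the isotropic subspace spanned by
  \<open>e\<^sub>0, \<dots>, e\<^bsub>r-1\<^esub>\<close>. The operators \<open>clifford r v\<close> satisfy
  \<open>clifford r u \<circ> clifford r v + clifford r v \<circ> clifford r u = B (u, v)\<close>; as the \<open>B\<close>-dual basis
  of \<open>e\<^sub>k\<close> is \<open>e\<^bsub>partner k\<^esub>\<close>, the action of \<open>X\<close> is one half of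
  \<open>\<Sum>\<^sub>k clifford r (X e\<^sub>k) \<circ> clifford r (e\<^bsub>partner k\<^esub>)\<close>, the element of the Clifford algebra
  whose commutator with \<open>clifford r v\<close> is \<open>clifford r (X v)\<close>. The half-spin representation is
  the even part.
\<close>

definition clifford :: "nat \<Rightarrow> (nat \<Rightarrow> complex) \<Rightarrow> (nat set \<Rightarrow>\<^sub>0 complex) \<Rightarrow> (nat set \<Rightarrow>\<^sub>0 complex)" where
  "clifford r v \<psi> = (\<Sum>i<r. cscale (v i) (wedge i \<psi>) + cscale (v (r + i)) (contract i \<psi>))"

definition half_spin :: "nat \<Rightarrow> (cmatrix, nat set \<Rightarrow>\<^sub>0 complex) lie_module" where
  "half_spin r = \<lparr>mscale = cscale,
     mcarrier = {\<psi>. Poly_Mapping.keys \<psi> \<subseteq> {I. I \<subseteq> {..<r} \<and> even (card I)}},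
     maction = (\<lambda>X \<psi>. cscale (1 / 2) (\<Sum>k<2 * r.
       clifford r (\<lambda>i. entry X i k)
         (clifford r (\<lambda>i. if i = partner r k then 1 else 0) \<psi>)))\<rparr>"

end

theory Submission
  imports Defs
begin

text \<open>
  The theorem says that, in the four listed families, the Weyl orbit of \<open>E\<^sub>r\<close> is the weight system
  of a minuscule representation, seen once as a vertex set and once as a set of weights. The
  decisive numerical fact is that every \<open>(-1)\<close>-divisor \<open>D\<close> has \<open>D \<sqdot> \<alpha>\<^sub>i \<in> {-1, 0, 1}\<close> for every
  simple root. It is read off from an explicit list of the orbit: subsets of a fixed size (type
  \<open>A\<close>), subsets of even size (type \<open>D\<close>), and the exceptional curves of the del Pezzo surfaces of
  degree 3 and 2 (types \<open>E\<^sub>6\<close> and \<open>E\<^sub>7\<close>). Such a list is the whole orbit because it is closed under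
  the simple reflections and every entry other than \<open>E\<^sub>r\<close> is moved by one of them to an entry of
  smaller rank (\<open>orbit_eqI\<close>).

  For the polytope, a linear map that is isometric on \<open>K\<^sup>\<bottom>\<close> carries the listed classes, up to a
  translation, to the vectors that span the hypersimplex, the demicube or the Gosset polytope. All
  \<open>(-1)\<close>-divisors have the same self-intersection and the same degree against \<open>K\<close>, so their
  projections lie on one sphere; a finite subset of a sphere consists of the extreme points of its
  convex hull (\<open>images_are_vertices_of_hull\<close>).

  For the weights, let \<open>v\<^sub>0\<close> be a highest weight vector of a finite-dimensional irreducible module
  whose highest weight has a finite orbit with all values in \<open>{-1, 0, 1}\<close>. The module is spanned by
  words in the lowering operators applied to \<open>v\<^sub>0\<close>, and an induction on the length that uses only
  \<open>sl\<^sub>2\<close>-theory shows that a word vanishes unless its weight lies in the orbit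
  (\<open>word_zero_or_orbit\<close>). So the weights are exactly the orbit, whatever the Lie algebra is. Since
  the value of \<open>q(V)\<close> on the \<open>i\<close>-th coroot is \<open>V \<sqdot> \<alpha>\<^sub>i\<close>, this orbit is the image of the
  \<open>(-1)\<close>-divisors, and a class of the orbit is determined by these numbers
  (\<open>minuscule_canonical_weight_bijection\<close>).

  It remains to see that the representations exist with Chevalley generators labelled by the
  T-shaped diagram. A criterion (\<open>labelled_module_minuscule\<close>) reduces this to a basis indexed by the
  orbit on which \<open>h\<^sub>i\<close> is diagonal and \<open>e\<^sub>i\<close>, \<open>f\<^sub>i\<close> move basis vectors along reflections: the Serre
  relations, the independence of the \<open>h\<^sub>i\<close> and irreducibility then follow. It is applied to exterior
  powers, to half-spin modules inside the exterior algebra, and, for \<open>E\<^sub>6\<close> and \<open>E\<^sub>7\<close>, to the Lie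
  algebra of matrices generated by the monomial operators on the orbit itself
  (\<open>minuscule_module_exists\<close>).
\<close>

section \<open>Minuscule highest weight modules\<close>

definition reflect_weight :: "(nat \<Rightarrow> nat \<Rightarrow> int) \<Rightarrow> nat \<Rightarrow> (nat \<Rightarrow> int) \<Rightarrow> nat \<Rightarrow> int" where
  "reflect_weight C i l = (\<lambda>j. l j - l i * C j i)"

inductive_set weight_orbit :: "(nat \<Rightarrow> nat \<Rightarrow> int) \<Rightarrow> nat set \<Rightarrow> (nat \<Rightarrow> int) \<Rightarrow> (nat \<Rightarrow> int) set"
  for C I l0 where
  base: "l0 \<in> weight_orbit C I l0"
| reflect: "l \<in> weight_orbit C I l0 \<Longrightarrow> i \<in> I \<Longrightarrow> reflect_weight C i l \<in> weight_orbit C I l0"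

text \<open>Raising, lowering and Cartan operators with their commutation relations, without an
  ambient Lie algebra. The same locale then serves for modules and, with either choice of
  the raising operators, for the adjoint action.\<close>

locale chevalley_rep = vector_space sc
  for sc :: "complex \<Rightarrow> 'v::ab_group_add \<Rightarrow> 'v" +
  fixes V :: "'v set" and I :: "nat set" and C :: "nat \<Rightarrow> nat \<Rightarrow> int"
    and E F H :: "nat \<Rightarrow> 'v \<Rightarrow> 'v"
  assumes V: "subspace V" and fin: "\<exists>B. finite B \<and> V \<subseteq> span B"
    and closed: "i \<in> I \<Longrightarrow> x \<in> V \<Longrightarrow> E i x \<in> V" "i \<in> I \<Longrightarrow> x \<in> V \<Longrightarrow> F i x \<in> V"
      "i \<in> I \<Longrightarrow> x \<in> V \<Longrightarrow> H i x \<in> V"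
    and lin: "i \<in> I \<Longrightarrow> x \<in> V \<Longrightarrow> y \<in> V \<Longrightarrow> E i (x + y) = E i x + E i y"
      "i \<in> I \<Longrightarrow> x \<in> V \<Longrightarrow> y \<in> V \<Longrightarrow> F i (x + y) = F i x + F i y"
      "i \<in> I \<Longrightarrow> x \<in> V \<Longrightarrow> y \<in> V \<Longrightarrow> H i (x + y) = H i x + H i y"
      "i \<in> I \<Longrightarrow> x \<in> V \<Longrightarrow> E i (sc k x) = sc k (E i x)"
      "i \<in> I \<Longrightarrow> x \<in> V \<Longrightarrow> F i (sc k x) = sc k (F i x)"
      "i \<in> I \<Longrightarrow> x \<in> V \<Longrightarrow> H i (sc k x) = sc k (H i x)"
    and HE: "i \<in> I \<Longrightarrow> j \<in> I \<Longrightarrow> x \<in> V \<Longrightarrow> H i (E j x) = E j (H i x) + sc (of_int (C i j)) (E j x)"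
    and HF: "i \<in> I \<Longrightarrow> j \<in> I \<Longrightarrow> x \<in> V \<Longrightarrow> H i (F j x) = F j (H i x) - sc (of_int (C i j)) (F j x)"
    and EF: "i \<in> I \<Longrightarrow> j \<in> I \<Longrightarrow> x \<in> V \<Longrightarrow> E i (F j x) = F j (E i x) + (if i = j then H i x else 0)"
    and C2: "i \<in> I \<Longrightarrow> C i i = 2"
begin

lemma zeros: "i \<in> I \<Longrightarrow> E i 0 = 0" "i \<in> I \<Longrightarrow> F i 0 = 0" "i \<in> I \<Longrightarrow> H i 0 = 0"
  using lin(4-6)[of i 0 0] subspace_0[OF V] by auto

lemma V_scale: "x \<in> V \<Longrightarrow> sc k x \<in> V"
  using subspace_scale[OF V] .

lemma V_add: "x \<in> V \<Longrightarrow> y \<in> V \<Longrightarrow> x + y \<in> V"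
  using subspace_add[OF V] .

lemma minus_lin:
  assumes "i \<in> I" "x \<in> V" "y \<in> V"
  shows "E i (x - y) = E i x - E i y" "F i (x - y) = F i x - F i y" "H i (x - y) = H i x - H i y"
proof -
  have m: "sc (-1) y \<in> V" using V_scale assms by blast
  show "E i (x - y) = E i x - E i y" "F i (x - y) = F i x - F i y" "H i (x - y) = H i x - H i y"
    using lin(1-3)[OF assms(1,2) m] lin(4-6)[OF assms(1,3), of "-1"] by simp_all
qed

definition wv :: "(nat \<Rightarrow> int) \<Rightarrow> 'v \<Rightarrow> bool" where
  "wv l x \<longleftrightarrow> x \<in> V \<and> (\<forall>i\<in>I. H i x = sc (of_int (l i)) x)"

lemma subspace_wv: "subspace {x. wv l x}"
  by (rule subspaceI)
     (auto simp: wv_def subspace_0[OF V] V_add V_scale lin zeros scale_right_distrib mult.commute)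

lemma wv_V: "wv l x \<Longrightarrow> x \<in> V" by (simp add: wv_def)

lemma wv_E: "wv l x \<Longrightarrow> j \<in> I \<Longrightarrow> wv (\<lambda>i. l i + C i j) (E j x)"
  by (auto simp: wv_def closed HE lin scale_left_distrib)

lemma wv_F: "wv l x \<Longrightarrow> j \<in> I \<Longrightarrow> wv (\<lambda>i. l i - C i j) (F j x)"
  by (auto simp: wv_def closed HF lin scale_left_diff_distrib)

text \<open>A vector whose weight is negative at \<open>i\<close> and that is killed by \<open>E i\<close> would generate a free
  module over \<open>F i\<close>, which finite dimension excludes.\<close>

lemma negative_highest_vector_zero:
  assumes i: "i \<in> I" and y: "y \<in> V" "E i y = 0" "H i y = sc (of_int m) y" "m < 0"
  shows "y = 0"
proof -
  define f where "f n = (F i ^^ n) y" for n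
  have fV: "f n \<in> V" for n by (induction n) (auto simp: f_def y closed i)
  have Hf: "H i (f n) = sc (of_int (m - 2 * int n)) (f n)" for n
  proof (induction n)
    case (Suc n)
    have "f (Suc n) = F i (f n)" by (simp add: f_def)
    then have "H i (f (Suc n)) = sc (of_int (m - 2 * int n)) (f (Suc n)) - sc 2 (f (Suc n))"
      using HF[OF i i fV[of n]] Suc C2[OF i] lin(5)[OF i fV[of n]] by simp
    also have "\<dots> = sc (of_int (m - 2 * int n) - 2) (f (Suc n))" by (simp only: scale_left_diff_distrib)
    also have "of_int (m - 2 * int n) - 2 = (of_int (m - 2 * int (Suc n)) :: complex)" by simp
    finally show ?case .
  qed (simp add: f_def y)
  \<comment> \<open>The factor vanishes for no n, as m is negative; so E leads back from f n to a multiple of y.\<close>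
  have Ef: "E i (f (Suc n)) = sc (of_int ((int n + 1) * (m - int n))) (f n)" for n
  proof (induction n)
    case 0 
    have "E i (F i y) = F i (E i y) + H i y" using EF[OF i i y(1)] by simp
    then show ?case using y zeros i by (simp add: f_def)
  next
    case (Suc n)
    have "E i (f (Suc (Suc n))) = F i (E i (f (Suc n))) + H i (f (Suc n))"
      using EF[OF i i fV[of "Suc n"]] by (simp add: f_def)
    also have "F i (E i (f (Suc n))) = sc (of_int ((int n + 1) * (m - int n))) (f (Suc n))"
      unfolding Suc using lin(5)[OF i fV[of n]] by (simp add: f_def)
    finally show ?case unfolding Hf
      by (simp only: scale_left_distrib[symmetric] of_int_add[symmetric]) (simp add: algebra_simps)
  qed
  have lower: "\<exists>k. k \<noteq> 0 \<and> (E i ^^ n) (f n) = sc k y" for n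
  proof (induction n)
    case 0 then show ?case by (auto intro!: exI[of _ 1] simp: f_def)
  next
    case (Suc n)
    then obtain k where k: "k \<noteq> 0" "(E i ^^ n) (f n) = sc k y" by auto
    have EnV: "x \<in> V \<Longrightarrow> (E i ^^ n) x \<in> V \<and> (E i ^^ n) (sc c x) = sc c ((E i ^^ n) x)" for c x n
      by (induction n) (auto simp: closed i lin)
    have "(E i ^^ Suc n) (f (Suc n)) = (E i ^^ n) (E i (f (Suc n)))" by (simp add: funpow_swap1)
    also have "\<dots> = sc (of_int ((int n + 1) * (m - int n)) * k) y"
      unfolding Ef using EnV[OF fV[of n]] k by simp
    finally show ?case using k y(4)
      by (intro exI[of _ "of_int ((int n + 1) * (m - int n)) * k"]) (auto simp del: of_int_mult of_int_add of_int_diff)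
  qed
  have kill: "k < n \<Longrightarrow> (E i ^^ n) (f k) = 0" for k n
  proof (induction n arbitrary: k)
    case (Suc n)
    have "(E i ^^ Suc n) (f k) = (E i ^^ n) (E i (f k))" by (simp add: funpow_swap1)
    also have "\<dots> = 0"
    proof (cases k)
      case 0 
      have "(E i ^^ n) 0 = 0" by (induction n) (auto simp: zeros i)
      then show ?thesis using 0 y by (simp add: f_def)
    next
      case (Suc k')
      have EnV: "x \<in> V \<Longrightarrow> (E i ^^ n) x \<in> V \<and> (E i ^^ n) (sc c x) = sc c ((E i ^^ n) x)" for c x n
        by (induction n) (auto simp: closed i lin)
      show ?thesis unfolding Suc Ef using EnV[OF fV[of k']] Suc.IH[of k'] Suc.prems Suc by simp
    qed
    finally show ?case .
  qed simp
  obtain B where B: "finite B" "V \<subseteq> span B" using fin by blast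
  have "\<exists>n. f n \<in> span (f ` {..<n})"
  proof (rule ccontr)
    assume a: "\<not> ?thesis"
    have "independent (f ` {..<n}) \<and> card (f ` {..<n}) = n" for n
    proof (induction n)
      case (Suc n)
      have "f n \<notin> f ` {..<n}" using a span_base[of "f n" "f ` {..<n}"] by blast
      then show ?case using Suc a independent_insertI[of "f n" "f ` {..<n}"] by (simp add: lessThan_Suc)
    qed (auto simp: dependent_def)
    from this[of "Suc (card B)"] show False
      using independent_span_bound[OF B(1), of "f ` {..<Suc (card B)}"] B(2) fV by fastforce
  qed
  then obtain n where n: "f n \<in> span (f ` {..<n})" by auto
  have "x \<in> V \<and> (E i ^^ n) x = 0" if "x \<in> span (f ` {..<n})" for x
  proof (rule span_induct[OF that])
    have EnV: "x \<in> V \<Longrightarrow> (E i ^^ n) x \<in> V \<and> (E i ^^ n) (sc c x) = sc c ((E i ^^ n) x)" for c x n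
        by (induction n) (auto simp: closed i lin)
    have EnA: "x \<in> V \<Longrightarrow> y \<in> V \<Longrightarrow> (E i ^^ n) (x + y) = (E i ^^ n) x + (E i ^^ n) y" for x y n
      by (induction n) (use EnV in \<open>auto simp: closed i lin\<close>)
    have E0: "(E i ^^ n) 0 = 0" by (induction n) (auto simp: zeros i)
    show "subspace {x. x \<in> V \<and> (E i ^^ n) x = 0}"
      by (rule subspaceI) (use EnV EnA E0 in \<open>auto simp: subspace_0[OF V] V_add V_scale\<close>)
  qed (auto simp: fV kill)
  then show ?thesis using n lower[of n] by auto
qed

end

text \<open>Here \<open>l0\<close> is the highest weight, recorded by its values on the coroots.\<close>

locale minuscule_rep = chevalley_rep +
  fixes l0 :: "nat \<Rightarrow> int" and v0
  assumes hw: "v0 \<in> V" "v0 \<noteq> 0" "\<And>i. i \<in> I \<Longrightarrow> E i v0 = 0" "\<And>i. i \<in> I \<Longrightarrow> H i v0 = sc (of_int (l0 i)) v0"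
    and irred: "\<And>U. subspace U \<Longrightarrow> U \<subseteq> V \<Longrightarrow>
       (\<And>i x. i \<in> I \<Longrightarrow> x \<in> U \<Longrightarrow> E i x \<in> U \<and> F i x \<in> U \<and> H i x \<in> U) \<Longrightarrow> U = {0} \<or> U = V"
    and minuscule: "\<And>l i. l \<in> weight_orbit C I l0 \<Longrightarrow> i \<in> I \<Longrightarrow> l i \<in> {-1, 0, 1}"
    and fin_orbit: "finite (weight_orbit C I l0)"
begin

abbreviation "\<Lambda> \<equiv> weight_orbit C I l0"

fun word :: "nat list \<Rightarrow> 'a" where
  "word [] = v0" | "word (i # w) = F i (word w)"

fun word_weight :: "nat list \<Rightarrow> nat \<Rightarrow> int" where
  "word_weight [] = l0" | "word_weight (i # w) = (\<lambda>j. word_weight w j - C j i)"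

definition words :: "nat \<Rightarrow> (nat \<Rightarrow> int) \<Rightarrow> 'a set" where
  "words n l = {word w | w. set w \<subseteq> I \<and> length w = n \<and> word_weight w = l}"

lemma wv_word: "set w \<subseteq> I \<Longrightarrow> wv (word_weight w) (word w)"
proof (induction w)
  case (Cons i w)
  then show ?case using wv_F[of "word_weight w" "word w" i] by simp
qed (simp add: wv_def hw)

lemma words_V: "words n l \<subseteq> {x. wv l x}"
  using wv_word by (auto simp: words_def)

lemma span_words_wv: "x \<in> span (words n l) \<Longrightarrow> wv l x"
  using span_minimal[OF words_V subspace_wv] by auto

lemma F_span_words:
  assumes "j \<in> I" "x \<in> span (words n l)"
  shows "F j x \<in> span (words (Suc n) (\<lambda>i. l i - C i j))"
proof -
  have "wv l x \<and> F j x \<in> span (words (Suc n) (\<lambda>i. l i - C i j))"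
  proof (rule span_induct[OF assms(2)])
    show "subspace {x. wv l x \<and> F j x \<in> span (words (Suc n) (\<lambda>i. l i - C i j))}"
      using subspace_wv[of l] assms(1)
      by (auto simp: subspace_def zeros lin wv_V span_add span_scale span_zero)
    fix x assume x: "x \<in> words n l"
    then obtain w where "x = word w" "set w \<subseteq> I" "length w = n" "word_weight w = l" by (auto simp: words_def)
    then have "F j x \<in> words (Suc n) (\<lambda>i. l i - C i j)"
      using assms(1) by (auto simp: words_def intro!: exI[of _ "j # w"])
    then show "wv l x \<and> F j x \<in> span (words (Suc n) (\<lambda>i. l i - C i j))"
      using x words_V by (auto intro: span_base)
  qed
  then show ?thesis by auto
qed

text \<open>Commuting \<open>E i\<close> through a word of lowering operators either removes one letter \<open>i\<close> or
  reaches the highest weight vector, which it kills.\<close>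

text \<open>Commuting \<open>E i\<close> past the letters of a word removes one letter \<open>i\<close>, and it kills \<open>v0\<close> at the
  end.\<close>

lemma E_word:
  assumes "set w \<subseteq> I" "i \<in> I"
  shows "E i (word w) \<in> span (words (length w - 1) (\<lambda>j. word_weight w j + C j i))"
  using assms
proof (induction w)
  case Nil
  then show ?case by (simp add: hw span_zero)
next
  case (Cons j w)
  have w: "wv (word_weight w) (word w)" "j \<in> I" using Cons wv_word by auto
  let ?S = "span (words (length w) (\<lambda>k. word_weight w k - C k j + C k i))"
  have 1: "F j (E i (word w)) \<in> ?S"
  proof (cases "w = []")
    case True
    then show ?thesis using Cons.prems w by (simp add: hw zeros span_zero)
  next
    case False
    then show ?thesis using F_span_words[OF w(2) Cons.IH] Cons.prems by (simp add: algebra_simps)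
  qed
  have 2: "(if i = j then H i (word w) else 0) \<in> ?S"
  proof (cases "i = j")
    case True
    have "word w \<in> ?S" using True Cons.prems by (intro span_base) (auto simp: words_def)
    then show ?thesis using True w Cons.prems by (auto simp: wv_def span_scale)
  qed (simp add: span_zero)
  show ?case using EF[OF Cons.prems(2) w(2) wv_V[OF w(1)]] span_add[OF 1 2] by simp
qed

lemma E_span_words:
  assumes "i \<in> I" "x \<in> span (words n l)"
  shows "E i x \<in> span (words (n - 1) (\<lambda>j. l j + C j i))"
proof -
  have "wv l x \<and> E i x \<in> span (words (n - 1) (\<lambda>j. l j + C j i))"
  proof (rule span_induct[OF assms(2)])
    show "subspace {x. wv l x \<and> E i x \<in> span (words (n - 1) (\<lambda>j. l j + C j i))}"
      using subspace_wv[of l] assms(1)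
      by (auto simp: subspace_def zeros lin wv_V span_add span_scale span_zero)
    fix x assume x: "x \<in> words n l"
    then show "wv l x \<and> E i x \<in> span (words (n - 1) (\<lambda>j. l j + C j i))"
      using E_word assms(1) words_V by (fastforce simp: words_def)
  qed
  then show ?thesis by auto
qed

lemma orbit_lower:
  assumes "l \<in> \<Lambda>" "i \<in> I" "l i = 1"
  shows "(\<lambda>j. l j - C j i) \<in> \<Lambda>"
  using weight_orbit.reflect[OF assms(1,2)] assms(3) by (simp add: reflect_weight_def)
text \<open>The heart of the weight computation. Let \<open>x\<close> be a nonzero word of weight \<open>l\<close> in the orbit.
  If \<open>l i = 1\<close>, then \<open>F i x\<close> has the reflected weight. If \<open>l i = 0\<close>, the vector \<open>E i x\<close>
  is built from shorter words of a weight outside the orbit, so it vanishes, and then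
  \<open>F i x\<close> is killed by \<open>E i\<close> and has weight \<open>-2\<close>. If \<open>l i = -1\<close>, the same argument applied
  to \<open>z = E i x\<close> gives \<open>E i z = 0\<close>, so \<open>z\<close> generates a two-dimensional \<open>sl\<^sub>2\<close>-module whose
  lowest vector is \<open>x\<close>; hence \<open>F i x = 0\<close>.\<close>

lemma word_zero_or_orbit:
  "set w \<subseteq> I \<Longrightarrow> word w = 0 \<or> word_weight w \<in> \<Lambda>"
proof (induction "length w" arbitrary: w rule: less_induct)
  case less
  have nonorbit: "x = 0" if "x \<in> span (words n l)" "n < length w" "l \<notin> \<Lambda>" for n l x
  proof -
    have "words n l \<subseteq> {0}" using less(1) that(2,3) by (auto simp: words_def)
    then show ?thesis using that(1) span_mono[of "words n l" "{0}"] by (auto simp: span_insert_0)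
  qed
  show ?case
  proof (cases w)
    case Nil
    then show ?thesis by (simp add: weight_orbit.base)
  next
    case (Cons i u)
    define x where "x = word u" 
    define l where "l = word_weight u"
    have i: "i \<in> I" and u: "set u \<subseteq> I" using less Cons by auto
    have wx: "wv l x" "x \<in> V" using wv_word[OF u] by (auto simp: x_def l_def wv_def)
    have "x = 0 \<or> l \<in> \<Lambda>" using less(1)[of u] u Cons by (simp add: x_def l_def)
    moreover have ?thesis if "x = 0" using that zeros[OF i] Cons by (simp add: x_def)
    moreover have ?thesis if l: "l \<in> \<Lambda>"
    proof -
      have big: "(\<lambda>j. l j + k * C j i) \<notin> \<Lambda>" if "l i + 2 * k > 1" for k
        using minuscule[OF _ i] that C2[OF i] by fastforce
      have Ex: "E i x \<in> span (words (length u - 1) (\<lambda>j. l j + C j i))"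
        using E_word[OF u i] by (simp add: x_def l_def)
      consider "l i = 1" | "l i = 0" | "l i = -1" using minuscule[OF l i] by auto
      then show ?thesis
      proof cases
        case 1
        then show ?thesis using orbit_lower[OF l i] Cons by (simp add: l_def)
      next
        case 2
        have "E i x = 0" using nonorbit[OF Ex] big[of 1] 2 Cons by (simp add: mult.commute)
        then have "E i (F i x) = 0" using EF[OF i i wx(2)] wx i 2 by (simp add: wv_def zeros)
        then have "F i x = 0"
          using negative_highest_vector_zero[OF i closed(2)[OF i wx(2)], of "-2"] wv_F[OF wx(1) i] i 2 C2[OF i]
          by (auto simp: wv_def)
        then show ?thesis using Cons by (simp add: x_def)
      next
        case 3
        define z where "z = E i x"
        have z: "wv (\<lambda>j. l j + C j i) z" "z \<in> V" using wv_E[OF wx(1) i] by (auto simp: z_def wv_def)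
        have Hz: "H i z = z" using z(1) i 3 C2[OF i] by (simp add: wv_def)
        have "E i z \<in> span (words (length u - 1 - 1) (\<lambda>j. l j + C j i + C j i))"
          unfolding z_def by (rule E_span_words[OF i Ex])
        then have Ez: "E i z = 0" using nonorbit[of "E i z"] big[of 2] 3 Cons by (simp add: algebra_simps)
        have FzV: "F i z \<in> V" by (rule closed(2)[OF i z(2)])
        have EFz: "E i (F i z) = z" using EF[OF i i z(2)] Ez Hz zeros[OF i] by simp
        have HFz: "H i (F i z) = sc (-1) (F i z)" using wv_F[OF z(1) i] i 3 C2[OF i] by (auto simp: wv_def)
        have Hx: "H i x = sc (-1) x" using wx i 3 by (simp add: wv_def)
        have "x - F i z = 0"
        proof (rule negative_highest_vector_zero[OF i, of _ "-1"])
          show "x - F i z \<in> V" using subspace_diff[OF V wx(2) FzV] .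
          show "E i (x - F i z) = 0" using minus_lin(1)[OF i wx(2) FzV] EFz by (simp add: z_def)
          show "H i (x - F i z) = sc (of_int (-1)) (x - F i z)"
            using minus_lin(3)[OF i wx(2) FzV] HFz Hx by (simp add: scale_right_diff_distrib)
        qed simp
        moreover have "F i (F i z) = 0"
        proof (rule negative_highest_vector_zero[OF i, of _ "-3"])
          show "F i (F i z) \<in> V" by (rule closed(2)[OF i FzV])
          show "E i (F i (F i z)) = 0" using EF[OF i i FzV] EFz HFz by simp
          show "H i (F i (F i z)) = sc (of_int (-3)) (F i (F i z))"
            using wv_F[OF wv_F[OF z(1) i] i] i 3 C2[OF i] by (auto simp: wv_def)
        qed simp
        ultimately have "F i x = 0" by simp
        then show ?thesis using Cons by (simp add: x_def)
      qed
    qed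
    ultimately show ?thesis by blast
  qed
qed

text \<open>The span of the words is stable under all operators and contains \<open>v0\<close>, so irreducibility
  applies.\<close>

lemma V_spanned_by_words: "V = span (\<Union>n l. words n l)"
proof -
  let ?W = "\<Union>n l. words n l" and ?U = "span (\<Union>n l. words n l)"
  have "?W \<subseteq> V" using words_V wv_V by blast
  then have UV: "?U \<subseteq> V" by (rule span_minimal[OF _ V])
  have mono: "span (words n l) \<subseteq> ?U" for n l by (rule span_mono) auto
  have "E i x \<in> ?U \<and> F i x \<in> ?U \<and> H i x \<in> ?U" if "i \<in> I" "x \<in> ?U" for i x
  proof -
    have "x \<in> V \<and> E i x \<in> ?U \<and> F i x \<in> ?U \<and> H i x \<in> ?U"
    proof (rule span_induct[OF that(2)])
      show "subspace {x. x \<in> V \<and> E i x \<in> ?U \<and> F i x \<in> ?U \<and> H i x \<in> ?U}"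
        using that(1) V by (auto simp: subspace_def zeros lin span_add span_scale span_zero)
      fix x assume "x \<in> ?W"
      then obtain n l where x: "x \<in> span (words n l)" by (auto intro: span_base)
      have "H i x \<in> span (words n l)" using span_words_wv[OF x] that(1) x by (auto simp: wv_def span_scale)
      then show "x \<in> V \<and> E i x \<in> ?U \<and> F i x \<in> ?U \<and> H i x \<in> ?U"
        using E_span_words[OF that(1) x] F_span_words[OF that(1) x] span_words_wv[OF x] mono by (auto simp: wv_def)
    qed
    then show ?thesis by auto
  qed
  then have "?U = {0} \<or> ?U = V" using irred[OF subspace_span UV] by simp
  moreover have "v0 \<in> ?U" by (rule span_base) (auto simp: words_def intro!: exI[of _ "[]"])
  ultimately show ?thesis using hw(2) by auto
qed

lemma orbit_decomposition:
  assumes "x \<in> V"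
  shows "\<exists>y. (\<forall>l\<in>\<Lambda>. wv l (y l)) \<and> x = (\<Sum>l\<in>\<Lambda>. y l)"
proof (rule span_induct[where S="\<Union>n l. words n l" and P = "\<lambda>x. \<exists>y. (\<forall>l\<in>\<Lambda>. wv l (y l)) \<and> x = (\<Sum>l\<in>\<Lambda>. y l)"])
  show "x \<in> span (\<Union>n l. words n l)" using assms V_spanned_by_words by simp
  show "subspace {x. \<exists>y. (\<forall>l\<in>\<Lambda>. wv l (y l)) \<and> x = (\<Sum>l\<in>\<Lambda>. y l)}"
  proof (rule subspaceI)
    show "0 \<in> {x. \<exists>y. (\<forall>l\<in>\<Lambda>. wv l (y l)) \<and> x = (\<Sum>l\<in>\<Lambda>. y l)}"
      using subspace_0[OF subspace_wv] by (auto intro!: exI[of _ "\<lambda>_. 0"])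
  next
    fix x y assume "x \<in> {x. \<exists>y. (\<forall>l\<in>\<Lambda>. wv l (y l)) \<and> x = (\<Sum>l\<in>\<Lambda>. y l)}" "y \<in> {x. \<exists>y. (\<forall>l\<in>\<Lambda>. wv l (y l)) \<and> x = (\<Sum>l\<in>\<Lambda>. y l)}"
    then obtain p q where "\<forall>l\<in>\<Lambda>. wv l (p l)" "x = (\<Sum>l\<in>\<Lambda>. p l)" "\<forall>l\<in>\<Lambda>. wv l (q l)" "y = (\<Sum>l\<in>\<Lambda>. q l)" by auto
    then have "(\<forall>l\<in>\<Lambda>. wv l (p l + q l)) \<and> x + y = (\<Sum>l\<in>\<Lambda>. p l + q l)"
      using subspace_add[OF subspace_wv] by (auto simp: sum.distrib)
    then show "x + y \<in> {x. \<exists>y. (\<forall>l\<in>\<Lambda>. wv l (y l)) \<and> x = (\<Sum>l\<in>\<Lambda>. y l)}"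
      by (intro CollectI exI[of _ "\<lambda>l. p l + q l"])
  next
    fix c x assume "x \<in> {x. \<exists>y. (\<forall>l\<in>\<Lambda>. wv l (y l)) \<and> x = (\<Sum>l\<in>\<Lambda>. y l)}"
    then obtain p where "\<forall>l\<in>\<Lambda>. wv l (p l)" "x = (\<Sum>l\<in>\<Lambda>. p l)" by auto
    then have "(\<forall>l\<in>\<Lambda>. wv l (sc c (p l))) \<and> sc c x = (\<Sum>l\<in>\<Lambda>. sc c (p l))"
      using subspace_scale[OF subspace_wv] by (auto simp: scale_sum_right)
    then show "sc c x \<in> {x. \<exists>y. (\<forall>l\<in>\<Lambda>. wv l (y l)) \<and> x = (\<Sum>l\<in>\<Lambda>. y l)}"
      by (intro CollectI exI[of _ "\<lambda>l. sc c (p l)"])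
  qed
next
  fix x assume "x \<in> (\<Union>n l. words n l)"
  then obtain w where w: "x = word w" "set w \<subseteq> I" by (auto simp: words_def)
  show "\<exists>y. (\<forall>l\<in>\<Lambda>. wv l (y l)) \<and> x = (\<Sum>l\<in>\<Lambda>. y l)"
  proof (cases "x = 0")
    case True
    then show ?thesis using subspace_0[OF subspace_wv] by (auto intro!: exI[of _ "\<lambda>_. 0"])
  next
    case False
    then have "word_weight w \<in> \<Lambda>" using word_zero_or_orbit w by auto
    then show ?thesis using wv_word[OF w(2)] w(1) fin_orbit subspace_0[OF subspace_wv]
      by (intro exI[of _ "\<lambda>l. if l = word_weight w then x else 0"]) auto
  qed
qed

text \<open>Eigenvectors with different systems of eigenvalues are independent: applying
  \<open>H i - l i\<close> removes the component of weight \<open>l\<close> and rescales all others.\<close>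

lemma eigenvector_avoiding_weights_zero:
  assumes "finite S" "x = (\<Sum>l\<in>S. y l)" "\<And>l. l \<in> S \<Longrightarrow> wv l (y l)"
    "\<And>i. i \<in> I \<Longrightarrow> H i x = sc (k i) x" "\<And>l. l \<in> S \<Longrightarrow> \<exists>i\<in>I. k i \<noteq> of_int (l i)"
  shows "x = 0"
  using assms
proof (induction S arbitrary: x y rule: finite_induct)
  case (insert l S)
  obtain i where i: "i \<in> I" "k i \<noteq> of_int (l i)" using insert.prems(4)[of l] by blast
  have yV: "y m \<in> V" if "m \<in> insert l S" for m using insert.prems(2)[OF that] by (simp add: wv_def)
  have Hsum: "T \<subseteq> insert l S \<Longrightarrow> H i (\<Sum>m\<in>T. y m) = (\<Sum>m\<in>T. sc (of_int (m i)) (y m))" for T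
  proof (induction T rule: infinite_finite_induct)
    case (infinite T) then show ?case using zeros i by simp
  next
    case empty then show ?case using zeros i by simp
  next
    case (insert m T)
    have "sum y T \<in> V" using insert by (intro subspace_sum[OF V]) (auto intro: yV)
    then show ?case using insert lin(3)[OF i(1), of "y m" "sum y T"] yV insert.prems 
        \<open>\<And>m. m \<in> insert l _ \<Longrightarrow> wv m (y m)\<close>[of m] i(1) by (auto simp: wv_def)
  qed
  have "sc (k i - of_int (l i)) x = H i x - sc (of_int (l i)) x"
    using insert.prems(3)[OF i(1)] by (simp add: scale_left_diff_distrib)
  also have "\<dots> = (\<Sum>m\<in>insert l S. sc (of_int (m i) - of_int (l i)) (y m))"
    unfolding insert.prems(1) Hsum[OF subset_refl]
    by (simp only: scale_sum_right sum_subtractf[symmetric] scale_left_diff_distrib)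
  also have "\<dots> = (\<Sum>m\<in>S. sc (of_int (m i) - of_int (l i)) (y m))" using insert.hyps by simp
  finally have eq: "sc (k i - of_int (l i)) x = (\<Sum>m\<in>S. sc (of_int (m i) - of_int (l i)) (y m))" .
  have xV: "x \<in> V" unfolding insert.prems(1) by (rule subspace_sum[OF V yV])
  have "sc (k i - of_int (l i)) x = 0"
  proof (rule insert.IH[OF eq])
    show "wv m (sc (of_int (m i) - of_int (l i)) (y m))" if "m \<in> S" for m
      using insert.prems(2)[of m] that subspace_scale[OF subspace_wv] by auto
    show "H j (sc (k i - of_int (l i)) x) = sc (k j) (sc (k i - of_int (l i)) x)" if "j \<in> I" for j
      using insert.prems(3)[OF that] lin(6)[OF that xV] by (simp add: mult.commute)
  qed (use insert.prems in auto)
  then show ?case using i by simp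
qed simp

lemma weight_in_orbit:
  assumes "x \<in> V" "x \<noteq> 0" "\<And>i. i \<in> I \<Longrightarrow> H i x = sc (k i) x"
  shows "\<exists>l\<in>\<Lambda>. \<forall>i\<in>I. k i = of_int (l i)"
proof (rule ccontr)
  assume a: "\<not> ?thesis"
  obtain y where "\<forall>l\<in>\<Lambda>. wv l (y l)" "x = (\<Sum>l\<in>\<Lambda>. y l)" using orbit_decomposition[OF assms(1)] by auto
  then show False using eigenvector_avoiding_weights_zero[OF fin_orbit, of x y k] a assms by auto
qed

lemma wv_orbit_agree:
  assumes "wv l x" "x \<noteq> 0" "i \<in> I"
  shows "l i \<in> {-1, 0, 1}"
proof -
  obtain m where "m \<in> \<Lambda>" "\<forall>i\<in>I. (of_int (l i) :: complex) = of_int (m i)"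
    using weight_in_orbit[of x "\<lambda>i. of_int (l i)"] assms by (auto simp: wv_def)
  then show ?thesis using minuscule assms(3) by auto
qed

text \<open>Moving along the orbit: if the weight at \<open>i\<close> is \<open>1\<close>, then \<open>E i\<close> kills the weight vector,
  because the raised weight has the value \<open>3\<close>; so \<open>E i (F i x) = x\<close> and \<open>F i x\<close> does not
  vanish. The case \<open>-1\<close> is symmetric.\<close>

lemma orbit_is_weight:
  assumes "l \<in> \<Lambda>"
  shows "\<exists>x. x \<noteq> 0 \<and> wv l x"
  using assms
proof induction
  case base
  then show ?case using hw by (auto simp: wv_def)
next
  case (reflect l i)
  then obtain x where x: "x \<noteq> 0" "wv l x" by auto
  have xV: "x \<in> V" using x by (simp add: wv_def)
  have Hx: "H i x = sc (of_int (l i)) x" using x reflect by (simp add: wv_def)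
  consider "l i = 1" | "l i = 0" | "l i = -1" using minuscule[OF reflect(1,2)] by auto
  then show ?case
  proof cases
    case 1
    have "E i x = 0" using wv_orbit_agree[OF wv_E[OF x(2) reflect(2)] _ reflect(2)] 1 C2[OF reflect(2)] by auto
    then have "F i x \<noteq> 0" using EF[OF reflect(2,2) xV] Hx 1 x(1) zeros[OF reflect(2)] by auto
    then show ?thesis using wv_F[OF x(2) reflect(2)] 1 by (auto simp: reflect_weight_def)
  next
    case 2
    then show ?thesis using x by (auto simp: reflect_weight_def)
  next
    case 3
    have "F i x = 0" using wv_orbit_agree[OF wv_F[OF x(2) reflect(2)] _ reflect(2)] 3 C2[OF reflect(2)] by auto
    then have "E i x \<noteq> 0" using EF[OF reflect(2,2) xV] Hx 3 x(1) zeros[OF reflect(2)] by auto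
    then show ?thesis using wv_E[OF x(2) reflect(2)] 3 by (auto simp: reflect_weight_def)
  qed
qed

end

section \<open>The intersection form\<close>

lemma pic_form_superset:
  assumes "finite A" "finite B" "Poly_Mapping.keys x \<subseteq> A" "Poly_Mapping.keys y \<subseteq> B"
  shows "pic_form c x y = (\<Sum>i\<in>A. \<Sum>j\<in>B.
    Poly_Mapping.lookup x i * Poly_Mapping.lookup y j * of_int (pic_gram c i j))"
proof -
  have "pic_form c x y = (\<Sum>i\<in>Poly_Mapping.keys x. \<Sum>j\<in>B.
    Poly_Mapping.lookup x i * Poly_Mapping.lookup y j * of_int (pic_gram c i j))"
    unfolding pic_form_def using assms
    by (intro sum.cong sum.mono_neutral_left) (auto simp: in_keys_iff)
  also have "\<dots> = (\<Sum>i\<in>A. \<Sum>j\<in>B.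
    Poly_Mapping.lookup x i * Poly_Mapping.lookup y j * of_int (pic_gram c i j))"
    using assms by (intro sum.mono_neutral_left) (auto simp: in_keys_iff)
  finally show ?thesis .
qed

lemma pic_gram_sym: "pic_gram c i j = pic_gram c j i"
  by (cases i; cases j) auto

lemma pic_form_sym: "pic_form c x y = pic_form c y x"
  unfolding pic_form_def by (subst sum.swap) (simp add: pic_gram_sym mult.commute)

lemma pic_form_add_left: "pic_form c (x + y) z = pic_form c x z + pic_form c y z"
proof -
  let ?A = "Poly_Mapping.keys x \<union> Poly_Mapping.keys y" and ?B = "Poly_Mapping.keys z"
  have k: "Poly_Mapping.keys (x + y) \<subseteq> ?A" by (rule Poly_Mapping.keys_add)
  show ?thesis
    using k by (simp add: pic_form_superset[of ?A ?B] lookup_add algebra_simps sum.distrib)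
qed

lemma pic_form_minus_left: "pic_form c (x - y) z = pic_form c x z - pic_form c y z"
  using pic_form_add_left[of c "x - y" y z] by simp

lemma pic_form_add_right: "pic_form c z (x + y) = pic_form c z x + pic_form c z y"
  using pic_form_add_left pic_form_sym by metis

lemma pic_form_minus_right: "pic_form c z (x - y) = pic_form c z x - pic_form c z y"
  using pic_form_minus_left pic_form_sym by metis

lemma lookup_scaleR [simp]: "Poly_Mapping.lookup (t *\<^sub>R (x :: 'a \<Rightarrow>\<^sub>0 real)) i = t * Poly_Mapping.lookup x i"
proof -
  have "finite {i. t *\<^sub>R Poly_Mapping.lookup x i \<noteq> 0}"
    by (rule finite_subset[OF _ finite_lookup[of x]]) auto
  then show ?thesis by (simp add: scaleR_poly_mapping_def)
qed

lemma keys_scaleR: "Poly_Mapping.keys (t *\<^sub>R (x :: 'a \<Rightarrow>\<^sub>0 real)) \<subseteq> Poly_Mapping.keys x"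
  by (auto simp: in_keys_iff)

lemma pic_form_scaleR_left: "pic_form c (t *\<^sub>R x) y = t * pic_form c x (y :: pic_gen \<Rightarrow>\<^sub>0 real)"
  using keys_scaleR[of t x]
  by (simp add: pic_form_superset[of "Poly_Mapping.keys x" "Poly_Mapping.keys y"] sum_distrib_left mult.assoc)

lemma pic_form_scaleR_right: "pic_form c y (t *\<^sub>R x) = t * pic_form c (y :: pic_gen \<Rightarrow>\<^sub>0 real) x"
  using pic_form_scaleR_left pic_form_sym by metis

lemma lookup_frag_cmul: "Poly_Mapping.lookup (frag_cmul k x) i = k * Poly_Mapping.lookup x i"
  by (simp add: frag_cmul_def Poly_Mapping.map.rep_eq when_def)

lemma pic_form_frag_cmul_left: "pic_form c (frag_cmul k x) y = k * pic_form c x y"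
proof -
  have "Poly_Mapping.keys (frag_cmul k x) \<subseteq> Poly_Mapping.keys x" by (auto simp: in_keys_iff lookup_frag_cmul)
  then show ?thesis
    by (simp add: pic_form_superset[of "Poly_Mapping.keys x" "Poly_Mapping.keys y"] lookup_frag_cmul
        sum_distrib_left mult.assoc)
qed

lemma lookup_realify [simp]: "Poly_Mapping.lookup (realify x) i = of_int (Poly_Mapping.lookup x i)"
  by (simp add: realify_def Poly_Mapping.map.rep_eq when_def)

lemma keys_realify [simp]: "Poly_Mapping.keys (realify x) = Poly_Mapping.keys x"
  by (auto simp: in_keys_iff)
lemma inj_realify: "realify x = realify y \<longleftrightarrow> x = y"
proof
  assume "realify x = realify y"
  then have "Poly_Mapping.lookup (realify x) i = Poly_Mapping.lookup (realify y) i" for i by simp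
  then show "x = y" by (intro poly_mapping_eqI) simp
qed simp

lemma pic_form_realify: "pic_form c (realify x) (realify y) = of_int (pic_form c x y)"
  by (simp add: pic_form_def)

definition hyp_sum :: "nat \<Rightarrow> (pic_gen \<Rightarrow>\<^sub>0 'k::comm_ring_1) \<Rightarrow> 'k" where
  "hyp_sum a x = (\<Sum>i=1..a-1. Poly_Mapping.lookup x (Hcl i))"

definition exc_sum :: "nat \<Rightarrow> nat \<Rightarrow> (pic_gen \<Rightarrow>\<^sub>0 'k::comm_ring_1) \<Rightarrow> 'k" where
  "exc_sum b c x = (\<Sum>j=1..b+c. Poly_Mapping.lookup x (Ecl j))"

lemma finite_pic_basis: "finite (pic_basis a b c)"
  by (simp add: pic_basis_def)

text \<open>The form is a rank-one form in the total hyperplane degree minus the Euclidean form,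
  which keeps all later pairings to two sums.\<close>

lemma pic_form_coords:
  fixes x y :: "pic_gen \<Rightarrow>\<^sub>0 'k::comm_ring_1"
  assumes "Poly_Mapping.keys x \<subseteq> pic_basis a b c" "Poly_Mapping.keys y \<subseteq> pic_basis a b c"
  shows "pic_form c x y = (of_nat c - 1) * hyp_sum a x * hyp_sum a y
    - (\<Sum>i=1..a-1. Poly_Mapping.lookup x (Hcl i) * Poly_Mapping.lookup y (Hcl i))
    - (\<Sum>j=1..b+c. Poly_Mapping.lookup x (Ecl j) * Poly_Mapping.lookup y (Ecl j))"
proof -
  let ?x = "Poly_Mapping.lookup x" and ?y = "Poly_Mapping.lookup y"
  have split: "(\<Sum>i\<in>pic_basis a b c. f i) = (\<Sum>i=1..a-1. f (Hcl i)) + (\<Sum>j=1..b+c. f (Ecl j))"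
    for f :: "pic_gen \<Rightarrow> 'k"
  proof -
    have "(\<Sum>i\<in>pic_basis a b c. f i) = (\<Sum>i\<in>Hcl ` {1..a-1}. f i) + (\<Sum>i\<in>Ecl ` {1..b+c}. f i)"
      unfolding pic_basis_def by (rule sum.union_disjoint) auto
    then show ?thesis by (simp add: sum.reindex inj_on_def)
  qed
  have "pic_form c x y = (\<Sum>i=1..a-1. \<Sum>j=1..a-1. ?x (Hcl i) * ?y (Hcl j) * (of_int (int c - 1) - (if i = j then 1 else 0)))
    + (\<Sum>i=1..b+c. \<Sum>j=1..b+c. ?x (Ecl i) * ?y (Ecl j) * (- (if i = j then 1 else 0)))"
    unfolding pic_form_superset[OF finite_pic_basis finite_pic_basis assms] split
    by (simp add: if_distrib cong: if_cong)
  also have "(\<Sum>i=1..b+c. \<Sum>j=1..b+c. ?x (Ecl i) * ?y (Ecl j) * (- (if i = j then 1 else 0)))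
    = - (\<Sum>j=1..b+c. ?x (Ecl j) * ?y (Ecl j))"
    by (simp add: if_distrib sum_negf cong: if_cong)
  also have "(\<Sum>i=1..a-1. \<Sum>j=1..a-1. ?x (Hcl i) * ?y (Hcl j) * (of_int (int c - 1) - (if i = j then 1 else 0)))
    = (\<Sum>i=1..a-1. \<Sum>j=1..a-1. of_int (int c - 1) * (?x (Hcl i) * ?y (Hcl j)))
      - (\<Sum>i=1..a-1. \<Sum>j=1..a-1. if i = j then ?x (Hcl i) * ?y (Hcl j) else 0)"
    unfolding sum_subtractf[symmetric] by (intro sum.cong refl) (simp add: algebra_simps)
  also have "(\<Sum>i=1..a-1. \<Sum>j=1..a-1. of_int (int c - 1) * (?x (Hcl i) * ?y (Hcl j)))
    = (of_nat c - 1) * hyp_sum a x * hyp_sum a y"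
  proof -
    have "(of_nat c - 1) * hyp_sum a x * hyp_sum a y
      = (of_nat c - 1) * (\<Sum>i=1..a-1. \<Sum>j=1..a-1. ?x (Hcl i) * ?y (Hcl j))"
      by (simp only: mult.assoc hyp_sum_def sum_product)
    also have "\<dots> = (\<Sum>i=1..a-1. \<Sum>j=1..a-1. of_int (int c - 1) * (?x (Hcl i) * ?y (Hcl j)))"
      by (simp only: sum_distrib_left) simp
    finally show ?thesis by simp
  qed
  finally show ?thesis by simp
qed

definition mk_pic :: "nat \<Rightarrow> nat \<Rightarrow> nat \<Rightarrow> (nat \<Rightarrow> 'k) \<Rightarrow> (nat \<Rightarrow> 'k) \<Rightarrow> (pic_gen \<Rightarrow>\<^sub>0 'k::comm_ring_1)" where
  "mk_pic a b c X Y = (\<Sum>i=1..a-1. Poly_Mapping.single (Hcl i) (X i)) + (\<Sum>j=1..b+c. Poly_Mapping.single (Ecl j) (Y j))"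

lemma lookup_mk_pic [simp]:
  "Poly_Mapping.lookup (mk_pic a b c X Y) (Hcl i) = (if i \<in> {1..a-1} then X i else 0)"
  "Poly_Mapping.lookup (mk_pic a b c X Y) (Ecl j) = (if j \<in> {1..b+c} then Y j else 0)"
  by (simp_all add: mk_pic_def lookup_add lookup_sum lookup_single when_def)

lemma keys_mk_pic: "Poly_Mapping.keys (mk_pic a b c X Y) \<subseteq> pic_basis a b c"
proof
  fix k assume "k \<in> Poly_Mapping.keys (mk_pic a b c X Y)"
  then show "k \<in> pic_basis a b c"
    by (cases k) (auto simp: in_keys_iff pic_basis_def split: if_splits)
qed

lemma hyp_sum_mk_pic [simp]: "hyp_sum a (mk_pic a b c X Y) = (\<Sum>i=1..a-1. X i)"
  by (simp add: hyp_sum_def)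

lemma exc_sum_mk_pic [simp]: "exc_sum b c (mk_pic a b c X Y) = (\<Sum>j=1..b+c. Y j)"
  by (simp add: exc_sum_def)

lemma pic_eqI:
  assumes "Poly_Mapping.keys x \<subseteq> pic_basis a b c" "Poly_Mapping.keys y \<subseteq> pic_basis a b c"
    "\<And>i. i \<in> {1..a-1} \<Longrightarrow> Poly_Mapping.lookup x (Hcl i) = Poly_Mapping.lookup y (Hcl i)"
    "\<And>j. j \<in> {1..b+c} \<Longrightarrow> Poly_Mapping.lookup x (Ecl j) = Poly_Mapping.lookup y (Ecl j)"
  shows "x = y"
proof (rule poly_mapping_eqI)
  fix k
  show "Poly_Mapping.lookup x k = Poly_Mapping.lookup y k"
  proof (cases "k \<in> pic_basis a b c")
    case True then show ?thesis using assms by (auto simp: pic_basis_def)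
  next
    case False 
    then have "k \<notin> Poly_Mapping.keys x" "k \<notin> Poly_Mapping.keys y" using assms by auto
    then show ?thesis by (simp add: in_keys_iff)
  qed
qed

lemma hyp_sum_linear:
  "hyp_sum a (x + y) = hyp_sum a x + hyp_sum a y" "hyp_sum a (x - y) = hyp_sum a x - hyp_sum a y"
  "hyp_sum a (t *\<^sub>R z) = t * hyp_sum a z" "hyp_sum a (realify w) = of_int (hyp_sum a w)"
  by (simp_all add: hyp_sum_def lookup_add lookup_minus sum.distrib sum_subtractf sum_distrib_left)

lemma exc_sum_linear:
  "exc_sum b c (x + y) = exc_sum b c x + exc_sum b c y" "exc_sum b c (x - y) = exc_sum b c x - exc_sum b c y"
  "exc_sum b c (t *\<^sub>R z) = t * exc_sum b c z" "exc_sum b c (realify w) = of_int (exc_sum b c w)"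
  by (simp_all add: exc_sum_def lookup_add lookup_minus sum.distrib sum_subtractf sum_distrib_left)

section \<open>Roots, canonical class and the orthogonal complement\<close>

text \<open>The inequality \<open>a * c > a + c\<close> makes the coefficient of the \<open>E\<^sub>j\<close> in \<open>K\<close> positive;
  positivity of \<open>\<delta>\<close> is the condition that the diagram is of finite type.\<close>

locale picard =
  fixes a b c :: nat
  assumes params: "a \<ge> 2" "b \<ge> 1" "c \<ge> 2" "a * c > a + c" and delta_pos: "pic_delta a b c > 0"
begin

abbreviation "r \<equiv> b + c"
abbreviation "\<alpha> \<equiv> simple_root a b c"
abbreviation "K \<equiv> canonical_class a b c"
abbreviation "N \<equiv> nodes a b c"
abbreviation "\<O> \<equiv> minus_one_divisors a b c"
abbreviation basis where "basis \<equiv> pic_basis a b c"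
abbreviation "\<delta> \<equiv> pic_delta a b c"

lemma K_mk_pic: "K = mk_pic a b c (\<lambda>_. - int c) (\<lambda>_. int (a * c) - int a - int c)"
proof (rule poly_mapping_eqI)
  show "Poly_Mapping.lookup K k = Poly_Mapping.lookup (mk_pic a b c (\<lambda>_. - int c) (\<lambda>_. int (a * c) - int a - int c)) k" for k
    by (cases k) (simp_all add: canonical_class_def lookup_add lookup_sum lookup_frag_cmul lookup_single when_def)
qed

lemma keys_K: "Poly_Mapping.keys K \<subseteq> basis"
  unfolding K_mk_pic by (rule keys_mk_pic)

lemma lookup_\<alpha>_H: "Poly_Mapping.lookup (\<alpha> i) (Hcl k) =
    (if i < r then 0 else if i = r then (if k = 1 then 1 else 0)
     else (if k = i - r + 1 then 1 else 0) - (if k = i - r then 1 else 0))"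
  by (auto simp: simple_root_def lookup_minus lookup_sum lookup_single when_def)

lemma lookup_\<alpha>_E: "Poly_Mapping.lookup (\<alpha> i) (Ecl k) =
    (if i < r then (if k = i then 1 else 0) - (if k = i + 1 then 1 else 0)
     else if i = r then (if k \<in> {1..c} then -1 else 0) else 0)"
  by (auto simp: simple_root_def lookup_minus lookup_sum lookup_single when_def)

lemma keys_\<alpha>:
  assumes "i \<in> N"
  shows "Poly_Mapping.keys (\<alpha> i) \<subseteq> basis"
proof
  fix k assume "k \<in> Poly_Mapping.keys (\<alpha> i)"
  then show "k \<in> basis"
    using assms params
    by (cases k) (auto simp: in_keys_iff lookup_\<alpha>_H lookup_\<alpha>_E pic_basis_def nodes_def image_iff split: if_splits)
qed

lemma pairing_\<alpha>:
  fixes x :: "pic_gen \<Rightarrow>\<^sub>0 real"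
  assumes "Poly_Mapping.keys x \<subseteq> basis" "i \<in> N"
  shows "pic_form c x (realify (\<alpha> i)) =
    (if i < r then Poly_Mapping.lookup x (Ecl (i + 1)) - Poly_Mapping.lookup x (Ecl i)
     else if i = r then (real c - 1) * hyp_sum a x - Poly_Mapping.lookup x (Hcl 1) + (\<Sum>j=1..c. Poly_Mapping.lookup x (Ecl j))
     else Poly_Mapping.lookup x (Hcl (i - r)) - Poly_Mapping.lookup x (Hcl (i - r + 1)))"
proof -
  have k: "Poly_Mapping.keys (realify (\<alpha> i)) \<subseteq> basis" using keys_\<alpha>[OF assms(2)] by simp
  have i: "1 \<le> i" "i \<le> a + b + c - 2" using assms(2) by (auto simp: nodes_def)
  show ?thesis
  proof (cases "i < r")
    case True
    have h: "hyp_sum a (realify (\<alpha> i)) = 0" using True by (simp add: hyp_sum_def lookup_\<alpha>_H)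
    have "(\<Sum>j=1..r. Poly_Mapping.lookup x (Ecl j) * real_of_int (Poly_Mapping.lookup (\<alpha> i) (Ecl j)))
      = (\<Sum>j=1..r. if j = i then Poly_Mapping.lookup x (Ecl j) else 0) - (\<Sum>j=1..r. if j = i + 1 then Poly_Mapping.lookup x (Ecl j) else 0)"
      unfolding sum_subtractf[symmetric] using True by (intro sum.cong refl) (simp add: lookup_\<alpha>_E)
    also have "\<dots> = Poly_Mapping.lookup x (Ecl i) - Poly_Mapping.lookup x (Ecl (i + 1))"
      using True i by simp
    finally show ?thesis unfolding pic_form_coords[OF assms(1) k] h using True by (simp add: lookup_\<alpha>_H)
  next
    case False
    show ?thesis
    proof (cases "i = r")
      case True
      have h: "hyp_sum a (realify (\<alpha> i)) = 1"
        using True params unfolding hyp_sum_linear by (simp add: hyp_sum_def lookup_\<alpha>_H)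
      have "(\<Sum>j=1..r. Poly_Mapping.lookup x (Ecl j) * real_of_int (Poly_Mapping.lookup (\<alpha> i) (Ecl j)))
        = (\<Sum>j=1..r. - (if j \<in> {1..c} then Poly_Mapping.lookup x (Ecl j) else 0))"
        using True by (intro sum.cong refl) (simp add: lookup_\<alpha>_E)
      also have "\<dots> = - (\<Sum>j\<in>{1..r} \<inter> {1..c}. Poly_Mapping.lookup x (Ecl j))"
        unfolding sum_negf by (subst sum.inter_restrict) simp_all
      also have "{1..r} \<inter> {1..c} = {1..c}" by auto
      finally have e: "(\<Sum>j=1..r. Poly_Mapping.lookup x (Ecl j) * real_of_int (Poly_Mapping.lookup (\<alpha> i) (Ecl j)))
        = - (\<Sum>j=1..c. Poly_Mapping.lookup x (Ecl j))" .
      have "(\<Sum>k=1..a-1. Poly_Mapping.lookup x (Hcl k) * real_of_int (Poly_Mapping.lookup (\<alpha> i) (Hcl k)))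
        = (\<Sum>k=1..a-1. if k = 1 then Poly_Mapping.lookup x (Hcl k) else 0)"
        using True by (intro sum.cong refl) (simp add: lookup_\<alpha>_H)
      also have "\<dots> = Poly_Mapping.lookup x (Hcl 1)" using params by simp
      finally have "(\<Sum>k=1..a-1. Poly_Mapping.lookup x (Hcl k) * real_of_int (Poly_Mapping.lookup (\<alpha> i) (Hcl k)))
        = Poly_Mapping.lookup x (Hcl 1)" .
      then show ?thesis unfolding pic_form_coords[OF assms(1) k] h using True e by simp
    next
      case F2: False
      define m where "m = i - r"
      have m: "i > r" "1 \<le> m" "m + 1 \<le> a - 1" using False F2 i by (auto simp: m_def)
      have L: "Poly_Mapping.lookup (\<alpha> i) (Hcl k) = (if k = m + 1 then 1 else 0) - (if k = m then 1 else 0)" for k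
        using m by (simp add: lookup_\<alpha>_H m_def)
      have "(\<Sum>k=1..a-1. (if k = m + 1 then 1 else 0) - (if k = m then 1 else (0::int))) = 0"
        unfolding sum_subtractf using m by simp
      then have h: "hyp_sum a (realify (\<alpha> i)) = 0" unfolding hyp_sum_linear by (simp add: hyp_sum_def L)
      have "(\<Sum>k=1..a-1. Poly_Mapping.lookup x (Hcl k) * real_of_int (Poly_Mapping.lookup (\<alpha> i) (Hcl k)))
      = (\<Sum>k=1..a-1. if k = m + 1 then Poly_Mapping.lookup x (Hcl k) else 0) - (\<Sum>k=1..a-1. if k = m then Poly_Mapping.lookup x (Hcl k) else 0)"
        unfolding sum_subtractf[symmetric] by (intro sum.cong refl) (simp add: L)
      also have "\<dots> = Poly_Mapping.lookup x (Hcl (m + 1)) - Poly_Mapping.lookup x (Hcl m)"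
        using m by simp
      finally show ?thesis unfolding pic_form_coords[OF assms(1) k] h using m False by (simp add: lookup_\<alpha>_E m_def)
    qed
  qed
qed

lemma pairing_\<alpha>_int:
  fixes x :: "pic_gen \<Rightarrow>\<^sub>0 int"
  assumes "Poly_Mapping.keys x \<subseteq> basis" "i \<in> N"
  shows "pic_form c x (\<alpha> i) =
    (if i < r then Poly_Mapping.lookup x (Ecl (i + 1)) - Poly_Mapping.lookup x (Ecl i)
     else if i = r then (int c - 1) * hyp_sum a x - Poly_Mapping.lookup x (Hcl 1) + (\<Sum>j=1..c. Poly_Mapping.lookup x (Ecl j))
     else Poly_Mapping.lookup x (Hcl (i - r)) - Poly_Mapping.lookup x (Hcl (i - r + 1)))" (is "_ = ?R")
proof -
  have "real_of_int (pic_form c x (\<alpha> i)) = real_of_int ?R"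
    using pairing_\<alpha>[of "realify x" i] assms by (simp add: pic_form_realify hyp_sum_linear)
  then show ?thesis by (simp only: of_int_eq_iff)
qed

definition "m = real (a * c) - real a - real c"

lemma m_pos: "m > 0" using params by (simp add: m_def del: of_nat_mult) 

lemma pairing_K:
  fixes x :: "pic_gen \<Rightarrow>\<^sub>0 real"
  assumes "Poly_Mapping.keys x \<subseteq> basis"
  shows "pic_form c x (realify K) = - m * (real c * hyp_sum a x + exc_sum b c x)"
proof -
  have k: "Poly_Mapping.keys (realify K) \<subseteq> basis" using keys_K by simp
  have h: "hyp_sum a (realify K) = - real c * (real a - 1)"
    using params unfolding K_mk_pic hyp_sum_linear hyp_sum_mk_pic by (simp add: of_nat_diff)
  have H: "(\<Sum>i=1..a-1. Poly_Mapping.lookup x (Hcl i) * Poly_Mapping.lookup (realify K) (Hcl i)) = - real c * hyp_sum a x"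
    unfolding K_mk_pic by (simp add: hyp_sum_def sum_distrib_left mult.commute sum_negf)
  have E: "(\<Sum>i=1..r. Poly_Mapping.lookup x (Ecl i) * Poly_Mapping.lookup (realify K) (Ecl i)) = m * exc_sum b c x"
    unfolding K_mk_pic by (simp add: exc_sum_def sum_distrib_left mult.commute m_def)
  show ?thesis unfolding pic_form_coords[OF assms k] h H E by (simp add: m_def algebra_simps)
qed

text \<open>The pairing of \<open>x\<close> with \<open>K\<close> is \<open>- m\<close> times the sum of \<open>c\<close> times the hyperplane degree and of
  the exceptional coefficients, and \<open>m\<close> is positive.\<close>

lemma Kperp_iff: "x \<in> Kperp a b c \<longleftrightarrow> Poly_Mapping.keys x \<subseteq> basis \<and> exc_sum b c x = - real c * hyp_sum a x"
  using m_pos pairing_K[of x] by (auto simp: Kperp_def)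

lemma keys_add_subset: "Poly_Mapping.keys x \<subseteq> S \<Longrightarrow> Poly_Mapping.keys y \<subseteq> S \<Longrightarrow> Poly_Mapping.keys (x + y) \<subseteq> S"
  using Poly_Mapping.keys_add[of x y] by blast

lemma keys_diff_subset: "Poly_Mapping.keys x \<subseteq> S \<Longrightarrow> Poly_Mapping.keys y \<subseteq> S \<Longrightarrow> Poly_Mapping.keys (x - y) \<subseteq> S"
  using keys_diff[of x y] by blast

lemma subspace_Kperp: "subspace (Kperp a b c)"
proof (rule subspaceI)
  show "0 \<in> Kperp a b c" by (simp add: Kperp_iff hyp_sum_def exc_sum_def)
  show "x + y \<in> Kperp a b c" if "x \<in> Kperp a b c" "y \<in> Kperp a b c" for x y
    using that keys_add_subset[of x basis y] by (simp add: Kperp_iff hyp_sum_linear exc_sum_linear algebra_simps)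
  show "t *\<^sub>R x \<in> Kperp a b c" if "x \<in> Kperp a b c" for t x
    using that order.trans[OF keys_scaleR[of t x]] by (simp add: Kperp_iff hyp_sum_linear(3) exc_sum_linear(3))
qed

lemma hyp_exc_\<alpha>:
  assumes "i \<in> N"
  shows "exc_sum b c (\<alpha> i) = - int c * hyp_sum a (\<alpha> i)"
proof -
  have i: "1 \<le> i" "i \<le> a + b + c - 2" using assms by (auto simp: nodes_def)
  consider "i < r" | "i = r" | "i > r" by linarith
  then show ?thesis
  proof cases
    case 1
    then show ?thesis using i by (simp add: hyp_sum_def exc_sum_def lookup_\<alpha>_H lookup_\<alpha>_E sum_subtractf)
  next
    case 2
    have "(\<Sum>j=1..r. if j \<in> {1..c} then -1 else (0::int)) = (\<Sum>j\<in>{1..r} \<inter> {1..c}. -1)"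
      by (subst sum.inter_restrict) simp_all
    also have "{1..r} \<inter> {1..c} = {1..c}" by auto
    finally show ?thesis using 2 params i by (simp add: hyp_sum_def exc_sum_def lookup_\<alpha>_H lookup_\<alpha>_E)
  next
    case 3
    then have "i - r \<in> {1..a-1}" "i - r + 1 \<in> {1..a-1}" using i by auto
    then show ?thesis using 3 by (simp add: hyp_sum_def exc_sum_def lookup_\<alpha>_H lookup_\<alpha>_E sum_subtractf)
  qed
qed

lemma \<alpha>_Kperp: "i \<in> N \<Longrightarrow> realify (\<alpha> i) \<in> Kperp a b c"
  using hyp_exc_\<alpha>[of i] keys_\<alpha>[of i] by (simp add: Kperp_iff hyp_sum_linear exc_sum_linear)

lemma K_\<alpha>: "i \<in> N \<Longrightarrow> pic_form c (realify K) (realify (\<alpha> i)) = 0"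
  using \<alpha>_Kperp[of i] by (subst pic_form_sym) (simp add: Kperp_def)

lemma K_sums: "exc_sum b c (realify K) + real c * hyp_sum a (realify K) = - \<delta>"
  using params unfolding K_mk_pic hyp_sum_linear exc_sum_linear hyp_sum_mk_pic exc_sum_mk_pic
  by (simp add: of_nat_diff pic_delta_def algebra_simps)

text \<open>Orthogonality to \<open>E\<^sub>i - E\<^sub>i\<^sub>+\<^sub>1\<close> and to \<open>H\<^sub>i\<^sub>+\<^sub>1 - H\<^sub>i\<close> makes the two families of coefficients
  constant. The remaining two equations have determinant \<open>\<delta>\<close>, up to sign.\<close>

lemma Kperp_zeroI:
  assumes x: "x \<in> Kperp a b c" and 0: "\<And>i. i \<in> N \<Longrightarrow> pic_form c x (realify (\<alpha> i)) = 0"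
  shows "x = 0"
proof -
  let ?x = "Poly_Mapping.lookup x"
  have kx: "Poly_Mapping.keys x \<subseteq> basis" using x by (simp add: Kperp_iff)
  have E: "?x (Ecl j) = ?x (Ecl 1)" if "j \<in> {1..r}" for j
  proof -
    have "1 \<le> j \<Longrightarrow> j \<le> r \<Longrightarrow> ?x (Ecl j) = ?x (Ecl 1)"
    proof (induction j rule: dec_induct)
      case (step j)
      have "j \<in> N" using step params by (auto simp: nodes_def)
      then show ?case using 0[of j] pairing_\<alpha>[OF kx, of j] step by simp
    qed simp
    then show ?thesis using that by simp
  qed
  have H: "?x (Hcl k) = ?x (Hcl 1)" if "k \<in> {1..a-1}" for k
  proof -
    have "1 \<le> k \<Longrightarrow> k \<le> a - 1 \<Longrightarrow> ?x (Hcl k) = ?x (Hcl 1)"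
    proof (induction k rule: dec_induct)
      case (step k)
      have "r + k \<in> N" using step by (auto simp: nodes_def)
      then show ?case using 0[of "r + k"] pairing_\<alpha>[OF kx, of "r + k"] step by simp
    qed simp
    then show ?thesis using that by simp
  qed
  define X where "X = ?x (Hcl 1)"
  define Y where "Y = ?x (Ecl 1)"
  have hs: "hyp_sum a x = (real a - 1) * X"
  proof -
    have "hyp_sum a x = (\<Sum>i=1..a-1. X)" unfolding hyp_sum_def X_def by (rule sum.cong[OF refl H])
    then show ?thesis using params by (simp add: of_nat_diff)
  qed
  have es: "exc_sum b c x = real r * Y"
  proof -
    have "exc_sum b c x = (\<Sum>i=1..r. Y)" unfolding exc_sum_def Y_def by (rule sum.cong[OF refl E])
    then show ?thesis by simp
  qed
  have "r \<in> N" using params by (auto simp: nodes_def)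
  from 0[OF this] pairing_\<alpha>[OF kx this]
  have "(real c - 1) * hyp_sum a x - ?x (Hcl 1) + (\<Sum>j=1..c. ?x (Ecl j)) = 0" by simp
  moreover have "(\<Sum>j=1..c. ?x (Ecl j)) = real c * Y"
  proof -
    have "(\<Sum>j=1..c. ?x (Ecl j)) = (\<Sum>j=1..c. Y)" unfolding Y_def by (rule sum.cong[OF refl E]) simp
    then show ?thesis by simp
  qed
  ultimately have 1: "m * X + real c * Y = 0" unfolding hs X_def[symmetric]
    by (simp add: m_def algebra_simps)
  have 2: "real r * Y = - real c * ((real a - 1) * X)" using x by (simp add: Kperp_iff hs es)
  have cY: "real c * Y = - (m * X)" using 1 by linarith
  have "real c * (real r * Y) = real r * (real c * Y)" by simp
  from this[unfolded 2 cY] have "- (real c * real c * (real a - 1)) * X = - (real r * m) * X"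
    by (simp add: algebra_simps)
  moreover have "real c * real c * (real a - 1) - real r * m = \<delta>"
    by (simp add: m_def pic_delta_def algebra_simps)
  ultimately have "\<delta> * X = 0" by (auto simp: algebra_simps)
  then have "X = 0" using delta_pos by simp
  moreover then have "Y = 0" using 1 params by simp
  ultimately show ?thesis using E[folded Y_def] H[folded X_def] kx
    by (intro pic_eqI[of _ a b c]) auto
qed

text \<open>Partial sums solve the equations of the two chains of differences, one free constant
  solves the equation of the branching root, and adding a multiple of \<open>K\<close>, which is
  orthogonal to all roots, leads into \<open>K\<^sup>\<bottom>\<close>.\<close>

lemma Kperp_pairings_exist: "\<exists>w\<in>Kperp a b c. \<forall>i\<in>N. pic_form c w (realify (\<alpha> i)) = t i"
proof -
  define X where "X k = - (\<Sum>i\<in>{1..<k}. t (r + i))" for k :: nat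
  define S where "S = (real c - 1) * (\<Sum>k=1..a-1. X k) - X 1 + (\<Sum>j=1..c. \<Sum>i\<in>{1..<j}. t i)"
  define y where "y = (t r - S) / real c"
  define Y where "Y j = y + (\<Sum>i\<in>{1..<j}. t i)" for j :: nat
  define v where "v = mk_pic a b c X Y"
  have kv: "Poly_Mapping.keys v \<subseteq> basis" unfolding v_def by (rule keys_mk_pic)
  have v: "pic_form c v (realify (\<alpha> i)) = t i" if i: "i \<in> N" for i
  proof -
    have ib: "1 \<le> i" "i \<le> a + b + c - 2" using i by (auto simp: nodes_def)
    consider "i < r" | "i = r" | "i > r" by linarith
    then show ?thesis
    proof cases
      case 1
      then have "pic_form c v (realify (\<alpha> i)) = Y (Suc i) - Y i"
        using ib unfolding pairing_\<alpha>[OF kv i] by (simp add: v_def)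
      then show ?thesis using ib by (simp add: Y_def)
    next
      case 2
      have "(\<Sum>j=1..c. Poly_Mapping.lookup v (Ecl j)) = (\<Sum>j=1..c. Y j)"
        by (rule sum.cong) (auto simp: v_def)
      then have "pic_form c v (realify (\<alpha> i)) = (real c - 1) * (\<Sum>k=1..a-1. X k) - X 1 + (\<Sum>j=1..c. Y j)"
        using 2 params unfolding pairing_\<alpha>[OF kv i] by (simp add: v_def)
      also have "\<dots> = S + real c * y" by (simp add: Y_def S_def sum.distrib)
      finally show ?thesis using 2 params by (simp add: y_def)
    next
      case 3
      then have "pic_form c v (realify (\<alpha> i)) = X (i - r) - X (Suc (i - r))"
        using ib unfolding pairing_\<alpha>[OF kv i] by (simp add: v_def) linarith
      moreover have "i - r \<ge> 1" "r + (i - r) = i" using 3 by auto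
      ultimately show ?thesis by (simp add: X_def)
    qed
  qed
  \<comment> \<open>The multiple of K for which w is orthogonal to K.\<close>
  define w where "w = v + ((exc_sum b c v + real c * hyp_sum a v) / \<delta>) *\<^sub>R realify K"
  have "Poly_Mapping.keys (realify K) \<subseteq> basis" using keys_K by simp
  then have "Poly_Mapping.keys w \<subseteq> basis"
    unfolding w_def by (intro keys_add_subset kv order.trans[OF keys_scaleR]) 
  moreover have "exc_sum b c w = - real c * hyp_sum a w"
  proof -
    let ?k = "(exc_sum b c v + real c * hyp_sum a v) / \<delta>"
    have "exc_sum b c w + real c * hyp_sum a w = exc_sum b c v + real c * hyp_sum a v + ?k * (exc_sum b c (realify K) + real c * hyp_sum a (realify K))"
      by (simp add: w_def exc_sum_linear(1,3) hyp_sum_linear(1,3) algebra_simps)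
    then show ?thesis unfolding K_sums using delta_pos by simp
  qed
  ultimately have "w \<in> Kperp a b c" by (simp add: Kperp_iff)
  moreover have "\<forall>i\<in>N. pic_form c w (realify (\<alpha> i)) = t i"
    using v K_\<alpha> by (simp add: w_def pic_form_add_left pic_form_scaleR_left)
  ultimately show ?thesis by auto
qed

lemma Kperp_eqI:
  assumes "x \<in> Kperp a b c" "y \<in> Kperp a b c"
    "\<And>i. i \<in> N \<Longrightarrow> pic_form c x (realify (\<alpha> i)) = pic_form c y (realify (\<alpha> i))"
  shows "x = y"
proof -
  have "x - y = 0"
    using assms subspace_diff[OF subspace_Kperp, of x y]
    by (intro Kperp_zeroI) (simp_all add: pic_form_minus_left)
  then show ?thesis by simp
qed

lemma omega:
  "omega a b c i \<in> Kperp a b c"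
  "j \<in> N \<Longrightarrow> pic_form c (omega a b c i) (realify (\<alpha> j)) = (if i = j then 1 else 0)"
proof -
  let ?P = "\<lambda>w. w \<in> Kperp a b c \<and> (\<forall>j\<in>N. pic_form c w (realify (\<alpha> j)) = (if i = j then 1 else 0))"
  obtain w where w: "?P w" using Kperp_pairings_exist[of "\<lambda>j. if i = j then 1 else 0"] by auto
  have "?P (omega a b c i)" unfolding omega_def
  proof (rule theI[of ?P w])
    show "w' = w" if "?P w'" for w' by (rule Kperp_eqI) (use that w in auto)
  qed (rule w)
  then show "omega a b c i \<in> Kperp a b c"
    "j \<in> N \<Longrightarrow> pic_form c (omega a b c i) (realify (\<alpha> j)) = (if i = j then 1 else 0)" by auto
qed

lemma \<alpha>_\<alpha>:
  assumes i: "i \<in> N" and j: "j \<in> N"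
  shows "pic_form c (\<alpha> i) (\<alpha> j) = - T_cartan_matrix a b c i j"
proof -
  have b: "1 \<le> i" "i \<le> a + b + c - 2" "1 \<le> j" "j \<le> a + b + c - 2" using assms by (auto simp: nodes_def)
  have h: "hyp_sum a (\<alpha> i) = (if i = r then 1 else 0)"
  proof -
    have "exc_sum b c (\<alpha> i) = (if i < r then 0 else if i = r then - int c else 0)"
    proof (cases "i = r")
      case True
      have "(\<Sum>j=1..r. if j \<in> {1..c} then -1 else (0::int)) = (\<Sum>j\<in>{1..r} \<inter> {1..c}. -1)"
        by (subst sum.inter_restrict) simp_all
      also have "{1..r} \<inter> {1..c} = {1..c}" by auto
      finally show ?thesis using True by (simp add: exc_sum_def lookup_\<alpha>_E)
    qed (use b in \<open>simp add: exc_sum_def lookup_\<alpha>_E sum_subtractf\<close>)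
    then have "int c * hyp_sum a (\<alpha> i) = int c * (if i = r then 1 else 0)" using hyp_exc_\<alpha>[OF i] by (simp split: if_splits)
    then show ?thesis using params by simp
  qed
  have e: "(\<Sum>k=1..c. Poly_Mapping.lookup (\<alpha> i) (Ecl k)) = (if i = r then - int c else if i = c then 1 else 0)"
  proof -
    consider "i < r" | "i = r" | "i > r" by linarith
    then show ?thesis using b params by cases (auto simp: lookup_\<alpha>_E sum_subtractf)
  qed
  have te: "T_edge a b c i j = ((j = i + 1 \<and> j \<noteq> b + c) \<or> (i = j + 1 \<and> i \<noteq> b + c) \<or>
      (i = c \<and> j = b + c) \<or> (i = b + c \<and> j = c))" using assms by (simp add: T_edge_def)
  have split: "n < r \<or> n = r \<or> (\<exists>p. n = r + Suc p)" for n
    using less_imp_Suc_add[of r n] by (cases n r rule: linorder_cases) auto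
  have g: "pic_form c (\<alpha> i) (\<alpha> j) = (if j < r then Poly_Mapping.lookup (\<alpha> i) (Ecl (j + 1)) - Poly_Mapping.lookup (\<alpha> i) (Ecl j)
     else if j = r then (int c - 1) * (if i = r then 1 else 0) - Poly_Mapping.lookup (\<alpha> i) (Hcl 1) + (if i = r then - int c else if i = c then 1 else 0)
     else Poly_Mapping.lookup (\<alpha> i) (Hcl (j - r)) - Poly_Mapping.lookup (\<alpha> i) (Hcl (j - r + 1)))"
    unfolding pairing_\<alpha>_int[OF keys_\<alpha>[OF i] j] h e ..
  have rc: "c < r" "c \<noteq> r" "c \<ge> 2" using params by auto
  consider "i < r" "j < r" | "i < r" "j = r" | p where "i < r" "j = r + Suc p"
    | "i = r" "j < r" | "i = r" "j = r" | p where "i = r" "j = r + Suc p"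
    | p where "i = r + Suc p" "j < r" | p where "i = r + Suc p" "j = r" | p q where "i = r + Suc p" "j = r + Suc q"
    using split[of i] split[of j] by blast
  then show ?thesis
    unfolding g T_cartan_matrix_def te lookup_\<alpha>_E lookup_\<alpha>_H by cases (use b rc in auto)
qed

lemma keys_O: "D \<in> \<O> \<Longrightarrow> Poly_Mapping.keys D \<subseteq> basis"
proof (induction rule: minus_one_divisors.induct)
  case base
  then show ?case using params by (auto simp: pic_basis_def)
next
  case (reflect D i)
  have "Poly_Mapping.keys (frag_cmul k (\<alpha> i)) \<subseteq> Poly_Mapping.keys (\<alpha> i)" for k
    by (auto simp: in_keys_iff lookup_frag_cmul)
  then show ?case using reflect keys_\<alpha> by (intro keys_add_subset) (auto simp: subset_eq)
qed

text \<open>This quantity is the pairing with \<open>K\<close> up to a factor, and roots lie in \<open>K\<^sup>\<bottom>\<close>; so it keeps its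
  value at \<open>E\<^sub>r\<close>.\<close>

lemma sums_O: "D \<in> \<O> \<Longrightarrow> exc_sum b c D + int c * hyp_sum a D = 1"
proof (induction rule: minus_one_divisors.induct)
  case base
  then show ?case using params by (simp add: exc_sum_def hyp_sum_def lookup_single when_def)
next
  case (reflect D i)
  have f: "exc_sum b c (frag_cmul k x) = k * exc_sum b c x" "hyp_sum a (frag_cmul k x) = k * hyp_sum a x" for k x
    by (simp_all add: exc_sum_def hyp_sum_def lookup_frag_cmul sum_distrib_left)
  show ?case using reflect hyp_exc_\<alpha>[of i]
    by (simp add: exc_sum_linear(1) hyp_sum_linear(1) f algebra_simps)
qed

lemma self_intersection_O: "D \<in> \<O> \<Longrightarrow> pic_form c D D = -1"
proof (induction rule: minus_one_divisors.induct)
  case base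
  then show ?case by (simp add: pic_form_def)
next
  case (reflect D i)
  have "pic_form c (frag_cmul k x) (frag_cmul l y) = k * l * pic_form c x y" for k l x y
    by (simp add: pic_form_frag_cmul_left pic_form_sym[of c _ "frag_cmul l y"] pic_form_sym[of c y])
  moreover have "pic_form c x (frag_cmul l y) = l * pic_form c x y" for l x y
    by (simp add: pic_form_frag_cmul_left pic_form_sym[of c _ "frag_cmul l y"] pic_form_sym[of c y])
  ultimately show ?case using reflect \<alpha>_\<alpha>[of i i]
    by (simp add: pic_form_add_left pic_form_add_right pic_form_frag_cmul_left pic_form_sym[of c "\<alpha> i" D] T_cartan_matrix_def)
qed

lemma proj_Kperp: "D \<in> \<O> \<Longrightarrow> proj a b c D \<in> Kperp a b c"
proof -
  assume D: "D \<in> \<O>"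
  have k: "Poly_Mapping.keys (realify D) \<subseteq> basis" "Poly_Mapping.keys (realify K) \<subseteq> basis"
    using keys_O[OF D] keys_K by auto
  have "exc_sum b c (proj a b c D) + real c * hyp_sum a (proj a b c D)
    = of_int (exc_sum b c D + int c * hyp_sum a D) + (1 / \<delta>) * (exc_sum b c (realify K) + real c * hyp_sum a (realify K))"
    by (simp add: proj_def exc_sum_linear(1,3) hyp_sum_linear(1,3) exc_sum_linear(4)[of _ _ D] hyp_sum_linear(4)[of _ D] algebra_simps)
  then have "exc_sum b c (proj a b c D) + real c * hyp_sum a (proj a b c D) = 0"
    unfolding K_sums sums_O[OF D] using delta_pos by simp
  moreover have "Poly_Mapping.keys (proj a b c D) \<subseteq> basis"
    unfolding proj_def by (intro keys_add_subset k order.trans[OF keys_scaleR])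
  ultimately show ?thesis by (simp add: Kperp_iff)
qed

lemma proj_pairing: "i \<in> N \<Longrightarrow> pic_form c (proj a b c D) (realify (\<alpha> i)) = of_int (pic_form c D (\<alpha> i))"
  using K_\<alpha>[of i] by (simp add: proj_def pic_form_add_left pic_form_scaleR_left pic_form_realify)

lemma inj_proj: "proj a b c D = proj a b c D' \<longleftrightarrow> D = D'"
  by (simp add: proj_def inj_realify)

lemma proj_base: "proj a b c (Ediv r) = omega a b c (r - 1)"
proof (rule Kperp_eqI)
  show "pic_form c (proj a b c (Ediv r)) (realify (\<alpha> i)) = pic_form c (omega a b c (r - 1)) (realify (\<alpha> i))"
    if i: "i \<in> N" for i
  proof -
    have k: "Poly_Mapping.keys (Ediv r) \<subseteq> basis" using keys_O[OF minus_one_divisors.base] .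
    have h: "hyp_sum a (Ediv r) = 0" "(\<Sum>j=1..c. Poly_Mapping.lookup (Ediv r) (Ecl j)) = 0"
      using params by (simp_all add: hyp_sum_def lookup_single when_def)
    have "pic_form c (Ediv r) (\<alpha> i) = (if r - 1 = i then 1 else 0)"
      unfolding pairing_\<alpha>_int[OF k i] h using i params by (auto simp: lookup_single when_def nodes_def)
    then show ?thesis unfolding proj_pairing[OF i] omega(2)[OF i] by simp
  qed
qed (auto intro: proj_Kperp minus_one_divisors.base omega)

end

section \<open>Finite orbits on a sphere\<close>

lemma dotp_superset:
  assumes "finite A" "Poly_Mapping.keys x \<subseteq> A"
  shows "dotp x y = (\<Sum>i\<in>A. Poly_Mapping.lookup x i * Poly_Mapping.lookup y i)"
  unfolding dotp_def using assms by (intro sum.mono_neutral_left) (auto simp: in_keys_iff)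

lemma dotp_scaleR: "dotp (t *\<^sub>R x) (t *\<^sub>R x) = t\<^sup>2 * dotp x x"
  using keys_scaleR[of t x]
  by (simp add: dotp_superset[of "Poly_Mapping.keys x"] sum_distrib_left power2_eq_square mult_ac)

lemma dotp_nonneg: "dotp x x \<ge> 0"
  unfolding dotp_def by (intro sum_nonneg) simp

lemma dotp_eq_0: "dotp x x = 0 \<longleftrightarrow> x = 0"
proof
  assume "dotp x x = 0"
  then have "\<forall>i\<in>Poly_Mapping.keys x. Poly_Mapping.lookup x i * Poly_Mapping.lookup x i = 0"
    unfolding dotp_def by (subst (asm) sum_nonneg_eq_0_iff) simp_all
  then show "x = 0" by (auto simp: in_keys_iff intro: poly_mapping_eqI)
qed (simp add: dotp_def)

context picard
begin

text \<open>The projected divisors all have the same norm \<open>n0\<close>. For two of them, \<open>x\<close> and \<open>y\<close>, the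
  definiteness of the form on \<open>x - y\<close> gives that the functional \<open>-(x \<sqdot> _)\<close> is strictly
  less than \<open>n0\<close> at \<open>y\<close>: it exposes \<open>x\<close> as a vertex of the hull. The similarity is \<open>L\<close> rescaled,
  with a translation that absorbs the multiple of \<open>K\<close> in the projection. Definiteness on \<open>K\<^sup>\<bottom>\<close>
  is itself inherited from the Euclidean space through \<open>L\<close>.\<close>

lemma images_are_vertices_of_hull:
  fixes L :: "(pic_gen \<Rightarrow>\<^sub>0 real) \<Rightarrow> (nat \<Rightarrow>\<^sub>0 real)"
  assumes L: "linear L"
    and iso: "\<And>x y. x \<in> Kperp a b c \<Longrightarrow> y \<in> Kperp a b c \<Longrightarrow> dotp (L x) (L y) = - pic_form c x y"
    and X: "(\<lambda>D. L (realify D) + u) ` \<O> = X" and fX: "finite X"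
  shows "images_are_vertices_of a b c (convex hull X)" "finite \<O>" "card \<O> = card X"
proof -
  interpret L: linear L by (rule L)
  have neg: "pic_form c x x < 0" if x: "x \<in> Kperp a b c" "x \<noteq> 0" for x
  proof (rule ccontr)
    assume "\<not> ?thesis"
    then have "L x = 0" using iso[OF x(1,1)] dotp_nonneg[of "L x"] dotp_eq_0[of "L x"] by simp
    then have "pic_form c x (realify (\<alpha> i)) = 0" if "i \<in> N" for i
      using iso[OF x(1) \<alpha>_Kperp[OF that]] by (simp add: dotp_def)
    then show False using Kperp_zeroI[OF x(1)] x(2) by simp
  qed
  have injL: "x = y" if "x \<in> Kperp a b c" "y \<in> Kperp a b c" "L x = L y" for x y
  proof (rule ccontr)
    assume "x \<noteq> y"
    moreover have xy: "x - y \<in> Kperp a b c" using subspace_diff[OF subspace_Kperp] that by auto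
    ultimately have "pic_form c (x - y) (x - y) < 0" using neg by auto
    then show False using iso[OF xy xy] that(3) by (simp add: L.diff dotp_def)
  qed
  have "inj_on (\<lambda>D. L (realify D) + u) \<O>"
  proof (rule inj_onI)
    fix D D' assume D: "D \<in> \<O>" "D' \<in> \<O>" "L (realify D) + u = L (realify D') + u"
    then have "L (proj a b c D) = L (proj a b c D')" by (simp add: proj_def L.add)
    then show "D = D'" using injL proj_Kperp D inj_proj by blast
  qed
  then show finO: "finite \<O>" and "card \<O> = card X" using X fX by (auto dest: finite_imageD simp: card_image)
  define \<nu> where "\<nu> = (1 + (real (a * c) - real a - real c) / \<delta>) powr (- 1 / 2)"
  have "0 < 1 + m / \<delta>" using m_pos delta_pos by (intro add_pos_pos) auto
  then have \<nu>: "\<nu> > 0" unfolding \<nu>_def m_def[symmetric] by simp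
  define S where "S = nproj a b c ` \<O>"
  have np: "nproj a b c D = \<nu> *\<^sub>R proj a b c D" for D by (simp add: nproj_def \<nu>_def)
  have SK: "S \<subseteq> Kperp a b c"
    using proj_Kperp subspace_scale[OF subspace_Kperp] by (auto simp: S_def np)
  have PK: "convex hull S \<subseteq> Kperp a b c"
    by (rule hull_minimal[of S "Kperp a b c" convex]) (use SK subspace_Kperp subspace_imp_convex in auto)
  define n0 where "n0 = \<nu>\<^sup>2 * (1 + 2 * m / \<delta> - pic_form c (realify K) (realify K) / \<delta>\<^sup>2)"
  have norm: "- pic_form c y y = n0" if "y \<in> S" for y
  proof -
    obtain D where D: "D \<in> \<O>" "y = \<nu> *\<^sub>R proj a b c D" using \<open>y \<in> S\<close> by (auto simp: S_def np)
    have "real c * hyp_sum a (realify D) + exc_sum b c (realify D) = 1"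
    proof -
      have "real_of_int (exc_sum b c D + int c * hyp_sum a D) = 1" by (simp only: sums_O[OF D(1)] of_int_1)
      then show ?thesis by (simp add: hyp_sum_linear(4) exc_sum_linear(4))
    qed
    then have "pic_form c (realify D) (realify K) = - m" using pairing_K[of "realify D"] keys_O[OF D(1)] by simp
    moreover have "pic_form c (realify D) (realify D) = -1" by (simp add: pic_form_realify self_intersection_O[OF D(1)])
    ultimately show ?thesis unfolding D(2) n0_def
      by (simp add: pic_form_scaleR_left pic_form_scaleR_right proj_def pic_form_add_left pic_form_add_right
          pic_form_sym[of c "realify K" "realify D"] power2_eq_square algebra_simps
          add_divide_distrib diff_divide_distrib)
  qed
  have extreme: "x extreme_point_of (convex hull S)" if x: "x \<in> S" for x
  proof -
    define g where "g y = - pic_form c x y" for y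
    have g: "g (s *\<^sub>R y + t *\<^sub>R z) = s * g y + t * g z" for s t y z
      by (simp add: g_def pic_form_add_right pic_form_scaleR_right)
    have gS: "g y < n0" if "y \<in> S" "y \<noteq> x" for y
    proof -
      have "pic_form c (x - y) (x - y) < 0"
        using that x SK subspace_diff[OF subspace_Kperp] by (intro neg) auto
      then show ?thesis using norm[OF x] norm[OF that(1)]
        by (simp add: pic_form_minus_left pic_form_minus_right g_def pic_form_sym[of c y x])
    qed
    have gx: "g x = n0" using norm[OF x] by (simp add: g_def)
    \<comment> \<open>An open half-space together with one point of its boundary.\<close>
    have "convex ({y. g y < n0} \<union> {x})"
      unfolding convex_def
    proof (intro ballI allI impI)
      fix y z s t assume y: "y \<in> {y. g y < n0} \<union> {x}" and z: "z \<in> {y. g y < n0} \<union> {x}"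
        and st: "(0::real) \<le> s" "0 \<le> t" "s + t = 1"
      consider "y = x" "z = x" | "s = 0" | "t = 0" | "s > 0" "t > 0" "g y < n0 \<and> g z \<le> n0 \<or> g y \<le> n0 \<and> g z < n0"
        using y z gx st by fastforce
      then show "s *\<^sub>R y + t *\<^sub>R z \<in> {y. g y < n0} \<union> {x}"
      proof cases
        case 1
        then show ?thesis using st by (simp add: scaleR_left_distrib[symmetric])
      next
        case 4
        have "s * g y + t * g z < s * n0 + t * n0"
          using 4 by (auto intro: add_less_le_mono add_le_less_mono)
        also have "\<dots> = n0" using st by (simp add: distrib_right[symmetric])
        finally show ?thesis by (simp add: g)
      qed (use y z st in auto)
    qed
    moreover have "S \<subseteq> {y. g y < n0} \<union> {x}" using gS by auto
    ultimately have hull: "convex hull S \<subseteq> {y. g y < n0} \<union> {x}" by (rule hull_minimal[rotated])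
    show ?thesis
      unfolding extreme_point_of_def
    proof (intro conjI ballI notI)
      show "x \<in> convex hull S" using x by (rule hull_inc)
      fix p q assume p: "p \<in> convex hull S" and q: "q \<in> convex hull S" and "x \<in> open_segment p q"
      then obtain t where t: "0 < t" "t < 1" "p \<noteq> q" "x = (1 - t) *\<^sub>R p + t *\<^sub>R q"
        by (auto simp: in_segment)
      have le: "g p \<le> n0" "g q \<le> n0" using hull p q gx by auto
      have "n0 = (1 - t) * g p + t * g q" using gx g[of "1 - t" p t q] t(4) by metis
      moreover have "(1 - t) * g p + t * g q < n0" if "g p < n0 \<or> g q < n0"
      proof -
        have "(1 - t) * g p + t * g q < (1 - t) * n0 + t * n0"
          using that le t by (auto intro: add_less_le_mono add_le_less_mono)
        then show ?thesis by (simp add: algebra_simps)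
      qed
      ultimately have "\<not> (g p < n0 \<or> g q < n0)" by auto
      then have "p = x" "q = x" using hull p q by auto
      then show False using t(3) by simp
    qed
  qed
  have ext: "S = {x. x extreme_point_of (convex hull S)}"
    using extreme extreme_point_of_convex_hull[of _ S] by blast
  \<comment> \<open>The translation that cancels the image of the multiple of K in the projection.\<close>
  define w where "w = u - (1 / \<delta>) *\<^sub>R L (realify K)"
  define \<phi> where "\<phi> x = w + (1 / \<nu>) *\<^sub>R L x" for x
  have dist: "euclid_dist (\<phi> x) (\<phi> y) = (1 / \<nu>) * Kperp_dist c x y"
    if "x \<in> Kperp a b c" "y \<in> Kperp a b c" for x y
  proof -
    have xy: "x - y \<in> Kperp a b c" using subspace_diff[OF subspace_Kperp] that by auto
    have "\<phi> x - \<phi> y = (1 / \<nu>) *\<^sub>R L (x - y)" by (simp add: \<phi>_def L.diff scaleR_diff_right)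
    then have "dotp (\<phi> x - \<phi> y) (\<phi> x - \<phi> y) = (1 / \<nu>)\<^sup>2 * (- pic_form c (x - y) (x - y))"
      by (simp only: dotp_scaleR iso[OF xy xy])
    then have "euclid_dist (\<phi> x) (\<phi> y) = sqrt ((1 / \<nu>)\<^sup>2) * sqrt (- pic_form c (x - y) (x - y))"
      unfolding euclid_dist_def by (simp only: real_sqrt_mult)
    then show ?thesis using \<nu> by (simp add: Kperp_dist_def)
  qed
  have "linear (\<lambda>x. (1 / \<nu>) *\<^sub>R L x)"
    by (intro linearI) (simp_all add: L.add L.scaleR scaleR_add_right)
  then have "\<phi> ` (convex hull S) = (+) w ` (convex hull ((\<lambda>x. (1 / \<nu>) *\<^sub>R L x) ` S))"
    by (simp add: convex_hull_linear_image[symmetric] \<phi>_def image_image)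
  also have "\<dots> = convex hull (\<phi> ` S)"
    by (simp add: convex_hull_translation[symmetric] \<phi>_def image_image)
  also have "\<phi> ` S = X"
  proof -
    have "\<phi> (nproj a b c D) = L (realify D) + u" for D
      using \<nu> by (simp add: np \<phi>_def L.scaleR proj_def L.add w_def)
    then show ?thesis using X by (simp add: S_def image_image)
  qed
  finally have img: "\<phi> ` (convex hull S) = convex hull X" .
  show "images_are_vertices_of a b c (convex hull X)"
    unfolding images_are_vertices_of_def
  proof (intro exI[of _ "convex hull S"] conjI)
    show "polytope (convex hull S)" using finO by (auto simp: polytope_def S_def)
    show "similar_polytope a b c (convex hull S) (convex hull X)"
      unfolding similar_polytope_def
      by (rule exI[of _ \<phi>], rule exI[of _ "1 / \<nu>"]) (use \<nu> dist img in auto)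
  qed (use PK ext in \<open>auto simp: S_def\<close>)
qed

end

section \<open>Weights of a labelled module\<close>

context picard
begin

definition wt :: "(pic_gen \<Rightarrow>\<^sub>0 int) \<Rightarrow> nat \<Rightarrow> int" where
  "wt D = (\<lambda>j. if j \<in> N then pic_form c D (\<alpha> j) else 0)"

abbreviation "reflect_div i D \<equiv> D + frag_cmul (pic_form c D (\<alpha> i)) (\<alpha> i)"

lemma T_cartan_sym: "T_cartan_matrix a b c i j = T_cartan_matrix a b c j i"
proof -
  have "T_edge a b c i j = T_edge a b c j i" unfolding T_edge_def by blast
  then show ?thesis by (simp add: T_cartan_matrix_def eq_commute)
qed

lemma wt_refl:
  assumes "i \<in> N"
  shows "wt (reflect_div i D) = reflect_weight (T_cartan_matrix a b c) i (wt D)"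
proof
  fix j
  show "wt (reflect_div i D) j = reflect_weight (T_cartan_matrix a b c) i (wt D) j"
  proof (cases "j \<in> N")
    case True
    then show ?thesis using assms \<alpha>_\<alpha>[OF assms True]
      by (simp add: wt_def reflect_weight_def pic_form_add_left pic_form_frag_cmul_left T_cartan_sym)
  next
    case False
    then have "T_cartan_matrix a b c j i = 0" using assms by (simp add: T_cartan_matrix_def T_edge_def split: if_splits) blast
    then show ?thesis using False by (simp add: wt_def reflect_weight_def)
  qed
qed

lemma wt_base: "wt (Ediv r) = (\<lambda>i. if i = r - 1 then 1 else 0)"
proof
  fix i
  have "r - 1 \<in> N" using params by (auto simp: nodes_def)
  then show "wt (Ediv r) i = (if i = r - 1 then 1 else 0)"
  proof (cases "i \<in> N")
    case True
    have "real_of_int (pic_form c (Ediv r) (\<alpha> i)) = (if r - 1 = i then 1 else 0)"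
      using proj_pairing[OF True, of "Ediv r"] omega(2)[OF True, of "r - 1"] unfolding proj_base by simp
    then have "pic_form c (Ediv r) (\<alpha> i) = (if r - 1 = i then 1 else 0)" by (simp split: if_splits)
    then show ?thesis using True by (simp add: wt_def)
  next
    case False
    then show ?thesis using \<open>r - 1 \<in> N\<close> by (auto simp: wt_def)
  qed
qed

text \<open>On the numbers \<open>D \<sqdot> \<alpha>\<^sub>j\<close> the reflection of classes is the reflection of weights, because
  \<open>\<alpha>\<^sub>i \<sqdot> \<alpha>\<^sub>j\<close> is minus the Cartan matrix.\<close>

lemma wt_O: "wt ` \<O> = weight_orbit (T_cartan_matrix a b c) N (\<lambda>i. if i = r - 1 then 1 else 0)" (is "_ = ?W")
proof (intro equalityI subsetI)
  fix l assume "l \<in> wt ` \<O>"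
  then obtain D where "D \<in> \<O>" "l = wt D" by auto
  then show "l \<in> ?W"
  proof (induction arbitrary: l rule: minus_one_divisors.induct)
    case base
    then show ?case unfolding wt_base using weight_orbit.base by auto
  next
    case (reflect D i)
    then show ?case using wt_refl[of i D] weight_orbit.reflect[of "wt D"] by auto
  qed
next
  fix l assume "l \<in> ?W"
  then show "l \<in> wt ` \<O>"
  proof induction
    case base
    show ?case unfolding wt_base[symmetric] by (intro imageI minus_one_divisors.base)
  next
    case (reflect l i)
    then obtain D where "D \<in> \<O>" "l = wt D" by auto
    show ?case unfolding \<open>l = wt D\<close> wt_refl[OF reflect(2), symmetric]
      by (intro imageI minus_one_divisors.reflect \<open>D \<in> \<O>\<close> reflect(2))
  qed
qed

lemma inj_wt: "inj_on wt \<O>"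
proof (rule inj_onI)
  fix D D' assume D: "D \<in> \<O>" "D' \<in> \<O>" and eq: "wt D = wt D'"
  have "proj a b c D = proj a b c D'"
  proof (rule Kperp_eqI)
    show "pic_form c (proj a b c D) (realify (\<alpha> i)) = pic_form c (proj a b c D') (realify (\<alpha> i))" if "i \<in> N" for i
      using fun_cong[OF eq, of i] that by (simp add: proj_pairing wt_def)
  qed (use D proj_Kperp in auto)
  then show "D = D'" by (simp add: inj_proj)
qed

text \<open>The identification sends \<open>x\<close> to the functional with value \<open>x \<sqdot> \<alpha>\<^sub>i\<close> on \<open>h\<^sub>i\<close>. It turns \<open>q(D)\<close>
  into the weight of \<open>D\<close>, so the weights of the module, being the orbit of the highest
  weight, are exactly the images of the divisors.\<close>

theorem minuscule_canonical_weight_bijection: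
  fixes g :: "'g::ab_group_add lie_algebra" and M :: "('g, 'v::ab_group_add) lie_module"
  assumes mins: "\<And>D i. D \<in> \<O> \<Longrightarrow> i \<in> N \<Longrightarrow> pic_form c D (\<alpha> i) \<in> {-1, 0, 1}"
    and finO: "finite \<O>"
    and lab: "labelled_module a b c g M e f h"
  shows "canonical_weight_bijection a b c g M h"
proof -
  let ?A = "T_cartan_matrix a b c"
  have lie: "is_lie_algebra g" and chev: "chevalley_generators g N ?A e f h"
    and md: "is_lie_module g M" and irr: "irreducible_module g M" using lab by (auto simp: labelled_module_def)
  obtain v0 where v0: "v0 \<in> mcarrier M" "v0 \<noteq> 0" "\<And>i. i \<in> N \<Longrightarrow> maction M (e i) v0 = 0"
    "\<And>i. i \<in> N \<Longrightarrow> maction M (h i) v0 = mscale M (if i = r - 1 then 1 else 0) v0"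
    using lab by (auto simp: labelled_module_def)
  define L where "L = lcarrier g"
  define br where "br = lbracket g"
  define sc where "sc = lscale g"
  define V where "V = mcarrier M"
  define act where "act = maction M"
  define ms where "ms = mscale M"
  note defs = L_def[symmetric] br_def[symmetric] sc_def[symmetric] V_def[symmetric] act_def[symmetric] ms_def[symmetric]
  interpret G: vector_space sc using lie by (simp add: is_lie_algebra_def fin_dim_space_def Let_def sc_def)
  interpret MM: vector_space ms using md by (simp add: is_lie_module_def fin_dim_space_def Let_def ms_def)
  obtain B where B: "finite B" "L = G.span B"
    using lie unfolding is_lie_algebra_def fin_dim_space_def Let_def defs by blast
  obtain B' where B': "finite B'" "V = MM.span B'"
    using md unfolding is_lie_module_def fin_dim_space_def Let_def defs by blast
  have subL: "G.subspace L" and subV: "MM.subspace V" using B B' by auto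
  have act: "\<And>x v. x \<in> L \<Longrightarrow> v \<in> V \<Longrightarrow> act x v \<in> V"
    "\<And>x y v. x \<in> L \<Longrightarrow> y \<in> L \<Longrightarrow> v \<in> V \<Longrightarrow> act (x + y) v = act x v + act y v"
    "\<And>x v w. x \<in> L \<Longrightarrow> v \<in> V \<Longrightarrow> w \<in> V \<Longrightarrow> act x (v + w) = act x v + act x w"
    "\<And>x v k. x \<in> L \<Longrightarrow> v \<in> V \<Longrightarrow> act (sc k x) v = ms k (act x v)"
    "\<And>x v k. x \<in> L \<Longrightarrow> v \<in> V \<Longrightarrow> act x (ms k v) = ms k (act x v)"
    "\<And>x y v. x \<in> L \<Longrightarrow> y \<in> L \<Longrightarrow> v \<in> V \<Longrightarrow> act (br x y) v = act x (act y v) - act y (act x v)"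
    using md unfolding is_lie_module_def Let_def defs by blast+
  have brL: "x \<in> L \<Longrightarrow> y \<in> L \<Longrightarrow> br x y \<in> L" for x y
    using lie unfolding is_lie_algebra_def Let_def defs by blast
  note chev' = chev[unfolded chevalley_generators_def Let_def defs]
  have gens: "e ` N \<union> f ` N \<union> h ` N \<subseteq> L" by (rule chev'[THEN conjunct1])
  have rel: "br (h i) (h j) = 0 \<and> br (h i) (e j) = sc (of_int (?A i j)) (e j) \<and>
         br (h i) (f j) = sc (- of_int (?A i j)) (f j) \<and> br (e i) (f j) = (if i = j then h i else 0)"
    if "i \<in> N" "j \<in> N" for i j
    by (rule chev'[THEN conjunct2, THEN conjunct1, rule_format, OF that])
  have ind: "\<forall>i\<in>N. k i = 0" if "(\<Sum>i\<in>N. sc (k i) (h i)) = 0" for k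
    by (rule chev'[THEN conjunct2, THEN conjunct2, THEN conjunct2, THEN conjunct1, THEN spec, THEN mp, OF that])
  have gen: "S = L" if "G.subspace S" "S \<subseteq> L" "\<And>x y. x \<in> S \<Longrightarrow> y \<in> S \<Longrightarrow> br x y \<in> S"
    "e ` N \<union> f ` N \<union> h ` N \<subseteq> S" for S
    by (rule chev'[THEN conjunct2, THEN conjunct2, THEN conjunct2, THEN conjunct2, THEN spec, THEN mp]) (use that in simp)
  have eL: "e i \<in> L" "f i \<in> L" "h i \<in> L" if "i \<in> N" for i using gens that by auto
  have act0: "act 0 v = 0" if "v \<in> V" for v
    using act(4)[OF G.subspace_0[OF subL] that, of 0] by simp
  \<comment> \<open>The elements that preserve U form a subalgebra, so it suffices to test the generators.\<close>
  have irrU: "U = {0} \<or> U = V"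
    if U: "MM.subspace U" "U \<subseteq> V" "\<And>i x. i \<in> N \<Longrightarrow> x \<in> U \<Longrightarrow> act (e i) x \<in> U \<and> act (f i) x \<in> U \<and> act (h i) x \<in> U" for U
  proof -
    let ?S = "{x \<in> L. \<forall>u\<in>U. act x u \<in> U}"
    have "?S = L"
    proof (rule gen)
      show "G.subspace ?S"
        using U(2) MM.subspace_0[OF U(1)] MM.subspace_add[OF U(1)] MM.subspace_scale[OF U(1)]
          G.subspace_0[OF subL] G.subspace_add[OF subL] G.subspace_scale[OF subL]
        by (intro G.subspaceI) (auto simp: act act0 subset_eq)
      show "br x y \<in> ?S" if "x \<in> ?S" "y \<in> ?S" for x y
        using that U(2) MM.subspace_diff[OF U(1)] by (auto simp: brL act subset_eq)
    qed (use eL U(3) in auto)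
    then show ?thesis using irr U(1,2) unfolding irreducible_module_def defs by blast
  qed
  have orbit: "wt ` \<O> = weight_orbit ?A N (\<lambda>i. if i = r - 1 then 1 else 0)" by (rule wt_O)
  interpret MR: minuscule_rep ms V N ?A "\<lambda>i. act (e i)" "\<lambda>i. act (f i)" "\<lambda>i. act (h i)" "\<lambda>i. if i = r - 1 then 1 else 0" v0
  proof unfold_locales
    show "\<exists>B. finite B \<and> V \<subseteq> MM.span B" using B' by auto
    show "act (h i) (act (e j) x) = act (e j) (act (h i) x) + ms (complex_of_int (?A i j)) (act (e j) x)"
      if "i \<in> N" "j \<in> N" "x \<in> V" for i j x
      using act(6)[of "h i" "e j" x] act(4)[of "e j" x] rel[OF that(1,2)] eL that by (simp add: algebra_simps)
    show "act (h i) (act (f j) x) = act (f j) (act (h i) x) - ms (complex_of_int (?A i j)) (act (f j) x)"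
      if "i \<in> N" "j \<in> N" "x \<in> V" for i j x
    proof -
      have "br (h i) (f j) = sc (- of_int (?A i j)) (f j)" using rel[OF that(1,2)] by blast
      then have "act (br (h i) (f j)) x = ms (- of_int (?A i j)) (act (f j) x)"
        by (simp only: act(4)[OF eL(2)[OF that(2)] that(3)])
      then show ?thesis using act(6)[OF eL(3)[OF that(1)] eL(2)[OF that(2)] that(3)] by (simp add: algebra_simps)
    qed
    show "act (e i) (act (f j) x) = act (f j) (act (e i) x) + (if i = j then act (h i) x else 0)"
      if "i \<in> N" "j \<in> N" "x \<in> V" for i j x
      using act(6)[of "e i" "f j" x] rel[OF that(1,2)] eL that act0 by (auto simp: algebra_simps)
    show "l i \<in> {-1, 0, 1}" if "l \<in> weight_orbit ?A N (\<lambda>i. if i = r - 1 then 1 else 0)" "i \<in> N" for l i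
    proof -
      obtain D where "D \<in> \<O>" "l = wt D" using \<open>l \<in> _\<close> unfolding orbit[symmetric] by auto
      then show ?thesis using mins[of D i] \<open>i \<in> N\<close> by (simp add: wt_def)
    qed
    show "finite (weight_orbit ?A N (\<lambda>i. if i = r - 1 then 1 else 0))" unfolding orbit[symmetric] using finO by simp
    show "act (h i) v0 = ms (complex_of_int (if i = r - 1 then 1 else 0)) v0" if "i \<in> N" for i
      using v0(4)[OF that] unfolding defs by simp
    show "?A i i = 2" for i by (simp add: T_cartan_matrix_def)
  qed (use subV act eL v0 irrU in \<open>auto simp: defs\<close>)
  \<comment> \<open>The \<open>h\<^sub>i\<close> are a basis of the Cartan subalgebra, so a functional may be prescribed on them.\<close>
  have finN: "finite N" by (simp add: nodes_def)
  have injh: "inj_on h N"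
  proof (rule inj_onI, rule ccontr)
    fix i j assume ij: "i \<in> N" "j \<in> N" "h i = h j" "i \<noteq> j"
    let ?k = "\<lambda>l. (if l = i then 1 else if l = j then -1 else 0) :: complex"
    have "(\<Sum>l\<in>N. sc (?k l) (h l)) = (\<Sum>l\<in>{i, j}. sc (?k l) (h l))"
      using ij finN by (intro sum.mono_neutral_right) auto
    also have "\<dots> = 0" using ij by simp
    finally show False using ind[of ?k] ij by force
  qed
  have indh: "G.independent (h ` N)"
  proof (rule G.independent_if_scalars_zero)
    fix u x assume u: "(\<Sum>x\<in>h ` N. sc (u x) x) = 0" and x: "x \<in> h ` N"
    have "(\<Sum>i\<in>N. sc (u (h i)) (h i)) = 0" using u by (simp add: sum.reindex[OF injh])
    then show "u x = 0" using ind[of "\<lambda>i. u (h i)"] x by auto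
  qed (simp add: finN)
  define Ca where "Ca = G.span (h ` N)"
  have CaL: "Ca \<subseteq> L" unfolding Ca_def using G.span_minimal[OF _ subL] eL by blast
  have hCa: "h i \<in> Ca" if "i \<in> N" for i unfolding Ca_def using that by (intro G.span_base) auto
  have cartan: "cartan g N h = Ca" by (simp add: cartan_def Ca_def sc_def)
  define R where "R = G.representation (h ` N)"
  define \<iota> where "\<iota> x z = (if z \<in> Ca then \<Sum>i\<in>N. of_real (pic_form c x (realify (\<alpha> i))) * R z (h i) else (0::complex))" for x z
  have R_add: "R (x + y) z = R x z + R y z" if "x \<in> Ca" "y \<in> Ca" for x y z
    using G.representation_add[OF indh, of y x] that by (simp add: R_def Ca_def)
  have R_scale: "R (sc k x) z = k * R x z" if "x \<in> Ca" for k x z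
    using G.representation_scale[OF indh, of x k] that by (simp add: R_def Ca_def)
  have Ca_add: "x \<in> Ca \<Longrightarrow> y \<in> Ca \<Longrightarrow> x + y \<in> Ca" for x y by (simp add: Ca_def G.span_add)
  have Ca_scale: "x \<in> Ca \<Longrightarrow> sc k x \<in> Ca" for k x by (simp add: Ca_def G.span_scale)
  have Rh: "R (h i) (h j) = (if i = j then 1 else 0)" if "i \<in> N" "j \<in> N" for i j
    using G.representation_basis[OF indh, of "h i"] that injh by (auto simp: R_def inj_on_eq_iff)
  have \<iota>h: "\<iota> x (h j) = of_real (pic_form c x (realify (\<alpha> j)))" if "j \<in> N" for x j
  proof -
    have "\<iota> x (h j) = (\<Sum>i\<in>N. of_real (pic_form c x (realify (\<alpha> i))) * (if j = i then 1 else 0))"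
      using hCa[OF that] Rh[OF that] by (simp add: \<iota>_def)
    also have "\<dots> = (\<Sum>i\<in>N. if j = i then of_real (pic_form c x (realify (\<alpha> i))) else 0)"
      by (intro sum.cong) auto
    finally show ?thesis using that finN by simp
  qed
  have cdual: "l \<in> cartan_dual g N h \<longleftrightarrow> (\<forall>x\<in>Ca. \<forall>y\<in>Ca. l (x + y) = l x + l y) \<and> (\<forall>k. \<forall>x\<in>Ca. l (sc k x) = k * l x) \<and>
         (\<forall>x. x \<notin> Ca \<longrightarrow> l x = 0)" for l
    by (auto simp: cartan_dual_def cartan sc_def)
  have \<iota>dual: "\<iota> x \<in> cartan_dual g N h" for x
    unfolding cdual by (auto simp: \<iota>_def Ca_add Ca_scale R_add R_scale distrib_left sum.distrib sum_distrib_left intro!: sum.cong)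
  have dual_eqI: "l = l'" if l: "l \<in> cartan_dual g N h" "l' \<in> cartan_dual g N h" "\<And>i. i \<in> N \<Longrightarrow> l (h i) = l' (h i)" for l l'
  proof
    fix z
    show "l z = l' z"
    proof (cases "z \<in> Ca")
      case True
      have 0: "0 \<in> Ca" by (simp add: Ca_def G.span_zero)
      have l0: "l 0 = 0" "l' 0 = 0" using l(1,2) 0 unfolding cdual by (metis G.scale_zero_left mult_zero_left)+
      have "z \<in> Ca \<and> l z = l' z"
      proof (rule G.span_induct[OF True[unfolded Ca_def]])
        show "G.subspace {z. z \<in> Ca \<and> l z = l' z}"
          using l(1,2) 0 l0 unfolding cdual by (intro G.subspaceI) (auto simp: Ca_add Ca_scale)
      qed (use l(3) hCa in auto)
      then show ?thesis by simp
    qed (use l cdual in auto)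
  qed
  have ident: "canonical_identification a b c g h \<iota>"
    unfolding canonical_identification_def
  proof (intro conjI ballI allI)
    show "bij_betw \<iota> (Kperp a b c) (real_weight_space g N h)"
    proof (rule bij_betwI')
      show "(\<iota> x = \<iota> y) = (x = y)" if "x \<in> Kperp a b c" "y \<in> Kperp a b c" for x y
      proof
        assume eq: "\<iota> x = \<iota> y"
        show "x = y"
        proof (rule Kperp_eqI[OF that])
          fix i assume i: "i \<in> N"
          show "pic_form c x (realify (\<alpha> i)) = pic_form c y (realify (\<alpha> i))"
            using \<iota>h[OF i, of x] \<iota>h[OF i, of y] eq by simp
        qed
      qed simp
      show "\<iota> x \<in> real_weight_space g N h" for x by (auto simp: real_weight_space_def \<iota>dual \<iota>h)
      fix l assume l: "l \<in> real_weight_space g N h"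
      obtain w where w: "w \<in> Kperp a b c" "\<forall>i\<in>N. pic_form c w (realify (\<alpha> i)) = Re (l (h i))"
        using Kperp_pairings_exist[of "\<lambda>i. Re (l (h i))"] by auto
      have "l = \<iota> w"
      proof (rule dual_eqI)
        show "l (h i) = \<iota> w (h i)" if "i \<in> N" for i
          using that l w by (auto simp: \<iota>h real_weight_space_def complex_is_Real_iff complex_eq_iff)
      qed (use l \<iota>dual in \<open>auto simp: real_weight_space_def\<close>)
      then show "\<exists>x\<in>Kperp a b c. l = \<iota> x" using w by auto
    qed
    show "\<iota> (x + y) z = \<iota> x z + \<iota> y z" for x y z
      by (simp add: \<iota>_def pic_form_add_left distrib_right sum.distrib)
    show "\<iota> (t *\<^sub>R x) z = of_real t * \<iota> x z" for t x z
      by (simp add: \<iota>_def pic_form_scaleR_left sum_distrib_left mult.assoc)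
    show "\<iota> (omega a b c i) (h j) = (if i = j then 1 else 0)" if "i \<in> N" "j \<in> N" for i j
      using that by (simp add: \<iota>h omega)
  qed
  have \<iota>wt: "\<iota> (proj a b c D) (h i) = of_int (wt D i)" if "i \<in> N" for D i
    using that by (simp add: \<iota>h proj_pairing wt_def)
  have Kp: "proj a b c D \<in> Kperp a b c" if "D \<in> \<O>" for D using proj_Kperp that .
  have bij: "bij_betw (\<lambda>V. \<iota> (proj a b c V)) \<O> (weights g M N h)"
  proof (rule bij_betwI')
    show "(\<iota> (proj a b c x) = \<iota> (proj a b c y)) = (x = y)" if "x \<in> \<O>" "y \<in> \<O>" for x y
      using ident Kp[OF that(1)] Kp[OF that(2)] inj_proj
      unfolding canonical_identification_def bij_betw_def by (metis inj_onD)
    show "\<iota> (proj a b c D) \<in> weights g M N h" if D: "D \<in> \<O>" for D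
    proof -
      let ?l = "\<iota> (proj a b c D)"
      obtain x where x: "x \<noteq> 0" "MR.wv (wt D) x" using MR.orbit_is_weight[of "wt D"] imageI[OF D, of wt] unfolding orbit by blast
      have xV: "x \<in> V" using x by (simp add: MR.wv_def)
      have l: "?l \<in> cartan_dual g N h" by (rule \<iota>dual)
      have Ca0: "0 \<in> Ca" by (simp add: Ca_def G.span_zero)
      have l0: "?l 0 = 0" using l Ca0 unfolding cdual by (metis G.scale_zero_left mult_zero_left)
      have "z \<in> Ca \<and> act z x = ms (?l z) x" if "z \<in> G.span (h ` N)" for z
      proof (rule G.span_induct[OF that])
        have CaL': "z \<in> Ca \<Longrightarrow> z \<in> L" for z using CaL by auto
        show "G.subspace {z. z \<in> Ca \<and> act z x = ms (?l z) x}"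
        proof (rule G.subspaceI)
          show "0 \<in> {z. z \<in> Ca \<and> act z x = ms (?l z) x}" using Ca0 l0 act0[OF xV] by simp
        next
          fix y z assume "y \<in> {z. z \<in> Ca \<and> act z x = ms (?l z) x}" "z \<in> {z. z \<in> Ca \<and> act z x = ms (?l z) x}"
          then show "y + z \<in> {z. z \<in> Ca \<and> act z x = ms (?l z) x}"
            using l xV unfolding cdual by (simp add: Ca_add act(2) CaL' MM.scale_left_distrib)
        next
          fix k z assume "z \<in> {z. z \<in> Ca \<and> act z x = ms (?l z) x}"
          then show "sc k z \<in> {z. z \<in> Ca \<and> act z x = ms (?l z) x}"
            using l xV unfolding cdual by (simp add: Ca_scale act(4) CaL')
        qed
        show "z \<in> Ca \<and> act z x = ms (?l z) x" if "z \<in> h ` N" for z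
          using that x hCa by (auto simp: MR.wv_def \<iota>wt)
      qed
      then show ?thesis unfolding weights_def defs cartan using l x xV by (auto simp: Ca_def)
    qed
    fix l assume "l \<in> weights g M N h"
    then obtain x where l: "l \<in> cartan_dual g N h" and x: "x \<in> V" "x \<noteq> 0" "\<forall>z\<in>Ca. act z x = ms (l z) x"
      unfolding weights_def defs cartan by auto
    obtain l' where l': "l' \<in> wt ` \<O>" "\<forall>i\<in>N. l (h i) = of_int (l' i)"
      using MR.weight_in_orbit[of x "\<lambda>i. l (h i)"] x hCa unfolding orbit by blast
    then obtain D where D: "D \<in> \<O>" "l' = wt D" by auto
    have "l = \<iota> (proj a b c D)" by (rule dual_eqI[OF l \<iota>dual]) (use l' D \<iota>wt in auto)
    then show "\<exists>D\<in>\<O>. l = \<iota> (proj a b c D)" using D by auto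
  qed
  show ?thesis unfolding canonical_weight_bijection_def
    using proj_base ident bij by auto
qed

end

section \<open>Listing an orbit\<close>

context picard
begin

text \<open>The difference of the two classes is orthogonal to all roots and, having degree zero,
  lies in \<open>K\<^sup>\<bottom>\<close>.\<close>

lemma pic_class_eqI:
  assumes k: "Poly_Mapping.keys D \<subseteq> basis" "Poly_Mapping.keys D' \<subseteq> basis"
    and s: "exc_sum b c D + int c * hyp_sum a D = 1" "exc_sum b c D' + int c * hyp_sum a D' = 1"
    and p: "\<And>i. i \<in> N \<Longrightarrow> pic_form c D (\<alpha> i) = pic_form c D' (\<alpha> i)"
  shows "D = D'"
proof -
  have "realify D - realify D' = 0"
  proof (rule Kperp_zeroI)
    have "real_of_int (exc_sum b c D + int c * hyp_sum a D) = real_of_int (exc_sum b c D' + int c * hyp_sum a D')"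
      using s by simp
    then have "exc_sum b c (realify D - realify D') = - real c * hyp_sum a (realify D - realify D')"
      by (simp add: exc_sum_linear(2) hyp_sum_linear(2) exc_sum_linear(4)[of _ _ D] exc_sum_linear(4)[of _ _ D']
          hyp_sum_linear(4)[of _ D] hyp_sum_linear(4)[of _ D'] algebra_simps)
    then show "realify D - realify D' \<in> Kperp a b c"
      using keys_diff_subset[of "realify D" basis "realify D'"] k by (simp add: Kperp_iff)
    show "pic_form c (realify D - realify D') (realify (\<alpha> i)) = 0" if "i \<in> N" for i
      using p[OF that] by (simp add: pic_form_minus_left pic_form_realify)
  qed
  then show ?thesis by (simp add: inj_realify)
qed

lemma reflect_div_keys:
  assumes "Poly_Mapping.keys D \<subseteq> basis" "i \<in> N"
  shows "Poly_Mapping.keys (reflect_div i D) \<subseteq> basis"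
proof -
  have "Poly_Mapping.keys (frag_cmul k (\<alpha> i)) \<subseteq> Poly_Mapping.keys (\<alpha> i)" for k
    by (auto simp: in_keys_iff lookup_frag_cmul)
  then show ?thesis using assms keys_\<alpha>[of i] by (intro keys_add_subset) (auto simp: subset_eq)
qed

lemma reflect_div_sums:
  assumes "i \<in> N"
  shows "exc_sum b c (reflect_div i D) + int c * hyp_sum a (reflect_div i D) = exc_sum b c D + int c * hyp_sum a D"
proof -
  have f: "exc_sum b c (frag_cmul k x) = k * exc_sum b c x" "hyp_sum a (frag_cmul k x) = k * hyp_sum a x" for k x
    by (simp_all add: exc_sum_def hyp_sum_def lookup_frag_cmul sum_distrib_left)
  show ?thesis using hyp_exc_\<alpha>[OF assms]
    by (simp add: exc_sum_linear(1) hyp_sum_linear(1) f algebra_simps)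
qed

lemma reflect_div_pairing:
  assumes "i \<in> N" "j \<in> N"
  shows "pic_form c (reflect_div i D) (\<alpha> j) = pic_form c D (\<alpha> j) - pic_form c D (\<alpha> i) * T_cartan_matrix a b c i j"
  using \<alpha>_\<alpha>[OF assms] by (simp add: pic_form_add_left pic_form_frag_cmul_left)

lemma reflect_div_involution:
  assumes "i \<in> N"
  shows "reflect_div i (reflect_div i D) = D"
proof -
  have "frag_cmul k x + frag_cmul (- k) x = 0" for k and x :: "pic_gen \<Rightarrow>\<^sub>0 int"
    by (rule poly_mapping_eqI) (simp add: lookup_add lookup_frag_cmul)
  moreover have "pic_form c (reflect_div i D) (\<alpha> i) = - pic_form c D (\<alpha> i)"
    using reflect_div_pairing[OF assms assms] by (simp add: T_cartan_matrix_def)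
  ultimately show ?thesis by (simp add: add.assoc)
qed

text \<open>Closure gives one inclusion. For the other, a descent along the rank leads from any member of
  the family to \<open>E\<^sub>r\<close>, and since reflections are involutions the same path leads back.\<close>

lemma orbit_eqI:
  fixes rank :: "'i \<Rightarrow> nat"
  assumes base: "Ediv r \<in> Dv ` Q"
    and closed: "\<And>I i. I \<in> Q \<Longrightarrow> i \<in> N \<Longrightarrow> reflect_div i (Dv I) \<in> Dv ` Q"
    and descent: "\<And>I. I \<in> Q \<Longrightarrow> Dv I = Ediv r \<or> (\<exists>i\<in>N. \<exists>J\<in>Q. reflect_div i (Dv I) = Dv J \<and> rank J < rank I)"
  shows "\<O> = Dv ` Q"
proof (intro equalityI subsetI)
  fix D assume "D \<in> \<O>"
  then show "D \<in> Dv ` Q"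
  proof (induction rule: minus_one_divisors.induct)
    case (reflect D i)
    then show ?case using closed by auto
  qed (rule base)
next
  have "Dv I \<in> \<O>" if "I \<in> Q" for I
    using that
  proof (induction "rank I" arbitrary: I rule: less_induct)
    case less
    from descent[OF less(2)] show ?case
    proof
      assume "Dv I = Ediv r"
      then show ?thesis using minus_one_divisors.base by metis
    next
      assume "\<exists>i\<in>N. \<exists>J\<in>Q. reflect_div i (Dv I) = Dv J \<and> rank J < rank I"
      then obtain i J where i: "i \<in> N" and J: "J \<in> Q" "reflect_div i (Dv I) = Dv J" "rank J < rank I" by blast
      have "reflect_div i (Dv J) \<in> \<O>" using less(1)[OF J(3,1)] i by (rule minus_one_divisors.reflect)
      then show ?thesis using reflect_div_involution[OF i, of "Dv I"] J(2) by simp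
    qed
  qed
  then show "D \<in> \<O>" if "D \<in> Dv ` Q" for D using that by auto
qed

end

definition vec_of :: "nat \<Rightarrow> (nat \<Rightarrow> 'a::comm_monoid_add) \<Rightarrow> (nat \<Rightarrow>\<^sub>0 'a)" where
  "vec_of n g = (\<Sum>q<n. Poly_Mapping.single q (g q))"

lemma lookup_vec_of [simp]: "Poly_Mapping.lookup (vec_of n g) k = (if k < n then g k else 0)"
  by (simp add: vec_of_def lookup_sum lookup_single when_def)

lemma dotp_vec_of: "dotp (vec_of n g) (vec_of n g') = (\<Sum>q<n. g q * g' q)"
proof -
  have "Poly_Mapping.keys (vec_of n g) \<subseteq> {..<n}" by (auto simp: in_keys_iff split: if_splits)
  then show ?thesis by (simp add: dotp_superset[of "{..<n}"])
qed

lemma lookup_zero_one [simp]: "finite I \<Longrightarrow> Poly_Mapping.lookup (zero_one I) k = of_bool (k \<in> I)"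
  by (simp add: zero_one_def lookup_sum lookup_single when_def)

lemma zero_one_inject:
  assumes "finite I" "finite J" "zero_one I = zero_one J"
  shows "I = J"
proof -
  have "of_bool (k \<in> I) = (of_bool (k \<in> J) :: real)" for k
    using arg_cong[OF assms(3), of "\<lambda>x. Poly_Mapping.lookup x k"] assms(1,2) by simp
  then show ?thesis by (auto simp: of_bool_eq_iff)
qed

lemma sum_of_bool_card:
  assumes "I \<subseteq> {..<n::nat}"
  shows "(\<Sum>k<n. of_bool (k \<in> I)) = int (card I)"
proof -
  have "(\<Sum>k<n. of_bool (k \<in> I)) = (\<Sum>k\<in>{..<n} \<inter> I. 1 :: int)"
    unfolding of_bool_def by (rule sum.inter_restrict[symmetric]) simp
  then show ?thesis using assms by (simp add: Int_absorb1)
qed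

section \<open>Type A: subsets of fixed size\<close>

locale type_A = picard + assumes b1: "b = 1"
begin

lemma a1: "Suc 0 \<le> a - Suc 0" using params(1) by linarith

lemma rS: "b + c = Suc c" using b1 by simp

definition Q :: "nat set set" where "Q = {I. I \<subseteq> {..<c + a} \<and> card I = c}"

definition tail :: "nat set \<Rightarrow> int" where "tail I = (\<Sum>k=1..a-1. of_bool (c + k \<in> I))"

text \<open>A subset \<open>I\<close> of size \<open>c\<close> gives the class \<open>\<Sum>\<^sub>k x\<^sub>k H\<^sub>k + \<Sum>\<^sub>j y\<^sub>j E\<^sub>j\<close> in which the last \<open>a - 1\<close>
  points of the ground set record the \<open>x\<^sub>k\<close>, and the first \<open>c + 1\<close> points record the \<open>y\<^sub>j\<close> up to
  a common shift by the degree. The set of the first \<open>c\<close> points gives \<open>E\<^sub>r\<close>.\<close>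

definition Dv :: "nat set \<Rightarrow> pic_gen \<Rightarrow>\<^sub>0 int" where
  "Dv I = mk_pic a b c (\<lambda>k. of_bool (c + k \<in> I)) (\<lambda>j. 1 - tail I - of_bool (j - 1 \<in> I))"

lemma finite_Q: "I \<in> Q \<Longrightarrow> finite I"
  by (auto simp: Q_def intro: finite_subset)

lemma head_tail:
  assumes "I \<in> Q"
  shows "(\<Sum>j=1..c. of_bool (j - 1 \<in> I)) + of_bool (c \<in> I) + tail I = int c"
proof -
  have "int c = (\<Sum>k\<in>{0..<c+a}. of_bool (k \<in> I))"
    using sum_of_bool_card[of I "c + a"] assms by (simp add: Q_def atLeast0LessThan)
  also have "\<dots> = (\<Sum>k\<in>{0..<c+1}. of_bool (k \<in> I)) + (\<Sum>k\<in>{c+1..<c+a}. of_bool (k \<in> I))"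
    by (rule sum.atLeastLessThan_concat[symmetric]) (use params in auto)
  also have "(\<Sum>k\<in>{0..<c+1}. of_bool (k \<in> I)) = (\<Sum>k\<in>{0..<c}. of_bool (k \<in> I)) + (of_bool (c \<in> I) :: int)"
    by simp
  also have "(\<Sum>k\<in>{0..<c}. of_bool (k \<in> I)) = (\<Sum>j=1..c. of_bool (j - 1 \<in> I) :: int)"
    by (rule sum.reindex_bij_witness[of _ "\<lambda>j. j - 1" "\<lambda>k. k + 1"]) auto
  also have "(\<Sum>k\<in>{c+1..<c+a}. of_bool (k \<in> I)) = tail I"
    unfolding tail_def
    by (rule sum.reindex_bij_witness[of _ "\<lambda>k. c + k" "\<lambda>k. k - c"]) auto
  finally show ?thesis by simp
qed

lemma hyp_sum_Dv: "hyp_sum a (Dv I) = tail I"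
  by (simp add: Dv_def tail_def)

lemma Dv_sums:
  assumes "I \<in> Q"
  shows "exc_sum b c (Dv I) + int c * hyp_sum a (Dv I) = 1"
proof -
  have "exc_sum b c (Dv I) = (int c + 1) * (1 - tail I) - ((\<Sum>j=1..c. of_bool (j - 1 \<in> I)) + of_bool (c \<in> I))"
    unfolding Dv_def exc_sum_mk_pic sum_subtractf by (simp add: rS algebra_simps)
  also have "\<dots> = (int c + 1) * (1 - tail I) - (int c - tail I)" using head_tail[OF assms] by linarith
  finally show ?thesis unfolding hyp_sum_Dv by (simp add: algebra_simps)
qed

lemma keys_Dv: "Poly_Mapping.keys (Dv I) \<subseteq> basis"
  unfolding Dv_def by (rule keys_mk_pic)

lemma N_eq: "N = {1..c + a - 1}"
  by (auto simp: nodes_def b1)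

lemma pairing_Dv:
  assumes I: "I \<in> Q" and i: "i \<in> N"
  shows "pic_form c (Dv I) (\<alpha> i) = of_bool (i - 1 \<in> I) - of_bool (i \<in> I)"
proof -
  have ib: "1 \<le> i" "i \<le> c + a - 1" using i by (auto simp: N_eq)
  consider "i < c + 1" | "i = c + 1" | p where "i = c + 1 + Suc p"
    using less_imp_Suc_add[of "c + 1" i] by (cases i "c + 1" rule: linorder_cases) auto
  then show ?thesis
  proof cases
    case 1
    then show ?thesis unfolding pairing_\<alpha>_int[OF keys_Dv i] using ib by (simp add: Dv_def rS)
  next
    case 2
    have "(\<Sum>j=1..c. Poly_Mapping.lookup (Dv I) (Ecl j)) = (\<Sum>j=1..c. 1 - tail I - of_bool (j - 1 \<in> I))"
      by (rule sum.cong) (auto simp: Dv_def)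
    also have "\<dots> = (int c) * (1 - tail I) - (\<Sum>j=1..c. of_bool (j - 1 \<in> I))"
      by (simp add: sum_subtractf)
    also have "\<dots> = (int c) * (1 - tail I) - (int c - tail I - of_bool (c \<in> I))"
      using head_tail[OF I] by linarith
    finally have e: "(\<Sum>j=1..c. Poly_Mapping.lookup (Dv I) (Ecl j)) = \<dots>" .
    have "Poly_Mapping.lookup (Dv I) (Hcl 1) = of_bool (c + 1 \<in> I)"
      using a1 by (simp add: Dv_def)
    then show ?thesis unfolding pairing_\<alpha>_int[OF keys_Dv i] e hyp_sum_Dv using 2
      by (simp add: rS algebra_simps)
  next
    case 3
    then have "Suc (Suc p) \<le> a - Suc 0" using ib by linarith
    then show ?thesis unfolding pairing_\<alpha>_int[OF keys_Dv i] using 3 by (simp add: Dv_def rS)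
  qed
qed

text \<open>The simple reflections act as the adjacent transpositions.\<close>

definition swap :: "nat \<Rightarrow> nat set \<Rightarrow> nat set" where
  "swap i I = {k. Transposition.transpose (i - 1) i k \<in> I}"

lemma swap_Q:
  assumes "I \<in> Q" "i \<in> N"
  shows "swap i I \<in> Q"
proof -
  have "swap i I = Transposition.transpose (i - 1) i ` I"
  proof (intro equalityI subsetI)
    fix k assume "k \<in> swap i I"
    then show "k \<in> Transposition.transpose (i - 1) i ` I"
      by (intro image_eqI[of _ _ "Transposition.transpose (i - 1) i k"]) (auto simp: swap_def)
  qed (auto simp: swap_def)
  moreover have "card (Transposition.transpose (i - 1) i ` I) = card I"
    by (rule card_image, rule inj_onI, metis transpose_involutory)
  moreover have "swap i I \<subseteq> {..<c + a}" using assms by (auto simp: swap_def Q_def N_eq Transposition.transpose_def split: if_splits)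
  ultimately show ?thesis using assms by (simp add: Q_def)
qed

lemma T_cartan_A:
  assumes "i \<in> N" "j \<in> N"
  shows "T_cartan_matrix a b c i j = (if i = j then 2 else if i = j + 1 \<or> j = i + 1 then -1 else 0)"
  using assms by (auto simp: T_cartan_matrix_def T_edge_def b1)

lemma reflect_Dv:
  assumes I: "I \<in> Q" and i: "i \<in> N"
  shows "reflect_div i (Dv I) = Dv (swap i I)"
proof (rule pic_class_eqI)
  show "pic_form c (reflect_div i (Dv I)) (\<alpha> j) = pic_form c (Dv (swap i I)) (\<alpha> j)" if j: "j \<in> N" for j
  proof -
    have "1 \<le> i" "1 \<le> j" using i j by (auto simp: N_eq)
    then obtain i' j' where ij: "i = Suc i'" "j = Suc j'" by (metis Suc_le_D One_nat_def)
    consider "i' = j'" | "i' = Suc j'" | "j' = Suc i'" | "i' \<noteq> j'" "i' \<noteq> Suc j'" "j' \<noteq> Suc i'" by blast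
    then have "of_bool (j - 1 \<in> I) - of_bool (j \<in> I) - (of_bool (i - 1 \<in> I) - of_bool (i \<in> I)) * (if i = j then 2 else if i = j + 1 \<or> j = i + 1 then -1 else 0)
      = (of_bool (j - 1 \<in> swap i I) - of_bool (j \<in> swap i I) :: int)"
      unfolding ij by cases (simp_all add: swap_def Transposition.transpose_def)
    then show ?thesis
      unfolding reflect_div_pairing[OF i j] unfolding pairing_Dv[OF I i] pairing_Dv[OF I j] pairing_Dv[OF swap_Q[OF I i] j]
        T_cartan_A[OF i j] .
  qed
qed (use I i reflect_div_keys keys_Dv reflect_div_sums Dv_sums swap_Q in auto)

lemma down_closed_eq:
  assumes "finite I" "\<And>i. i \<ge> 1 \<Longrightarrow> i \<in> I \<Longrightarrow> i - 1 \<in> I"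
  shows "I = {..<card I}"
proof -
  have down: "j \<in> I" if "i \<in> I" "j \<le> i" for i j
    using that(2,1) by (induction rule: inc_induct) (use assms(2) in fastforce)+
  define m where "m = (LEAST m. m \<notin> I)"
  have "\<exists>m. m \<notin> I" using assms(1) ex_new_if_finite infinite_UNIV_nat by blast
  then have "m \<notin> I" "\<And>k. k < m \<Longrightarrow> k \<in> I" unfolding m_def by (rule LeastI_ex) (use not_less_Least in blast)
  then have "I = {..<m}" using down by (metis (no_types) lessThan_iff not_le_imp_less subsetI subset_antisym)
  then show ?thesis by simp
qed

text \<open>A set that is not an initial segment contains some \<open>i\<close> but not \<open>i - 1\<close>, and exchanging the
  two lowers the sum of its elements.\<close>

lemma orbit: "\<O> = Dv ` Q"
proof (rule orbit_eqI[where rank = "\<lambda>I. \<Sum>I"])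
  have base: "Dv {..<c} = Ediv (b + c)"
  proof (rule poly_mapping_eqI)
    have "tail {..<c} = 0" by (simp add: tail_def)
    then show "Poly_Mapping.lookup (Dv {..<c}) k = Poly_Mapping.lookup (Ediv (b + c)) k" for k
      by (cases k) (auto simp: Dv_def lookup_single when_def rS)
  qed
  have "{..<c} \<in> Q" by (auto simp: Q_def)
  then show "Ediv (b + c) \<in> Dv ` Q" using base by (metis imageI)
  show "reflect_div i (Dv I) \<in> Dv ` Q" if "I \<in> Q" "i \<in> N" for I i
    using reflect_Dv[OF that] swap_Q[OF that] by auto
  show "Dv I = Ediv (b + c) \<or> (\<exists>i\<in>N. \<exists>J\<in>Q. reflect_div i (Dv I) = Dv J \<and> \<Sum>J < \<Sum>I)" if I: "I \<in> Q" for I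
  proof (cases "\<exists>i\<ge>1. i \<in> I \<and> i - 1 \<notin> I")
    case True
    then obtain i where i: "i \<ge> 1" "i \<in> I" "i - 1 \<notin> I" by auto
    have iN: "i \<in> N" using i I by (auto simp: N_eq Q_def)
    have eq: "swap i I = insert (i - 1) (I - {i})"
      using i by (auto simp: swap_def Transposition.transpose_def split: if_splits)
    have "\<Sum>(swap i I) = (i - 1) + \<Sum>(I - {i})" unfolding eq using i finite_Q[OF I] by (subst sum.insert) auto
    also have "\<dots> < \<Sum>I" using i finite_Q[OF I] by (simp add: sum.remove[of I i])
    finally show ?thesis using reflect_Dv[OF I iN] swap_Q[OF I iN] iN by blast
  next
    case False
    then have "I = {..<c}" using down_closed_eq[OF finite_Q[OF I]] I by (auto simp: Q_def)
    then show ?thesis using base by simp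
  qed
qed

lemma minuscule: "D \<in> \<O> \<Longrightarrow> i \<in> N \<Longrightarrow> pic_form c D (\<alpha> i) \<in> {-1, 0, 1}"
  unfolding orbit by (auto simp: pairing_Dv)

text \<open>The inverse of the coding of classes by subsets, made linear. It is isometric because
  \<open>c + 1\<close> coordinates are shifted by the degree \<open>X\<close>, which contributes
  \<open>(c + 1) X\<^sup>2 - 2 c X\<^sup>2 = - (c - 1) X\<^sup>2\<close> on \<open>K\<^sup>\<bottom>\<close>.\<close>

definition Lmap :: "(pic_gen \<Rightarrow>\<^sub>0 real) \<Rightarrow> nat \<Rightarrow>\<^sub>0 real" where
  "Lmap x = vec_of (c + a) (\<lambda>q. if q < c + 1 then - hyp_sum a x - Poly_Mapping.lookup x (Ecl (q + 1))
     else Poly_Mapping.lookup x (Hcl (q - c)))"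

lemma sum_split: "(\<Sum>q<c+a. f q) = (\<Sum>j=1..b+c. f (j - 1)) + (\<Sum>k=1..a-1. f (c + k))" for f :: "nat \<Rightarrow> real"
proof -
  have "(\<Sum>q<c+a. f q) = (\<Sum>q\<in>{0..<c+1}. f q) + (\<Sum>q\<in>{c+1..<c+a}. f q)"
    using sum.atLeastLessThan_concat[of 0 "c+1" "c+a" f] params by (simp add: atLeast0LessThan)
  also have "(\<Sum>q\<in>{0..<c+1}. f q) = (\<Sum>j=1..b+c. f (j - 1))"
    unfolding rS by (rule sum.reindex_bij_witness[of _ "\<lambda>j. j - 1" "\<lambda>k. k + 1"]) auto
  also have "(\<Sum>q\<in>{c+1..<c+a}. f q) = (\<Sum>k=1..a-1. f (c + k))"
    by (rule sum.reindex_bij_witness[of _ "\<lambda>k. c + k" "\<lambda>k. k - c"]) auto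
  finally show ?thesis .
qed

lemma Lmap_isometry:
  assumes "x \<in> Kperp a b c" "y \<in> Kperp a b c"
  shows "dotp (Lmap x) (Lmap y) = - pic_form c x y"
proof -
  let ?x = "\<lambda>j. Poly_Mapping.lookup x (Ecl j)" and ?y = "\<lambda>j. Poly_Mapping.lookup y (Ecl j)"
  let ?X = "hyp_sum a x" and ?Y = "hyp_sum a y"
  have kx: "Poly_Mapping.keys x \<subseteq> basis" "Poly_Mapping.keys y \<subseteq> basis" using assms by (auto simp: Kperp_iff)
  have e: "(\<Sum>j=1..b+c. ?x j) = - real c * ?X" "(\<Sum>j=1..b+c. ?y j) = - real c * ?Y"
    using assms unfolding Kperp_iff exc_sum_def by auto
  have "dotp (Lmap x) (Lmap y) = (\<Sum>j=1..b+c. (?X + ?x j) * (?Y + ?y j))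
    + (\<Sum>k=1..a-1. Poly_Mapping.lookup x (Hcl k) * Poly_Mapping.lookup y (Hcl k))"
    unfolding Lmap_def dotp_vec_of sum_split by (intro arg_cong2[where f="(+)"] sum.cong refl) (auto simp: rS algebra_simps)
  also have "(\<Sum>j=1..b+c. (?X + ?x j) * (?Y + ?y j)) =
    (\<Sum>j=1..b+c. ?X * ?Y) + (\<Sum>j=1..b+c. ?X * ?y j) + (\<Sum>j=1..b+c. ?Y * ?x j) + (\<Sum>j=1..b+c. ?x j * ?y j)"
    by (simp only: sum.distrib[symmetric]) (intro sum.cong refl, simp add: algebra_simps)
  also have "\<dots> = (real c + 1) * ?X * ?Y + ?X * (- real c * ?Y) + ?Y * (- real c * ?X) + (\<Sum>j=1..b+c. ?x j * ?y j)"
    unfolding sum_distrib_left[symmetric] e by (simp add: b1)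
  finally show ?thesis unfolding pic_form_coords[OF kx] by (simp add: algebra_simps)
qed

lemma Lmap_Dv:
  assumes "I \<in> Q"
  shows "Lmap (realify (Dv I)) + vec_of (c + 1) (\<lambda>_. 1) = zero_one I"
proof (rule poly_mapping_eqI)
  fix k
  have "c + a \<le> k \<Longrightarrow> k \<notin> I" using assms by (auto simp: Q_def)
  then show "Poly_Mapping.lookup (Lmap (realify (Dv I)) + vec_of (c + 1) (\<lambda>_. 1)) k = Poly_Mapping.lookup (zero_one I) k"
    using finite_Q[OF assms] params by (auto simp: lookup_add Lmap_def hyp_sum_linear(4) hyp_sum_Dv) (auto simp: Dv_def rS)
qed

lemma linear_Lmap: "linear Lmap"
  by (rule linearI; rule poly_mapping_eqI)
     (simp_all add: Lmap_def lookup_add hyp_sum_linear algebra_simps)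

lemma vertices: "(\<lambda>D. Lmap (realify D) + vec_of (c + 1) (\<lambda>_. 1)) ` \<O> = zero_one ` Q"
  unfolding orbit image_image by (rule image_cong[OF refl Lmap_Dv])

lemma finite_orbit: "finite Q"
  by (rule finite_subset[of _ "Pow {..<c + a}"]) (auto simp: Q_def)

lemmas polytope_A = images_are_vertices_of_hull[OF linear_Lmap Lmap_isometry vertices finite_imageI[OF finite_orbit]]

end

section \<open>Type D: subsets of even size\<close>

locale type_D = picard + assumes a2: "a = 2" and b2: "b = 2" and c3: "c \<ge> 3"
begin

lemma rS: "b + c = Suc (Suc c)" using b2 by simp

definition Q :: "nat set set" where "Q = {I. I \<subseteq> {..<c + 2} \<and> even (card I)}"

text \<open>This is the degree of the class of \<open>I\<close>: the number of points in \<open>{1..c + 1}\<close> is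
  \<open>2 * deg I\<close> or \<open>2 * deg I + 1\<close>, according to whether \<open>0\<close> belongs to \<open>I\<close>.\<close>

definition deg :: "nat set \<Rightarrow> int" where "deg I = int (card I div 2) - of_bool (0 \<in> I)"

definition Dv :: "nat set \<Rightarrow> pic_gen \<Rightarrow>\<^sub>0 int" where
  "Dv I = mk_pic a b c (\<lambda>_. deg I)
     (\<lambda>j. if j = b + c then 1 - deg I - of_bool (0 \<in> I) else of_bool (j \<in> I) - deg I)"

lemma finite_Q: "I \<in> Q \<Longrightarrow> finite I"
  by (auto simp: Q_def intro: finite_subset)

lemma sum_inner:
  assumes "I \<in> Q"
  shows "(\<Sum>j=1..c. of_bool (j \<in> I)) + of_bool (c + 1 \<in> I) = 2 * deg I + of_bool (0 \<in> I)"
proof -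
  have "int (card I) = (\<Sum>k<c+2. of_bool (k \<in> I))"
    using sum_of_bool_card[of I "c + 2"] assms by (simp add: Q_def)
  also have "\<dots> = of_bool (0 \<in> I) + (\<Sum>k<c. of_bool (Suc k \<in> I)) + (of_bool (c + 1 \<in> I) :: int)"
    by (simp only: add_2_eq_Suc' sum.lessThan_Suc[of _ "Suc c"] sum.lessThan_Suc_shift[of _ c]) simp
  also have "(\<Sum>k<c. of_bool (Suc k \<in> I)) = (\<Sum>j=1..c. of_bool (j \<in> I) :: int)"
    by (rule sum.reindex_bij_witness[of _ "\<lambda>j. j - 1" Suc]) auto
  also have "int (card I) = 2 * int (card I div 2)" using assms by (auto simp: Q_def elim: evenE)
  finally show ?thesis by (simp add: deg_def)
qed

lemma hyp_sum_Dv: "hyp_sum a (Dv I) = deg I"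
  unfolding Dv_def by (simp add: a2)

lemma Dv_E: "j \<in> {1..c+1} \<Longrightarrow> Poly_Mapping.lookup (Dv I) (Ecl j) = of_bool (j \<in> I) - deg I"
  "Poly_Mapping.lookup (Dv I) (Ecl (c + 2)) = 1 - deg I - of_bool (0 \<in> I)"
  by (auto simp: Dv_def rS)

lemma Dv_H: "Poly_Mapping.lookup (Dv I) (Hcl (Suc 0)) = deg I"
  unfolding Dv_def by (simp add: a2)

lemma sum_E: "(\<Sum>j=1..c. Poly_Mapping.lookup (Dv I) (Ecl j)) = (\<Sum>j=1..c. of_bool (j \<in> I)) - int c * deg I"
proof -
  have "(\<Sum>j=1..c. Poly_Mapping.lookup (Dv I) (Ecl j)) = (\<Sum>j=1..c. of_bool (j \<in> I) - deg I)"
    by (rule sum.cong[OF refl], rule Dv_E) auto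
  then show ?thesis by (simp add: sum_subtractf)
qed

lemma Dv_sums:
  assumes "I \<in> Q"
  shows "exc_sum b c (Dv I) + int c * hyp_sum a (Dv I) = 1"
proof -
  have "exc_sum b c (Dv I) = (\<Sum>j=1..c. Poly_Mapping.lookup (Dv I) (Ecl j)) + Poly_Mapping.lookup (Dv I) (Ecl (c + 1))
     + Poly_Mapping.lookup (Dv I) (Ecl (c + 2))"
    by (simp add: exc_sum_def rS)
  also have "\<dots> = ((\<Sum>j=1..c. of_bool (j \<in> I)) + of_bool (c + 1 \<in> I)) - int c * deg I - deg I + 1 - deg I - of_bool (0 \<in> I)"
    unfolding sum_E Dv_E(2) using Dv_E(1)[of "c + 1" I] by simp
  finally show ?thesis unfolding sum_inner[OF assms] hyp_sum_Dv by simp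
qed

lemma keys_Dv: "Poly_Mapping.keys (Dv I) \<subseteq> basis"
  unfolding Dv_def by (rule keys_mk_pic)

lemma N_eq: "N = {1..c + 2}"
  by (auto simp: nodes_def a2 b2)

text \<open>In the coordinates \<open>1/2 - [k \<in> I]\<close> of a weight of the half-spin module, these are the
  differences of two coordinates, and their sum at node \<open>c + 1\<close>.\<close>

definition pair :: "nat set \<Rightarrow> nat \<Rightarrow> int" where
  "pair I i = (if i \<le> c then of_bool (i + 1 \<in> I) - of_bool (i \<in> I)
     else if i = c + 1 then 1 - of_bool (0 \<in> I) - of_bool (c + 1 \<in> I)
     else of_bool (0 \<in> I) - of_bool (c + 1 \<in> I))"

lemma pairing_Dv:
  assumes I: "I \<in> Q" and i: "i \<in> N"
  shows "pic_form c (Dv I) (\<alpha> i) = pair I i"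
proof -
  have ib: "1 \<le> i" "i \<le> c + 2" using i by (auto simp: N_eq)
  consider "i \<le> c" | "i = c + 1" | "i = c + 2" using ib by linarith
  then show ?thesis
  proof cases
    case 1
    then show ?thesis unfolding pairing_\<alpha>_int[OF keys_Dv i] using ib Dv_E(1)[of i I] Dv_E(1)[of "i + 1" I]
      by (simp add: rS pair_def)
  next
    case 2
    then show ?thesis unfolding pairing_\<alpha>_int[OF keys_Dv i] using Dv_E(1)[of "c + 1" I] Dv_E(2)[of I]
      by (simp add: rS pair_def)
  next
    case 3
    have "(\<Sum>j=1..c. of_bool (j \<in> I)) = 2 * deg I + of_bool (0 \<in> I) - of_bool (c + 1 \<in> I)"
      using sum_inner[OF I] by linarith
    then have e: "(\<Sum>j=1..c. Poly_Mapping.lookup (Dv I) (Ecl j)) = 2 * deg I + of_bool (0 \<in> I) - of_bool (c + 1 \<in> I) - int c * deg I"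
      unfolding sum_E by simp
    show ?thesis unfolding pairing_\<alpha>_int[OF keys_Dv i] e hyp_sum_Dv using 3
      by (simp add: rS Dv_H pair_def algebra_simps)
  qed
qed

text \<open>The simple reflections act as transpositions, except for the one at node \<open>c + 1\<close>, which
  exchanges two points and complements both of them.\<close>

definition move :: "nat \<Rightarrow> nat set \<Rightarrow> nat set" where
  "move i I = (if i \<le> c then {k. Transposition.transpose i (i + 1) k \<in> I}
     else if i = c + 1 then {k. if k = 0 then c + 1 \<notin> I else if k = c + 1 then 0 \<notin> I else k \<in> I}
     else {k. Transposition.transpose 0 (c + 1) k \<in> I})"

lemma card_transposed: "card {k. Transposition.transpose p q k \<in> I} = card I"
proof -
  have "{k. Transposition.transpose p q k \<in> I} = Transposition.transpose p q ` I"
  proof (intro equalityI subsetI)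
    fix k assume "k \<in> {k. Transposition.transpose p q k \<in> I}"
    then show "k \<in> Transposition.transpose p q ` I"
      by (intro image_eqI[of _ _ "Transposition.transpose p q k"]) auto
  qed auto
  then show ?thesis by (simp only:) (rule card_image, rule inj_onI, metis transpose_involutory)
qed

lemma move_pair:
  assumes "finite I"
  shows "even (card {k. if k = 0 then c + 1 \<notin> I else if k = c + 1 then 0 \<notin> I else k \<in> I}) = even (card I)"
proof -
  let ?J = "I - {0, c + 1}"
  have J: "finite ?J" "0 \<notin> ?J" "c + 1 \<notin> ?J" using assms by auto
  consider "0 \<in> I" "c + 1 \<in> I" | "0 \<in> I" "c + 1 \<notin> I" | "0 \<notin> I" "c + 1 \<in> I" | "0 \<notin> I" "c + 1 \<notin> I" by blast
  then show ?thesis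
  proof cases
    case 1
    then have "{k. if k = 0 then c + 1 \<notin> I else if k = c + 1 then 0 \<notin> I else k \<in> I} = ?J" "I = insert 0 (insert (c + 1) ?J)" by auto
    then show ?thesis using J by (metis (no_types, lifting) card_insert_disjoint even_Suc finite_insert insert_iff add_is_0 zero_neq_one)
  next
    case 2
    then have "{k. if k = 0 then c + 1 \<notin> I else if k = c + 1 then 0 \<notin> I else k \<in> I} = I" by auto
    then show ?thesis by simp
  next
    case 3
    then have "{k. if k = 0 then c + 1 \<notin> I else if k = c + 1 then 0 \<notin> I else k \<in> I} = I" by (auto intro: gr0I)
    then show ?thesis by simp
  next
    case 4
    then have "{k. if k = 0 then c + 1 \<notin> I else if k = c + 1 then 0 \<notin> I else k \<in> I} = insert 0 (insert (c + 1) ?J)" "I = ?J" by auto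
    then show ?thesis using J by (metis (no_types, lifting) card_insert_disjoint even_Suc finite_insert insert_iff add_is_0 zero_neq_one)
  qed
qed

lemma move_Q:
  assumes "I \<in> Q" "i \<in> N"
  shows "move i I \<in> Q"
proof -
  have I: "k < c + 2" if "k \<in> I" for k using assms that by (auto simp: Q_def)
  have "k < c + 2" if "Transposition.transpose p q k \<in> I" "p < c + 2" "q < c + 2" for p q k
    using that I[of k] by (cases "k = p \<or> k = q") auto
  then have "move i I \<subseteq> {..<c + 2}"
    unfolding move_def using I by (auto split: if_splits)
  moreover have "even (card (move i I))"
  proof -
    have ev: "even (card I)" using assms by (simp add: Q_def)
    consider "i \<le> c" | "\<not> i \<le> c" "i = c + 1" | "\<not> i \<le> c" "i \<noteq> c + 1" by blast
    then show ?thesis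
    proof cases
      case 1
      show ?thesis unfolding move_def if_P[OF 1] card_transposed by (rule ev)
    next
      case 2
      show ?thesis unfolding move_def if_not_P[OF 2(1)] if_P[OF 2(2)] using move_pair[OF finite_Q[OF assms(1)]] ev by blast
    next
      case 3
      show ?thesis unfolding move_def if_not_P[OF 3(1)] if_not_P[OF 3(2)] card_transposed by (rule ev)
    qed
  qed
  ultimately show ?thesis by (simp add: Q_def)
qed

lemma T_cartan_D:
  assumes "i \<in> N" "j \<in> N"
  shows "T_cartan_matrix a b c i j = (if i = j then 2 else if i \<le> c + 1 \<and> j \<le> c + 1 \<and> (i = j + 1 \<or> j = i + 1)
     \<or> i = c \<and> j = c + 2 \<or> i = c + 2 \<and> j = c then -1 else 0)"
proof -
  have b: "1 \<le> i" "i \<le> c + 2" "1 \<le> j" "j \<le> c + 2" using assms by (auto simp: N_eq)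
  have "T_edge a b c i j \<longleftrightarrow> (j = i + 1 \<and> j \<noteq> Suc (Suc c)) \<or> (i = j + 1 \<and> i \<noteq> Suc (Suc c)) \<or>
      (i = c \<and> j = Suc (Suc c)) \<or> (i = Suc (Suc c) \<and> j = c)"
    using assms unfolding T_edge_def rS by (simp only: simp_thms)
  also have "\<dots> \<longleftrightarrow> i \<le> c + 1 \<and> j \<le> c + 1 \<and> (i = j + 1 \<or> j = i + 1) \<or> i = c \<and> j = c + 2 \<or> i = c + 2 \<and> j = c"
    using b by presburger
  finally show ?thesis by (simp only: T_cartan_matrix_def)
qed

lemma pair_move:
  assumes i: "i \<in> N" and j: "j \<in> N"
  shows "pair I j - pair I i * T_cartan_matrix a b c i j = pair (move i I) j"
proof -
  have b: "1 \<le> i" "i \<le> c + 2" "1 \<le> j" "j \<le> c + 2" using i j by (auto simp: N_eq)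
  define x :: "nat \<Rightarrow> int" where "x k = of_bool (k \<in> I)" for k
  define y :: "nat \<Rightarrow> int" where "y k = of_bool (k \<in> move i I)" for k
  have pI: "pair I k = (if k \<le> c then x (Suc k) - x k else if k = Suc c then 1 - x 0 - x (Suc c) else x 0 - x (Suc c))" for k
    by (simp add: pair_def x_def)
  have pM: "pair (move i I) k = (if k \<le> c then y (Suc k) - y k else if k = Suc c then 1 - y 0 - y (Suc c) else y 0 - y (Suc c))" for k
    by (simp add: pair_def y_def)
  consider "i < c" | "i = c" | "i = Suc c" | "i = Suc (Suc c)" using b by linarith
  then show ?thesis
  proof cases
    case 1
    have y: "y k = (if k = i then x (Suc i) else if k = Suc i then x i else x k)" for k
      using 1 by (simp add: y_def x_def move_def Transposition.transpose_def)
    consider "j = i" | "j = Suc i" | "i = Suc j" | "j = Suc (Suc c)" | "j \<noteq> i" "j \<noteq> Suc i" "i \<noteq> Suc j" "j \<le> Suc c"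
      using b by linarith
    then show ?thesis unfolding T_cartan_D[OF i j] pI pM y using 1 b(1,3) by cases simp_all
  next
    case 2
    have y: "y k = (if k = c then x (Suc c) else if k = Suc c then x c else x k)" for k
      using 2 by (simp add: y_def x_def move_def Transposition.transpose_def)
    consider "j = c" | "j = Suc c" | "j = Suc (Suc c)" | "c = Suc j" | "Suc j < c"
      using b by linarith
    then show ?thesis unfolding T_cartan_D[OF i j] pI pM y using 2 b(1,3) by cases simp_all
  next
    case 3
    have y: "y k = (if k = 0 then 1 - x (Suc c) else if k = Suc c then 1 - x 0 else x k)" for k
      using 3 by (simp add: y_def x_def move_def)
    consider "j = c" | "j = Suc c" | "j = Suc (Suc c)" | "j < c"
      using b by linarith
    then show ?thesis unfolding T_cartan_D[OF i j] pI pM y using 3 b(1,3) by cases simp_all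
  next
    case 4
    have y: "y k = (if k = 0 then x (Suc c) else if k = Suc c then x 0 else x k)" for k
      using 4 by (simp add: y_def x_def move_def Transposition.transpose_def)
    consider "j = c" | "j = Suc c" | "j = Suc (Suc c)" | "j < c"
      using b by linarith
    then show ?thesis unfolding T_cartan_D[OF i j] pI pM y using 4 b(1,3) by cases simp_all
  qed
qed

lemma reflect_Dv:
  assumes I: "I \<in> Q" and i: "i \<in> N"
  shows "reflect_div i (Dv I) = Dv (move i I)"
proof (rule pic_class_eqI)
  show "pic_form c (reflect_div i (Dv I)) (\<alpha> j) = pic_form c (Dv (move i I)) (\<alpha> j)" if j: "j \<in> N" for j
    unfolding reflect_div_pairing[OF i j]
    unfolding pairing_Dv[OF I i] pairing_Dv[OF I j] pairing_Dv[OF move_Q[OF I i] j] by (rule pair_move[OF i j])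
qed (use I i reflect_div_keys keys_Dv reflect_div_sums Dv_sums move_Q in auto)

text \<open>A height that decreases when a point \<open>i \<ge> 1\<close> moves up, when the last point moves to \<open>0\<close>,
  and when \<open>0\<close> and the last point are removed together.\<close>

definition rank :: "nat set \<Rightarrow> nat" where
  "rank I = (\<Sum>k\<in>I. if k = 0 then 0 else c + 2 - k)"

lemma rank_replace:
  assumes "finite I" "k \<in> I" "l \<notin> I" "(if l = 0 then 0 else c + 2 - l) < (if k = 0 then 0 else c + 2 - k)"
  shows "rank (insert l (I - {k})) < rank I"
proof -
  let ?w = "\<lambda>k. if k = 0 then 0 else c + 2 - k"
  have "rank (insert l (I - {k})) = ?w l + (\<Sum>k\<in>I - {k}. ?w k)"
    unfolding rank_def using assms by (subst sum.insert) auto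
  also have "\<dots> < ?w k + (\<Sum>k\<in>I - {k}. ?w k)" using assms(4) by simp
  also have "\<dots> = rank I" unfolding rank_def using assms by (simp add: sum.remove[of I k])
  finally show ?thesis .
qed

lemma Dv_empty: "Dv {} = Ediv (b + c)"
proof (rule poly_mapping_eqI)
  show "Poly_Mapping.lookup (Dv {}) k = Poly_Mapping.lookup (Ediv (b + c)) k" for k
    by (cases k) (auto simp: Dv_def lookup_single when_def deg_def rS)
qed

text \<open>Every nonempty even set admits one of the three moves that decrease the rank: if no
  point below the last one can be moved up, the set contains the last point, which then
  goes to \<open>0\<close> or is cancelled against \<open>0\<close>.\<close>

lemma orbit: "\<O> = Dv ` Q"
proof (rule orbit_eqI[where rank = rank])
  have "{} \<in> Q" by (auto simp: Q_def)
  then show "Ediv (b + c) \<in> Dv ` Q" using Dv_empty by (metis imageI)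
  show "reflect_div i (Dv I) \<in> Dv ` Q" if "I \<in> Q" "i \<in> N" for I i
    using reflect_Dv[OF that] move_Q[OF that] by auto
  show "Dv I = Ediv (b + c) \<or> (\<exists>i\<in>N. \<exists>J\<in>Q. reflect_div i (Dv I) = Dv J \<and> rank J < rank I)" if I: "I \<in> Q" for I
  proof (cases "I = {}")
    case False
    have fI: "finite I" using finite_Q[OF I] .
    have Ib: "k < c + 2" if "k \<in> I" for k using I that by (auto simp: Q_def)
    have "\<exists>i\<in>N. rank (move i I) < rank I"
    proof (cases "\<exists>i\<ge>1. i \<in> I \<and> i \<noteq> c + 1 \<and> i + 1 \<notin> I")
      case True
      then obtain i where i: "i \<ge> 1" "i \<in> I" "i \<noteq> c + 1" "i + 1 \<notin> I" by auto
      have ic: "i \<le> c" using Ib[OF i(2)] i by linarith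
      have "move i I = insert (i + 1) (I - {i})"
        using i ic by (auto simp: move_def Transposition.transpose_def split: if_splits)
      then have "rank (move i I) < rank I" using rank_replace[OF fI i(2,4)] i ic by auto
      then show ?thesis using i ic by (auto simp: N_eq)
    next
      case F: False
      have last: "c + 1 \<in> I"
      proof -
        have "\<exists>k\<in>I. k \<ge> 1"
        proof (rule ccontr)
          assume "\<not> ?thesis"
          then have "I = {0}" using False by (auto simp: not_le)
          then show False using I by (simp add: Q_def)
        qed
        then obtain k where k: "k \<in> I" "k \<ge> 1" by auto
        have kc: "k \<le> c + 1" using Ib[OF k(1)] by simp
        have "k \<le> j \<Longrightarrow> j \<le> c + 1 \<Longrightarrow> j \<in> I" for j
        proof (induction j rule: dec_induct)
          case (step j)
          then show ?case using F k(2) by auto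
        qed (rule k)
        then show ?thesis using kc by simp
      qed
      show ?thesis
      proof (cases "0 \<in> I")
        case True
        have "move (c + 1) I = I - {0} - {c + 1}"
          using True last by (auto simp: move_def split: if_splits)
        moreover have "rank I = rank (I - {0}) + 0" unfolding rank_def using fI True by (simp add: sum.remove[of I 0])
        moreover have "rank (I - {0}) = rank (I - {0} - {c + 1}) + 1"
          unfolding rank_def using fI last by (subst sum.remove[of "I - {0}" "c + 1"]) auto
        ultimately have "rank (move (c + 1) I) < rank I" by simp
        then show ?thesis by (auto simp: N_eq)
      next
        case F0: False
        have "move (c + 2) I = insert 0 (I - {c + 1})"
          using F0 last by (auto simp: move_def Transposition.transpose_def split: if_splits)
        then have "rank (move (c + 2) I) < rank I" using rank_replace[OF fI last F0] by auto
        then show ?thesis by (auto simp: N_eq)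
      qed
    qed
    then show ?thesis using reflect_Dv[OF I] move_Q[OF I] by metis
  qed (simp add: Dv_empty)
qed

lemma minuscule: "D \<in> \<O> \<Longrightarrow> i \<in> N \<Longrightarrow> pic_form c D (\<alpha> i) \<in> {-1, 0, 1}"
  unfolding orbit by (auto simp: pairing_Dv pair_def)

text \<open>The point \<open>0\<close> records the last exceptional coefficient with the opposite sign, since \<open>E\<^sub>r\<close>
  corresponds to the empty set and to a translation by the unit vector at \<open>0\<close>.\<close>

definition Lmap :: "(pic_gen \<Rightarrow>\<^sub>0 real) \<Rightarrow> nat \<Rightarrow>\<^sub>0 real" where
  "Lmap x = vec_of (c + 2) (\<lambda>q. if q = 0 then - hyp_sum a x - Poly_Mapping.lookup x (Ecl (c + 2))
     else hyp_sum a x + Poly_Mapping.lookup x (Ecl q))"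

lemma Lmap_isometry:
  assumes "x \<in> Kperp a b c" "y \<in> Kperp a b c"
  shows "dotp (Lmap x) (Lmap y) = - pic_form c x y"
proof -
  let ?x = "\<lambda>j. Poly_Mapping.lookup x (Ecl j)" and ?y = "\<lambda>j. Poly_Mapping.lookup y (Ecl j)"
  let ?X = "hyp_sum a x" and ?Y = "hyp_sum a y"
  have kx: "Poly_Mapping.keys x \<subseteq> basis" "Poly_Mapping.keys y \<subseteq> basis" using assms by (auto simp: Kperp_iff)
  have e: "(\<Sum>j=1..b+c. ?x j) = - real c * ?X" "(\<Sum>j=1..b+c. ?y j) = - real c * ?Y"
    using assms unfolding Kperp_iff exc_sum_def by auto
  have H: "(\<Sum>i=1..a-1. Poly_Mapping.lookup x (Hcl i) * Poly_Mapping.lookup y (Hcl i)) = ?X * ?Y"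
    using a2 by (simp add: hyp_sum_def)
  have "dotp (Lmap x) (Lmap y) = (?X + ?x (c + 2)) * (?Y + ?y (c + 2)) + (\<Sum>q<c+1. (?X + ?x (Suc q)) * (?Y + ?y (Suc q)))"
  proof -
    have minus: "(- u - v) * (- u' - v') = (u + v) * (u' + v')" for u v u' v' :: real by (simp add: algebra_simps)
    have c2: "c + 2 = Suc (c + 1)" by simp
    show ?thesis unfolding Lmap_def dotp_vec_of unfolding c2 sum.lessThan_Suc_shift[of _ "c + 1"] by (simp add: minus)
  qed
  also have "(\<Sum>q<c+1. (?X + ?x (Suc q)) * (?Y + ?y (Suc q))) = (\<Sum>j=1..c+1. (?X + ?x j) * (?Y + ?y j))"
    by (rule sum.reindex_bij_witness[of _ "\<lambda>j. j - 1" Suc]) auto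
  also have "(?X + ?x (c + 2)) * (?Y + ?y (c + 2)) + \<dots> = (\<Sum>j=1..b+c. (?X + ?x j) * (?Y + ?y j))"
    unfolding rS by simp
  also have "(\<Sum>j=1..b+c. (?X + ?x j) * (?Y + ?y j)) =
    (\<Sum>j=1..b+c. ?X * ?Y) + (\<Sum>j=1..b+c. ?X * ?y j) + (\<Sum>j=1..b+c. ?Y * ?x j) + (\<Sum>j=1..b+c. ?x j * ?y j)"
    by (simp only: sum.distrib[symmetric]) (intro sum.cong refl, simp add: algebra_simps)
  also have "\<dots> = (real c + 2) * ?X * ?Y + ?X * (- real c * ?Y) + ?Y * (- real c * ?X) + (\<Sum>j=1..b+c. ?x j * ?y j)"
    unfolding sum_distrib_left[symmetric] e by (simp add: b2)
  finally show ?thesis unfolding pic_form_coords[OF kx] H by (simp add: algebra_simps)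
qed

lemma Lmap_Dv:
  assumes "I \<in> Q"
  shows "Lmap (realify (Dv I)) + vec_of 1 (\<lambda>_. 1) = zero_one I"
proof (rule poly_mapping_eqI)
  fix k
  have "c + 2 \<le> k \<Longrightarrow> k \<notin> I" using assms by (auto simp: Q_def)
  then show "Poly_Mapping.lookup (Lmap (realify (Dv I)) + vec_of 1 (\<lambda>_. 1)) k = Poly_Mapping.lookup (zero_one I) k"
    using finite_Q[OF assms] Dv_E(1)[of k I] Dv_E(2)[of I]
    by (cases "k < c + 2"; cases "k = 0")
       (simp_all add: lookup_add Lmap_def hyp_sum_linear(4) hyp_sum_Dv lookup_single when_def)
qed

lemma linear_Lmap: "linear Lmap"
  by (rule linearI; rule poly_mapping_eqI)
     (simp_all add: Lmap_def lookup_add hyp_sum_linear algebra_simps)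

lemma vertices: "(\<lambda>D. Lmap (realify D) + vec_of 1 (\<lambda>_. 1)) ` \<O> = zero_one ` Q"
  unfolding orbit image_image by (rule image_cong[OF refl Lmap_Dv])

lemma finite_orbit: "finite Q"
  by (rule finite_subset[of _ "Pow {..<c + 2}"]) (auto simp: Q_def)

lemmas polytope_D = images_are_vertices_of_hull[OF linear_Lmap Lmap_isometry vertices finite_imageI[OF finite_orbit]]

end

section \<open>Exceptional curves on del Pezzo surfaces\<close>

text \<open>A list \<open>[x, y\<^sub>1, \<dots>, y\<^sub>r]\<close> stands for \<open>x H + \<Sum>\<^sub>j y\<^sub>j E\<^sub>j\<close>. The four kinds are the
  exceptional curves \<open>E\<^sub>i\<close>, the lines through two points, the conics through five points and,
  for seven points, the cubics through all points with one double point.\<close>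

definition exc_list :: "nat \<Rightarrow> int list list" where
  "exc_list r = concat (map (\<lambda>m. let k = sum_list m in
     (if k = 1 then [0 # m] else []) @ (if k = 2 then [1 # map uminus m] else []) @
     (if k = 5 then [2 # map uminus m] else []) @ (if k = 1 \<and> r = 7 then [3 # map (\<lambda>t. - 1 - t) m] else []))
   (List.n_lists r [0, 1]))"

definition pair_list :: "nat \<Rightarrow> nat \<Rightarrow> int list \<Rightarrow> int" where
  "pair_list r i xs = (if i < r then xs ! Suc i - xs ! i else xs ! 0 + xs ! 1 + xs ! 2 + xs ! 3)"

definition refl_list :: "nat \<Rightarrow> nat \<Rightarrow> int list \<Rightarrow> int list" where
  "refl_list r i xs = (let p = pair_list r i xs in
     if i < r then xs[i := xs ! Suc i, Suc i := xs ! i]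
     else xs[0 := xs ! 0 + p, 1 := xs ! 1 - p, 2 := xs ! 2 - p, 3 := xs ! 3 - p])"

text \<open>The linear functional that is \<open>1\<close> on every simple root and \<open>0\<close> on \<open>E\<^sub>r\<close>; on the orbit it is the
  height above \<open>E\<^sub>r\<close>.\<close>

definition height_list :: "nat \<Rightarrow> int list \<Rightarrow> nat" where
  "height_list r xs = nat (int (3 * r - 5) * xs ! 0 + sum_list (map (\<lambda>j. int (r - j) * xs ! j) [1..<Suc r]))"

text \<open>The finite check behind the description of the orbit: closure under reflections,
  pairings in \<open>{-1, 0, 1}\<close>, and descent to \<open>E\<^sub>r\<close>. For \<open>r = 6\<close> and \<open>r = 7\<close> it is decided by
  rewriting.\<close>

definition exc_check :: "nat \<Rightarrow> bool" where
  "exc_check r \<longleftrightarrow> (let X = exc_list r; B = replicate r 0 @ [1] in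
     B \<in> set X \<and> list_all (\<lambda>xs. length xs = Suc r
       \<and> list_all (\<lambda>i. refl_list r i xs \<in> set X \<and> pair_list r i xs \<in> set [-1, 0, 1]) [1..<Suc r]
       \<and> (xs = B \<or> list_ex (\<lambda>i. height_list r (refl_list r i xs) < height_list r xs) [1..<Suc r])) X)"

definition pair_indices :: "((nat \<times> nat) \<times> (int \<times> int)) list" where
  "pair_indices = List.product (filter (\<lambda>(i, j). i < j) (List.product [0..<8] [0..<8]))
     (List.product [2, -2] [2, -2])"

text \<open>The roots of \<open>E\<^sub>8\<close> with all coordinates doubled, so that they are integers.\<close>

definition e8_list :: "int list list" where
  "e8_list = map (\<lambda>((i, j), (s, t)). (replicate 8 0)[i := s, j := t]) pair_indices
     @ filter (\<lambda>m. prod_list m = 1) (List.n_lists 8 [1, -1])"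

text \<open>The doubled coordinates of the root of \<open>E\<^sub>8\<close> with inner product \<open>1\<close> with \<open>(1,1,0,\<dots>,0)\<close> that
  belongs to a class. They come from an isometry of \<open>K\<^sup>\<bottom>\<close> onto the complement of this vector,
  followed by a translation.\<close>

definition e7_coords :: "int list \<Rightarrow> int list" where
  "e7_coords xs = (let t = xs ! 0 + xs ! 1 in [t, 2 - t] @ map (\<lambda>k. - t - 2 * xs ! (9 - k)) [2..<8])"

text \<open>As before, with inner product \<open>1\<close> with both \<open>(1,1,0,\<dots>,0)\<close> and \<open>(1,0,1,0,\<dots>,0)\<close>.\<close>

definition e6_coords :: "int list \<Rightarrow> int list" where
  "e6_coords xs = (let t = xs ! 0 + xs ! 1 in [2 - t, t, t] @ map (\<lambda>k. t + 2 * xs ! (9 - k)) [3..<8])"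

definition same_elements :: "'a list \<Rightarrow> 'a list \<Rightarrow> bool" where
  "same_elements xs ys \<longleftrightarrow> list_all (\<lambda>x. x \<in> set ys) xs \<and> list_all (\<lambda>y. y \<in> set xs) ys"

lemma exc_check_6: "exc_check 6" by code_simp

lemma card_6: "length (remdups (exc_list 6)) = 27" by code_simp

lemma coords_6: "same_elements (map e6_coords (exc_list 6)) (filter (\<lambda>w. w ! 0 + w ! 1 = 2 \<and> w ! 0 + w ! 2 = 2) e8_list)"
  by code_simp

lemma exc_check_7: "exc_check 7" by code_simp

lemma card_7: "length (remdups (exc_list 7)) = 56" by code_simp

lemma coords_7: "same_elements (map e7_coords (exc_list 7)) (filter (\<lambda>w. w ! 0 + w ! 1 = 2) e8_list)"
  by code_simp

lemma same_elements_set: "same_elements xs ys \<Longrightarrow> set xs = set ys"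
  by (auto simp: same_elements_def list_all_iff)

definition half_vec :: "int list \<Rightarrow> nat \<Rightarrow>\<^sub>0 real" where
  "half_vec w = vec_of 8 (\<lambda>q. of_int (w ! q) / 2)"

lemma dotp_half_vec:
  assumes "i < 8" "j < 8" "i \<noteq> j"
  shows "dotp (half_vec w) (zero_one {i, j}) = of_int (w ! i + w ! j) / 2"
proof -
  have "Poly_Mapping.keys (half_vec w) \<subseteq> {..<8}" by (auto simp: in_keys_iff half_vec_def split: if_splits)
  then have "dotp (half_vec w) (zero_one {i, j}) = (\<Sum>q<8. of_int (w ! q) / 2 * of_bool (q \<in> {i, j}))"
    by (simp add: dotp_superset[of "{..<8}"] half_vec_def)
  also have "\<dots> = (\<Sum>q<8. if q \<in> {i, j} then of_int (w ! q) / 2 else 0)"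
    by (intro sum.cong) auto
  also have "\<dots> = (\<Sum>q\<in>{..<8} \<inter> {i, j}. of_int (w ! q) / 2)"
    by (rule sum.inter_restrict[symmetric]) simp
  also have "{..<8} \<inter> {i, j} = {i, j}" using assms by auto
  finally show ?thesis using assms by (simp add: add_divide_distrib)
qed

lemma dotp_half_vec_eq_1:
  assumes "i < 8" "j < 8" "i \<noteq> j"
  shows "dotp (half_vec w) (zero_one {i, j}) = 1 \<longleftrightarrow> w ! i + w ! j = 2"
proof -
  have "(real_of_int k / 2 = 1) = (k = 2)" for k by linarith
  then show ?thesis unfolding dotp_half_vec[OF assms] .
qed

lemma set_e8_list: "set e8_list = {(replicate 8 0)[i := s, j := t] | i j s t. i < j \<and> j < 8 \<and> s \<in> {2, -2} \<and> t \<in> {2, -2}}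
  \<union> {m. length m = 8 \<and> set m \<subseteq> {1, -1} \<and> prod_list m = 1}" (is "_ = ?P \<union> ?M")
proof -
  have "set (filter (\<lambda>m. prod_list m = 1) (List.n_lists 8 [1, -1])) = ?M"
    by (auto simp: set_n_lists)
  moreover have "set (map (\<lambda>((i, j), (s, t)). (replicate 8 0)[i := s, j := t]) pair_indices) = (?P :: int list set)"
  proof (intro equalityI subsetI)
    fix w :: "int list" assume "w \<in> ?P"
    then obtain i j s t where w: "w = (replicate 8 0)[i := s, j := t]" and ij: "((i, j), (s, t)) \<in> set pair_indices"
      by (fastforce simp: pair_indices_def)
    then show "w \<in> set (map (\<lambda>((i, j), (s, t)). (replicate 8 0)[i := s, j := t]) pair_indices)"
      unfolding set_map by (intro image_eqI[OF _ ij]) simp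
  next
    fix w :: "int list" assume "w \<in> set (map (\<lambda>((i, j), (s, t)). (replicate 8 0)[i := s, j := t]) pair_indices)"
    then obtain i j s t where w: "w = (replicate 8 0)[i := s, j := t]" and "((i, j), (s, t)) \<in> set pair_indices"
      unfolding set_map by (auto simp del: set_map)
    then have "i < j" "j < 8" "s \<in> {2, -2}" "t \<in> {2, -2}" by (auto simp: pair_indices_def)
    then show "w \<in> ?P" using w by blast
  qed
  ultimately show ?thesis unfolding e8_list_def set_append by simp
qed

lemma half_vec_pair:
  assumes "i < j" "j < 8"
  shows "half_vec ((replicate 8 0)[i := s, j := t]) = Poly_Mapping.single i (of_int s / 2) + Poly_Mapping.single j (of_int t / 2)"
  by (rule poly_mapping_eqI)
     (use assms in \<open>auto simp: half_vec_def lookup_add lookup_single when_def nth_list_update\<close>)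

lemma e8_roots_half_vec: "e8_roots = half_vec ` set e8_list"
proof (intro equalityI subsetI)
  fix w assume "w \<in> e8_roots"
  then consider i j s t where "w = Poly_Mapping.single i s + Poly_Mapping.single j t" "i < j" "j < 8" "s \<in> {1, - 1}" "t \<in> {1, - 1}"
    | s where "w = (\<Sum>i<8. Poly_Mapping.single i (s i / 2))" "\<forall>i<8. s i \<in> {1, - 1}" "(\<Prod>i<8. s i) = 1"
    unfolding e8_roots_def by blast
  then show "w \<in> half_vec ` set e8_list"
  proof cases
    case 1
    define s' t' :: int where "s' = (if s = 1 then 2 else -2)" and "t' = (if t = 1 then 2 else -2)"
    have "s = of_int s' / 2" "t = of_int t' / 2" using 1 by (auto simp: s'_def t'_def)
    then have "w = half_vec ((replicate 8 0)[i := s', j := t'])" using half_vec_pair[OF 1(2,3), of s' t'] 1(1) by (simp only:)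
    moreover have "(replicate 8 0)[i := s', j := t'] \<in> set e8_list"
      unfolding set_e8_list using 1(2,3) by (auto simp: s'_def t'_def)
    ultimately show ?thesis by blast
  next
    case 2
    define m :: "int list" where "m = map (\<lambda>i. if s i = 1 then 1 else -1) [0..<8]"
    have s: "s i = of_int (m ! i)" if "i < 8" for i using 2(2) that by (auto simp: m_def)
    have "w = half_vec m"
      by (rule poly_mapping_eqI) (auto simp: 2(1) half_vec_def lookup_sum lookup_single when_def s)
    moreover have "real_of_int (prod_list m) = (\<Prod>i<8. s i)"
    proof -
      have "prod_list m = (\<Prod>i<8. m ! i)" using prod.list_conv_set_nth[of m] by (simp add: m_def atLeast0LessThan)
      then show ?thesis using s by simp
    qed
    then have "prod_list m = 1" using 2(3) by simp
    then have "m \<in> set e8_list" unfolding set_e8_list by (auto simp: m_def)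
    ultimately show ?thesis by blast
  qed
next
  fix w assume "w \<in> half_vec ` set e8_list"
  then obtain m where m: "w = half_vec m" "m \<in> set e8_list" by auto
  from m(2) consider i j s t where "m = (replicate 8 0)[i := s, j := t]" "i < j" "j < 8" "s \<in> {2, -2}" "t \<in> {2, -2}"
    | "length m = 8" "set m \<subseteq> {1, -1}" "prod_list m = 1"
    unfolding set_e8_list by blast
  then show "w \<in> e8_roots"
  proof cases
    case 1
    then have "w = Poly_Mapping.single i (of_int s / 2) + Poly_Mapping.single j (of_int t / 2)"
      using m(1) half_vec_pair by simp
    moreover have "real_of_int s / 2 \<in> {1, -1}" "real_of_int t / 2 \<in> {1, -1}" using 1 by auto
    ultimately show ?thesis unfolding e8_roots_def using 1(2,3) by blast
  next
    case 2
    have "w = (\<Sum>i<8. Poly_Mapping.single i (real_of_int (m ! i) / 2))" by (simp add: m(1) half_vec_def vec_of_def)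
    moreover have "\<forall>i<8. real_of_int (m ! i) \<in> {1, -1}"
    proof (intro allI impI)
      fix i :: nat assume "i < 8"
      then have "m ! i \<in> {1, -1}" using 2(1) by (intro subsetD[OF 2(2) nth_mem]) simp
      then show "real_of_int (m ! i) \<in> {1, -1}" by auto
    qed
    moreover have "(\<Prod>i<8. real_of_int (m ! i)) = 1"
    proof -
      have "prod_list m = (\<Prod>i<8. m ! i)" using prod.list_conv_set_nth[of m] 2(1) by (simp add: atLeast0LessThan)
      then show ?thesis using 2(3) by (metis of_int_1 of_int_prod)
    qed
    ultimately show ?thesis unfolding e8_roots_def by (intro UnI2 CollectI exI[of _ "\<lambda>i. real_of_int (m ! i)"]) auto
  qed
qed

lemma gosset_3_21_hull: "gosset_3_21 = convex hull (half_vec ` e7_coords ` set (exc_list 7))"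
proof -
  have "{w \<in> e8_roots. dotp w (zero_one {0, 1}) = 1} = half_vec ` set (filter (\<lambda>w. w ! 0 + w ! 1 = 2) e8_list)"
    unfolding e8_roots_half_vec by (auto simp: dotp_half_vec_eq_1)
  then show ?thesis unfolding gosset_3_21_def using same_elements_set[OF coords_7] by simp
qed

lemma gosset_2_21_hull: "gosset_2_21 = convex hull (half_vec ` e6_coords ` set (exc_list 6))"
proof -
  have "{w \<in> e8_roots. dotp w (zero_one {0, 1}) = 1 \<and> dotp w (zero_one {0, 2}) = 1}
    = half_vec ` set (filter (\<lambda>w. w ! 0 + w ! 1 = 2 \<and> w ! 0 + w ! 2 = 2) e8_list)"
    unfolding e8_roots_half_vec by (auto simp: dotp_half_vec_eq_1)
  then show ?thesis unfolding gosset_2_21_def using same_elements_set[OF coords_6] by simp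
qed

locale del_pezzo = picard + assumes a2: "a = 2" and c3: "c = 3" and check: "exc_check (b + c)"
begin

definition Dv :: "int list \<Rightarrow> pic_gen \<Rightarrow>\<^sub>0 int" where
  "Dv xs = mk_pic a b c (\<lambda>_. xs ! 0) (\<lambda>j. xs ! j)"

lemma r_ge: "b + c \<ge> 4" "b + c > 3" using params c3 by auto

lemma N_eq: "N = {1..b + c}"
  by (auto simp: nodes_def a2)

lemma keys_Dv: "Poly_Mapping.keys (Dv xs) \<subseteq> basis"
  unfolding Dv_def by (rule keys_mk_pic)

lemma Dv_H: "Poly_Mapping.lookup (Dv xs) (Hcl (Suc 0)) = xs ! 0"
  unfolding Dv_def by (simp add: a2)

lemma Dv_E: "j \<in> {1..b+c} \<Longrightarrow> Poly_Mapping.lookup (Dv xs) (Ecl j) = xs ! j"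
  unfolding Dv_def by simp

lemma hyp_sum_Dv: "hyp_sum a (Dv xs) = xs ! 0"
  unfolding Dv_def by (simp add: a2)

lemma sum_upto_3: "(\<Sum>j=1..c. f j) = f 1 + f 2 + f (3::nat)" for f :: "nat \<Rightarrow> 'z::comm_monoid_add"
  by (simp add: c3 eval_nat_numeral add.assoc)

lemma pairing_Dv:
  assumes i: "i \<in> N"
  shows "pic_form c (Dv xs) (\<alpha> i) = pair_list (b + c) i xs"
  unfolding pairing_\<alpha>_int[OF keys_Dv i] sum_upto_3 hyp_sum_Dv
  using i r_ge Dv_E[of i xs] Dv_E[of "Suc i" xs] Dv_E[of 1 xs] Dv_E[of 2 xs] Dv_E[of 3 xs]
  by (auto simp: pair_list_def N_eq Dv_H) (simp_all add: c3)

lemma reflect_Dv: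
  assumes i: "i \<in> N" and l: "length xs = Suc (b + c)"
  shows "reflect_div i (Dv xs) = Dv (refl_list (b + c) i xs)"
proof (rule pic_eqI[OF reflect_div_keys[OF keys_Dv i] keys_Dv])
  have ib: "1 \<le> i" "i \<le> b + c" using i by (auto simp: N_eq)
  fix k assume "k \<in> {1..a-1}"
  then have k: "k = Suc 0" by (simp add: a2)
  show "Poly_Mapping.lookup (reflect_div i (Dv xs)) (Hcl k) = Poly_Mapping.lookup (Dv (refl_list (b + c) i xs)) (Hcl k)"
    unfolding k lookup_add lookup_frag_cmul pairing_Dv[OF i] Dv_H lookup_\<alpha>_H
    using ib l by (cases "i < b + c") (auto simp: refl_list_def Let_def)
next
  have ib: "1 \<le> i" "i \<le> b + c" using i by (auto simp: N_eq)
  fix j assume j: "j \<in> {1..b+c}"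
  show "Poly_Mapping.lookup (reflect_div i (Dv xs)) (Ecl j) = Poly_Mapping.lookup (Dv (refl_list (b + c) i xs)) (Ecl j)"
  proof (cases "i < b + c")
    case True
    then show ?thesis
      unfolding lookup_add lookup_frag_cmul pairing_Dv[OF i] Dv_E[OF j] lookup_\<alpha>_E
      using ib l j by (auto simp: refl_list_def Let_def pair_list_def nth_list_update)
  next
    case False
    then have ir: "i = b + c" using ib by simp
    have "j = 1 \<or> j = 2 \<or> j = 3 \<or> j > 3" using j by auto
    then show ?thesis
      unfolding lookup_add lookup_frag_cmul pairing_Dv[OF i] Dv_E[OF j] lookup_\<alpha>_E
      using False ir l j r_ge c3 by (auto simp: refl_list_def Let_def nth_list_update)
  qed
qed

lemma exc_facts:
  assumes "xs \<in> set (exc_list (b + c))"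
  shows "length xs = Suc (b + c)"
    "i \<in> N \<Longrightarrow> refl_list (b + c) i xs \<in> set (exc_list (b + c)) \<and> pair_list (b + c) i xs \<in> {-1, 0, 1}"
    "xs = replicate (b + c) 0 @ [1] \<or> (\<exists>i\<in>N. height_list (b + c) (refl_list (b + c) i xs) < height_list (b + c) xs)"
  using check assms by (auto simp: exc_check_def Let_def list_all_iff list_ex_iff N_eq atLeastLessThanSuc_atLeastAtMost simp del: upt_Suc)

lemma Dv_base: "Dv (replicate (b + c) 0 @ [1]) = Ediv (b + c)"
proof (rule poly_mapping_eqI)
  show "Poly_Mapping.lookup (Dv (replicate (b + c) 0 @ [1])) k = Poly_Mapping.lookup (Ediv (b + c)) k" for k
    using r_ge unfolding Dv_def by (cases k) (auto simp: lookup_single when_def nth_append)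
qed

lemma orbit: "\<O> = Dv ` set (exc_list (b + c))"
proof (rule orbit_eqI[where rank = "height_list (b + c)"])
  have "replicate (b + c) 0 @ [1] \<in> set (exc_list (b + c))" using check by (auto simp: exc_check_def Let_def)
  then show "Ediv (b + c) \<in> Dv ` set (exc_list (b + c))" using Dv_base by (metis imageI)
  show "reflect_div i (Dv xs) \<in> Dv ` set (exc_list (b + c))" if "xs \<in> set (exc_list (b + c))" "i \<in> N" for xs i
    using reflect_Dv[OF that(2) exc_facts(1)[OF that(1)]] exc_facts(2)[OF that] by auto
  show "Dv xs = Ediv (b + c) \<or> (\<exists>i\<in>N. \<exists>J\<in>set (exc_list (b + c)). reflect_div i (Dv xs) = Dv J \<and>
      height_list (b + c) J < height_list (b + c) xs)" if xs: "xs \<in> set (exc_list (b + c))" for xs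
    using exc_facts(3)[OF xs]
  proof
    assume "\<exists>i\<in>N. height_list (b + c) (refl_list (b + c) i xs) < height_list (b + c) xs"
    then obtain i where i: "i \<in> N" "height_list (b + c) (refl_list (b + c) i xs) < height_list (b + c) xs" by auto
    then show ?thesis using reflect_Dv[OF i(1) exc_facts(1)[OF xs]] exc_facts(2)[OF xs i(1)] by blast
  qed (simp add: Dv_base)
qed

lemma minuscule: "D \<in> \<O> \<Longrightarrow> i \<in> N \<Longrightarrow> pic_form c D (\<alpha> i) \<in> {-1, 0, 1}"
proof -
  assume "D \<in> \<O>" and i: "i \<in> N"
  then obtain xs where xs: "xs \<in> set (exc_list (b + c))" "D = Dv xs" unfolding orbit by auto
  then show ?thesis using exc_facts(2)[OF xs(1) i] pairing_Dv[OF i, of xs] by simp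
qed

lemma inj_Dv: "inj_on Dv (set (exc_list (b + c)))"
proof (rule inj_onI)
  fix xs ys assume x: "xs \<in> set (exc_list (b + c))" "ys \<in> set (exc_list (b + c))" and eq: "Dv xs = Dv ys"
  have "xs ! j = ys ! j" if "j < Suc (b + c)" for j
  proof (cases "j = 0")
    case True
    then show ?thesis using eq Dv_H[of xs] Dv_H[of ys] by simp
  next
    case False
    then have "j \<in> {1..b + c}" using that by auto
    then show ?thesis using eq Dv_E[of j xs] Dv_E[of j ys] by simp
  qed
  then show "xs = ys" using exc_facts(1)[OF x(1)] exc_facts(1)[OF x(2)] by (intro nth_equalityI) auto
qed

lemma card_O: "card \<O> = length (remdups (exc_list (b + c)))"
  unfolding orbit card_image[OF inj_Dv] by (simp add: length_remdups_card_conv)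

end


interpretation E6: del_pezzo 2 3 3
  by unfold_locales (simp_all add: pic_delta_def exc_check_6)

interpretation E7: del_pezzo 2 4 3
  by unfold_locales (simp_all add: pic_delta_def exc_check_7)

definition e7_map :: "(pic_gen \<Rightarrow>\<^sub>0 real) \<Rightarrow> nat \<Rightarrow>\<^sub>0 real" where
  "e7_map x = (let t = (Poly_Mapping.lookup x (Hcl 1) + Poly_Mapping.lookup x (Ecl 1)) / 2 in
     vec_of 8 (\<lambda>q. if q = 0 then t else if q = 1 then - t else - t - Poly_Mapping.lookup x (Ecl (9 - q))))"

definition e6_map :: "(pic_gen \<Rightarrow>\<^sub>0 real) \<Rightarrow> nat \<Rightarrow>\<^sub>0 real" where
  "e6_map x = (let t = (Poly_Mapping.lookup x (Hcl 1) + Poly_Mapping.lookup x (Ecl 1)) / 2 in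
     vec_of 8 (\<lambda>q. if q = 0 then - t else if q \<le> 2 then t else t + Poly_Mapping.lookup x (Ecl (9 - q))))"

lemma linear_e7_map: "linear e7_map"
  by (rule linearI; rule poly_mapping_eqI) (simp_all add: e7_map_def Let_def lookup_add field_simps)

lemma linear_e6_map: "linear e6_map"
  by (rule linearI; rule poly_mapping_eqI) (simp_all add: e6_map_def Let_def lookup_add field_simps)

lemma sum_upto_6: "(\<Sum>j=1..3+3. f j) = f 1 + f 2 + f 3 + f 4 + f 5 + f (6::nat)" for f :: "nat \<Rightarrow> 'z::comm_monoid_add"
  by (simp add: eval_nat_numeral add.assoc)

lemma sum_upto_7: "(\<Sum>j=1..4+3. f j) = f 1 + f 2 + f 3 + f 4 + f 5 + f 6 + f (7::nat)" for f :: "nat \<Rightarrow> 'z::comm_monoid_add"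
  by (simp add: eval_nat_numeral add.assoc)

lemma sum_less_8: "(\<Sum>j<8. f j) = f 0 + f 1 + f 2 + f 3 + f 4 + f 5 + f 6 + f (7::nat)" for f :: "nat \<Rightarrow> 'z::comm_monoid_add"
  by (simp add: eval_nat_numeral add.assoc)

text \<open>With \<open>t = (X + y\<^sub>1) / 2\<close>, expanding the eight products and using \<open>\<Sum>\<^sub>j y\<^sub>j = -3 X\<close>
  leaves the intersection form; the argument for six points is the same.\<close>

lemma e7_map_isometry:
  assumes "x \<in> Kperp 2 4 3" "y \<in> Kperp 2 4 3"
  shows "dotp (e7_map x) (e7_map y) = - pic_form 3 x y"
proof -
  define X where "X = Poly_Mapping.lookup x (Hcl 1)"
  define Y where "Y = Poly_Mapping.lookup y (Hcl 1)"
  define p where "p j = Poly_Mapping.lookup x (Ecl j)" for j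
  define q where "q j = Poly_Mapping.lookup y (Ecl j)" for j
  have kx: "Poly_Mapping.keys x \<subseteq> pic_basis 2 4 3" "Poly_Mapping.keys y \<subseteq> pic_basis 2 4 3" using assms by (auto simp: E7.Kperp_iff)
  have h: "hyp_sum 2 x = X" "hyp_sum 2 y = Y" by (simp_all add: hyp_sum_def X_def Y_def)
  have 7: "p 7 = -3 * X - (p 1 + p 2 + p 3 + p 4 + p 5 + p 6)" "q 7 = -3 * Y - (q 1 + q 2 + q 3 + q 4 + q 5 + q 6)"
    using assms unfolding E7.Kperp_iff h exc_sum_def sum_upto_7 by (simp_all add: p_def q_def)
  have form: "pic_form 3 x y = X * Y - (p 1 * q 1 + p 2 * q 2 + p 3 * q 3 + p 4 * q 4 + p 5 * q 5 + p 6 * q 6 + p 7 * q 7)"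
    unfolding pic_form_coords[OF kx] h sum_upto_7 by (simp add: X_def Y_def p_def q_def)
  define t where "t = (X + p 1) / 2"
  define u where "u = (Y + q 1) / 2"
  have "e7_map x = vec_of 8 (\<lambda>k. if k = 0 then t else if k = 1 then - t else - t - p (9 - k))" "e7_map y = vec_of 8 (\<lambda>k. if k = 0 then u else if k = 1 then - u else - u - q (9 - k))"
    by (simp_all add: e7_map_def Let_def t_def u_def X_def Y_def p_def q_def cong: if_cong)
  then have dp: "dotp (e7_map x) (e7_map y) = 2 * (t * u) + ((t + p 2) * (u + q 2) + (t + p 3) * (u + q 3) + (t + p 4) * (u + q 4) + (t + p 5) * (u + q 5) + (t + p 6) * (u + q 6) + (t + p 7) * (u + q 7))"
    by (simp add: dotp_vec_of sum_less_8 algebra_simps)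
  have 1: "p 1 = 2 * t - X" "q 1 = 2 * u - Y" by (simp_all add: t_def u_def field_simps)
  show ?thesis unfolding form dp unfolding 7 unfolding 1 by (simp add: algebra_simps)
qed

lemma e6_map_isometry:
  assumes "x \<in> Kperp 2 3 3" "y \<in> Kperp 2 3 3"
  shows "dotp (e6_map x) (e6_map y) = - pic_form 3 x y"
proof -
  define X where "X = Poly_Mapping.lookup x (Hcl 1)"
  define Y where "Y = Poly_Mapping.lookup y (Hcl 1)"
  define p where "p j = Poly_Mapping.lookup x (Ecl j)" for j
  define q where "q j = Poly_Mapping.lookup y (Ecl j)" for j
  have kx: "Poly_Mapping.keys x \<subseteq> pic_basis 2 3 3" "Poly_Mapping.keys y \<subseteq> pic_basis 2 3 3" using assms by (auto simp: E6.Kperp_iff)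
  have h: "hyp_sum 2 x = X" "hyp_sum 2 y = Y" by (simp_all add: hyp_sum_def X_def Y_def)
  have 6: "p 6 = -3 * X - (p 1 + p 2 + p 3 + p 4 + p 5)" "q 6 = -3 * Y - (q 1 + q 2 + q 3 + q 4 + q 5)"
    using assms unfolding E6.Kperp_iff h exc_sum_def sum_upto_6 by (simp_all add: p_def q_def)
  have form: "pic_form 3 x y = X * Y - (p 1 * q 1 + p 2 * q 2 + p 3 * q 3 + p 4 * q 4 + p 5 * q 5 + p 6 * q 6)"
    unfolding pic_form_coords[OF kx] h sum_upto_6 by (simp add: X_def Y_def p_def q_def)
  define t where "t = (X + p 1) / 2"
  define u where "u = (Y + q 1) / 2"
  have "e6_map x = vec_of 8 (\<lambda>k. if k = 0 then - t else if k \<le> 2 then t else t + p (9 - k))" "e6_map y = vec_of 8 (\<lambda>k. if k = 0 then - u else if k \<le> 2 then u else u + q (9 - k))"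
    by (simp_all add: e6_map_def Let_def t_def u_def X_def Y_def p_def q_def cong: if_cong)
  then have dp: "dotp (e6_map x) (e6_map y) = 3 * (t * u) + ((t + p 2) * (u + q 2) + (t + p 3) * (u + q 3) + (t + p 4) * (u + q 4) + (t + p 5) * (u + q 5) + (t + p 6) * (u + q 6))"
    by (simp add: dotp_vec_of sum_less_8 algebra_simps)
  have 1: "p 1 = 2 * t - X" "q 1 = 2 * u - Y" by (simp_all add: t_def u_def field_simps)
  show ?thesis unfolding form dp unfolding 6 unfolding 1 by (simp add: algebra_simps)
qed

lemma nth_e7_coords:
  assumes "q < 8"
  shows "e7_coords xs ! q = (let t = xs ! 0 + xs ! 1 in if q = 0 then t else if q = 1 then 2 - t else - t - 2 * xs ! (9 - q))"
proof -
  have "q \<in> {0, 1, 2, 3, 4, 5, 6, 7}" using assms by auto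
  then show ?thesis by (auto simp: e7_coords_def Let_def upt_rec)
qed

lemma nth_e6_coords:
  assumes "q < 8"
  shows "e6_coords xs ! q = (let t = xs ! 0 + xs ! 1 in if q = 0 then 2 - t else if q \<le> 2 then t else t + 2 * xs ! (9 - q))"
proof -
  have "q \<in> {0, 1, 2, 3, 4, 5, 6, 7}" using assms by auto
  then show ?thesis by (auto simp: e6_coords_def Let_def upt_rec)
qed

lemma e7_vertices: "(\<lambda>D. e7_map (realify D) + Poly_Mapping.single 1 1) ` minus_one_divisors 2 4 3 = half_vec ` e7_coords ` set (exc_list 7)"
proof -
  have "e7_map (realify (E7.Dv xs)) + Poly_Mapping.single 1 1 = half_vec (e7_coords xs)" for xs
  proof (rule poly_mapping_eqI)
    fix q
    show "Poly_Mapping.lookup (e7_map (realify (E7.Dv xs)) + Poly_Mapping.single 1 1) q = Poly_Mapping.lookup (half_vec (e7_coords xs)) q"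
    proof (cases "q < 8")
      case True
      have "Poly_Mapping.lookup (E7.Dv xs) (Ecl (9 - q)) = xs ! (9 - q)" if "q \<noteq> 0" "q \<noteq> Suc 0"
        by (rule E7.Dv_E) (use True that in auto)
      then show ?thesis using True E7.Dv_H[of xs] E7.Dv_E[of 1 xs]
          nth_e7_coords[OF True, of xs]
        by (auto simp: e7_map_def half_vec_def Let_def lookup_add lookup_single when_def field_simps)
    next
      case False
      then show ?thesis by (simp add: e7_map_def half_vec_def Let_def lookup_add lookup_single when_def)
    qed
  qed
  then show ?thesis unfolding E7.orbit image_image by simp
qed

lemma e6_vertices: "(\<lambda>D. e6_map (realify D) + vec_of 1 (\<lambda>_. 1)) ` minus_one_divisors 2 3 3 = half_vec ` e6_coords ` set (exc_list 6)"
proof -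
  have "e6_map (realify (E6.Dv xs)) + vec_of 1 (\<lambda>_. 1) = half_vec (e6_coords xs)" for xs
  proof (rule poly_mapping_eqI)
    fix q
    show "Poly_Mapping.lookup (e6_map (realify (E6.Dv xs)) + vec_of 1 (\<lambda>_. 1)) q = Poly_Mapping.lookup (half_vec (e6_coords xs)) q"
    proof (cases "q < 8")
      case True
      have "Poly_Mapping.lookup (E6.Dv xs) (Ecl (9 - q)) = xs ! (9 - q)" if "\<not> q \<le> 2"
        by (rule E6.Dv_E) (use True that in auto)
      then show ?thesis using True E6.Dv_H[of xs] E6.Dv_E[of 1 xs]
          nth_e6_coords[OF True, of xs]
        by (auto simp: e6_map_def half_vec_def Let_def lookup_add lookup_single when_def field_simps)
    next
      case False
      then show ?thesis by (simp add: e6_map_def half_vec_def Let_def lookup_add)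
    qed
  qed
  then show ?thesis unfolding E6.orbit image_image by simp
qed

lemmas polytope_E6 = E6.images_are_vertices_of_hull[OF linear_e6_map e6_map_isometry e6_vertices, simplified]
lemmas polytope_E7 = E7.images_are_vertices_of_hull[OF linear_e7_map e7_map_isometry e7_vertices, simplified]

section \<open>Finitely supported complex vectors\<close>

lemma lookup_cscale [simp]: "Poly_Mapping.lookup (cscale k x) i = k * Poly_Mapping.lookup x i"
  by (simp add: cscale_def Poly_Mapping.map.rep_eq when_def)

interpretation CV: vector_space "cscale :: complex \<Rightarrow> ('i \<Rightarrow>\<^sub>0 complex) \<Rightarrow> ('i \<Rightarrow>\<^sub>0 complex)"
  by unfold_locales (auto intro!: poly_mapping_eqI simp: lookup_add algebra_simps)

lemma cscale_single: "cscale k (Poly_Mapping.single i z) = Poly_Mapping.single i (k * z)"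
  by (rule poly_mapping_eqI) (simp add: lookup_single when_def)

lemma poly_mapping_sum_singles: "(\<Sum>i\<in>Poly_Mapping.keys x. Poly_Mapping.single i (Poly_Mapping.lookup x i)) = x"
  by (rule poly_mapping_eqI) (auto simp: lookup_sum lookup_single when_def in_keys_iff)

definition supported :: "'i set \<Rightarrow> ('i \<Rightarrow>\<^sub>0 complex) set" where
  "supported S = {x. Poly_Mapping.keys x \<subseteq> S}"

lemma supported_iff: "x \<in> supported S \<longleftrightarrow> (\<forall>i. i \<notin> S \<longrightarrow> Poly_Mapping.lookup x i = 0)"
  by (auto simp: supported_def in_keys_iff)

lemma subspace_supported: "CV.subspace (supported S)"
  by (rule CV.subspaceI) (auto simp: supported_iff lookup_add)

lemma single_supported: "i \<in> S \<Longrightarrow> Poly_Mapping.single i k \<in> supported S"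
  by (auto simp: supported_iff lookup_single when_def)

lemma supported_span: 
  assumes "finite S"
  shows "supported S = CV.span ((\<lambda>i. Poly_Mapping.single i 1) ` S)"
proof
  show "supported S \<subseteq> CV.span ((\<lambda>i. Poly_Mapping.single i 1) ` S)"
  proof
    fix x :: "'a \<Rightarrow>\<^sub>0 complex" assume "x \<in> supported S"
    then have "(\<Sum>i\<in>Poly_Mapping.keys x. cscale (Poly_Mapping.lookup x i) (Poly_Mapping.single i 1))
      \<in> CV.span ((\<lambda>i. Poly_Mapping.single i 1) ` S)"
      by (intro CV.span_sum CV.span_scale CV.span_base) (auto simp: supported_def)
    then show "x \<in> CV.span ((\<lambda>i. Poly_Mapping.single i 1) ` S)"
      by (simp add: cscale_single poly_mapping_sum_singles)
  qed
  show "CV.span ((\<lambda>i. Poly_Mapping.single i 1) ` S) \<subseteq> supported S"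
    by (rule CV.span_minimal) (auto simp: subspace_supported single_supported)
qed

lemma fin_dim_subspace:
  assumes "CV.subspace V" "V \<subseteq> supported S" "finite S"
  shows "fin_dim_space cscale V"
proof -
  obtain B where B: "B \<subseteq> V" "CV.independent B" "V \<subseteq> CV.span B"
    using CV.maximal_independent_subset[of V] by blast
  have "finite B"
    using CV.independent_span_bound[OF _ B(2), of "(\<lambda>i. Poly_Mapping.single i 1) ` S"] B(1) assms(2,3)
    unfolding supported_span[OF assms(3)] by auto
  moreover have "V = CV.span B" using B CV.span_minimal[OF B(1) assms(1)] by auto
  ultimately show ?thesis unfolding fin_dim_space_def using CV.vector_space_axioms by blast
qed

lemma dim_supported:
  assumes "finite S"
  shows "CV.dim (supported S) = card S"
proof -
  let ?f = "\<lambda>i. Poly_Mapping.single i (1 :: complex)"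
  have inj: "inj_on ?f S" by (auto simp: inj_on_def poly_mapping_eq_iff fun_eq_iff lookup_single when_def split: if_splits)
  have "CV.independent (?f ` S)"
  proof (rule CV.independent_if_scalars_zero)
    fix u x assume u: "(\<Sum>x\<in>?f ` S. cscale (u x) x) = 0" and x: "x \<in> ?f ` S"
    then obtain i where i: "i \<in> S" "x = ?f i" by auto
    have "(\<Sum>j\<in>S. cscale (u (?f j)) (?f j)) = 0" using u by (simp add: sum.reindex[OF inj])
    then have "Poly_Mapping.lookup (\<Sum>j\<in>S. cscale (u (?f j)) (?f j)) i = 0" by simp
    then show "u x = 0" using i assms by (simp add: lookup_sum lookup_single when_def if_distrib cong: if_cong)
  qed (simp add: assms)
  then show ?thesis unfolding supported_span[OF assms]
    by (simp add: CV.dim_eq_card_independent card_image[OF inj])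
qed

section \<open>Lie algebras of matrices\<close>

definition gl_carrier :: "nat \<Rightarrow> cmatrix set" where
  "gl_carrier N = supported ({..<N} \<times> {..<N})"

lemma entry_commutator:
  "entry (commutator N X Y) i k = (if i < N \<and> k < N
     then (\<Sum>j<N. entry X i j * entry Y j k) - (\<Sum>j<N. entry Y i j * entry X j k) else 0)"
proof -
  have "entry (commutator N X Y) i k = (\<Sum>i'<N. \<Sum>k'<N. if i' = i \<and> k' = k then
      (\<Sum>j<N. entry X i' j * entry Y j k' - entry Y i' j * entry X j k') else 0)"
    unfolding commutator_def by (simp add: lookup_sum lookup_single when_def)
  also have "\<dots> = (\<Sum>i'<N. if i' = i then \<Sum>k'<N. if k' = k then
      (\<Sum>j<N. entry X i' j * entry Y j k' - entry Y i' j * entry X j k') else 0 else 0)"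
    by (intro sum.cong) auto
  finally show ?thesis by (simp add: sum_subtractf)
qed

lemma cmatrix_eqI: "(\<And>i j. entry X i j = entry Y i j) \<Longrightarrow> X = Y"
  by (rule poly_mapping_eqI) auto

lemma commutator_gl: "commutator N X Y \<in> gl_carrier N"
  by (auto simp: gl_carrier_def supported_iff entry_commutator)

lemma commutator_linear:
  "commutator N (X + Y) Z = commutator N X Z + commutator N Y Z"
  "commutator N Z (X + Y) = commutator N Z X + commutator N Z Y"
  "commutator N (cscale k X) Y = cscale k (commutator N X Y)"
  "commutator N X (cscale k Y) = cscale k (commutator N X Y)"
  "commutator N X X = 0"
  by (rule cmatrix_eqI; simp add: entry_commutator lookup_add algebra_simps sum.distrib sum_distrib_left)+
lemma commutator_minus:
  "commutator N (X - Y) Z = commutator N X Z - commutator N Y Z"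
  "commutator N Z (X - Y) = commutator N Z X - commutator N Z Y"
  by (rule cmatrix_eqI; simp add: entry_commutator lookup_minus algebra_simps sum_subtractf)+
text \<open>Each of the three double commutators is a signed sum of four triple matrix products, and
  the twelve terms cancel in pairs.\<close>

lemma commutator_jacobi:
  "commutator N X (commutator N Y Z) + commutator N Y (commutator N Z X) + commutator N Z (commutator N X Y) = 0"
proof (rule cmatrix_eqI)
  fix i k
  define T where "T A B C = (\<Sum>j<N. \<Sum>l<N. entry A i j * entry B j l * entry C l k)" for A B C
  have e: "entry (commutator N A (commutator N B C)) i k = T A B C - T A C B - (T B C A - T C B A)"
    if "i < N" "k < N" for A B C
  proof -
    have "(\<Sum>j<N. entry A i j * entry (commutator N B C) j k) = T A B C - T A C B"
      unfolding T_def using that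
      by (simp add: entry_commutator right_diff_distrib sum_distrib_left sum_subtractf mult.assoc)
    moreover have "(\<Sum>j<N. entry (commutator N B C) i j * entry A j k)
      = (\<Sum>j<N. \<Sum>l<N. entry B i l * entry C l j * entry A j k) - (\<Sum>j<N. \<Sum>l<N. entry C i l * entry B l j * entry A j k)"
      using that by (simp add: entry_commutator left_diff_distrib sum_distrib_right sum_subtractf)
    moreover have "\<dots> = T B C A - T C B A"
      unfolding T_def by (intro arg_cong2[where f = "(-)"]; subst sum.swap; simp)
    ultimately show ?thesis using that by (subst entry_commutator) simp
  qed
  show "entry (commutator N X (commutator N Y Z) + commutator N Y (commutator N Z X) + commutator N Z (commutator N X Y)) i k = entry 0 i k"
  proof (cases "i < N \<and> k < N")
    case True
    then show ?thesis by (simp add: lookup_add e)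
  next
    case False
    then show ?thesis by (auto simp add: lookup_add entry_commutator)
  qed
qed

lemma is_lie_algebra_gl:
  assumes "CV.subspace L" "L \<subseteq> gl_carrier N" "\<And>X Y. X \<in> L \<Longrightarrow> Y \<in> L \<Longrightarrow> commutator N X Y \<in> L"
  shows "is_lie_algebra \<lparr>lscale = cscale, lcarrier = L, lbracket = commutator N\<rparr>"
  unfolding is_lie_algebra_def Let_def
  using fin_dim_subspace[OF assms(1) assms(2)[unfolded gl_carrier_def]] assms(3)
  by (simp add: commutator_linear commutator_jacobi)

text \<open>In a finite-dimensional Lie algebra the Serre relations follow from the others: the elements
  concerned are lowest or highest weight vectors of the wrong sign for the adjoint action.\<close>

lemma serre_relations:
  fixes g :: "'g::ab_group_add lie_algebra" and I :: "nat set"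
  defines "br \<equiv> lbracket g" and "sc \<equiv> lscale g" and "L \<equiv> lcarrier g"
  assumes lie: "is_lie_algebra g" 
    and gens: "\<And>i. i \<in> I \<Longrightarrow> e i \<in> L \<and> f i \<in> L \<and> h i \<in> L"
    and he: "\<And>i j. i \<in> I \<Longrightarrow> j \<in> I \<Longrightarrow> br (h i) (e j) = sc (of_int (A i j)) (e j)"
    and hf: "\<And>i j. i \<in> I \<Longrightarrow> j \<in> I \<Longrightarrow> br (h i) (f j) = sc (- of_int (A i j)) (f j)"
    and ef: "\<And>i j. i \<in> I \<Longrightarrow> j \<in> I \<Longrightarrow> br (e i) (f j) = (if i = j then h i else 0)"
    and A: "\<And>i. A i i = 2" "\<And>i j. i \<noteq> j \<Longrightarrow> A i j = 0 \<or> A i j = -1"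
    and ij: "i \<in> I" "j \<in> I" "i \<noteq> j"
  shows "(br (e i) ^^ nat (1 - A i j)) (e j) = 0" "(br (f i) ^^ nat (1 - A i j)) (f j) = 0"
proof -
  interpret G: vector_space sc using lie by (simp add: is_lie_algebra_def fin_dim_space_def Let_def sc_def)
  obtain B where B: "finite B" "L = G.span B"
    using lie unfolding is_lie_algebra_def fin_dim_space_def Let_def sc_def L_def by blast
  note lie' = lie[unfolded is_lie_algebra_def Let_def, folded br_def sc_def L_def]
  have subL: "G.subspace L" and finL: "\<exists>B. finite B \<and> L \<subseteq> G.span B" using B by auto
  have brL: "br x y \<in> L" if "x \<in> L" "y \<in> L" for x y
    using lie' that by blast
  have add: "br (x + y) z = br x z + br y z" "br z (x + y) = br z x + br z y" if "x \<in> L" "y \<in> L" "z \<in> L" for x y z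
    using lie'[THEN conjunct2, THEN conjunct2, THEN conjunct1] that by blast+
  have scal: "br (sc k x) y = sc k (br x y)" "br x (sc k y) = sc k (br x y)" if "x \<in> L" "y \<in> L" for k x y
    using lie'[THEN conjunct2, THEN conjunct2, THEN conjunct2, THEN conjunct1] that by blast+
  have alt: "br x x = 0" if "x \<in> L" for x
    using lie'[THEN conjunct2, THEN conjunct2, THEN conjunct2, THEN conjunct2, THEN conjunct1] that by blast
  have jac: "br x (br y z) + br y (br z x) + br z (br x y) = 0" if "x \<in> L" "y \<in> L" "z \<in> L" for x y z
    using lie'[THEN conjunct2, THEN conjunct2, THEN conjunct2, THEN conjunct2, THEN conjunct2] that by blast
  have L_add: "x + y \<in> L" if "x \<in> L" "y \<in> L" for x y using G.subspace_add[OF subL that] .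
  have anti: "br x y = - br y x" if "x \<in> L" "y \<in> L" for x y
  proof -
    have "br (x + y) (x + y) = br x (x + y) + br y (x + y)" using that L_add by (intro add) auto
    also have "\<dots> = br x y + br y x" using that by (simp add: add alt)
    finally have "br x y + br y x = 0" using alt[OF L_add[OF that]] by simp
    then show ?thesis by (simp add: eq_neg_iff_add_eq_0)
  qed
  have neg: "br x (- y) = - br x y" "br (- x) y = - br x y" if "x \<in> L" "y \<in> L" for x y
    using scal[OF that, of "-1"] by simp_all
  have ad: "br x (br y z) = br y (br x z) + br (br x y) z" if "x \<in> L" "y \<in> L" "z \<in> L" for x y z
  proof -
    have "br y (br z x) = - br y (br x z)" "br z (br x y) = - br (br x y) z"
      using that by (simp_all add: anti[of z] neg brL)
    then show ?thesis using jac[OF that] by (simp add: algebra_simps)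
  qed
  have A': "A i j = 0 \<or> A i j = -1" using A(2) ij by auto
  have eL: "e i \<in> L" "f i \<in> L" "h i \<in> L" "e j \<in> L" "f j \<in> L" "h j \<in> L" using gens ij by auto
  have zer: "br x 0 = 0" "br 0 x = 0" if "x \<in> L" for x
    using scal[OF that G.subspace_0[OF subL], of 0] scal[OF G.subspace_0[OF subL] that, of 0] by simp_all
  have fe: "br (f k) (e l) = (if k = l then - h k else 0)" if "k \<in> I" "l \<in> I" for k l
    using anti[of "f k" "e l"] ef[OF that(2,1)] gens that by auto
  interpret up: chevalley_rep sc L I A "\<lambda>i. br (e i)" "\<lambda>i. br (f i)" "\<lambda>i. br (h i)"
  proof unfold_locales
    show "br (h i) (br (e j) x) = br (e j) (br (h i) x) + sc (complex_of_int (A i j)) (br (e j) x)"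
      if "i \<in> I" "j \<in> I" "x \<in> L" for i j x
      using ad[of "h i" "e j" x] scal(1)[of "e j" x] gens that by (simp add: he)
    show "br (e i) (br (f j) x) = br (f j) (br (e i) x) + (if i = j then br (h i) x else 0)"
      if "i \<in> I" "j \<in> I" "x \<in> L" for i j x
      using ad[of "e i" "f j" x] gens that by (simp add: ef zer)
    show "br (h i) (br (f j) x) = br (f j) (br (h i) x) - sc (complex_of_int (A i j)) (br (f j) x)"
      if "i \<in> I" "j \<in> I" "x \<in> L" for i j x
    proof -
      have "br (br (h i) (f j)) x = sc (- of_int (A i j)) (br (f j) x)"
        unfolding hf[OF that(1,2)] using gens that by (intro scal) auto
      then show ?thesis using ad[of "h i" "f j" x] gens that by simp
    qed
  qed (use subL finL gens in \<open>auto simp: brL add scal A\<close>)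
  interpret down: chevalley_rep sc L I A "\<lambda>i. br (f i)" "\<lambda>i. br (e i)" "\<lambda>i x. - br (h i) x"
  proof unfold_locales
    have Lneg: "x \<in> L \<Longrightarrow> - x \<in> L" for x using G.subspace_neg[OF subL] .
    show "- br (h i) x \<in> L" if "i \<in> I" "x \<in> L" for i x using that gens brL Lneg by auto
    show "- br (h i) (br (f j) x) = br (f j) (- br (h i) x) + sc (complex_of_int (A i j)) (br (f j) x)"
      if "i \<in> I" "j \<in> I" "x \<in> L" for i j x
      using up.HF[OF that] gens that by (simp add: neg brL)
    show "- br (h i) (br (e j) x) = br (e j) (- br (h i) x) - sc (complex_of_int (A i j)) (br (e j) x)"
      if "i \<in> I" "j \<in> I" "x \<in> L" for i j x
      using up.HE[OF that] gens that by (simp add: neg brL)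
    show "br (f i) (br (e j) x) = br (e j) (br (f i) x) + (if i = j then - br (h i) x else 0)"
      if "i \<in> I" "j \<in> I" "x \<in> L" for i j x
      using ad[of "f i" "e j" x] fe[OF that(1,2)] gens that by (auto simp: neg zer)
  qed (use subL finL gens in \<open>auto simp: brL add scal A\<close>)
  show "(br (e i) ^^ nat (1 - A i j)) (e j) = 0"
    using A'
  proof
    assume a: "A i j = 0"
    have "br (e i) (e j) = 0"
    proof (rule down.negative_highest_vector_zero[OF ij(1), of _ "-2"])
      show "br (f i) (br (e i) (e j)) = 0"
        using down.EF[OF ij(1,1) eL(4)] fe[OF ij(1,2)] he[OF ij(1,2)] ij a eL by (simp add: zer)
      show "- br (h i) (br (e i) (e j)) = sc (of_int (- 2)) (br (e i) (e j))"
        using up.HE[OF ij(1,1) eL(4)] he[OF ij(1,2)] a eL by (simp add: A zer)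
    qed (use brL eL in auto)
    then show ?thesis using a by simp
  next
    assume a: "A i j = -1"
    let ?z = "br (e i) (e j)"
    have zL: "?z \<in> L" using brL eL by auto
    have hej: "br (h i) (e j) = - e j" using he[OF ij(1,2)] a by simp
    have hz: "br (h i) ?z = ?z" using up.HE[OF ij(1,1) eL(4)] hej eL by (simp add: A neg) (simp add: G.scale_left_distrib[of 1 1, simplified])
    have fz: "br (f i) ?z = e j" using down.EF[OF ij(1,1) eL(4)] fe[OF ij(1,2)] hej ij eL by (simp add: zer)
    have "br (e i) ?z = 0"
    proof (rule down.negative_highest_vector_zero[OF ij(1), of _ "-3"])
      show "br (f i) (br (e i) ?z) = 0" using down.EF[OF ij(1,1) zL] fz hz by simp
      show "- br (h i) (br (e i) ?z) = sc (of_int (- 3)) (br (e i) ?z)"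
        using up.HE[OF ij(1,1) zL] hz by (simp add: A) (simp add: G.scale_left_distrib[of 1 2, simplified])
    qed (use brL eL zL in auto)
    then show ?thesis using a by (simp add: eval_nat_numeral)
  qed
  show "(br (f i) ^^ nat (1 - A i j)) (f j) = 0"
    using A'
  proof
    assume a: "A i j = 0"
    have "br (f i) (f j) = 0"
    proof (rule up.negative_highest_vector_zero[OF ij(1), of _ "-2"])
      show "br (e i) (br (f i) (f j)) = 0"
        using up.EF[OF ij(1,1) eL(5)] ef[OF ij(1,2)] hf[OF ij(1,2)] ij a eL by (simp add: zer)
      show "br (h i) (br (f i) (f j)) = sc (of_int (- 2)) (br (f i) (f j))"
        using up.HF[OF ij(1,1) eL(5)] hf[OF ij(1,2)] a eL by (simp add: A zer)
    qed (use brL eL in auto)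
    then show ?thesis using a by simp
  next
    assume a: "A i j = -1"
    let ?z = "br (f i) (f j)"
    have zL: "?z \<in> L" using brL eL by auto
    have hfj: "br (h i) (f j) = f j" using hf[OF ij(1,2)] a by simp
    have hz: "br (h i) ?z = - ?z" using up.HF[OF ij(1,1) eL(5)] hfj eL by (simp add: A) (simp add: G.scale_left_distrib[of 1 1, simplified])
    have ez: "br (e i) ?z = f j" using up.EF[OF ij(1,1) eL(5)] ef[OF ij(1,2)] hfj ij eL by (simp add: zer)
    have "br (f i) ?z = 0"
    proof (rule up.negative_highest_vector_zero[OF ij(1), of _ "-3"])
      show "br (e i) (br (f i) ?z) = 0" using up.EF[OF ij(1,1) zL] ez hz by simp
      show "br (h i) (br (f i) ?z) = sc (of_int (- 3)) (br (f i) ?z)"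
        using up.HF[OF ij(1,1) zL] hz eL zL by (simp add: A neg) (simp add: G.scale_left_distrib[of 1 2, simplified])
    qed (use brL eL zL in auto)
    then show ?thesis using a by (simp add: eval_nat_numeral)
  qed
qed

section \<open>Modules with a basis indexed by the orbit\<close>

context picard
begin

text \<open>A real relation among the rows gives a combination of roots orthogonal to all roots; it
  vanishes in \<open>K\<^sup>\<bottom>\<close>, and pairing it with the fundamental weights recovers the coefficients.
  Complex relations split into real and imaginary parts.\<close>

lemma cartan_matrix_regular:
  fixes k :: "nat \<Rightarrow> complex"
  assumes 0: "\<And>j. j \<in> N \<Longrightarrow> (\<Sum>i\<in>N. k i * of_int (pic_form c (\<alpha> i) (\<alpha> j))) = 0" and i: "i \<in> N"
  shows "k i = 0"
proof -
  have real: "t i = 0" if t: "\<And>j. j \<in> N \<Longrightarrow> (\<Sum>i\<in>N. t i * of_int (pic_form c (\<alpha> i) (\<alpha> j))) = 0" for t :: "nat \<Rightarrow> real"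
  proof -
    define x where "x = (\<Sum>i\<in>N. t i *\<^sub>R realify (\<alpha> i))"
    have form: "pic_form c x y = (\<Sum>i\<in>N. t i * pic_form c (realify (\<alpha> i)) y)" for y
    proof -
      have "pic_form c (\<Sum>i\<in>A. t i *\<^sub>R realify (\<alpha> i)) y = (\<Sum>i\<in>A. t i * pic_form c (realify (\<alpha> i)) y)" for A
        by (induction A rule: infinite_finite_induct) (auto simp: pic_form_add_left pic_form_scaleR_left pic_form_def[of _ 0])
      then show ?thesis by (simp add: x_def)
    qed
    have "x \<in> Kperp a b c" unfolding x_def
      by (intro subspace_sum[OF subspace_Kperp] subspace_scale[OF subspace_Kperp] \<alpha>_Kperp)
    then have "x = 0" by (rule Kperp_zeroI) (use t in \<open>simp add: form pic_form_realify\<close>)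
    then have "0 = pic_form c x (omega a b c i)" by (simp add: pic_form_def)
    also have "\<dots> = (\<Sum>j\<in>N. t j * (if i = j then 1 else 0))"
      unfolding form by (intro sum.cong refl) (simp add: omega(2) pic_form_sym[of c "realify (\<alpha> _)"])
    also have "\<dots> = (\<Sum>j\<in>N. if i = j then t j else 0)" by (intro sum.cong) auto
    also have "\<dots> = t i" using i by (simp add: nodes_def)
    finally show ?thesis by simp
  qed
  have "Re (k i) = 0"
  proof (rule real)
    fix j assume "j \<in> N"
    from arg_cong[OF 0[OF this], of Re] show "(\<Sum>i\<in>N. Re (k i) * of_int (pic_form c (\<alpha> i) (\<alpha> j))) = 0" by simp
  qed
  moreover have "Im (k i) = 0"
  proof (rule real)
    fix j assume "j \<in> N"
    from arg_cong[OF 0[OF this], of Im] show "(\<Sum>i\<in>N. Im (k i) * of_int (pic_form c (\<alpha> i) (\<alpha> j))) = 0" by simp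
  qed
  ultimately show ?thesis by (simp add: complex_eq_iff)
qed

text \<open>The remaining axioms follow from the orbit. A linear relation between the \<open>h\<^sub>i\<close> gives, by
  evaluating on two basis vectors related by a reflection, a relation between the rows of
  the Cartan matrix, which is regular. For irreducibility, a nonzero vector of a submodule
  with minimal support is a multiple of a basis vector: different classes have different
  weights, so otherwise some \<open>h\<^sub>i - k\<close> would shorten it. From one basis vector, the \<open>e\<^sub>i\<close> and
  \<open>f\<^sub>i\<close> reach all others, because the orbit is connected by reflections.\<close>

theorem labelled_module_minuscule:
  fixes g :: "'g::ab_group_add lie_algebra" and M :: "('g, 's \<Rightarrow>\<^sub>0 complex) lie_module"
  assumes lie: "is_lie_algebra g" and md: "is_lie_module g M"
    and ms: "mscale M = cscale" and mc: "mcarrier M = supported S" and fS: "finite S"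
    and bij: "bij_betw Dv S \<O>"
    and mins: "\<And>D i. D \<in> \<O> \<Longrightarrow> i \<in> N \<Longrightarrow> pic_form c D (\<alpha> i) \<in> {-1, 0, 1}"
    and nonzero: "\<And>i. i \<in> N \<Longrightarrow> \<exists>D\<in>\<O>. pic_form c D (\<alpha> i) \<noteq> 0"
    and gens: "\<And>i. i \<in> N \<Longrightarrow> e i \<in> lcarrier g \<and> f i \<in> lcarrier g \<and> h i \<in> lcarrier g"
    and hh: "\<And>i j. i \<in> N \<Longrightarrow> j \<in> N \<Longrightarrow> lbracket g (h i) (h j) = 0"
    and he: "\<And>i j. i \<in> N \<Longrightarrow> j \<in> N \<Longrightarrow> lbracket g (h i) (e j) = lscale g (of_int (T_cartan_matrix a b c i j)) (e j)"
    and hf: "\<And>i j. i \<in> N \<Longrightarrow> j \<in> N \<Longrightarrow> lbracket g (h i) (f j) = lscale g (- of_int (T_cartan_matrix a b c i j)) (f j)"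
    and ef: "\<And>i j. i \<in> N \<Longrightarrow> j \<in> N \<Longrightarrow> lbracket g (e i) (f j) = (if i = j then h i else 0)"
    and gen: "\<And>U. module.subspace (lscale g) U \<Longrightarrow> U \<subseteq> lcarrier g \<Longrightarrow> (\<And>x y. x \<in> U \<Longrightarrow> y \<in> U \<Longrightarrow> lbracket g x y \<in> U) \<Longrightarrow>
      (\<And>i. i \<in> N \<Longrightarrow> e i \<in> U \<and> f i \<in> U \<and> h i \<in> U) \<Longrightarrow> U = lcarrier g"
    and acth: "\<And>i I. i \<in> N \<Longrightarrow> I \<in> S \<Longrightarrow> maction M (h i) (Poly_Mapping.single I 1) = cscale (of_int (pic_form c (Dv I) (\<alpha> i))) (Poly_Mapping.single I 1)"
    and acte: "\<And>i I J. i \<in> N \<Longrightarrow> I \<in> S \<Longrightarrow> J \<in> S \<Longrightarrow> pic_form c (Dv I) (\<alpha> i) = -1 \<Longrightarrow> Dv J = reflect_div i (Dv I) \<Longrightarrow>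
      \<exists>k. k \<noteq> 0 \<and> maction M (e i) (Poly_Mapping.single I 1) = Poly_Mapping.single J k"
    and actf: "\<And>i I J. i \<in> N \<Longrightarrow> I \<in> S \<Longrightarrow> J \<in> S \<Longrightarrow> pic_form c (Dv I) (\<alpha> i) = 1 \<Longrightarrow> Dv J = reflect_div i (Dv I) \<Longrightarrow>
      \<exists>k. k \<noteq> 0 \<and> maction M (f i) (Poly_Mapping.single I 1) = Poly_Mapping.single J k"
    and act0: "\<And>i I. i \<in> N \<Longrightarrow> I \<in> S \<Longrightarrow> Dv I = Ediv r \<Longrightarrow> maction M (e i) (Poly_Mapping.single I 1) = 0"
  shows "labelled_module a b c g M e f h"
proof -
  let ?A = "T_cartan_matrix a b c"
  define act where "act = maction M"
  define L where "L = lcarrier g"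
  define V where "V = (supported S :: ('s \<Rightarrow>\<^sub>0 complex) set)"
  let ?v = "\<lambda>I. Poly_Mapping.single I 1 :: 's \<Rightarrow>\<^sub>0 complex"
  have act: "\<And>x v. x \<in> L \<Longrightarrow> v \<in> V \<Longrightarrow> act x v \<in> V"
    "\<And>x y v. x \<in> L \<Longrightarrow> y \<in> L \<Longrightarrow> v \<in> V \<Longrightarrow> act (x + y) v = act x v + act y v"
    "\<And>x v w. x \<in> L \<Longrightarrow> v \<in> V \<Longrightarrow> w \<in> V \<Longrightarrow> act x (v + w) = act x v + act x w"
    "\<And>x v k. x \<in> L \<Longrightarrow> v \<in> V \<Longrightarrow> act (lscale g k x) v = cscale k (act x v)"
    "\<And>x v k. x \<in> L \<Longrightarrow> v \<in> V \<Longrightarrow> act x (cscale k v) = cscale k (act x v)"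
    using md unfolding is_lie_module_def Let_def ms mc act_def[symmetric] L_def[symmetric] V_def[symmetric] by blast+
  interpret G: vector_space "lscale g" using lie by (simp add: is_lie_algebra_def fin_dim_space_def Let_def)
  obtain B where B: "L = G.span B"
    using lie unfolding is_lie_algebra_def fin_dim_space_def Let_def L_def by blast
  have subL: "G.subspace L" using B by simp
  have subV: "CV.subspace V" unfolding V_def by (rule subspace_supported)
  have vV: "?v I \<in> V" if "I \<in> S" for I unfolding V_def by (rule single_supported[OF that])
  have act_0: "act 0 v = 0" if "v \<in> V" for v using act(4)[OF G.subspace_0[OF subL] that, of 0] by simp
  have act_z: "act x 0 = 0" if "x \<in> L" for x using act(5)[OF that CV.subspace_0[OF subV], of 0] by simp
  have DvO: "Dv I \<in> \<O>" if "I \<in> S" for I using bij that by (auto simp: bij_betw_def)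
  have injS: "I = J" if "I \<in> S" "J \<in> S" "Dv I = Dv J" for I J
    using bij that by (auto simp: bij_betw_def inj_on_def)
  have surjS: "\<exists>I\<in>S. Dv I = D" if "D \<in> \<O>" for D
    using that unfolding bij_betw_imp_surj_on[OF bij, symmetric] by auto
  have indep: "\<forall>i\<in>N. k i = 0" if k: "(\<Sum>i\<in>N. lscale g (k i) (h i)) = 0" for k
  proof
    fix i assume i: "i \<in> N"
    have eq: "(\<Sum>i\<in>N. k i * of_int (pic_form c D (\<alpha> i))) = 0" if "D \<in> \<O>" for D
    proof -
      obtain I where I: "I \<in> S" "D = Dv I" using bij \<open>D \<in> \<O>\<close> by (auto simp: bij_betw_def)
      have "(\<Sum>i\<in>A. lscale g (k i) (h i)) \<in> L \<and> act (\<Sum>i\<in>A. lscale g (k i) (h i)) (?v I)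
          = cscale (\<Sum>i\<in>A. k i * of_int (pic_form c D (\<alpha> i))) (?v I)" if "A \<subseteq> N" "finite A" for A
        using that(2,1)
      proof (induction A rule: finite_induct)
        case empty
        then show ?case using act_0[OF vV[OF I(1)]] G.subspace_0[OF subL] by simp
      next
        case (insert i A)
        have hL: "h i \<in> L" using gens insert.prems by (auto simp: L_def)
        then have "lscale g (k i) (h i) \<in> L" using G.subspace_scale[OF subL] by auto
        moreover have "act (lscale g (k i) (h i)) (?v I) = cscale (k i * of_int (pic_form c D (\<alpha> i))) (?v I)"
          using act(4)[OF hL vV[OF I(1)]] acth[OF _ I(1), of i] insert.prems I by (simp add: act_def)
        ultimately show ?case
          using insert act(2)[OF _ _ vV[OF I(1)]] G.subspace_add[OF subL] by (simp add: CV.scale_left_distrib)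
      qed
      from this[of N] have "cscale (\<Sum>i\<in>N. k i * of_int (pic_form c D (\<alpha> i))) (?v I) = 0"
        unfolding k using act_0[OF vV[OF I(1)]] by (auto simp: nodes_def)
      from arg_cong[OF this, of "\<lambda>x. Poly_Mapping.lookup x I"] show ?thesis by simp
    qed
    \<comment> \<open>The relation at D is subtracted from the one at its reflection.\<close>
    show "k i = 0"
    proof (rule cartan_matrix_regular[OF _ i])
      fix j assume j: "j \<in> N"
      then obtain D where D: "D \<in> \<O>" "pic_form c D (\<alpha> j) \<noteq> 0" using nonzero by blast
      have "0 = (\<Sum>i\<in>N. k i * of_int (pic_form c (reflect_div j D) (\<alpha> i))) - (\<Sum>i\<in>N. k i * of_int (pic_form c D (\<alpha> i)))"
        using eq[OF D(1)] eq[OF minus_one_divisors.reflect[OF D(1) j]] by simp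
      also have "\<dots> = (\<Sum>i\<in>N. of_int (pic_form c D (\<alpha> j)) * (k i * of_int (pic_form c (\<alpha> i) (\<alpha> j))))"
        unfolding sum_subtractf[symmetric]
        by (intro sum.cong refl) (simp add: pic_form_add_left pic_form_frag_cmul_left pic_form_sym[of c "\<alpha> j"] algebra_simps)
      also have "\<dots> = of_int (pic_form c D (\<alpha> j)) * (\<Sum>i\<in>N. k i * of_int (pic_form c (\<alpha> i) (\<alpha> j)))"
        by (simp add: sum_distrib_left)
      finally show "(\<Sum>i\<in>N. k i * of_int (pic_form c (\<alpha> i) (\<alpha> j))) = 0" using D(2) by simp
    qed
  qed
  have A: "?A i i = 2" "i \<noteq> j \<Longrightarrow> ?A i j = 0 \<or> ?A i j = -1" for i j by (auto simp: T_cartan_matrix_def)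
  have chev: "chevalley_generators g N ?A e f h"
    unfolding chevalley_generators_def Let_def
  proof (intro conjI ballI allI impI)
    show "e ` N \<union> f ` N \<union> h ` N \<subseteq> lcarrier g" using gens by auto
    show "(lbracket g (e i) ^^ nat (1 - ?A i j)) (e j) = 0" "(lbracket g (f i) ^^ nat (1 - ?A i j)) (f j) = 0"
      if "i \<in> N" "j \<in> N" "i \<noteq> j" for i j
      using serre_relations[OF lie, of N e f h ?A i j] gens he hf ef A that by blast+
    show "k i = 0" if "(\<Sum>i\<in>N. lscale g (k i) (h i)) = 0" "i \<in> N" for k i using indep[OF that(1)] that(2) by blast
    show "U = lcarrier g" if "G.subspace U \<and> U \<subseteq> lcarrier g \<and> (\<forall>x\<in>U. \<forall>y\<in>U. lbracket g x y \<in> U) \<and> e ` N \<union> f ` N \<union> h ` N \<subseteq> U" for U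
      by (rule gen) (use that in auto)
  qed (use hh he hf ef in auto)
  have expand: "act x \<psi> = (\<Sum>K\<in>Poly_Mapping.keys \<psi>. cscale (Poly_Mapping.lookup \<psi> K) (act x (?v K)))" if x: "x \<in> L" and \<psi>: "\<psi> \<in> V" for x \<psi>
  proof -
    have "(\<Sum>K\<in>A. cscale (Poly_Mapping.lookup \<psi> K) (?v K)) \<in> V \<and> act x (\<Sum>K\<in>A. cscale (Poly_Mapping.lookup \<psi> K) (?v K))
        = (\<Sum>K\<in>A. cscale (Poly_Mapping.lookup \<psi> K) (act x (?v K)))" if "A \<subseteq> S" "finite A" for A
      using that(2,1)
    proof (induction A rule: finite_induct)
      case (insert K A)
      then show ?case using act(3)[OF x] act(5)[OF x] vV CV.subspace_add[OF subV] CV.subspace_scale[OF subV] by simp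
    qed (simp add: act_z[OF x] CV.subspace_0[OF subV])
    from this[of "Poly_Mapping.keys \<psi>"] show ?thesis
      using \<psi> by (simp add: V_def supported_def cscale_single poly_mapping_sum_singles)
  qed
  obtain I0 where I0: "I0 \<in> S" "Dv I0 = Ediv r"
    using surjS[OF minus_one_divisors.base] by blast
  have irr: "irreducible_module g M"
    unfolding irreducible_module_def ms mc act_def[symmetric] L_def[symmetric] V_def[symmetric]
  proof (intro conjI allI impI)
    have "?v I0 \<noteq> 0" by (metis lookup_single_eq lookup_zero zero_neq_one)
    then show "V \<noteq> {0}" using vV[OF I0(1)] by auto
    fix U assume "CV.subspace U \<and> U \<subseteq> V \<and> (\<forall>x\<in>L. \<forall>u\<in>U. act x u \<in> U)"
    then have U: "CV.subspace U" "U \<subseteq> V" "\<And>x u. x \<in> L \<Longrightarrow> u \<in> U \<Longrightarrow> act x u \<in> U" by auto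
    show "U = {0} \<or> U = V"
    proof (cases "U = {0}")
      case False
      then have "\<exists>\<psi>. \<psi> \<in> U \<and> \<psi> \<noteq> 0" using CV.subspace_0[OF U(1)] by auto
      then obtain \<psi> where \<psi>: "\<psi> \<in> U" "\<psi> \<noteq> 0" and min: "\<And>\<phi>. \<phi> \<in> U \<and> \<phi> \<noteq> 0 \<Longrightarrow> card (Poly_Mapping.keys \<psi>) \<le> card (Poly_Mapping.keys \<phi>)"
        using ex_has_least_nat[of "\<lambda>\<psi>. \<psi> \<in> U \<and> \<psi> \<noteq> 0" _ "\<lambda>\<psi>. card (Poly_Mapping.keys \<psi>)"] by blast
      have \<psi>V: "\<psi> \<in> V" using \<psi> U by auto
      then have keysS: "Poly_Mapping.keys \<psi> \<subseteq> S" by (simp add: V_def supported_def)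
      obtain I where I: "I \<in> Poly_Mapping.keys \<psi>" using \<psi>(2) by (metis ex_in_conv keys_eq_empty)
      have single: "J = I" if J: "J \<in> Poly_Mapping.keys \<psi>" for J
      proof (rule ccontr)
        assume "J \<noteq> I"
        then have "Dv J \<noteq> Dv I" using injS I J keysS by blast
        then have "wt (Dv J) \<noteq> wt (Dv I)" using inj_wt DvO I J keysS unfolding inj_on_def by blast
        then obtain i where i: "i \<in> N" "pic_form c (Dv J) (\<alpha> i) \<noteq> pic_form c (Dv I) (\<alpha> i)"
          unfolding wt_def by (metis (full_types))
        have hL: "h i \<in> L" using gens i by (auto simp: L_def)
        \<comment> \<open>This vector loses I from the support and keeps J.\<close>
        define \<phi> where "\<phi> = act (h i) \<psi> - cscale (of_int (pic_form c (Dv I) (\<alpha> i))) \<psi>"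
        have "\<phi> \<in> U" unfolding \<phi>_def
          using U(3)[OF hL \<psi>(1)] CV.subspace_scale[OF U(1) \<psi>(1)] CV.subspace_diff[OF U(1)] by blast
        have "act (h i) \<psi> = (\<Sum>K\<in>Poly_Mapping.keys \<psi>. Poly_Mapping.single K (Poly_Mapping.lookup \<psi> K * of_int (pic_form c (Dv K) (\<alpha> i))))"
          unfolding expand[OF hL \<psi>V]
        proof (intro sum.cong refl)
          fix K assume "K \<in> Poly_Mapping.keys \<psi>"
          then have "K \<in> S" using keysS by auto
          then show "cscale (Poly_Mapping.lookup \<psi> K) (act (h i) (?v K)) = Poly_Mapping.single K (Poly_Mapping.lookup \<psi> K * of_int (pic_form c (Dv K) (\<alpha> i)))"
            using acth[OF i(1)] by (simp add: act_def cscale_single)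
        qed
        then have lk: "Poly_Mapping.lookup \<phi> K = (of_int (pic_form c (Dv K) (\<alpha> i)) - of_int (pic_form c (Dv I) (\<alpha> i))) * Poly_Mapping.lookup \<psi> K" for K
          by (cases "K \<in> Poly_Mapping.keys \<psi>")
             (auto simp: \<phi>_def lookup_minus lookup_sum lookup_single when_def in_keys_iff algebra_simps)
        have "Poly_Mapping.lookup \<phi> J \<noteq> 0" using lk[of J] i(2) J by (simp add: in_keys_iff)
        then have "\<phi> \<noteq> 0" by auto
        have "Poly_Mapping.keys \<phi> \<subseteq> Poly_Mapping.keys \<psi> - {I}" using lk by (auto simp: in_keys_iff)
        then have "card (Poly_Mapping.keys \<phi>) \<le> card (Poly_Mapping.keys \<psi> - {I})" by (intro card_mono) auto
        also have "\<dots> < card (Poly_Mapping.keys \<psi>)" using I by (intro psubset_card_mono) auto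
        finally show False using min[of \<phi>] \<open>\<phi> \<in> U\<close> \<open>\<phi> \<noteq> 0\<close> by auto
      qed
      have "\<psi> = Poly_Mapping.single I (Poly_Mapping.lookup \<psi> I)"
      proof (rule poly_mapping_eqI)
        show "Poly_Mapping.lookup \<psi> K = Poly_Mapping.lookup (Poly_Mapping.single I (Poly_Mapping.lookup \<psi> I)) K" for K
          using single[of K] by (auto simp: lookup_single when_def in_keys_iff)
      qed
      then have "?v I = cscale (1 / Poly_Mapping.lookup \<psi> I) \<psi>" using I by (metis cscale_single in_keys_iff nonzero_divide_eq_eq)
      then have vI: "?v I \<in> U" using CV.subspace_scale[OF U(1) \<psi>(1)] by metis
      have IS: "I \<in> S" using I keysS by auto
      have move: "?v J \<in> U" if mv: "i \<in> N" "I \<in> S" "J \<in> S" "Dv J = reflect_div i (Dv I)" "?v I \<in> U" for i I J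
      proof -
        have scaled: "?v J \<in> U" if "k \<noteq> 0" "Poly_Mapping.single J k \<in> U" for k
        proof -
          have "?v J = cscale (1 / k) (Poly_Mapping.single J k)" using that by (simp add: cscale_single)
          then show ?thesis using CV.subspace_scale[OF U(1) that(2)] by metis
        qed
        consider "pic_form c (Dv I) (\<alpha> i) = -1" | "pic_form c (Dv I) (\<alpha> i) = 0" | "pic_form c (Dv I) (\<alpha> i) = 1"
          using mins[OF DvO[OF mv(2)] mv(1)] by auto
        then show ?thesis
        proof cases
          case 1
          have "e i \<in> L" using gens mv by (auto simp: L_def)
          then show ?thesis using acte[OF mv(1-3) 1 mv(4)] U(3)[OF _ mv(5), of "e i"] scaled by (auto simp: act_def)
        next
          case 2
          have "Dv J = Dv I" using mv(4) 2 by (metis CV.scale_zero_left add_0_right frag_cmul_zero)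
          then have "J = I" using injS[OF mv(3,2)] by simp
          then show ?thesis using mv by simp
        next
          case 3
          have "f i \<in> L" using gens mv by (auto simp: L_def)
          then show ?thesis using actf[OF mv(1-3) 3 mv(4)] U(3)[OF _ mv(5), of "f i"] scaled by (auto simp: act_def)
        qed
      qed
      have conn: "D \<in> \<O> \<Longrightarrow> J \<in> S \<Longrightarrow> Dv J = D \<Longrightarrow> (?v J \<in> U) = (?v I0 \<in> U)" for D J
      proof (induction arbitrary: J rule: minus_one_divisors.induct)
        case base
        then have "J = I0" using injS[OF base(1) I0(1)] I0(2) by simp
        then show ?case by simp
      next
        case (reflect D i)
        obtain K where K: "K \<in> S" "Dv K = D" using surjS[OF reflect(1)] by blast
        have "Dv K = reflect_div i (Dv J)" unfolding reflect(5) K(2) by (rule reflect_div_involution[OF reflect(2), symmetric])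
        moreover have "Dv J = reflect_div i (Dv K)" unfolding reflect(5) K(2) ..
        ultimately have "(?v J \<in> U) = (?v K \<in> U)"
          using move[OF reflect(2) reflect(4) K(1)] move[OF reflect(2) K(1) reflect(4)] by blast
        then show ?case using reflect.IH[OF K] by simp
      qed
      have allU: "?v J \<in> U" if "J \<in> S" for J
        using conn[OF DvO[OF that] that refl] conn[OF DvO[OF IS] IS refl] vI by simp
      have "V \<subseteq> U"
      proof -
        have "V = CV.span (?v ` S)" unfolding V_def by (rule supported_span[OF fS])
        also have "\<dots> \<subseteq> U" by (rule CV.span_minimal) (use allU U(1) in auto)
        finally show ?thesis .
      qed
      then show ?thesis using U(2) by auto
    qed simp
  qed
  have hw: "\<exists>v\<in>mcarrier M. v \<noteq> 0 \<and> (\<forall>i\<in>N. maction M (e i) v = 0 \<and>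
        maction M (h i) v = mscale M (if i = r - 1 then 1 else 0) v)"
  proof (intro bexI[of _ "?v I0"] conjI ballI)
    show "?v I0 \<noteq> 0" by (metis lookup_single_eq lookup_zero zero_neq_one)
    show "maction M (h i) (?v I0) = mscale M (if i = r - 1 then 1 else 0) (?v I0)" if "i \<in> N" for i
      using acth[OF that I0(1)] fun_cong[OF wt_base, of i] that unfolding ms I0(2) by (simp add: wt_def)
  qed (use act0 I0 vV[OF I0(1)] mc V_def in auto)
  show ?thesis unfolding labelled_module_def using lie chev md irr hw by blast
qed

end

section \<open>The special linear Lie algebra\<close>

lemma trace_commutator: "(\<Sum>i<N. entry (commutator N X Y) i i) = 0"
proof -
  have "(\<Sum>i<N. \<Sum>j<N. entry Y i j * entry X j i) = (\<Sum>i<N. \<Sum>j<N. entry X i j * entry Y j i)"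
    by (subst sum.swap) (simp add: mult.commute)
  then show ?thesis by (simp add: entry_commutator sum_subtractf)
qed

lemma is_lie_algebra_sl: "is_lie_algebra (sl N)"
  unfolding sl_def
proof (rule is_lie_algebra_gl)
  let ?L = "{X :: cmatrix. Poly_Mapping.keys X \<subseteq> {..<N} \<times> {..<N} \<and> (\<Sum>i<N. entry X i i) = 0}"
  have eq: "?L = {X \<in> gl_carrier N. (\<Sum>i<N. entry X i i) = 0}" by (auto simp: gl_carrier_def supported_def)
  show "CV.subspace ?L" unfolding eq gl_carrier_def using subspace_supported[of "{..<N} \<times> {..<N}"]
    by (auto simp: CV.subspace_def lookup_add sum.distrib sum_distrib_left[symmetric])
  show "?L \<subseteq> gl_carrier N" unfolding eq by auto
  show "commutator N X Y \<in> ?L" if "X \<in> ?L" "Y \<in> ?L" for X Y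
    unfolding eq using commutator_gl trace_commutator by auto
qed

abbreviation unit_matrix :: "nat \<Rightarrow> nat \<Rightarrow> cmatrix" where
  "unit_matrix i j \<equiv> Poly_Mapping.single (i, j) 1"

lemma commutator_unit:
  assumes "i < N" "j < N" "k < N" "l < N"
  shows "commutator N (unit_matrix i j) (unit_matrix k l) =
    (if j = k then unit_matrix i l else 0) - (if l = i then unit_matrix k j else 0)"
proof (rule cmatrix_eqI)
  fix p q
  have 1: "(\<Sum>t<N. entry (unit_matrix x y) p t * entry (unit_matrix z w) t q)
    = (if x = p \<and> y = z \<and> w = q then 1 else 0)" if "y < N" for x y z w
  proof -
    have "(\<Sum>t<N. entry (unit_matrix x y) p t * entry (unit_matrix z w) t q)
      = (\<Sum>t<N. if t = y then (if x = p \<and> y = z \<and> w = q then 1 else 0) else 0)"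
      by (intro sum.cong refl) (auto simp: lookup_single when_def)
    then show ?thesis using that by simp
  qed
  show "entry (commutator N (unit_matrix i j) (unit_matrix k l)) p q =
      entry ((if j = k then unit_matrix i l else 0) - (if l = i then unit_matrix k j else 0)) p q"
    unfolding entry_commutator 1[OF assms(2)] 1[OF assms(4)] using assms
    by (auto simp: lookup_minus lookup_single when_def)
qed

text \<open>By induction on the distance: a pair is composed of one at smaller distance and a pair of
  neighbours. Transitivity is available for distinct points only, as is the case for brackets of
  matrix units.\<close>

lemma neighbours_generate:
  fixes P :: "nat \<Rightarrow> nat \<Rightarrow> bool"
  assumes up: "\<And>t. Suc t < n \<Longrightarrow> P t (Suc t)" and down: "\<And>t. Suc t < n \<Longrightarrow> P (Suc t) t"
    and trans: "\<And>x y z. x < n \<Longrightarrow> y < n \<Longrightarrow> z < n \<Longrightarrow> distinct [x, y, z] \<Longrightarrow> P x y \<Longrightarrow> P y z \<Longrightarrow> P x z"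
    and xy: "x < n" "y < n" "x \<noteq> y"
  shows "P x y"
proof -
  have "x + Suc d < n \<Longrightarrow> P x (x + Suc d) \<and> P (x + Suc d) x" for x d
  proof (induction d)
    case 0
    then show ?case using up[of x] down[of x] by simp
  next
    case (Suc d)
    then have "P x (x + Suc d)" "P (x + Suc d) x" by auto
    moreover have "P (x + Suc d) (x + Suc (Suc d))" "P (x + Suc (Suc d)) (x + Suc d)"
      using up[of "x + Suc d"] down[of "x + Suc d"] Suc.prems by auto
    ultimately show ?case
      using trans[of x "x + Suc d" "x + Suc (Suc d)"] trans[of "x + Suc (Suc d)" "x + Suc d" x] Suc.prems by auto
  qed
  from this[of x "y - x - 1"] this[of y "x - y - 1"] show ?thesis
    using xy by (cases x y rule: linorder_cases) auto
qed

text \<open>Brackets of neighbouring matrix units give all off-diagonal ones, and brackets of these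
  give the differences of diagonal ones.\<close>

lemma sl_generated:
  assumes U: "CV.subspace U" "U \<subseteq> lcarrier (sl N)" "\<And>X Y. X \<in> U \<Longrightarrow> Y \<in> U \<Longrightarrow> commutator N X Y \<in> U"
    and gens: "\<And>t. Suc t < N \<Longrightarrow> unit_matrix t (Suc t) \<in> U \<and> unit_matrix (Suc t) t \<in> U"
  shows "U = lcarrier (sl N)"
proof -
  have off: "unit_matrix i j \<in> U" if "i < N" "j < N" "i \<noteq> j" for i j
  proof (rule neighbours_generate[where P = "\<lambda>i j. unit_matrix i j \<in> U", OF _ _ _ that])
    fix x y z assume "x < N" "y < N" "z < N" "distinct [x, y, z]" "unit_matrix x y \<in> U" "unit_matrix y z \<in> U"
    then show "unit_matrix x z \<in> U" using U(3)[of "unit_matrix x y" "unit_matrix y z"] by (simp add: commutator_unit)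
  qed (use gens in auto)
  have diag: "unit_matrix i i - unit_matrix 0 0 \<in> U" if "i < N" for i
  proof (cases "i = 0")
    case False
    then show ?thesis using U(3)[OF off[of i 0] off[of 0 i]] that by (simp add: commutator_unit)
  qed (simp add: CV.subspace_0[OF U(1)])
  have "X \<in> U" if X: "X \<in> lcarrier (sl N)" for X
  proof -
    \<comment> \<open>For the diagonal entries the multiples of the corner unit add up to the trace, which is zero.\<close>
    define G where "G i j = (if i = j then unit_matrix i i - unit_matrix 0 0 else unit_matrix i j)" for i j
    have X0: "(\<Sum>i<N. entry X i i) = 0" and keys: "Poly_Mapping.keys X \<subseteq> {..<N} \<times> {..<N}"
      using X by (auto simp: sl_def)
    have "X = (\<Sum>i<N. \<Sum>j<N. cscale (entry X i j) (G i j))"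
    proof (rule cmatrix_eqI)
      fix p q
      have "entry (\<Sum>i<N. \<Sum>j<N. cscale (entry X i j) (G i j)) p q
        = (\<Sum>i<N. \<Sum>j<N. (if j = q then if i = p then entry X i j else 0 else 0) - (if j = i then if p = 0 \<and> q = 0 then entry X i i else 0 else 0))"
        unfolding lookup_sum lookup_cscale by (intro sum.cong refl) (auto simp: G_def lookup_minus lookup_single when_def)
      also have "\<dots> = (if p < N \<and> q < N then entry X p q else 0) - (if p = 0 \<and> q = 0 then \<Sum>i<N. entry X i i else 0)"
        by (cases "q < N") (auto simp: sum_subtractf sum_negf)
      also have "\<dots> = entry X p q" using keys by (auto simp: X0 in_keys_iff subset_iff)
      finally show "entry X p q = entry (\<Sum>i<N. \<Sum>j<N. cscale (entry X i j) (G i j)) p q" by simp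
    qed
    moreover have "(\<Sum>i<N. \<Sum>j<N. cscale (entry X i j) (G i j)) \<in> U"
      by (intro CV.subspace_sum[OF U(1)] CV.subspace_scale[OF U(1)]) (auto simp: G_def off diag)
    ultimately show ?thesis by simp
  qed
  then show ?thesis using U(2) by auto
qed

section \<open>The exterior algebra\<close>

text \<open>Identities between additive operators need to be checked on monomials only.\<close>

lemma additive_eqI:
  fixes f g :: "('i \<Rightarrow>\<^sub>0 complex) \<Rightarrow> ('j \<Rightarrow>\<^sub>0 complex)"
  assumes f: "\<And>x y. f (x + y) = f x + f y" and g: "\<And>x y. g (x + y) = g x + g y"
    and eq: "\<And>i z. f (Poly_Mapping.single i z) = g (Poly_Mapping.single i z)"
  shows "f x = g x"
proof -
  have 0: "f 0 = 0" "g 0 = 0" using f[of 0 0] g[of 0 0] by auto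
  have "f (\<Sum>i\<in>A. Poly_Mapping.single i (Poly_Mapping.lookup x i)) = g (\<Sum>i\<in>A. Poly_Mapping.single i (Poly_Mapping.lookup x i))" for A
    by (induction A rule: infinite_finite_induct) (auto simp: f g 0 eq)
  then show ?thesis using poly_mapping_sum_singles[of x] by metis
qed

definition wedge_sign :: "nat \<Rightarrow> nat set \<Rightarrow> complex" where
  "wedge_sign i I = (- 1) ^ card {j\<in>I. j < i}"

lemma sum_keys_add:
  fixes x y :: "'i \<Rightarrow>\<^sub>0 complex" and g :: "'i \<Rightarrow> complex \<Rightarrow> 'b::ab_group_add"
  assumes g: "\<And>i u v. g i (u + v) = g i u + g i v"
  shows "(\<Sum>i\<in>Poly_Mapping.keys (x + y). g i (Poly_Mapping.lookup (x + y) i))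
    = (\<Sum>i\<in>Poly_Mapping.keys x. g i (Poly_Mapping.lookup x i)) + (\<Sum>i\<in>Poly_Mapping.keys y. g i (Poly_Mapping.lookup y i))"
proof -
  let ?A = "Poly_Mapping.keys x \<union> Poly_Mapping.keys y"
  have 0: "g i 0 = 0" for i using g[of i 0 0] by simp
  have sup: "(\<Sum>i\<in>Poly_Mapping.keys z. g i (Poly_Mapping.lookup z i)) = (\<Sum>i\<in>?A. g i (Poly_Mapping.lookup z i))"
    if "Poly_Mapping.keys z \<subseteq> ?A" for z
    using that by (intro sum.mono_neutral_left) (auto simp: in_keys_iff 0)
  show ?thesis
    using sup[of x] sup[of y] sup[OF Poly_Mapping.keys_add[of x y]] by (simp add: lookup_add g sum.distrib)
qed

lemma wedge_add: "wedge i (x + y) = wedge i x + wedge i y"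
  unfolding wedge_def
  by (rule sum_keys_add[where g = "\<lambda>I z. if i \<in> I then 0 else Poly_Mapping.single (insert i I) ((- 1) ^ card {j\<in>I. j < i} * z)"])
     (simp add: distrib_left single_add)

lemma contract_add: "contract i (x + y) = contract i x + contract i y"
  unfolding contract_def
  by (rule sum_keys_add[where g = "\<lambda>I z. if i \<notin> I then 0 else Poly_Mapping.single (I - {i}) ((- 1) ^ card {j\<in>I. j < i} * z)"])
     (simp add: distrib_left single_add)

lemma wedge_single: "wedge i (Poly_Mapping.single I z) = (if i \<in> I then 0 else Poly_Mapping.single (insert i I) (wedge_sign i I * z))"
  by (cases "z = 0") (auto simp: wedge_def wedge_sign_def)

lemma contract_single: "contract i (Poly_Mapping.single I z) = (if i \<notin> I then 0 else Poly_Mapping.single (I - {i}) (wedge_sign i I * z))"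
  by (cases "z = 0") (auto simp: contract_def wedge_sign_def)

lemma wedge_cscale: "wedge i (cscale k x) = cscale k (wedge i x)"
  by (rule additive_eqI[where f = "\<lambda>x. wedge i (cscale k x)" and g = "\<lambda>x. cscale k (wedge i x)"])
     (auto simp: wedge_add CV.scale_right_distrib wedge_single cscale_single mult_ac)

lemma contract_cscale: "contract i (cscale k x) = cscale k (contract i x)"
  by (rule additive_eqI[where f = "\<lambda>x. contract i (cscale k x)" and g = "\<lambda>x. cscale k (contract i x)"])
     (auto simp: contract_add CV.scale_right_distrib contract_single cscale_single mult_ac)

lemma wedge_sign_insert: "j \<notin> I \<Longrightarrow> wedge_sign i (insert j I) = (if j < i then - wedge_sign i I else wedge_sign i I)"
proof -
  assume j: "j \<notin> I"
  have fin: "finite {k \<in> I. k < i}" by (rule finite_subset[of _ "{..<i}"]) auto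
  show ?thesis
  proof (cases "j < i")
    case True
    then have "{k \<in> insert j I. k < i} = insert j {k \<in> I. k < i}" by auto
    then show ?thesis using True j fin by (simp add: wedge_sign_def)
  next
    case False
    then have "{k \<in> insert j I. k < i} = {k \<in> I. k < i}" by auto
    then show ?thesis using False by (simp add: wedge_sign_def)
  qed
qed

lemma wedge_sign_remove: "j \<in> I \<Longrightarrow> wedge_sign i (I - {j}) = (if j < i then - wedge_sign i I else wedge_sign i I)"
  using wedge_sign_insert[of j "I - {j}" i] by (simp add: insert_absorb)

lemma wedge_sign_square: "wedge_sign i I * (wedge_sign i I * z) = z"
  by (simp add: wedge_sign_def mult.assoc[symmetric] power_mult_distrib[symmetric])

lemma wedge_wedge: "wedge i (wedge j x) = - wedge j (wedge i x)"
proof (rule additive_eqI[where f = "\<lambda>x. wedge i (wedge j x)" and g = "\<lambda>x. - wedge j (wedge i x)"])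
  fix I z
  show "wedge i (wedge j (Poly_Mapping.single I z)) = - wedge j (wedge i (Poly_Mapping.single I z))"
    by (cases i j rule: linorder_cases)
       (auto simp: wedge_single wedge_sign_insert insert_commute single_uminus[symmetric] mult_ac wedge_add
         wedge_def[of _ 0])
qed (simp_all add: wedge_add)

lemma contract_contract: "contract i (contract j x) = - contract j (contract i x)"
proof (rule additive_eqI[where f = "\<lambda>x. contract i (contract j x)" and g = "\<lambda>x. - contract j (contract i x)"])
  fix I z
  have "I - {i} - {j} = I - {j} - {i}" by auto
  then show "contract i (contract j (Poly_Mapping.single I z)) = - contract j (contract i (Poly_Mapping.single I z))"
    by (cases i j rule: linorder_cases)
       (auto simp: contract_single wedge_sign_remove single_uminus[symmetric] mult_ac contract_def[of _ 0])
qed (simp_all add: contract_add)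

text \<open>The canonical anticommutation relation. For \<open>i \<noteq> j\<close> the two orders of the product differ
  by a sign, and for \<open>i = j\<close> exactly one of them is nonzero on a given monomial.\<close>

lemma wedge_contract: "wedge i (contract j x) = (if i = j then x else 0) - contract j (wedge i x)"
proof (rule additive_eqI[where f = "\<lambda>x. wedge i (contract j x)" and g = "\<lambda>x. (if i = j then x else 0) - contract j (wedge i x)"])
  fix I z
  show "wedge i (contract j (Poly_Mapping.single I z)) = (if i = j then Poly_Mapping.single I z else 0) - contract j (wedge i (Poly_Mapping.single I z))"
  proof (cases "i = j")
    case True
    then show ?thesis
      by (auto simp: wedge_single contract_single wedge_sign_insert wedge_sign_remove wedge_sign_square insert_absorb
          wedge_def[of _ 0] contract_def[of _ 0])
  next
    case False
    then have "insert i I - {j} = insert i (I - {j})" by auto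
    then show ?thesis using False
      by (cases i j rule: linorder_cases)
         (auto simp: wedge_single contract_single wedge_sign_insert wedge_sign_remove single_uminus[symmetric] mult_ac
          wedge_def[of _ 0] contract_def[of _ 0])
  qed
qed (simp_all add: wedge_add contract_add)

lemma ext_zero [simp]: "wedge i 0 = 0" "contract i 0 = 0"
  by (simp_all add: wedge_def contract_def)

lemma ext_minus: "wedge i (- x) = - wedge i x" "contract i (- x) = - contract i x"
  using wedge_cscale[of i "-1" x] contract_cscale[of i "-1" x] by simp_all

lemma ext_diff: "wedge i (x - y) = wedge i x - wedge i y" "contract i (x - y) = contract i x - contract i y"
  using wedge_add[of i "x - y" y] contract_add[of i "x - y" y] by simp_all

text \<open>The operators \<open>wedge i \<circ> contract j\<close> satisfy the commutation relations of the matrix units,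
  by the anticommutation relations.\<close>

lemma wedge_contract_commutator:
  "wedge i (contract j (wedge k (contract l x))) - wedge k (contract l (wedge i (contract j x)))
   = (if j = k then wedge i (contract l x) else 0) - (if l = i then wedge k (contract j x) else 0)"
proof -
  have cw: "contract j (wedge k y) = (if j = k then y else 0) - wedge k (contract j y)" for j k y
    using wedge_contract[of k j y] by (auto simp: algebra_simps)
  have "wedge i (wedge k (contract j (contract l x))) = wedge k (wedge i (contract l (contract j x)))"
    using wedge_wedge[of i k] contract_contract[of j l x] by (simp add: ext_minus)
  then show ?thesis by (simp add: cw ext_diff)
qed

lemma wedge_contract_single:
  "wedge p (contract q (Poly_Mapping.single I z)) = (if q \<in> I \<and> p \<notin> I - {q}
    then Poly_Mapping.single (insert p (I - {q})) (wedge_sign p (I - {q}) * (wedge_sign q I * z)) else 0)"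
  by (auto simp: contract_single wedge_single)

lemma wedge_sign_nonzero: "wedge_sign i I \<noteq> 0"
  by (simp add: wedge_sign_def)

lemma wedge_sign_square_1: "wedge_sign i I * wedge_sign i I = 1"
  using wedge_sign_square[of i I 1] by simp

lemma wedge_contract_single_ex:
  assumes "q \<in> I" "p \<notin> I - {q}"
  shows "\<exists>k. k \<noteq> 0 \<and> wedge p (contract q (Poly_Mapping.single I 1)) = Poly_Mapping.single (insert p (I - {q})) k"
  using assms wedge_sign_nonzero
  by (intro exI[of _ "wedge_sign p (I - {q}) * wedge_sign q I"]) (simp add: wedge_contract_single)

section \<open>Modules over matrix Lie algebras\<close>

text \<open>A family of operators \<open>T i j\<close> that commute like the matrix units extends linearly to an
  action of matrices. The spin action has this form as well, with operators that obey the
  relations of the units only after antisymmetrisation.\<close>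

definition matrix_action :: "nat \<Rightarrow> (nat \<Rightarrow> nat \<Rightarrow> ('s \<Rightarrow>\<^sub>0 complex) \<Rightarrow> ('s \<Rightarrow>\<^sub>0 complex)) \<Rightarrow> cmatrix \<Rightarrow> ('s \<Rightarrow>\<^sub>0 complex) \<Rightarrow> ('s \<Rightarrow>\<^sub>0 complex)" where
  "matrix_action N T X x = (\<Sum>i<N. \<Sum>j<N. cscale (entry X i j) (T i j x))"

locale matrix_operators =
  fixes N :: nat and T :: "nat \<Rightarrow> nat \<Rightarrow> ('s \<Rightarrow>\<^sub>0 complex) \<Rightarrow> ('s \<Rightarrow>\<^sub>0 complex)" and S :: "'s set"
  assumes T_add: "\<And>i j x y. T i j (x + y) = T i j x + T i j y"
    and T_cscale: "\<And>i j k x. T i j (cscale k x) = cscale k (T i j x)"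
    and T_supported: "\<And>i j x. i < N \<Longrightarrow> j < N \<Longrightarrow> x \<in> supported S \<Longrightarrow> T i j x \<in> supported S"
    and fin_S: "finite S"
begin

abbreviation "act \<equiv> matrix_action N T"

lemma act_linear:
  "act (X + Y) x = act X x + act Y x" "act X (x + y) = act X x + act X y"
  "act (cscale k X) x = cscale k (act X x)" "act X (cscale k x) = cscale k (act X x)"
  unfolding matrix_action_def
  by (simp_all add: lookup_add CV.scale_left_distrib CV.scale_right_distrib T_add T_cscale sum.distrib CV.scale_sum_right mult.commute)

lemma act_diff: "act (X - Y) x = act X x - act Y x"
  using act_linear(1)[of "X - Y" Y x] by simp

lemma act_unit_matrix: "i < N \<Longrightarrow> j < N \<Longrightarrow> act (unit_matrix i j) x = T i j x"
proof -
  assume ij: "i < N" "j < N"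
  have "act (unit_matrix i j) x = (\<Sum>p<N. \<Sum>q<N. if q = j then if p = i then T i j x else 0 else 0)"
    unfolding matrix_action_def by (intro sum.cong refl) (auto simp: lookup_single when_def)
  then show ?thesis using ij by simp
qed

lemma action_commutator:
  "act X (act Y x) - act Y (act X x) = (\<Sum>i<N. \<Sum>j<N. \<Sum>k<N. \<Sum>l<N.
     cscale (entry X i j * entry Y k l) (T i j (T k l x) - T k l (T i j x)))"
proof -
  define P where "P = {..<N} \<times> {..<N}"
  define Q where "Q p = T (fst p) (snd p)" for p
  have act: "act X x = (\<Sum>p\<in>P. cscale (Poly_Mapping.lookup X p) (Q p x))" for X x
    by (simp add: matrix_action_def P_def Q_def sum.cartesian_product case_prod_beta)
  have T0: "T i j 0 = 0" for i j using T_add[of i j 0 0] by simp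
  have Tsum: "T i j (\<Sum>p\<in>A. f p) = (\<Sum>p\<in>A. T i j (f p))" for i j and f :: "nat \<times> nat \<Rightarrow> _" and A
    by (induction A rule: infinite_finite_induct) (auto simp: T0 T_add)
  have XY: "act X (act Y x) = (\<Sum>p\<in>P. \<Sum>q\<in>P. cscale (Poly_Mapping.lookup X p * Poly_Mapping.lookup Y q) (Q p (Q q x)))" for X Y :: cmatrix
    unfolding act by (simp add: Q_def Tsum T_cscale CV.scale_sum_right)
  have YX: "act Y (act X x) = (\<Sum>p\<in>P. \<Sum>q\<in>P. cscale (Poly_Mapping.lookup X p * Poly_Mapping.lookup Y q) (Q q (Q p x)))"
    unfolding act by (subst sum.swap) (simp add: Q_def Tsum T_cscale CV.scale_sum_right mult.commute)
  have "act X (act Y x) - act Y (act X x) = (\<Sum>p\<in>P. \<Sum>q\<in>P. cscale (Poly_Mapping.lookup X p * Poly_Mapping.lookup Y q) (Q p (Q q x) - Q q (Q p x)))"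
    unfolding XY[of X Y] YX by (simp only: sum_subtractf[symmetric] CV.scale_right_diff_distrib)
  moreover have "(\<Sum>p\<in>P. G p) = (\<Sum>i<N. \<Sum>j<N. G (i, j))" for G :: "nat \<times> nat \<Rightarrow> ('s \<Rightarrow>\<^sub>0 complex)"
    unfolding P_def by (simp add: sum.cartesian_product)
  ultimately show ?thesis by (simp add: Q_def)
qed

lemma is_lie_module_matrix_action:
  assumes br: "\<And>X Y x. X \<in> L \<Longrightarrow> Y \<in> L \<Longrightarrow> x \<in> supported S \<Longrightarrow> act (commutator N X Y) x = act X (act Y x) - act Y (act X x)"
  shows "is_lie_module \<lparr>lscale = cscale, lcarrier = L, lbracket = commutator N\<rparr>
    \<lparr>mscale = cscale, mcarrier = supported S, maction = act\<rparr>"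
proof -
  have closed: "act X x \<in> supported S" if "x \<in> supported S" for X x
    unfolding matrix_action_def using T_supported that
    by (intro CV.subspace_sum[OF subspace_supported] CV.subspace_scale[OF subspace_supported]) auto
  have "fin_dim_space cscale (supported S)" by (rule fin_dim_subspace[OF subspace_supported _ fin_S]) simp
  then show ?thesis
    unfolding is_lie_module_def Let_def using closed br by (simp add: act_linear)
qed

lemma act_commutator_gl:
  assumes comm: "\<And>i j k l. i < N \<Longrightarrow> j < N \<Longrightarrow> k < N \<Longrightarrow> l < N \<Longrightarrow>
      T i j (T k l x) - T k l (T i j x) = (if j = k then T i l x else 0) - (if l = i then T k j x else 0)"
  shows "act (commutator N X Y) x = act X (act Y x) - act Y (act X x)"
proof -
  let ?X = "Poly_Mapping.lookup X" and ?Y = "Poly_Mapping.lookup Y"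
  have "act X (act Y x) - act Y (act X x) = (\<Sum>i<N. \<Sum>j<N. \<Sum>k<N. \<Sum>l<N. cscale (?X (i, j) * ?Y (k, l))
        ((if j = k then T i l x else 0) - (if l = i then T k j x else 0)))"
    unfolding action_commutator by (intro sum.cong refl) (simp add: comm)
    also have "\<dots> = (\<Sum>i<N. \<Sum>j<N. \<Sum>k<N. \<Sum>l<N. if j = k then cscale (?X (i, j) * ?Y (k, l)) (T i l x) else 0)
      - (\<Sum>i<N. \<Sum>j<N. \<Sum>k<N. \<Sum>l<N. if l = i then cscale (?X (i, j) * ?Y (k, l)) (T k j x) else 0)"
      unfolding sum_subtractf[symmetric] by (intro sum.cong refl) (simp add: CV.scale_right_diff_distrib)
    also have "(\<Sum>i<N. \<Sum>j<N. \<Sum>k<N. \<Sum>l<N. if j = k then cscale (?X (i, j) * ?Y (k, l)) (T i l x) else 0)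
      = (\<Sum>i<N. \<Sum>l<N. cscale (\<Sum>j<N. ?X (i, j) * ?Y (j, l)) (T i l x))"
    proof (rule sum.cong[OF refl])
      fix i
      have "(\<Sum>j<N. \<Sum>k<N. \<Sum>l<N. if j = k then cscale (?X (i, j) * ?Y (k, l)) (T i l x) else 0)
        = (\<Sum>j<N. \<Sum>l<N. \<Sum>k<N. if j = k then cscale (?X (i, j) * ?Y (k, l)) (T i l x) else 0)"
        by (rule sum.cong[OF refl], rule sum.swap)
      also have "\<dots> = (\<Sum>j<N. \<Sum>l<N. cscale (?X (i, j) * ?Y (j, l)) (T i l x))"
        by (intro sum.cong refl) simp
      also have "\<dots> = (\<Sum>l<N. \<Sum>j<N. cscale (?X (i, j) * ?Y (j, l)) (T i l x))" by (rule sum.swap)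
      finally show "(\<Sum>j<N. \<Sum>k<N. \<Sum>l<N. if j = k then cscale (?X (i, j) * ?Y (k, l)) (T i l x) else 0)
        = (\<Sum>l<N. cscale (\<Sum>j<N. ?X (i, j) * ?Y (j, l)) (T i l x))" by (simp add: CV.scale_sum_left)
    qed
    also have "(\<Sum>i<N. \<Sum>j<N. \<Sum>k<N. \<Sum>l<N. if l = i then cscale (?X (i, j) * ?Y (k, l)) (T k j x) else 0)
      = (\<Sum>k<N. \<Sum>j<N. cscale (\<Sum>i<N. ?Y (k, i) * ?X (i, j)) (T k j x))"
    proof -
      have "(\<Sum>i<N. \<Sum>j<N. \<Sum>k<N. \<Sum>l<N. if l = i then cscale (?X (i, j) * ?Y (k, l)) (T k j x) else 0)
        = (\<Sum>i<N. \<Sum>j<N. \<Sum>k<N. cscale (?X (i, j) * ?Y (k, i)) (T k j x))"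
        by (intro sum.cong refl) simp
      also have "\<dots> = (\<Sum>i<N. \<Sum>k<N. \<Sum>j<N. cscale (?X (i, j) * ?Y (k, i)) (T k j x))"
        by (rule sum.cong[OF refl], rule sum.swap)
      also have "\<dots> = (\<Sum>k<N. \<Sum>i<N. \<Sum>j<N. cscale (?X (i, j) * ?Y (k, i)) (T k j x))" by (rule sum.swap)
      also have "\<dots> = (\<Sum>k<N. \<Sum>j<N. \<Sum>i<N. cscale (?X (i, j) * ?Y (k, i)) (T k j x))"
        by (rule sum.cong[OF refl], rule sum.swap)
      finally show ?thesis by (simp add: CV.scale_sum_left mult.commute)
    qed
    also have "(\<Sum>i<N. \<Sum>l<N. cscale (\<Sum>j<N. ?X (i, j) * ?Y (j, l)) (T i l x))
      - (\<Sum>k<N. \<Sum>j<N. cscale (\<Sum>i<N. ?Y (k, i) * ?X (i, j)) (T k j x)) = act (commutator N X Y) x"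
      unfolding matrix_action_def sum_subtractf[symmetric]
      by (intro sum.cong refl) (simp add: entry_commutator CV.scale_left_diff_distrib)
    finally show ?thesis by simp
qed

end

lemma additive_supported:
  fixes f :: "('i \<Rightarrow>\<^sub>0 complex) \<Rightarrow> ('j \<Rightarrow>\<^sub>0 complex)"
  assumes f: "\<And>x y. f (x + y) = f x + f y" and x: "x \<in> supported S"
    and s: "\<And>i z. i \<in> S \<Longrightarrow> f (Poly_Mapping.single i z) \<in> supported S'"
  shows "f x \<in> supported S'"
proof -
  have 0: "f 0 = 0" using f[of 0 0] by simp
  have "f (\<Sum>i\<in>A. Poly_Mapping.single i (Poly_Mapping.lookup x i)) \<in> supported S'" if "A \<subseteq> S" for A
    using that by (induction A rule: infinite_finite_induct)
      (auto simp: f 0 s CV.subspace_0[OF subspace_supported] CV.subspace_add[OF subspace_supported])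
  from this[of "Poly_Mapping.keys x"] show ?thesis using x by (simp add: poly_mapping_sum_singles supported_def)
qed

lemma matrix_operators_exterior:
  "matrix_operators N (\<lambda>i j x. wedge i (contract j x)) {I. I \<subseteq> {..<N} \<and> card I = k}"
proof
  let ?S = "{I. I \<subseteq> {..<N} \<and> card I = k}"
  show "wedge i (contract j x) \<in> supported ?S" if "i < N" "j < N" "x \<in> supported ?S" for i j x
  proof (rule additive_supported[where f = "\<lambda>x. wedge i (contract j x)", OF _ that(3)])
    fix I z assume I: "I \<in> ?S"
    then have fI: "finite I" by (auto intro: finite_subset)
    have "insert i (I - {j}) \<in> ?S" if "j \<in> I" "i \<notin> I - {j}"
    proof -
      have "finite (I - {j})" "card I = Suc (card (I - {j}))" using fI card.remove[OF fI that(1)] by auto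
      then have "card (insert i (I - {j})) = card I" using that(2) by simp
      then show ?thesis using I \<open>i < N\<close> by auto
    qed
    then show "wedge i (contract j (Poly_Mapping.single I z)) \<in> supported ?S"
      unfolding contract_single
      by (cases "j \<in> I"; cases "i \<in> I - {j}")
         (simp_all only: if_True if_False not_True_eq_False not_False_eq_True ext_zero wedge_single CV.subspace_0[OF subspace_supported] single_supported)
  qed (simp add: wedge_add contract_add)
  show "finite ?S" by (rule finite_subset[of _ "Pow {..<N}"]) auto
qed (simp_all add: wedge_add contract_add wedge_cscale contract_cscale)

lemma exterior_power_matrix_action:
  "exterior_power k N = \<lparr>mscale = cscale, mcarrier = supported {I. I \<subseteq> {..<N} \<and> card I = k},
     maction = matrix_action N (\<lambda>i j x. wedge i (contract j x))\<rparr>"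
  by (simp add: exterior_power_def supported_def matrix_action_def fun_eq_iff)

lemma is_lie_module_exterior_power: "is_lie_module (sl N) (exterior_power k N)"
proof -
  interpret matrix_operators N "\<lambda>i j x. wedge i (contract j x)" "{I. I \<subseteq> {..<N} \<and> card I = k}"
    by (rule matrix_operators_exterior)
  show ?thesis unfolding sl_def exterior_power_matrix_action
    by (intro is_lie_module_matrix_action act_commutator_gl wedge_contract_commutator)
qed

section \<open>The even orthogonal Lie algebra\<close>

lemma partner_less: "i < 2 * r \<Longrightarrow> partner r i < 2 * r"
  by (auto simp: partner_def)

lemma partner_partner: "i < 2 * r \<Longrightarrow> partner r (partner r i) = i"
  by (auto simp: partner_def)
lemma partner_eq_iff: "i < 2 * r \<Longrightarrow> j < 2 * r \<Longrightarrow> partner r i = j \<longleftrightarrow> i = partner r j"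
  by (auto simp: partner_def)

lemma sum_partner: "(\<Sum>i<2 * r. f (partner r i)) = (\<Sum>i<2 * r. f i)"
  by (rule sum.reindex_bij_witness[of _ "partner r" "partner r"]) (auto simp: partner_partner partner_less)

lemma so_even_carrier: "lcarrier (so_even r) = {X \<in> gl_carrier (2 * r).
    \<forall>j<2 * r. \<forall>k<2 * r. entry X (partner r k) j + entry X (partner r j) k = 0}"
  by (auto simp: so_even_def gl_carrier_def supported_def)

lemma so_even_skew:
  assumes "X \<in> lcarrier (so_even r)" "i < 2 * r" "j < 2 * r"
  shows "entry X (partner r i) (partner r j) = - entry X j i"
proof -
  have "entry X (partner r i) (partner r j) + entry X (partner r (partner r j)) i = 0"
    using assms by (auto simp: so_even_carrier partner_less)
  then show ?thesis using assms by (simp add: partner_partner eq_neg_iff_add_eq_0)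
qed

lemma so_even_iff: "X \<in> lcarrier (so_even r) \<longleftrightarrow> X \<in> gl_carrier (2 * r) \<and>
    (\<forall>i<2 * r. \<forall>j<2 * r. entry X (partner r i) (partner r j) = - entry X j i)"
proof
  assume X: "X \<in> gl_carrier (2 * r) \<and> (\<forall>i<2 * r. \<forall>j<2 * r. entry X (partner r i) (partner r j) = - entry X j i)"
  have "entry X (partner r k) j + entry X (partner r j) k = 0" if "j < 2 * r" "k < 2 * r" for j k
  proof -
    have "entry X (partner r k) (partner r (partner r j)) = - entry X (partner r j) k"
      using X that partner_less by auto
    then show ?thesis using that by (simp add: partner_partner)
  qed
  then show "X \<in> lcarrier (so_even r)" using X by (simp add: so_even_carrier)
qed (use so_even_skew so_even_carrier in auto)

lemma is_lie_algebra_so_even: "is_lie_algebra (so_even r)"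
proof -
  have "so_even r = \<lparr>lscale = cscale, lcarrier = lcarrier (so_even r), lbracket = commutator (2 * r)\<rparr>"
    by (simp add: so_even_def)
  moreover have "is_lie_algebra \<lparr>lscale = cscale, lcarrier = lcarrier (so_even r), lbracket = commutator (2 * r)\<rparr>"
  proof (rule is_lie_algebra_gl)
    show "CV.subspace (lcarrier (so_even r))"
      using subspace_supported[of "{..<2 * r} \<times> {..<2 * r}"]
      by (auto simp: so_even_iff gl_carrier_def CV.subspace_def lookup_add)
    show "commutator (2 * r) X Y \<in> lcarrier (so_even r)" if X: "X \<in> lcarrier (so_even r)" and Y: "Y \<in> lcarrier (so_even r)" for X Y
      unfolding so_even_iff
    proof (intro conjI allI impI commutator_gl)
      fix i j assume ij: "i < 2 * r" "j < 2 * r"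
      have prod: "(\<Sum>k<2 * r. entry X (partner r i) k * entry Y k (partner r j)) = (\<Sum>k<2 * r. entry Y j k * entry X k i)"
        if "X \<in> lcarrier (so_even r)" "Y \<in> lcarrier (so_even r)" for X Y
      proof -
        have "(\<Sum>k<2 * r. entry X (partner r i) k * entry Y k (partner r j))
          = (\<Sum>k<2 * r. entry X (partner r i) (partner r k) * entry Y (partner r k) (partner r j))"
          by (rule sum_partner[symmetric])
        also have "\<dots> = (\<Sum>k<2 * r. entry Y j k * entry X k i)"
          by (intro sum.cong refl) (simp add: so_even_skew[OF that(1) ij(1)] so_even_skew[OF that(2) _ ij(2)])
        finally show ?thesis .
      qed
      show "entry (commutator (2 * r) X Y) (partner r i) (partner r j) = - entry (commutator (2 * r) X Y) j i"
        using ij by (simp add: entry_commutator partner_less prod[OF X Y] prod[OF Y X])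
    qed
  qed (auto simp: so_even_carrier)
  ultimately show ?thesis by simp
qed

text \<open>The skew part of a matrix unit for the split bilinear form, in which the dual of the basis
  vector \<open>i\<close> is its partner.\<close>

definition skew_unit :: "nat \<Rightarrow> nat \<Rightarrow> nat \<Rightarrow> cmatrix" where
  "skew_unit r i j = unit_matrix i j - unit_matrix (partner r j) (partner r i)"

lemma skew_unit_partner:
  "i < 2 * r \<Longrightarrow> j < 2 * r \<Longrightarrow> skew_unit r (partner r j) (partner r i) = - skew_unit r i j"
  by (simp add: skew_unit_def partner_partner)

lemma skew_unit_so_even:
  assumes "i < 2 * r" "j < 2 * r"
  shows "skew_unit r i j \<in> lcarrier (so_even r)"
  unfolding so_even_iff
proof (intro conjI allI impI)
  show "skew_unit r i j \<in> gl_carrier (2 * r)"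
    using assms partner_less[of i r] partner_less[of j r] unfolding skew_unit_def gl_carrier_def
    by (intro CV.subspace_diff[OF subspace_supported] single_supported) auto
  show "entry (skew_unit r i j) (partner r p) (partner r q) = - entry (skew_unit r i j) q p" if pq: "p < 2 * r" "q < 2 * r" for p q
  proof -
    have u: "entry (unit_matrix x y) z w = (if x = z \<and> y = w then 1 else 0)" for x y z w :: nat
      by (simp add: lookup_single when_def)
    have "i = partner r p \<longleftrightarrow> partner r i = p" "j = partner r q \<longleftrightarrow> partner r j = q"
      "partner r j = partner r p \<longleftrightarrow> j = p" "partner r i = partner r q \<longleftrightarrow> i = q"
      using assms pq partner_partner by metis+
    then show ?thesis unfolding skew_unit_def lookup_minus u by simp
  qed
qed

lemma commutator_skew_unit:
  assumes "i < 2 * r" "j < 2 * r" "k < 2 * r" "l < 2 * r"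
  shows "commutator (2 * r) (skew_unit r i j) (skew_unit r k l) =
    (if j = k then skew_unit r i l else 0) - (if l = i then skew_unit r k j else 0)
    - (if j = partner r l then skew_unit r i (partner r k) else 0)
    + (if i = partner r k then skew_unit r (partner r l) j else 0)"
proof -
  have e: "partner r i = k \<longleftrightarrow> i = partner r k" "l = partner r j \<longleftrightarrow> j = partner r l"
    "partner r i = partner r l \<longleftrightarrow> l = i" "partner r k = partner r j \<longleftrightarrow> j = k" "partner r k = i \<longleftrightarrow> i = partner r k"
    using assms partner_eq_iff partner_partner by metis+
  show ?thesis
    unfolding skew_unit_def commutator_minus
    using assms partner_less[OF assms(1)] partner_less[OF assms(2)] partner_less[OF assms(3)] partner_less[OF assms(4)]
    by (simp add: commutator_unit e partner_partner algebra_simps)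
qed

section \<open>The spin representation\<close>

definition cliff :: "nat \<Rightarrow> nat \<Rightarrow> (nat set \<Rightarrow>\<^sub>0 complex) \<Rightarrow> (nat set \<Rightarrow>\<^sub>0 complex)" where
  "cliff r k = (if k < r then wedge k else contract (k - r))"

lemma cliff_linear: "cliff r k (x + y) = cliff r k x + cliff r k y" "cliff r k (cscale z x) = cscale z (cliff r k x)"
  "cliff r k 0 = 0" "cliff r k (- x) = - cliff r k x" "cliff r k (x - y) = cliff r k x - cliff r k y"
  by (simp_all add: cliff_def wedge_add contract_add wedge_cscale contract_cscale ext_minus ext_diff)

lemma cliff_cliff:
  assumes "i < 2 * r" "j < 2 * r"
  shows "cliff r i (cliff r j x) = (if j = partner r i then x else 0) - cliff r j (cliff r i x)"
proof -
  have cw: "contract j (wedge k y) = (if j = k then y else 0) - wedge k (contract j y)" for j k y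
    using wedge_contract[of k j y] by (auto simp: algebra_simps)
  consider "i < r" "j < r" | "i < r" "r \<le> j" | "r \<le> i" "j < r" | "r \<le> i" "r \<le> j" by linarith
  then show ?thesis
  proof cases
    case 1
    then show ?thesis by (simp add: cliff_def partner_def wedge_wedge[of i j])
  next
    case 2
    then show ?thesis using assms wedge_contract[of i "j - r" x] by (auto simp: cliff_def partner_def)
  next
    case 3
    then show ?thesis using assms cw[of "i - r" j x] by (auto simp: cliff_def partner_def)
  next
    case 4
    then show ?thesis using assms contract_contract[of "i - r" "j - r" x] by (auto simp: cliff_def partner_def)
  qed
qed

lemma clifford_cliff: "clifford r v x = (\<Sum>k<2 * r. cscale (v k) (cliff r k x))"
proof -
  have "(\<Sum>k<2 * r. cscale (v k) (cliff r k x)) = (\<Sum>k\<in>{0..<r}. cscale (v k) (cliff r k x)) + (\<Sum>k\<in>{r..<2 * r}. cscale (v k) (cliff r k x))"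
    using sum.atLeastLessThan_concat[of 0 r "2 * r" "\<lambda>k. cscale (v k) (cliff r k x)"] by (simp add: atLeast0LessThan)
  also have "(\<Sum>k\<in>{r..<2 * r}. cscale (v k) (cliff r k x)) = (\<Sum>k<r. cscale (v (r + k)) (contract k x))"
    by (rule sum.reindex_bij_witness[of _ "\<lambda>k. r + k" "\<lambda>k. k - r"]) (auto simp: cliff_def)
  also have "(\<Sum>k\<in>{0..<r}. cscale (v k) (cliff r k x)) = (\<Sum>k<r. cscale (v k) (wedge k x))"
    by (rule sum.cong) (auto simp: cliff_def)
  finally show ?thesis by (simp add: clifford_def sum.distrib)
qed

text \<open>The spin action is \<open>X \<mapsto> 1/2 \<Sum> X\<^sub>i\<^sub>k c\<^sub>i c\<^sub>k\<^sub>'\<close>, where \<open>c\<^sub>k\<^sub>'\<close> is dual to \<open>c\<^sub>k\<close> for the bilinear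
  form.\<close>

definition spin_op :: "nat \<Rightarrow> nat \<Rightarrow> nat \<Rightarrow> (nat set \<Rightarrow>\<^sub>0 complex) \<Rightarrow> (nat set \<Rightarrow>\<^sub>0 complex)" where
  "spin_op r i k x = cscale (1 / 2) (cliff r i (cliff r (partner r k) x))"

lemma half_spin_matrix_action:
  "half_spin r = \<lparr>mscale = cscale, mcarrier = supported {I. I \<subseteq> {..<r} \<and> even (card I)},
     maction = matrix_action (2 * r) (spin_op r)\<rparr>"
proof -
  have "cscale (1 / 2) (\<Sum>k<2 * r. clifford r (\<lambda>i. entry X i k) (clifford r (\<lambda>i. if i = partner r k then 1 else 0) x))
    = matrix_action (2 * r) (spin_op r) X x" for X x
  proof -
    have "clifford r (\<lambda>i. if i = partner r k then 1 else 0) x = cliff r (partner r k) x" if "k < 2 * r" for k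
    proof -
      have "clifford r (\<lambda>i. if i = partner r k then 1 else 0) x = (\<Sum>i<2 * r. if i = partner r k then cliff r i x else 0)"
        unfolding clifford_cliff by (intro sum.cong refl) auto
      then show ?thesis using partner_less[OF that] by simp
    qed
    then have "(\<Sum>k<2 * r. clifford r (\<lambda>i. entry X i k) (clifford r (\<lambda>i. if i = partner r k then 1 else 0) x))
      = (\<Sum>k<2 * r. \<Sum>i<2 * r. cscale (entry X i k) (cliff r i (cliff r (partner r k) x)))"
      by (intro sum.cong refl) (simp add: clifford_cliff[of r "\<lambda>i. entry X i _"])
    also have "\<dots> = (\<Sum>i<2 * r. \<Sum>k<2 * r. cscale (entry X i k) (cliff r i (cliff r (partner r k) x)))"
      by (rule sum.swap)
    finally show ?thesis by (simp add: matrix_action_def spin_op_def CV.scale_sum_right mult.commute)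
  qed
  then show ?thesis by (simp add: half_spin_def supported_def fun_eq_iff)
qed

definition parity_sets :: "nat \<Rightarrow> bool \<Rightarrow> nat set set" where
  "parity_sets r e = {I. I \<subseteq> {..<r} \<and> even (card I) = e}"

lemma cliff_parity:
  assumes "k < 2 * r" "x \<in> supported (parity_sets r e)"
  shows "cliff r k x \<in> supported (parity_sets r (\<not> e))"
proof (rule additive_supported[where f = "cliff r k", OF _ assms(2)])
  fix I and z :: complex assume I: "I \<in> parity_sets r e"
  then have fI: "finite I" by (auto simp: parity_sets_def intro: finite_subset)
  have ins: "insert k I \<in> parity_sets r (\<not> e)" if "k < r" "k \<notin> I"
    using I fI that by (auto simp: parity_sets_def)
  have rem: "I - {k - r} \<in> parity_sets r (\<not> e)" if "k - r \<in> I"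
    using I card.remove[OF fI that] by (auto simp: parity_sets_def)
  show "cliff r k (Poly_Mapping.single I z) \<in> supported (parity_sets r (\<not> e))"
  proof (cases "k < r")
    case True
    then show ?thesis using ins by (cases "k \<in> I") (simp_all add: cliff_def wedge_single CV.subspace_0[OF subspace_supported] single_supported)
  next
    case False
    then show ?thesis using rem by (cases "k - r \<in> I") (simp_all add: cliff_def contract_single CV.subspace_0[OF subspace_supported] single_supported)
  qed
qed (simp add: cliff_linear)

lemma matrix_operators_spin: "matrix_operators (2 * r) (spin_op r) {I. I \<subseteq> {..<r} \<and> even (card I)}"
proof
  have eq: "{I. I \<subseteq> {..<r} \<and> even (card I)} = parity_sets r True" by (auto simp: parity_sets_def)
  show "spin_op r i j x \<in> supported {I. I \<subseteq> {..<r} \<and> even (card I)}" if "i < 2 * r" "j < 2 * r" "x \<in> supported {I. I \<subseteq> {..<r} \<and> even (card I)}" for i j x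
    using cliff_parity[OF that(1) cliff_parity[OF partner_less[OF that(2)] that(3)[unfolded eq]]]
    unfolding eq spin_op_def by (intro CV.subspace_scale[OF subspace_supported]) simp
  show "finite {I. I \<subseteq> {..<r} \<and> even (card I)}" by (rule finite_subset[of _ "Pow {..<r}"]) auto
qed (simp_all add: spin_op_def cliff_linear CV.scale_right_distrib mult.commute)

text \<open>Four applications of the Clifford relation move \<open>c\<^sub>i c\<^sub>j\<^sub>'\<close> past \<open>c\<^sub>k c\<^sub>l\<^sub>'\<close>.\<close>

lemma spin_op_commutator:
  assumes i: "i < 2 * r" and j: "j < 2 * r" and k: "k < 2 * r" and l: "l < 2 * r"
  shows "spin_op r i j (spin_op r k l x) - spin_op r k l (spin_op r i j x) = cscale (1 / 2)
    ((if j = k then spin_op r i l x else 0) - (if partner r l = j then spin_op r i (partner r k) x else 0)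
     + (if partner r i = k then spin_op r (partner r l) j x else 0) - (if l = i then spin_op r k j x else 0))"
proof -
  let ?c = "cliff r"
  define A where "A = ?c i" define B where "B = ?c (partner r j)"
  define C where "C = ?c k" define D where "D = ?c (partner r l)"
  have lin: "F (x - y) = F x - F y" "F (x + y) = F x + F y" "F (cscale z x) = cscale z (F x)" "F 0 = 0" if "F \<in> {A, B, C, D}" for F x y z
    using that by (auto simp: A_def B_def C_def D_def cliff_linear)
  have BC: "B (C y) = (if j = k then y else 0) - C (B y)" for y
    unfolding B_def C_def using cliff_cliff[OF partner_less[OF j] k] j by (auto simp: partner_partner)
  have BD: "B (D y) = (if partner r l = j then y else 0) - D (B y)" for y
    unfolding B_def D_def using cliff_cliff[OF partner_less[OF j] partner_less[OF l]] j by (auto simp: partner_partner)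
  have AC: "A (C y) = (if partner r i = k then y else 0) - C (A y)" for y
    unfolding A_def C_def using cliff_cliff[OF i k] by auto
  have AD: "A (D y) = (if l = i then y else 0) - D (A y)" for y
  proof -
    have "partner r l = partner r i \<longleftrightarrow> l = i" using i l partner_partner by metis
    then show ?thesis unfolding A_def D_def using cliff_cliff[OF i partner_less[OF l]] by auto
  qed
  have "A (B (C (D x))) - C (D (A (B x))) = (if j = k then A (D x) else 0) - (if partner r l = j then A (C x) else 0)
     + (if partner r i = k then D (B x) else 0) - (if l = i then C (B x) else 0)"
  proof -
    have "A (B (C (D x))) = (if j = k then A (D x) else 0) - A (C (B (D x)))"
      by (simp add: BC lin)
    also have "A (C (B (D x))) = (if partner r l = j then A (C x) else 0) - A (C (D (B x)))"
      by (simp add: BD lin)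
    also have "A (C (D (B x))) = (if partner r i = k then D (B x) else 0) - C (A (D (B x)))"
      by (simp add: AC)
    also have "C (A (D (B x))) = (if l = i then C (B x) else 0) - C (D (A (B x)))"
      by (simp add: AD lin)
    finally show ?thesis by simp
  qed
  then have "cscale (1 / 4) (A (B (C (D x))) - C (D (A (B x)))) = cscale (1 / 4) ((if j = k then A (D x) else 0) - (if partner r l = j then A (C x) else 0)
     + (if partner r i = k then D (B x) else 0) - (if l = i then C (B x) else 0))" by simp
  moreover have "spin_op r i j (spin_op r k l x) - spin_op r k l (spin_op r i j x) = cscale (1 / 4) (A (B (C (D x))) - C (D (A (B x))))"
    by (simp add: spin_op_def A_def B_def C_def D_def cliff_linear CV.scale_right_diff_distrib)
  moreover have sp: "spin_op r i l x = cscale (1 / 2) (A (D x))" "spin_op r i (partner r k) x = cscale (1 / 2) (A (C x))"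
    "spin_op r (partner r l) j x = cscale (1 / 2) (D (B x))" "spin_op r k j x = cscale (1 / 2) (C (B x))"
    using k by (simp_all add: spin_op_def A_def B_def C_def D_def partner_partner)
  moreover have "cscale (1 / 4) y = cscale (1 / 2) (cscale (1 / 2) y)" for y :: "nat set \<Rightarrow>\<^sub>0 complex" by simp
  moreover have "(if j = k then cscale (1 / 2) (A (D x)) else 0) - (if partner r l = j then cscale (1 / 2) (A (C x)) else 0)
     + (if partner r i = k then cscale (1 / 2) (D (B x)) else 0) - (if l = i then cscale (1 / 2) (C (B x)) else 0)
    = cscale (1 / 2) ((if j = k then A (D x) else 0) - (if partner r l = j then A (C x) else 0)
     + (if partner r i = k then D (B x) else 0) - (if l = i then C (B x) else 0))"
    unfolding CV.scale_right_diff_distrib CV.scale_right_distrib if_distrib[of "cscale (1 / 2)"] CV.scale_zero_right ..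
  ultimately show ?thesis unfolding sp by metis
qed

text \<open>The commutator of two spin operators has four terms with factor \<open>1/2\<close>. Skewness of the
  matrices identifies them in pairs, which turns the factor into \<open>1\<close>.\<close>

lemma spin_action_commutator:
  assumes X: "X \<in> lcarrier (so_even r)" and Y: "Y \<in> lcarrier (so_even r)"
  shows "matrix_action (2 * r) (spin_op r) (commutator (2 * r) X Y) x
    = matrix_action (2 * r) (spin_op r) X (matrix_action (2 * r) (spin_op r) Y x)
     - matrix_action (2 * r) (spin_op r) Y (matrix_action (2 * r) (spin_op r) X x)"
proof -
  interpret matrix_operators "2 * r" "spin_op r" "{I. I \<subseteq> {..<r} \<and> even (card I)}" by (rule matrix_operators_spin)
  let ?T = "\<lambda>i j. spin_op r i j x" and ?n = "2 * r" and ?p = "partner r"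
  define f where "f i j k l = entry X i j * entry Y k l" for i j k l
  have pl: "?p i < ?n" if "i < ?n" for i using that by (rule partner_less)
  have s1: "(\<Sum>i<?n. \<Sum>j<?n. \<Sum>k<?n. \<Sum>l<?n. if j = k then cscale (f i j k l) (?T i l) else 0)
    = (\<Sum>i<?n. \<Sum>l<?n. \<Sum>j<?n. cscale (f i j j l) (?T i l))"
  proof (rule sum.cong[OF refl])
    fix i
    have "(\<Sum>j<?n. \<Sum>k<?n. \<Sum>l<?n. if j = k then cscale (f i j k l) (?T i l) else 0)
      = (\<Sum>j<?n. \<Sum>l<?n. \<Sum>k<?n. if j = k then cscale (f i j k l) (?T i l) else 0)"
      by (rule sum.cong[OF refl], rule sum.swap)
    also have "\<dots> = (\<Sum>j<?n. \<Sum>l<?n. cscale (f i j j l) (?T i l))" by (intro sum.cong refl) simp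
    also have "\<dots> = (\<Sum>l<?n. \<Sum>j<?n. cscale (f i j j l) (?T i l))" by (rule sum.swap)
    finally show "(\<Sum>j<?n. \<Sum>k<?n. \<Sum>l<?n. if j = k then cscale (f i j k l) (?T i l) else 0)
      = (\<Sum>l<?n. \<Sum>j<?n. cscale (f i j j l) (?T i l))" .
  qed
  have s2: "(\<Sum>i<?n. \<Sum>j<?n. \<Sum>k<?n. \<Sum>l<?n. if ?p l = j then cscale (f i j k l) (?T i (?p k)) else 0)
    = - (\<Sum>i<?n. \<Sum>l<?n. \<Sum>j<?n. cscale (f i j j l) (?T i l))"
  proof -
    have "(\<Sum>j<?n. \<Sum>k<?n. \<Sum>l<?n. if ?p l = j then cscale (f i j k l) (?T i (?p k)) else 0)
      = - (\<Sum>l<?n. \<Sum>j<?n. cscale (f i j j l) (?T i l))" if i: "i < ?n" for i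
    proof -
      have "(\<Sum>j<?n. \<Sum>k<?n. \<Sum>l<?n. if ?p l = j then cscale (f i j k l) (?T i (?p k)) else 0)
        = (\<Sum>j<?n. \<Sum>k<?n. cscale (f i j k (?p j)) (?T i (?p k)))"
      proof (intro sum.cong refl)
        fix j k assume j: "j \<in> {..<?n}"
        have "(\<Sum>l<?n. if ?p l = j then cscale (f i j k l) (?T i (?p k)) else 0)
          = (\<Sum>l<?n. if l = ?p j then cscale (f i j k l) (?T i (?p k)) else 0)"
          by (intro sum.cong refl if_cong) (use j partner_eq_iff in auto)
        then show "(\<Sum>l<?n. if ?p l = j then cscale (f i j k l) (?T i (?p k)) else 0) = cscale (f i j k (?p j)) (?T i (?p k))"
          using j pl by simp
      qed
      also have "\<dots> = (\<Sum>j<?n. \<Sum>k<?n. cscale (f i j (?p k) (?p j)) (?T i k))"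
      proof (rule sum.cong[OF refl])
        fix j
        have "(\<Sum>k<?n. cscale (f i j k (?p j)) (?T i (?p k))) = (\<Sum>k<?n. cscale (f i j (?p k) (?p j)) (?T i (?p (?p k))))"
          using sum_partner[of "\<lambda>k. cscale (f i j k (?p j)) (?T i (?p k))" r] by simp
        then show "(\<Sum>k<?n. cscale (f i j k (?p j)) (?T i (?p k))) = (\<Sum>k<?n. cscale (f i j (?p k) (?p j)) (?T i k))"
          by (simp add: partner_partner)
      qed
      also have "\<dots> = (\<Sum>j<?n. \<Sum>k<?n. - cscale (f i j j k) (?T i k))"
        by (intro sum.cong refl) (simp add: f_def so_even_skew[OF Y])
      also have "\<dots> = (\<Sum>k<?n. \<Sum>j<?n. - cscale (f i j j k) (?T i k))" by (rule sum.swap)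
      finally show ?thesis by (simp add: sum_negf)
    qed
    then show ?thesis by (simp add: sum_negf)
  qed
  have s4: "(\<Sum>i<?n. \<Sum>j<?n. \<Sum>k<?n. \<Sum>l<?n. if l = i then cscale (f i j k l) (?T k j) else 0)
    = (\<Sum>k<?n. \<Sum>j<?n. \<Sum>i<?n. cscale (f i j k i) (?T k j))"
  proof -
    have "(\<Sum>i<?n. \<Sum>j<?n. \<Sum>k<?n. \<Sum>l<?n. if l = i then cscale (f i j k l) (?T k j) else 0)
      = (\<Sum>i<?n. \<Sum>j<?n. \<Sum>k<?n. cscale (f i j k i) (?T k j))" by (intro sum.cong refl) simp
    also have "\<dots> = (\<Sum>i<?n. \<Sum>k<?n. \<Sum>j<?n. cscale (f i j k i) (?T k j))" by (rule sum.cong[OF refl], rule sum.swap)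
    also have "\<dots> = (\<Sum>k<?n. \<Sum>i<?n. \<Sum>j<?n. cscale (f i j k i) (?T k j))" by (rule sum.swap)
    also have "\<dots> = (\<Sum>k<?n. \<Sum>j<?n. \<Sum>i<?n. cscale (f i j k i) (?T k j))" by (rule sum.cong[OF refl], rule sum.swap)
    finally show ?thesis .
  qed
  have s3: "(\<Sum>i<?n. \<Sum>j<?n. \<Sum>k<?n. \<Sum>l<?n. if ?p i = k then cscale (f i j k l) (?T (?p l) j) else 0)
    = - (\<Sum>k<?n. \<Sum>j<?n. \<Sum>i<?n. cscale (f i j k i) (?T k j))"
  proof -
    have "(\<Sum>i<?n. \<Sum>j<?n. \<Sum>k<?n. \<Sum>l<?n. if ?p i = k then cscale (f i j k l) (?T (?p l) j) else 0)
      = (\<Sum>i<?n. \<Sum>j<?n. \<Sum>l<?n. \<Sum>k<?n. if ?p i = k then cscale (f i j k l) (?T (?p l) j) else 0)"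
      by (rule sum.cong[OF refl], rule sum.cong[OF refl], rule sum.swap)
    also have "\<dots> = (\<Sum>i<?n. \<Sum>j<?n. \<Sum>l<?n. cscale (f i j (?p i) l) (?T (?p l) j))"
      by (intro sum.cong refl) (simp add: pl)
    also have "\<dots> = (\<Sum>i<?n. \<Sum>j<?n. \<Sum>l<?n. cscale (f i j (?p i) (?p l)) (?T l j))"
    proof (rule sum.cong[OF refl], rule sum.cong[OF refl])
      fix i j
      have "(\<Sum>l<?n. cscale (f i j (?p i) l) (?T (?p l) j)) = (\<Sum>l<?n. cscale (f i j (?p i) (?p l)) (?T (?p (?p l)) j))"
        using sum_partner[of "\<lambda>l. cscale (f i j (?p i) l) (?T (?p l) j)" r] by simp
      then show "(\<Sum>l<?n. cscale (f i j (?p i) l) (?T (?p l) j)) = (\<Sum>l<?n. cscale (f i j (?p i) (?p l)) (?T l j))"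
        by (simp add: partner_partner)
    qed
    also have "\<dots> = (\<Sum>i<?n. \<Sum>j<?n. \<Sum>l<?n. - cscale (f i j l i) (?T l j))"
      by (intro sum.cong refl) (simp add: f_def so_even_skew[OF Y])
    also have "\<dots> = (\<Sum>i<?n. \<Sum>l<?n. \<Sum>j<?n. - cscale (f i j l i) (?T l j))" by (rule sum.cong[OF refl], rule sum.swap)
    also have "\<dots> = (\<Sum>l<?n. \<Sum>i<?n. \<Sum>j<?n. - cscale (f i j l i) (?T l j))" by (rule sum.swap)
    also have "\<dots> = (\<Sum>l<?n. \<Sum>j<?n. \<Sum>i<?n. - cscale (f i j l i) (?T l j))" by (rule sum.cong[OF refl], rule sum.swap)
    finally show ?thesis by (simp add: sum_negf)
  qed
  define P where "P = (\<Sum>i<?n. \<Sum>l<?n. \<Sum>j<?n. cscale (f i j j l) (?T i l))"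
  define R where "R = (\<Sum>k<?n. \<Sum>j<?n. \<Sum>i<?n. cscale (f i j k i) (?T k j))"
  have "act X (act Y x) - act Y (act X x) = (\<Sum>i<?n. \<Sum>j<?n. \<Sum>k<?n. \<Sum>l<?n. cscale (1 / 2)
      ((if j = k then cscale (f i j k l) (?T i l) else 0) - (if ?p l = j then cscale (f i j k l) (?T i (?p k)) else 0)
      + (if ?p i = k then cscale (f i j k l) (?T (?p l) j) else 0) - (if l = i then cscale (f i j k l) (?T k j) else 0)))"
    unfolding action_commutator
    by (intro sum.cong refl) (simp add: spin_op_commutator f_def CV.scale_right_diff_distrib CV.scale_right_distrib)
  also have "\<dots> = cscale (1 / 2) (P - (- P) + (- R) - R)"
    unfolding CV.scale_sum_right[symmetric] sum_subtractf sum.distrib s1 s2 s3 s4 P_def R_def ..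
  also have "\<dots> = P - R"
  proof -
    have "P - (- P) + (- R) - R = cscale 2 (P - R)" using CV.scale_left_distrib[of 1 1 "P - R"] by simp
    then show ?thesis by simp
  qed
  also have "P - R = act (commutator ?n X Y) x"
    unfolding matrix_action_def P_def R_def sum_subtractf[symmetric]
    by (intro sum.cong refl)
       (simp add: entry_commutator f_def CV.scale_left_diff_distrib CV.scale_sum_left mult.commute sum_subtractf)
  finally show ?thesis by simp
qed

lemma is_lie_module_half_spin: "is_lie_module (so_even r) (half_spin r)"
proof -
  interpret matrix_operators "2 * r" "spin_op r" "{I. I \<subseteq> {..<r} \<and> even (card I)}" by (rule matrix_operators_spin)
  have "so_even r = \<lparr>lscale = cscale, lcarrier = lcarrier (so_even r), lbracket = commutator (2 * r)\<rparr>"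
    by (simp add: so_even_def)
  moreover have "is_lie_module \<lparr>lscale = cscale, lcarrier = lcarrier (so_even r), lbracket = commutator (2 * r)\<rparr> (half_spin r)"
    unfolding half_spin_matrix_action by (rule is_lie_module_matrix_action) (rule spin_action_commutator)
  ultimately show ?thesis by simp
qed

section \<open>The module spanned by a minuscule orbit\<close>

context picard
begin

definition root_op :: "nat \<Rightarrow> nat \<Rightarrow> (nat \<Rightarrow>\<^sub>0 complex) \<Rightarrow> (nat \<Rightarrow>\<^sub>0 complex)" where
  "root_op i j x = Poly_Mapping.single i (Poly_Mapping.lookup x j)"

lemma matrix_operators_standard: "matrix_operators n root_op {..<n}"
  by unfold_locales (auto simp: root_op_def lookup_add single_add cscale_single intro: single_supported)

lemma reflect_div_commute:
  assumes ij: "i \<in> N" "j \<in> N" and 0: "T_cartan_matrix a b c i j = 0"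
  shows "reflect_div i (reflect_div j D) = reflect_div j (reflect_div i D)"
proof -
  have "pic_form c (reflect_div j D) (\<alpha> i) = pic_form c D (\<alpha> i)" "pic_form c (reflect_div i D) (\<alpha> j) = pic_form c D (\<alpha> j)"
    using reflect_div_pairing[OF ij, of D] reflect_div_pairing[OF ij(2,1), of D] 0 T_cartan_sym[of i j] by simp_all
  then show ?thesis by (simp add: add_ac)
qed

text \<open>The basis is the orbit itself, numbered by \<open>{..<n}\<close>; \<open>s i\<close> is the \<open>i\<close>-th reflection and
  \<open>w k i\<close> the pairing with \<open>\<alpha>\<^sub>i\<close>. The operators \<open>e\<^sub>i\<close> and \<open>f\<^sub>i\<close> move a basis vector of pairing \<open>-1\<close>
  respectively \<open>1\<close> to its reflection and kill the others. All values of \<open>w\<close> being at most \<open>1\<close> in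
  size, the relation \<open>[e\<^sub>i, f\<^sub>j] = 0\<close> holds for adjacent nodes since neither product can be
  nonzero, and for distant nodes since the reflections commute. The Lie algebra is the one
  that these matrices generate.\<close>

theorem minuscule_module_exists:
  assumes mins: "\<And>D i. D \<in> \<O> \<Longrightarrow> i \<in> N \<Longrightarrow> pic_form c D (\<alpha> i) \<in> {-1, 0, 1}"
    and fin: "finite \<O>" and nonzero: "\<And>i. i \<in> N \<Longrightarrow> \<exists>D\<in>\<O>. pic_form c D (\<alpha> i) \<noteq> 0"
  shows "\<exists>(g :: cmatrix lie_algebra) (M :: (cmatrix, nat \<Rightarrow>\<^sub>0 complex) lie_module) e f h.
    labelled_module a b c g M e f h \<and> module_dim M = card \<O>"
proof -
  define n where "n = card \<O>"
  obtain Dk where "bij_betw Dk {0..<n} \<O>" using ex_bij_betw_nat_finite[OF fin] unfolding n_def by blast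
  then have bij: "bij_betw Dk {..<n} \<O>" by (simp add: atLeast0LessThan)
  define w where "w k i = pic_form c (Dk k) (\<alpha> i)" for k i
  define s where "s i k = the_inv_into {..<n} Dk (reflect_div i (Dk k))" for i k
  have DO: "Dk k \<in> \<O>" if "k < n" for k using bij that by (auto simp: bij_betw_def)
  have inj: "k = l" if "k < n" "l < n" "Dk k = Dk l" for k l
    using bij that by (auto simp: bij_betw_def inj_on_def)
  have s: "s i k < n" "Dk (s i k) = reflect_div i (Dk k)" if "k < n" "i \<in> N" for i k
  proof -
    have r: "reflect_div i (Dk k) \<in> Dk ` {..<n}"
      using minus_one_divisors.reflect[OF DO[OF that(1)] that(2)] bij by (simp add: bij_betw_def)
    show "Dk (s i k) = reflect_div i (Dk k)" unfolding s_def
      by (rule f_the_inv_into_f) (use bij r in \<open>auto simp: bij_betw_def\<close>)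
    show "s i k < n" unfolding s_def
      using the_inv_into_into[of Dk "{..<n}" _ "{..<n}"] bij r by (auto simp: bij_betw_def)
  qed
  have ws: "w (s i k) j = w k j - w k i * T_cartan_matrix a b c i j" if "k < n" "i \<in> N" "j \<in> N" for i j k
    unfolding w_def s(2)[OF that(1,2)] by (rule reflect_div_pairing[OF that(2,3)])
  have ss: "s i (s i k) = k" if "k < n" "i \<in> N" for i k
    using that s[OF that] s[OF s(1)[OF that] that(2)] reflect_div_involution[OF that(2)] by (intro inj) auto
  have scomm: "s i (s j k) = s j (s i k)" if "k < n" "i \<in> N" "j \<in> N" "T_cartan_matrix a b c i j = 0" for i j k
  proof (rule inj)
    show "Dk (s i (s j k)) = Dk (s j (s i k))"
      unfolding s(2)[OF s(1)[OF that(1,3)] that(2)] s(2)[OF s(1)[OF that(1,2)] that(3)] s(2)[OF that(1,3)] s(2)[OF that(1,2)]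
      by (rule reflect_div_commute[OF that(2-4)])
  qed (use s that in auto)
  have wm: "w k i = -1 \<or> w k i = 0 \<or> w k i = 1" if "k < n" "i \<in> N" for k i
    using mins[OF DO[OF that(1)] that(2)] by (simp add: w_def)
  interpret matrix_operators n root_op "{..<n}" by (rule matrix_operators_standard)
  let ?v = "\<lambda>k. Poly_Mapping.single k 1 :: nat \<Rightarrow>\<^sub>0 complex"
  have act_entry: "Poly_Mapping.lookup (act X (?v k)) p = entry X p k" if "k < n" "p < n" for X k p
  proof -
    have "act X (?v k) = (\<Sum>i<n. \<Sum>j<n. if j = k then Poly_Mapping.single i (entry X i k) else 0)"
      unfolding matrix_action_def by (intro sum.cong refl) (auto simp: root_op_def cscale_single lookup_single when_def)
    then show ?thesis using that by (simp add: lookup_sum lookup_single when_def)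
  qed
  have eqI: "X = Y" if "X \<in> gl_carrier n" "Y \<in> gl_carrier n" "\<And>k. k < n \<Longrightarrow> act X (?v k) = act Y (?v k)" for X Y
  proof (rule cmatrix_eqI)
    show "entry X p q = entry Y p q" for p q
    proof (cases "p < n \<and> q < n")
      case True
      then show ?thesis using act_entry[of q p X] act_entry[of q p Y] that(3)[of q] by simp
    next
      case False
      then show ?thesis using that(1,2) by (simp add: gl_carrier_def supported_iff)
    qed
  qed
  have act_sum: "act (\<Sum>k\<in>A. X k) x = (\<Sum>k\<in>A. act (X k) x)" for A X x
  proof -
    have "act 0 x = 0" using act_linear(3)[of 0 0 x] by simp
    then show ?thesis by (induction A rule: infinite_finite_induct) (auto simp: act_linear(1))
  qed
  have act0: "act X 0 = 0" "act 0 x = 0" for X x using act_linear(3)[of 0 0 x] act_linear(4)[of X 0 0] by simp_all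
  have act_unit: "act (unit_matrix p q) (?v k) = (if q = k then ?v p else 0)" if "p < n" "q < n" for p q k
    using that by (simp add: act_unit_matrix root_op_def lookup_single when_def)
  define e where "e i = (\<Sum>k<n. cscale (of_bool (w k i = -1)) (unit_matrix (s i k) k))" for i
  define f where "f i = (\<Sum>k<n. cscale (of_bool (w k i = 1)) (unit_matrix (s i k) k))" for i
  define h where "h i = (\<Sum>k<n. cscale (of_int (w k i)) (unit_matrix k k))" for i
  have monomial: "act (\<Sum>l<n. cscale (z l) (unit_matrix (t l) l)) (?v k) = cscale (z k) (?v (t k))"
    if "k < n" "\<And>l. l < n \<Longrightarrow> t l < n" for z t k
  proof -
    have "act (\<Sum>l<n. cscale (z l) (unit_matrix (t l) l)) (?v k) = (\<Sum>l<n. if l = k then cscale (z l) (?v (t l)) else 0)"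
      unfolding act_sum by (intro sum.cong refl) (use that in \<open>auto simp: act_linear act_unit\<close>)
    then show ?thesis using that by simp
  qed
  have act_e: "act (e i) (?v k) = cscale (of_bool (w k i = -1)) (?v (s i k))" if "i \<in> N" "k < n" for i k
    unfolding e_def by (rule monomial) (use s that in auto)
  have act_f: "act (f i) (?v k) = cscale (of_bool (w k i = 1)) (?v (s i k))" if "i \<in> N" "k < n" for i k
    unfolding f_def by (rule monomial) (use s that in auto)
  have act_h: "act (h i) (?v k) = cscale (of_int (w k i)) (?v k)" if "k < n" for i k
    unfolding h_def by (rule monomial) (use that in auto)
  have gl: "(\<Sum>l<n. cscale (z l) (unit_matrix (t l) l)) \<in> gl_carrier n" if "\<And>l. l < n \<Longrightarrow> t l < n" for z t
    unfolding gl_carrier_def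
    by (intro CV.subspace_sum[OF subspace_supported] CV.subspace_scale[OF subspace_supported] single_supported) (use that in auto)
  have gens_gl: "e i \<in> gl_carrier n" "f i \<in> gl_carrier n" "h i \<in> gl_carrier n" if "i \<in> N" for i
    unfolding e_def f_def h_def by (rule gl; use s that in auto)+
  have gl0: "0 \<in> gl_carrier n" by (simp add: gl_carrier_def supported_def)
  have gl_scale: "cscale k X \<in> gl_carrier n" if "X \<in> gl_carrier n" for k X
    using that unfolding gl_carrier_def by (rule CV.subspace_scale[OF subspace_supported])
  have act_comm: "act (commutator n X Y) x = act X (act Y x) - act Y (act X x)" for X Y x
    by (rule act_commutator_gl) (auto simp: root_op_def lookup_single when_def)
  have sym: "T_cartan_matrix a b c i j = T_cartan_matrix a b c j i" for i j by (rule T_cartan_sym)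
  have hh: "commutator n (h i) (h j) = 0" for i j
  proof (rule eqI)
    show "act (commutator n (h i) (h j)) (?v k) = act 0 (?v k)" if "k < n" for k
      using that act_linear(3)[of 0 0 "?v k"] by (simp add: act_comm act_h act_linear mult.commute)
  qed (rule commutator_gl, rule gl0)
  have he: "commutator n (h i) (e j) = cscale (of_int (T_cartan_matrix a b c i j)) (e j)" if "i \<in> N" "j \<in> N" for i j
  proof (rule eqI)
    show "act (commutator n (h i) (e j)) (?v k) = act (cscale (of_int (T_cartan_matrix a b c i j)) (e j)) (?v k)" if k: "k < n" for k
      using k ws[OF k \<open>j \<in> N\<close> \<open>i \<in> N\<close>] s(1)[OF k \<open>j \<in> N\<close>]
      by (cases "w k j = -1") (simp_all add: act_comm act0 act_h act_e[OF \<open>j \<in> N\<close>] act_linear sym[of j i] CV.scale_left_distrib)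
  qed (use gens_gl that in \<open>auto simp: commutator_gl gl_scale\<close>)
  have hf: "commutator n (h i) (f j) = cscale (- of_int (T_cartan_matrix a b c i j)) (f j)" if "i \<in> N" "j \<in> N" for i j
  proof (rule eqI)
    show "act (commutator n (h i) (f j)) (?v k) = act (cscale (- of_int (T_cartan_matrix a b c i j)) (f j)) (?v k)" if k: "k < n" for k
      using k ws[OF k \<open>j \<in> N\<close> \<open>i \<in> N\<close>] s(1)[OF k \<open>j \<in> N\<close>] act_linear(3)[of "- of_int (T_cartan_matrix a b c i j)" "f j" "?v k"]
      by (cases "w k j = 1") (simp_all add: act_comm act0 act_h act_f[OF \<open>j \<in> N\<close>] act_linear(4) sym[of j i] CV.scale_left_diff_distrib)
  qed (use gens_gl[OF \<open>j \<in> N\<close>] in \<open>blast intro: commutator_gl gl_scale\<close>)+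
  have ef: "commutator n (e i) (f j) = (if i = j then h i else 0)" if i: "i \<in> N" and j: "j \<in> N" for i j
  proof (rule eqI)
    fix k assume k: "k < n"
    have sk: "s i k < n" "s j k < n" using s k i j by auto
    have comm: "act (commutator n (e i) (f j)) (?v k) =
        cscale (of_bool (w k j = 1) * of_bool (w (s j k) i = -1)) (?v (s i (s j k)))
        - cscale (of_bool (w k i = -1) * of_bool (w (s i k) j = 1)) (?v (s j (s i k)))"
      by (simp only: act_comm act_e[OF i k] act_f[OF j k] act_linear(4) act_e[OF i sk(2)] act_f[OF j sk(1)] CV.scale_scale)
    show "act (commutator n (e i) (f j)) (?v k) = act (if i = j then h i else 0) (?v k)"
    proof (cases "i = j")
      case True
      have "T_cartan_matrix a b c i i = 2" by (simp add: T_cartan_matrix_def)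
      then show ?thesis unfolding comm using True wm[OF k i] ws[OF k i i] ss[OF k i] act_h[OF k] by auto
    next
      case False
      have z: "act 0 (?v k) = 0" using act_linear(3)[of 0 0 "?v k"] by simp
      have C: "T_cartan_matrix a b c i j = 0 \<or> T_cartan_matrix a b c i j = -1" using False by (auto simp: T_cartan_matrix_def)
      show ?thesis
      proof (cases "T_cartan_matrix a b c i j = 0")
        case True
        then show ?thesis unfolding comm using False z ws[OF k i j] ws[OF k j i] sym[of j i] scomm[OF k i j True] by (simp add: mult.commute)
      next
        case F: False
        then have "T_cartan_matrix a b c i j = -1" using C by simp
        then have "\<not> (w k j = 1 \<and> w (s j k) i = -1)" "\<not> (w k i = -1 \<and> w (s i k) j = 1)"
          using ws[OF k i j] ws[OF k j i] sym[of j i] wm[OF k i] wm[OF k j] by auto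
        then show ?thesis unfolding comm using False z by (auto simp: of_bool_def)
      qed
    qed
  qed (use gens_gl(3)[OF i] gl0 commutator_gl in auto)
  \<comment> \<open>The subalgebras that contain the generators; the least one is the Lie algebra sought.\<close>
  define good where "good U \<longleftrightarrow> CV.subspace U \<and> U \<subseteq> gl_carrier n \<and> (\<forall>X\<in>U. \<forall>Y\<in>U. commutator n X Y \<in> U) \<and>
    (\<forall>i\<in>N. e i \<in> U \<and> f i \<in> U \<and> h i \<in> U)" for U
  define L where "L = \<Inter> {U. good U}"
  have "good (gl_carrier n)"
    using gens_gl commutator_gl subspace_supported unfolding good_def gl_carrier_def by auto
  then have Lgl: "L \<subseteq> gl_carrier n" unfolding L_def by auto
  have subL: "CV.subspace L" unfolding L_def by (rule CV.subspace_Inter) (auto simp: good_def)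
  have brL: "commutator n X Y \<in> L" if "X \<in> L" "Y \<in> L" for X Y using that by (auto simp: L_def good_def)
  have gensL: "e i \<in> L \<and> f i \<in> L \<and> h i \<in> L" if "i \<in> N" for i using that by (auto simp: L_def good_def)
  define g where "g = \<lparr>lscale = cscale, lcarrier = L, lbracket = commutator n\<rparr>"
  define M where "M = \<lparr>mscale = cscale, mcarrier = supported {..<n}, maction = act\<rparr>"
  have "labelled_module a b c g M e f h"
  proof (rule labelled_module_minuscule[where Dv = Dk and S = "{..<n}"])
    show "is_lie_algebra g" unfolding g_def by (rule is_lie_algebra_gl[OF subL Lgl brL])
    show "is_lie_module g M" unfolding g_def M_def by (rule is_lie_module_matrix_action) (rule act_comm)
    show "U = lcarrier g" if "module.subspace (lscale g) U" "U \<subseteq> lcarrier g" "\<And>x y. x \<in> U \<Longrightarrow> y \<in> U \<Longrightarrow> lbracket g x y \<in> U"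
      "\<And>i. i \<in> N \<Longrightarrow> e i \<in> U \<and> f i \<in> U \<and> h i \<in> U" for U
    proof -
      have "good U" using that Lgl by (auto simp: good_def g_def)
      then have "L \<subseteq> U" by (auto simp: L_def)
      then show ?thesis using that(2) by (auto simp: g_def)
    qed
    show "maction M (h i) (?v I) = cscale (of_int (pic_form c (Dk I) (\<alpha> i))) (?v I)" if "i \<in> N" "I \<in> {..<n}" for i I
      using act_h[of I i] that by (simp add: M_def w_def)
    show "\<exists>k. k \<noteq> 0 \<and> maction M (e i) (?v I) = Poly_Mapping.single J k"
      if "i \<in> N" "I \<in> {..<n}" "J \<in> {..<n}" "pic_form c (Dk I) (\<alpha> i) = -1" "Dk J = reflect_div i (Dk I)" for i I J
    proof -
      have "s i I = J" using s[of I i] that by (intro inj) auto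
      then show ?thesis using act_e[of i I] that by (intro exI[of _ 1]) (simp add: M_def w_def)
    qed
    show "\<exists>k. k \<noteq> 0 \<and> maction M (f i) (?v I) = Poly_Mapping.single J k"
      if "i \<in> N" "I \<in> {..<n}" "J \<in> {..<n}" "pic_form c (Dk I) (\<alpha> i) = 1" "Dk J = reflect_div i (Dk I)" for i I J
    proof -
      have "s i I = J" using s[of I i] that by (intro inj) auto
      then show ?thesis using act_f[of i I] that by (intro exI[of _ 1]) (simp add: M_def w_def)
    qed
    show "maction M (e i) (?v I) = 0" if "i \<in> N" "I \<in> {..<n}" "Dk I = Ediv r" for i I
    proof -
      have "w I i \<noteq> -1" using fun_cong[OF wt_base, of i] that by (auto simp: wt_def w_def)
      then show ?thesis using act_e[of i I] that by (simp add: M_def)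
    qed
  qed (use bij mins nonzero gensL hh he hf ef in \<open>auto simp: g_def M_def\<close>)
  moreover have "module_dim M = card \<O>" by (simp add: module_dim_def M_def dim_supported n_def)
  ultimately show ?thesis by blast
qed

end

section \<open>Exterior powers as labelled modules\<close>

context type_A
begin

lemma inj_Dv: "inj_on Dv Q"
proof (rule inj_onI)
  fix I J assume IJ: "I \<in> Q" "J \<in> Q" "Dv I = Dv J"
  then have "zero_one I = zero_one J" using Lmap_Dv[of I] Lmap_Dv[of J] by simp
  then show "I = J" by (rule zero_one_inject[OF finite_Q[OF IJ(1)] finite_Q[OF IJ(2)]])
qed

definition e_sl :: "nat \<Rightarrow> cmatrix" where "e_sl i = unit_matrix (i - 1) i"
definition f_sl :: "nat \<Rightarrow> cmatrix" where "f_sl i = unit_matrix i (i - 1)"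
definition h_sl :: "nat \<Rightarrow> cmatrix" where "h_sl i = unit_matrix (i - 1) (i - 1) - unit_matrix i i"

lemma sl_relations:
  assumes i: "i \<in> N" and j: "j \<in> N"
  shows "commutator (c + a) (h_sl i) (h_sl j) = 0"
    "commutator (c + a) (h_sl i) (e_sl j) = cscale (of_int (T_cartan_matrix a b c i j)) (e_sl j)"
    "commutator (c + a) (h_sl i) (f_sl j) = cscale (- of_int (T_cartan_matrix a b c i j)) (f_sl j)"
    "commutator (c + a) (e_sl i) (f_sl j) = (if i = j then h_sl i else 0)"
proof -
  have "1 \<le> i" "1 \<le> j" "i < c + a" "j < c + a" using i j by (auto simp: N_eq)
  then obtain i' j' where ij: "i = Suc i'" "j = Suc j'" and lt: "Suc i' < c + a" "Suc j' < c + a" "i' < c + a" "j' < c + a"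
    by (metis Suc_le_D One_nat_def Suc_lessD)
  have tw: "cscale 2 x = x + x" for x :: cmatrix using CV.scale_left_distrib[of 1 1 x] by simp
  have cases: "i' = j' \<or> i' = Suc j' \<or> j' = Suc i' \<or> (i' \<noteq> j' \<and> i' \<noteq> Suc j' \<and> j' \<noteq> Suc i')" by blast
  show "commutator (c + a) (h_sl i) (h_sl j) = 0"
    using lt by (auto simp: ij h_sl_def commutator_minus commutator_unit)
  show "commutator (c + a) (h_sl i) (e_sl j) = cscale (of_int (T_cartan_matrix a b c i j)) (e_sl j)"
    using cases lt unfolding T_cartan_A[OF i j] unfolding ij
    by (elim disjE) (auto simp: h_sl_def e_sl_def commutator_minus commutator_unit tw)
  show "commutator (c + a) (h_sl i) (f_sl j) = cscale (- of_int (T_cartan_matrix a b c i j)) (f_sl j)"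
    using cases lt unfolding T_cartan_A[OF i j] unfolding ij
    by (elim disjE) (auto simp: h_sl_def f_sl_def commutator_minus commutator_unit tw)
  show "commutator (c + a) (e_sl i) (f_sl j) = (if i = j then h_sl i else 0)"
    using cases lt unfolding ij
    by (elim disjE) (auto simp: h_sl_def f_sl_def e_sl_def commutator_minus commutator_unit)
qed

text \<open>The divisor with subset \<open>I\<close> corresponds to the basis monomial of \<open>I\<close>, and \<open>e\<^sub>i\<close> replaces the
  factor \<open>i\<close> by \<open>i - 1\<close>.\<close>

lemma labelled_module_sl: "labelled_module a b c (sl (c + a)) (exterior_power c (c + a)) e_sl f_sl h_sl"
proof -
  let ?n = "c + a" and ?T = "\<lambda>i j x. wedge i (contract j x)"
  interpret matrix_operators ?n ?T "{I. I \<subseteq> {..<?n} \<and> card I = c}" by (rule matrix_operators_exterior)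
  have M: "maction (exterior_power c ?n) = matrix_action ?n ?T" "mscale (exterior_power c ?n) = cscale"
    "mcarrier (exterior_power c ?n) = supported Q"
    by (simp_all add: exterior_power_matrix_action Q_def)
  have g: "lscale (sl ?n) = cscale" "lbracket (sl ?n) = commutator ?n" by (simp_all add: sl_def)
  have lt: "i - 1 < ?n" "i < ?n" "1 \<le> i" if "i \<in> N" for i using that by (auto simp: N_eq)
  have entries: "(\<Sum>k<?n. entry (h_sl i) k k) = 0" if "i \<in> N" for i
  proof -
    have "(\<Sum>k<?n. entry (h_sl i) k k) = (\<Sum>k<?n. if k = i - 1 then 1 else 0) - (\<Sum>k<?n. if k = i then 1 else 0)"
      unfolding sum_subtractf[symmetric] by (intro sum.cong refl) (auto simp: h_sl_def lookup_minus lookup_single when_def)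
    then show ?thesis using lt[OF that] by simp
  qed
  have Qiff: "Dv J = reflect_div i (Dv I) \<longleftrightarrow> J = swap i I" if "I \<in> Q" "J \<in> Q" "i \<in> N" for I J i
    unfolding reflect_Dv[OF that(1,3)] using inj_on_eq_iff[OF inj_Dv that(2) swap_Q[OF that(1,3)]] .
  show ?thesis
  proof (rule labelled_module_minuscule[where Dv = Dv and S = Q])
    show "is_lie_algebra (sl ?n)" by (rule is_lie_algebra_sl)
    show "is_lie_module (sl ?n) (exterior_power c ?n)" by (rule is_lie_module_exterior_power)
    show "bij_betw Dv Q \<O>" unfolding orbit by (rule inj_on_imp_bij_betw[OF inj_Dv])
    show "\<exists>D\<in>\<O>. pic_form c D (\<alpha> i) \<noteq> 0" if i: "i \<in> N" for i
    proof -
      define I where "I = (if i \<le> c then {..<c + 1} - {i} else {i - c..<i})"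
      have "I \<in> Q" "i - 1 \<in> I" "i \<notin> I" using lt[OF i] params by (auto simp: I_def Q_def)
      then have "pic_form c (Dv I) (\<alpha> i) \<noteq> 0" using pairing_Dv[OF _ i] by simp
      then show ?thesis using \<open>I \<in> Q\<close> unfolding orbit by blast
    qed
    show "e_sl i \<in> lcarrier (sl ?n) \<and> f_sl i \<in> lcarrier (sl ?n) \<and> h_sl i \<in> lcarrier (sl ?n)" if i: "i \<in> N" for i
    proof -
      have "(\<Sum>k<?n. entry (e_sl i) k k) = 0" "(\<Sum>k<?n. entry (f_sl i) k k) = 0"
        using lt[OF i] by (auto simp: e_sl_def f_sl_def lookup_single when_def intro!: sum.neutral)
      moreover have "Poly_Mapping.keys (h_sl i) \<subseteq> {..<?n} \<times> {..<?n}"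
        using lt[OF i] keys_diff[of "unit_matrix (i - 1) (i - 1)" "unit_matrix i i"] by (auto simp: h_sl_def)
      ultimately show ?thesis using entries[OF i] lt[OF i] by (auto simp: sl_def e_sl_def f_sl_def)
    qed
    show "U = lcarrier (sl ?n)" if "module.subspace (lscale (sl ?n)) U" "U \<subseteq> lcarrier (sl ?n)"
      "\<And>x y. x \<in> U \<Longrightarrow> y \<in> U \<Longrightarrow> lbracket (sl ?n) x y \<in> U" "\<And>i. i \<in> N \<Longrightarrow> e_sl i \<in> U \<and> f_sl i \<in> U \<and> h_sl i \<in> U" for U
    proof (rule sl_generated)
      show "unit_matrix t (Suc t) \<in> U \<and> unit_matrix (Suc t) t \<in> U" if "Suc t < c + a" for t
        using \<open>\<And>i. i \<in> N \<Longrightarrow> e_sl i \<in> U \<and> f_sl i \<in> U \<and> h_sl i \<in> U\<close>[of "Suc t"] that by (auto simp: N_eq e_sl_def f_sl_def)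
    qed (use that g in auto)
    show "maction (exterior_power c ?n) (h_sl i) (Poly_Mapping.single I 1) = cscale (of_int (pic_form c (Dv I) (\<alpha> i))) (Poly_Mapping.single I 1)"
      if "i \<in> N" "I \<in> Q" for i I
    proof -
      have diag: "wedge p (contract p (Poly_Mapping.single I 1)) = cscale (of_bool (p \<in> I)) (Poly_Mapping.single I 1)" for p
        by (auto simp: wedge_contract_single wedge_sign_remove wedge_sign_square_1 insert_absorb)
      show ?thesis
        unfolding M pairing_Dv[OF that(2,1)] h_sl_def act_diff act_unit_matrix[OF lt(1,1)[OF that(1)]] act_unit_matrix[OF lt(2,2)[OF that(1)]] diag
        by (simp add: CV.scale_left_diff_distrib)
    qed
    show "\<exists>k. k \<noteq> 0 \<and> maction (exterior_power c ?n) (e_sl i) (Poly_Mapping.single I 1) = Poly_Mapping.single J k"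
      if "i \<in> N" "I \<in> Q" "J \<in> Q" "pic_form c (Dv I) (\<alpha> i) = -1" "Dv J = reflect_div i (Dv I)" for i I J
    proof -
      have ii: "i \<in> I" "i - 1 \<notin> I" using that(4) pairing_Dv[OF that(2,1)] by (auto split: if_splits simp: of_bool_def)
      have "J = insert (i - 1) (I - {i})"
        using Qiff[OF that(2,3,1)] that(5) ii lt[OF that(1)] by (auto simp: swap_def Transposition.transpose_def split: if_splits)
      then show ?thesis unfolding M e_sl_def act_unit_matrix[OF lt(1,2)[OF that(1)]]
        using ii lt(3)[OF that(1)] wedge_contract_single_ex by auto
    qed
    show "\<exists>k. k \<noteq> 0 \<and> maction (exterior_power c ?n) (f_sl i) (Poly_Mapping.single I 1) = Poly_Mapping.single J k"
      if "i \<in> N" "I \<in> Q" "J \<in> Q" "pic_form c (Dv I) (\<alpha> i) = 1" "Dv J = reflect_div i (Dv I)" for i I J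
    proof -
      have ii: "i \<notin> I" "i - 1 \<in> I" using that(4) pairing_Dv[OF that(2,1)] by (auto split: if_splits simp: of_bool_def)
      have "J = insert i (I - {i - 1})"
        using Qiff[OF that(2,3,1)] that(5) ii lt[OF that(1)] by (auto simp: swap_def Transposition.transpose_def split: if_splits)
      then show ?thesis unfolding M f_sl_def act_unit_matrix[OF lt(2,1)[OF that(1)]]
        using ii lt(3)[OF that(1)] wedge_contract_single_ex by auto
    qed
    show "maction (exterior_power c ?n) (e_sl i) (Poly_Mapping.single I 1) = 0" if "i \<in> N" "I \<in> Q" "Dv I = Ediv r" for i I
    proof -
      have "pic_form c (Dv I) (\<alpha> i) \<noteq> -1" using fun_cong[OF wt_base, of i] that(1) unfolding that(3) by (auto simp: wt_def)
      then have "\<not> (i \<in> I \<and> i - 1 \<notin> I)" unfolding pairing_Dv[OF that(2,1)] by auto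
      moreover have "i - 1 \<noteq> i" using lt(3)[OF that(1)] by simp
      ultimately show ?thesis unfolding M e_sl_def act_unit_matrix[OF lt(1,2)[OF that(1)]]
        by (auto simp: wedge_contract_single)
    qed
  qed (use M g sl_relations minuscule finite_orbit in auto)
qed

end

section \<open>Half-spin modules as labelled modules\<close>

text \<open>The value at the \<open>p\<close>-th diagonal generator of the weight of the \<open>k\<close>-th standard basis
  vector; a vector and its partner have opposite weights.\<close>

definition diag_weight :: "nat \<Rightarrow> nat \<Rightarrow> nat \<Rightarrow> int" where
  "diag_weight r p k = of_bool (p = k) - of_bool (p = partner r k)"

lemma commutator_diag_skew_unit:
  assumes "p < 2 * r" "k < 2 * r" "l < 2 * r"
  shows "commutator (2 * r) (skew_unit r p p) (skew_unit r k l)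
    = cscale (of_int (diag_weight r p k - diag_weight r p l)) (skew_unit r k l)"
proof -
  have kp: "(if p = k then skew_unit r p l else 0) = cscale (of_bool (p = k)) (skew_unit r k l)"
    "(if l = p then skew_unit r k p else 0) = cscale (of_bool (p = l)) (skew_unit r k l)" by auto
  have 3: "(if p = partner r l then skew_unit r p (partner r k) else 0) = cscale (- of_bool (p = partner r l)) (skew_unit r k l)"
    using skew_unit_partner[OF assms(2,3)] by simp
  have 4: "(if p = partner r k then skew_unit r (partner r l) p else 0) = cscale (- of_bool (p = partner r k)) (skew_unit r k l)"
    using skew_unit_partner[OF assms(2,3)] by simp
  show ?thesis
    unfolding commutator_skew_unit[OF assms(1,1,2,3)] kp 3 4
    by (simp add: CV.scale_left_diff_distrib[symmetric] CV.scale_left_distrib[symmetric] diag_weight_def del: CV.scale_minus_left)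
qed

lemma skew_unit_self_partner: "i < 2 * r \<Longrightarrow> skew_unit r i (partner r i) = 0"
  by (simp add: skew_unit_def partner_partner)

text \<open>The generators are the root vectors along the chain \<open>1, \<dots>, m, 0\<close> and along the fork
  \<open>{m', 0}\<close>. The chain yields all \<open>skew_unit r k l\<close> with \<open>k, l < r\<close> (after the reindexing
  \<open>\<pi>\<close>, which makes it an interval), the fork then yields those with one index replaced by
  its partner, and the diagonal elements are halves of differences of brackets.\<close>

lemma so_even_generated:
  assumes r: "m \<ge> 1" "r = Suc m"
    and U: "CV.subspace U" "U \<subseteq> lcarrier (so_even r)" "\<And>X Y. X \<in> U \<Longrightarrow> Y \<in> U \<Longrightarrow> commutator (2 * r) X Y \<in> U"
    and chain: "\<And>i. 1 \<le> i \<Longrightarrow> i < m \<Longrightarrow> skew_unit r (Suc i) i \<in> U \<and> skew_unit r i (Suc i) \<in> U"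
    and last: "skew_unit r 0 m \<in> U" "skew_unit r m 0 \<in> U"
    and fork: "skew_unit r (partner r m) 0 \<in> U" "skew_unit r 0 (partner r m) \<in> U"
  shows "U = lcarrier (so_even r)"
proof -
  let ?F = "skew_unit r" and ?p = "partner r"
  have lt: "i < r \<Longrightarrow> i < 2 * r" "i < r \<Longrightarrow> ?p i < 2 * r" for i by (auto simp: partner_def)
  have pr: "?p i = i + r" if "i < r" for i using that by (simp add: partner_def)
  have pp: "?p (?p i) = i" if "i < r" for i using that by (simp add: partner_def)
  have neg: "- X \<in> U \<Longrightarrow> X \<in> U" for X using CV.subspace_neg[OF U(1), of "- X"] by simp
  have br: "commutator (2 * r) X Y \<in> U" if "X \<in> U" "Y \<in> U" for X Y using U(3) that .
  have A: "?F k l \<in> U" if kl: "k < r" "l < r" "k \<noteq> l" for k l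
  proof -
    \<comment> \<open>The chain 1, ..., m, 0 as the image of the interval 0, ..., m.\<close>
    define \<pi> where "\<pi> t = (if t < m then Suc t else 0)" for t :: nat
    have "?F (\<pi> x) (\<pi> y) \<in> U" if "x < r" "y < r" "x \<noteq> y" for x y
    proof (rule neighbours_generate[where P = "\<lambda>x y. ?F (\<pi> x) (\<pi> y) \<in> U", OF _ _ _ that])
      fix t assume t: "Suc t < r"
      show "?F (\<pi> t) (\<pi> (Suc t)) \<in> U" "?F (\<pi> (Suc t)) (\<pi> t) \<in> U"
        using t chain[of "Suc t"] last r by (cases "Suc t < m"; cases "Suc t = m"; simp add: \<pi>_def)+
    next
      fix x y z assume xyz: "x < r" "y < r" "z < r" "distinct [x, y, z]" "?F (\<pi> x) (\<pi> y) \<in> U" "?F (\<pi> y) (\<pi> z) \<in> U"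
      have b: "\<pi> x < r" "\<pi> y < r" "\<pi> z < r" "\<pi> z \<noteq> \<pi> x" using xyz r by (auto simp: \<pi>_def split: if_splits)
      have "commutator (2 * r) (?F (\<pi> x) (\<pi> y)) (?F (\<pi> y) (\<pi> z)) = ?F (\<pi> x) (\<pi> z)"
        using commutator_skew_unit[OF lt(1)[OF b(1)] lt(1)[OF b(2)] lt(1)[OF b(2)] lt(1)[OF b(3)]] b by (simp add: pr)
      then show "?F (\<pi> x) (\<pi> z) \<in> U" using br[OF xyz(5,6)] by simp
    qed
    moreover define \<kappa> where "\<kappa> t = (if t = 0 then m else t - 1)" for t :: nat
    moreover have "\<pi> (\<kappa> t) = t" "\<kappa> t < r" if "t < r" for t using that r by (auto simp: \<pi>_def \<kappa>_def)
    ultimately show ?thesis using kl by metis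
  qed
  have m: "m < r" "0 < r" "m \<noteq> 0" using r by auto
  have B1: "?F (?p l) m \<in> U" if l: "l < r" "l \<noteq> m" for l
  proof -
    have "?F (?p m) l \<in> U"
    proof (cases "l = 0")
      case False
      have "commutator (2 * r) (?F (?p m) 0) (?F 0 l) = ?F (?p m) l"
        using commutator_skew_unit[OF lt(2)[OF m(1)] lt(1)[OF m(2)] lt(1)[OF m(2)] lt(1)[OF l(1)]] l m False by (simp add: pr)
      then show ?thesis using br[OF fork(1) A[OF m(2) l(1)]] False by simp
    qed (simp add: fork)
    moreover have "?F (?p l) m = - ?F (?p m) l"
      using skew_unit_partner[OF lt(2)[OF m(1)] lt(1)[OF l(1)]] by (simp add: pp[OF m(1)])
    ultimately show ?thesis using CV.subspace_neg[OF U(1)] by simp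
  qed
  have B: "?F (?p l) k \<in> U" if lk: "l < r" "k < r" "l \<noteq> k" for l k
  proof (cases "l = m")
    case True
    have "?F (?p m) k = - ?F (?p k) m"
      using skew_unit_partner[OF lt(2)[OF lk(2)] lt(1)[OF m(1)]] by (simp add: pp[OF lk(2)])
    then show ?thesis using B1[OF lk(2)] True lk CV.subspace_neg[OF U(1)] by simp
  next
    case lm: False
    show ?thesis
    proof (cases "k = m")
      case False
      have "commutator (2 * r) (?F (?p l) m) (?F m k) = ?F (?p l) k"
        using commutator_skew_unit[OF lt(2)[OF lk(1)] lt(1)[OF m(1)] lt(1)[OF m(1)] lt(1)[OF lk(2)]] lk m lm False by (simp add: pr)
      then show ?thesis using br[OF B1[OF lk(1) lm] A[OF m(1) lk(2)]] False by simp
    qed (use B1 lk lm in simp)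
  qed
  have C1: "?F m (?p l) \<in> U" if l: "l < r" "l \<noteq> m" for l
  proof -
    have "?F l (?p m) \<in> U"
    proof (cases "l = 0")
      case False
      have "commutator (2 * r) (?F l 0) (?F 0 (?p m)) = ?F l (?p m)"
        using commutator_skew_unit[OF lt(1)[OF l(1)] lt(1)[OF m(2)] lt(1)[OF m(2)] lt(2)[OF m(1)]] l m False by (simp add: pr pp partner_def)
      then show ?thesis using br[OF A[OF l(1) m(2)] fork(2)] False by simp
    qed (simp add: fork)
    moreover have "?F m (?p l) = - ?F l (?p m)"
      using skew_unit_partner[OF lt(1)[OF l(1)] lt(2)[OF m(1)]] by (simp add: pp[OF m(1)])
    ultimately show ?thesis using CV.subspace_neg[OF U(1)] by simp
  qed
  have C: "?F k (?p l) \<in> U" if lk: "l < r" "k < r" "l \<noteq> k" for l k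
  proof (cases "l = m")
    case True
    have "?F k (?p m) = - ?F m (?p k)"
      using skew_unit_partner[OF lt(1)[OF m(1)] lt(2)[OF lk(2)]] by (simp add: pp[OF lk(2)])
    then show ?thesis using C1[OF lk(2)] True lk CV.subspace_neg[OF U(1)] by simp
  next
    case lm: False
    show ?thesis
    proof (cases "k = m")
      case False
      have "commutator (2 * r) (?F k m) (?F m (?p l)) = ?F k (?p l)"
        using commutator_skew_unit[OF lt(1)[OF lk(2)] lt(1)[OF m(1)] lt(1)[OF m(1)] lt(2)[OF lk(1)]] lk m lm False by (simp add: pr pp partner_def)
      then show ?thesis using br[OF A[OF lk(2) m(1)] C1[OF lk(1) lm]] False by simp
    qed (use C1 lk lm in simp)
  qed
  have D: "?F k k \<in> U" if k: "k < r" for k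
  proof -
    define l where "l = (if k = 0 then m else 0)"
    have l: "l < r" "l \<noteq> k" using m by (auto simp: l_def)
    have "commutator (2 * r) (?F k l) (?F l k) = ?F k k - ?F l l"
      using commutator_skew_unit[OF lt(1)[OF k] lt(1)[OF l(1)] lt(1)[OF l(1)] lt(1)[OF k]] k l by (simp add: pr)
    then have 1: "?F k k - ?F l l \<in> U" using br[OF A[OF k l(1)] A[OF l(1) k]] l by simp
    have "commutator (2 * r) (?F (?p k) l) (?F l (?p k)) = ?F (?p k) (?p k) - ?F l l"
      using commutator_skew_unit[OF lt(2)[OF k] lt(1)[OF l(1)] lt(1)[OF l(1)] lt(2)[OF k]] k l by (simp add: pr pp partner_def)
    then have 2: "- ?F k k - ?F l l \<in> U"
      using br[OF B[OF k l(1)] C[OF k l(1)]] l skew_unit_partner[OF lt(1)[OF k] lt(1)[OF k]] by simp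
    have "cscale (1 / 2) ((?F k k - ?F l l) - (- ?F k k - ?F l l)) \<in> U"
      using CV.subspace_scale[OF U(1) CV.subspace_diff[OF U(1) 1 2]] .
    moreover have "(?F k k - ?F l l) - (- ?F k k - ?F l l) = cscale 2 (?F k k)"
      using CV.scale_left_distrib[of 1 1 "?F k k"] by simp
    ultimately show ?thesis by simp
  qed
  have F: "?F i j \<in> U" if ij: "i < 2 * r" "j < 2 * r" for i j
  proof -
    have split: "x < r \<or> (\<exists>y<r. x = ?p y)" if "x < 2 * r" for x
      using that by (cases "x < r") (auto intro!: exI[of _ "x - r"] simp: partner_def)
    consider "i < r" "j < r" | l where "i < r" "l < r" "j = ?p l" | l where "l < r" "i = ?p l" "j < r"
      | k l where "k < r" "l < r" "i = ?p k" "j = ?p l"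
      using split[OF ij(1)] split[OF ij(2)] by blast
    then show ?thesis
    proof cases
      case 1
      then show ?thesis using A D by (cases "i = j") auto
    next
      case 2
      then show ?thesis using C skew_unit_self_partner[OF ij(1)] CV.subspace_0[OF U(1)] by (cases "l = i") auto
    next
      case 3
      then show ?thesis using B skew_unit_self_partner[OF lt(2)[OF 3(1)]] CV.subspace_0[OF U(1)] by (cases "l = j") (auto simp: pp)
    next
      case 4
      have "?F l k \<in> U" using A D 4 by (cases "l = k") auto
      then show ?thesis using 4 skew_unit_partner[OF lt(1)[OF 4(2)] lt(1)[OF 4(1)]] CV.subspace_neg[OF U(1)] by simp
    qed
  qed
  have "X \<in> U" if X: "X \<in> lcarrier (so_even r)" for X
  proof -
    \<comment> \<open>Each entry occurs in two skew units, hence the factor one half.\<close>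
    have "X = (\<Sum>i<2 * r. \<Sum>j<2 * r. cscale (entry X i j / 2) (?F i j))"
    proof (rule cmatrix_eqI)
      fix p q
      have u: "entry (unit_matrix x y) z w = (if x = z \<and> y = w then 1 else 0)" for x y z w :: nat
        by (simp add: lookup_single when_def)
      show "entry X p q = entry (\<Sum>i<2 * r. \<Sum>j<2 * r. cscale (entry X i j / 2) (?F i j)) p q"
      proof (cases "p < 2 * r \<and> q < 2 * r")
        case True
        have "entry (\<Sum>i<2 * r. \<Sum>j<2 * r. cscale (entry X i j / 2) (?F i j)) p q
          = (\<Sum>i<2 * r. \<Sum>j<2 * r. (if j = q then if i = p then entry X i j / 2 else 0 else 0) - (if j = ?p p then if i = ?p q then entry X i j / 2 else 0 else 0))"
          unfolding lookup_sum lookup_cscale skew_unit_def lookup_minus u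
        proof (intro sum.cong refl)
          fix i j assume ij: "i \<in> {..<2 * r}" "j \<in> {..<2 * r}"
          have e: "?p j = p \<longleftrightarrow> j = ?p p" "?p i = q \<longleftrightarrow> i = ?p q"
            using partner_eq_iff[of j r p] partner_eq_iff[of i r q] ij True by blast+
          have split: "x / 2 * ((if A \<and> B then 1 else 0) - (if C \<and> D then 1 else 0))
            = (if B then if A then x / 2 else 0 else 0) - (if C then if D then x / 2 else 0 else 0)" for A B C D and x :: complex
            by (cases A; cases B; cases C; cases D) simp_all
          show "entry X i j / 2 * ((if i = p \<and> j = q then 1 else 0) - (if ?p j = p \<and> ?p i = q then 1 else 0))
            = (if j = q then if i = p then entry X i j / 2 else 0 else 0) - (if j = ?p p then if i = ?p q then entry X i j / 2 else 0 else 0)"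
            unfolding e by (rule split)
        qed
        also have "\<dots> = entry X p q / 2 - entry X (?p q) (?p p) / 2"
          using True partner_less[of p r] partner_less[of q r] by (simp add: sum_subtractf)
        also have "\<dots> = entry X p q" using so_even_skew[OF X, of q p] True by simp
        finally show ?thesis by simp
      next
        case False
        have "(\<Sum>i<2 * r. \<Sum>j<2 * r. cscale (entry X i j / 2) (?F i j)) \<in> gl_carrier (2 * r)"
          unfolding gl_carrier_def using skew_unit_so_even[of _ r]
          by (intro CV.subspace_sum[OF subspace_supported] CV.subspace_scale[OF subspace_supported]) (auto simp: so_even_carrier gl_carrier_def)
        moreover have "X \<in> gl_carrier (2 * r)" using X by (simp add: so_even_carrier)
        ultimately show ?thesis using False by (simp add: gl_carrier_def supported_iff)
      qed
    qed
    moreover have "(\<Sum>i<2 * r. \<Sum>j<2 * r. cscale (entry X i j / 2) (?F i j)) \<in> U"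
      by (intro CV.subspace_sum[OF U(1)] CV.subspace_scale[OF U(1)]) (auto simp: F)
    ultimately show ?thesis by simp
  qed
  then show ?thesis using U(2) by auto
qed

text \<open>The Clifford relation brings both summands of the skew unit to the same order; the
  correction is the usual shift by \<open>1/2\<close>.\<close>

lemma act_skew_unit:
  assumes "i < 2 * r" "j < 2 * r"
  shows "matrix_action (2 * r) (spin_op r) (skew_unit r i j) x = cliff r i (cliff r (partner r j) x) - (if i = j then cscale (1 / 2) x else 0)"
proof -
  interpret matrix_operators "2 * r" "spin_op r" "{I. I \<subseteq> {..<r} \<and> even (card I)}" by (rule matrix_operators_spin)
  have e: "partner r i = partner r j \<longleftrightarrow> i = j" using assms partner_partner by metis
  have "act (skew_unit r i j) x = spin_op r i j x - spin_op r (partner r j) (partner r i) x"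
    unfolding skew_unit_def act_diff using assms partner_less by (simp add: act_unit_matrix)
  also have "\<dots> = cscale (1 / 2) (cliff r i (cliff r (partner r j) x) - cliff r (partner r j) (cliff r i x))"
    using assms by (simp add: spin_op_def partner_partner CV.scale_right_diff_distrib)
  also have "cliff r (partner r j) (cliff r i x) = (if i = j then x else 0) - cliff r i (cliff r (partner r j) x)"
    using cliff_cliff[OF partner_less[OF assms(2)] assms(1), of x] assms partner_partner[OF assms(2)] by auto
  also have "cscale (1 / 2) (cliff r i (cliff r (partner r j) x) - ((if i = j then x else 0) - cliff r i (cliff r (partner r j) x)))
    = cliff r i (cliff r (partner r j) x) - (if i = j then cscale (1 / 2) x else 0)"
  proof -
    have half: "cscale (1 / 2) (y + y) = y" for y :: "nat set \<Rightarrow>\<^sub>0 complex"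
      using CV.scale_left_distrib[of "1/2" "1/2" y] unfolding CV.scale_right_distrib by simp
    show ?thesis unfolding diff_diff_eq2 CV.scale_right_diff_distrib half by simp
  qed
  finally show ?thesis .
qed

context type_D
begin

abbreviation "R \<equiv> Suc (Suc c)"

text \<open>The root of node \<open>i\<close> is the weight of the basis vector \<open>upper i\<close> minus that of \<open>lower i\<close>.\<close>

definition upper :: "nat \<Rightarrow> nat" where
  "upper i = (if i \<le> c then Suc i else if i = Suc c then partner R (Suc c) else 0)"

definition lower :: "nat \<Rightarrow> nat" where
  "lower i = (if i \<le> c then i else if i = Suc c then 0 else Suc c)"

definition e_so :: "nat \<Rightarrow> cmatrix" where "e_so i = skew_unit R (upper i) (lower i)"
definition f_so :: "nat \<Rightarrow> cmatrix" where "f_so i = skew_unit R (lower i) (upper i)"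
definition h_so :: "nat \<Rightarrow> cmatrix" where "h_so i = skew_unit R (upper i) (upper i) - skew_unit R (lower i) (lower i)"

lemma upper_lower_less: "upper i < 2 * R" "lower i < 2 * R" "lower i < R"
  by (auto simp: upper_def lower_def partner_def)

lemma root_pairing:
  assumes i: "i \<in> N" and j: "j \<in> N"
  shows "diag_weight R (upper i) (upper j) - diag_weight R (upper i) (lower j)
    - (diag_weight R (lower i) (upper j) - diag_weight R (lower i) (lower j)) = T_cartan_matrix a b c i j"
proof -
  have ib: "1 \<le> i" "i \<le> c + 2" "1 \<le> j" "j \<le> c + 2" using i j by (auto simp: N_eq)
  define \<epsilon> where "\<epsilon> p k = diag_weight R p k" for p k
  have ll: "\<epsilon> p k = of_bool (p = k)" if "p < R" "k < R" for p k using that by (auto simp: \<epsilon>_def diag_weight_def partner_def)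
  have lu: "\<epsilon> p (partner R k) = - of_bool (p = k)" if "p < R" "k < R" for p k using that by (auto simp: \<epsilon>_def diag_weight_def partner_def)
  have ul: "\<epsilon> (partner R p) k = - of_bool (p = k)" if "p < R" "k < R" for p k using that by (auto simp: \<epsilon>_def diag_weight_def partner_def)
  have uu: "\<epsilon> (partner R p) (partner R k) = of_bool (p = k)" if "p < R" "k < R" for p k using that by (auto simp: \<epsilon>_def diag_weight_def partner_def)
  consider "i \<le> c" | "i = Suc c" | "i = Suc (Suc c)" using ib by linarith
  then have "\<epsilon> (upper i) (upper j) - \<epsilon> (upper i) (lower j) - (\<epsilon> (lower i) (upper j) - \<epsilon> (lower i) (lower j)) = T_cartan_matrix a b c i j"
  proof cases
    case 1
    consider "j = i" | "j \<le> c" "j = Suc i" | "j \<le> c" "i = Suc j" | "j \<le> c" "j \<noteq> i" "j \<noteq> Suc i" "i \<noteq> Suc j" | "j = Suc c" | "j = Suc (Suc c)"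
      using ib by linarith
    then show ?thesis unfolding T_cartan_D[OF i j] using 1 ib(1,3) c3
      by cases (simp_all add: upper_def lower_def ll lu ul uu)
  next
    case 2
    consider "j < c" | "j = c" | "j = Suc c" | "j = Suc (Suc c)" using ib by linarith
    then show ?thesis unfolding T_cartan_D[OF i j] using 2 ib(1,3) c3
      by cases (simp_all add: upper_def lower_def ll lu ul uu)
  next
    case 3
    consider "j < c" | "j = c" | "j = Suc c" | "j = Suc (Suc c)" using ib by linarith
    then show ?thesis unfolding T_cartan_D[OF i j] using 3 ib(1,3) c3
      by cases (simp_all add: upper_def lower_def ll lu ul uu)
  qed
  then show ?thesis by (simp add: \<epsilon>_def)
qed

lemma so_relations:
  assumes i: "i \<in> N" and j: "j \<in> N"
  shows "commutator (2 * R) (h_so i) (h_so j) = 0"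
    "commutator (2 * R) (h_so i) (e_so j) = cscale (of_int (T_cartan_matrix a b c i j)) (e_so j)"
    "commutator (2 * R) (h_so i) (f_so j) = cscale (- of_int (T_cartan_matrix a b c i j)) (f_so j)"
    "commutator (2 * R) (e_so i) (f_so j) = (if i = j then h_so i else 0)"
proof -
  note less = upper_lower_less
  show "commutator (2 * R) (h_so i) (h_so j) = 0"
    unfolding h_so_def commutator_minus commutator_diag_skew_unit[OF less(1) less(1) less(1)] commutator_diag_skew_unit[OF less(1) less(2) less(2)]
      commutator_diag_skew_unit[OF less(2) less(1) less(1)] commutator_diag_skew_unit[OF less(2) less(2) less(2)] by simp
  show "commutator (2 * R) (h_so i) (e_so j) = cscale (of_int (T_cartan_matrix a b c i j)) (e_so j)"
    unfolding root_pairing[OF i j, symmetric] h_so_def e_so_def commutator_minus commutator_diag_skew_unit[OF less(1) less(1) less(2)]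
      commutator_diag_skew_unit[OF less(2) less(1) less(2)] CV.scale_left_diff_distrib[symmetric] of_int_diff[symmetric] ..
  show "commutator (2 * R) (h_so i) (f_so j) = cscale (- of_int (T_cartan_matrix a b c i j)) (f_so j)"
    unfolding root_pairing[OF i j, symmetric] h_so_def f_so_def commutator_minus commutator_diag_skew_unit[OF less(1) less(2) less(1)]
      commutator_diag_skew_unit[OF less(2) less(2) less(1)] CV.scale_left_diff_distrib[symmetric] of_int_diff[symmetric] of_int_minus[symmetric]
    by (rule arg_cong[where f = "\<lambda>z. cscale (of_int z) _"]) simp
  have ib: "1 \<le> i" "i \<le> c + 2" "1 \<le> j" "j \<le> c + 2" using i j by (auto simp: N_eq)
  have i3: "i \<le> c \<or> i = Suc c \<or> i = Suc (Suc c)" and j3: "j \<le> c \<or> j = Suc c \<or> j = Suc (Suc c)" using ib by linarith+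
  have 1: "lower i = lower j \<longleftrightarrow> i = j" "upper j = upper i \<longleftrightarrow> i = j"
    using i3 j3 ib(1,3) by (auto simp: lower_def upper_def partner_def)
  have 2: "(if lower i = partner R (upper j) then skew_unit R (upper i) (partner R (lower j)) else 0) = 0"
    using i3 j3 ib(1,3) skew_unit_self_partner[of 0 R] by (auto simp: lower_def upper_def partner_def)
  have 3: "(if upper i = partner R (lower j) then skew_unit R (partner R (upper j)) (lower i) else 0) = 0"
    using i3 j3 ib(1,3) skew_unit_self_partner[of "partner R 0" R] by (auto simp: lower_def upper_def partner_def)
  show "commutator (2 * R) (e_so i) (f_so j) = (if i = j then h_so i else 0)"
    unfolding e_so_def f_so_def commutator_skew_unit[OF less(1) less(2) less(2) less(1)] 1 2 3
    by (simp add: h_so_def)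
qed

lemma inj_Dv: "inj_on Dv Q"
proof (rule inj_onI)
  fix I J assume IJ: "I \<in> Q" "J \<in> Q" "Dv I = Dv J"
  then have "zero_one I = zero_one J" using Lmap_Dv[of I] Lmap_Dv[of J] by simp
  then show "I = J" by (rule zero_one_inject[OF finite_Q[OF IJ(1)] finite_Q[OF IJ(2)]])
qed

text \<open>The divisor with subset \<open>I\<close> corresponds to the monomial of \<open>I\<close> in the even exterior algebra,
  and the empty set to the highest weight vector.\<close>

lemma labelled_module_so: "labelled_module a b c (so_even R) (half_spin R) e_so f_so h_so"
proof -
  note less = upper_lower_less
  have M: "maction (half_spin R) = matrix_action (2 * R) (spin_op R)" "mscale (half_spin R) = cscale"
    "mcarrier (half_spin R) = supported Q"
    by (simp_all add: half_spin_matrix_action Q_def)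
  interpret matrix_operators "2 * R" "spin_op R" "{I. I \<subseteq> {..<R} \<and> even (card I)}" by (rule matrix_operators_spin)
  have g: "lscale (so_even R) = cscale" "lbracket (so_even R) = commutator (2 * R)" by (simp_all add: so_even_def)
  have i3: "1 \<le> i \<and> i \<le> c \<or> i = Suc c \<or> i = Suc (Suc c)" if "i \<in> N" for i using that by (auto simp: N_eq)
  have cl: "cliff R k = wedge k" "cliff R (partner R k) = contract k" if "k < R" for k
    using that by (simp_all add: cliff_def partner_def)
  have cl2: "cliff R (partner R (partner R k)) = wedge k" if "k < R" for k
    using that cl(1)[OF that] by (simp add: partner_def cliff_def)
  have ul: "upper i \<noteq> lower i" if "i \<in> N" for i using i3[OF that] by (auto simp: upper_def lower_def partner_def)
  have act_e: "act (e_so i) x = (if i \<le> c then wedge (Suc i) (contract i x) else if i = Suc c then contract (Suc c) (contract 0 x) else wedge 0 (contract (Suc c) x))"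
    if "i \<in> N" for i x
    using i3[OF that] ul[OF that] cl unfolding e_so_def act_skew_unit[OF less(1,2)] by (auto simp: upper_def lower_def)
  have act_f: "act (f_so i) x = (if i \<le> c then wedge i (contract (Suc i) x) else if i = Suc c then wedge 0 (wedge (Suc c) x) else wedge (Suc c) (contract 0 x))"
    if "i \<in> N" for i x
    using i3[OF that] ul[OF that] cl cl2 unfolding f_so_def act_skew_unit[OF less(2,1)] by (auto simp: upper_def lower_def)
  have diag: "wedge p (contract p (Poly_Mapping.single I 1)) = cscale (of_bool (p \<in> I)) (Poly_Mapping.single I 1)" for p I
    by (auto simp: wedge_contract_single wedge_sign_remove wedge_sign_square_1 insert_absorb)
  have diag': "contract p (wedge p (Poly_Mapping.single I 1)) = Poly_Mapping.single I 1 - cscale (of_bool (p \<in> I)) (Poly_Mapping.single I 1)" for p I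
    using wedge_contract[of p p "Poly_Mapping.single I 1"] diag[of p I] by (simp add: algebra_simps)
  have act_h: "act (h_so i) (Poly_Mapping.single I 1) = cscale (of_int (pair I i)) (Poly_Mapping.single I 1)" if "i \<in> N" for i I
    using i3[OF that] cl cl2 unfolding h_so_def act_diff act_skew_unit[OF less(1,1)] act_skew_unit[OF less(2,2)]
    by (auto simp: upper_def lower_def pair_def diag diag' algebra_simps)
  have Qiff: "Dv J = reflect_div i (Dv I) \<longleftrightarrow> J = move i I" if "I \<in> Q" "J \<in> Q" "i \<in> N" for I J i
    unfolding reflect_Dv[OF that(1,3)] using inj_on_eq_iff[OF inj_Dv that(2) move_Q[OF that(1,3)]] .
  have ww: "\<exists>k. k \<noteq> 0 \<and> wedge p (wedge q (Poly_Mapping.single I 1)) = Poly_Mapping.single (insert p (insert q I)) k"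
    if "q \<notin> I" "p \<notin> insert q I" for p q I
    using that wedge_sign_nonzero by (intro exI[of _ "wedge_sign p (insert q I) * wedge_sign q I"]) (simp add: wedge_single)
  have cc: "\<exists>k. k \<noteq> 0 \<and> contract p (contract q (Poly_Mapping.single I 1)) = Poly_Mapping.single (I - {q} - {p}) k"
    if "q \<in> I" "p \<in> I - {q}" for p q I
    using that wedge_sign_nonzero by (intro exI[of _ "wedge_sign p (I - {q}) * wedge_sign q I"]) (simp add: contract_single)
  show ?thesis
  proof (rule labelled_module_minuscule[where Dv = Dv and S = Q])
    show "is_lie_algebra (so_even R)" by (rule is_lie_algebra_so_even)
    show "is_lie_module (so_even R) (half_spin R)" by (rule is_lie_module_half_spin)
    show "bij_betw Dv Q \<O>" unfolding orbit by (rule inj_on_imp_bij_betw[OF inj_Dv])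
    show "\<exists>D\<in>\<O>. pic_form c D (\<alpha> i) \<noteq> 0" if i: "i \<in> N" for i
    proof -
      define I where "I = (if i \<le> c then {0, i} else if i = Suc c then {} else {0, 1})"
      have "I \<in> Q" using i3[OF i] by (auto simp: I_def Q_def)
      moreover have "pair I i \<noteq> 0" using i3[OF i] c3 by (auto simp: pair_def I_def)
      ultimately show ?thesis using pairing_Dv[OF _ i] unfolding orbit by force
    qed
    show "e_so i \<in> lcarrier (so_even R) \<and> f_so i \<in> lcarrier (so_even R) \<and> h_so i \<in> lcarrier (so_even R)" if "i \<in> N" for i
    proof -
      have "CV.subspace (lcarrier (so_even R))"
        using subspace_supported[of "{..<2 * R} \<times> {..<2 * R}"] unfolding so_even_iff gl_carrier_def CV.subspace_def
        by (auto simp: so_even_iff gl_carrier_def CV.subspace_def lookup_add)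
      then show ?thesis unfolding e_so_def f_so_def h_so_def
        using skew_unit_so_even less CV.subspace_diff by blast
    qed
    show "U = lcarrier (so_even R)" if "module.subspace (lscale (so_even R)) U" "U \<subseteq> lcarrier (so_even R)"
      "\<And>x y. x \<in> U \<Longrightarrow> y \<in> U \<Longrightarrow> lbracket (so_even R) x y \<in> U" and gens: "\<And>i. i \<in> N \<Longrightarrow> e_so i \<in> U \<and> f_so i \<in> U \<and> h_so i \<in> U" for U
    proof (rule so_even_generated[where m = "Suc c"])
      show "skew_unit R (Suc i) i \<in> U \<and> skew_unit R i (Suc i) \<in> U" if "1 \<le> i" "i < Suc c" for i
        using gens[of i] that by (auto simp: N_eq e_so_def f_so_def upper_def lower_def)
      show "skew_unit R 0 (Suc c) \<in> U" "skew_unit R (Suc c) 0 \<in> U"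
        using gens[of "Suc (Suc c)"] by (auto simp: N_eq e_so_def f_so_def upper_def lower_def)
      show "skew_unit R (partner R (Suc c)) 0 \<in> U" "skew_unit R 0 (partner R (Suc c)) \<in> U"
        using gens[of "Suc c"] by (auto simp: N_eq e_so_def f_so_def upper_def lower_def)
    qed (use that g in auto)
    show "maction (half_spin R) (h_so i) (Poly_Mapping.single I 1) = cscale (of_int (pic_form c (Dv I) (\<alpha> i))) (Poly_Mapping.single I 1)"
      if "i \<in> N" "I \<in> Q" for i I
      unfolding M pairing_Dv[OF that(2,1)] by (rule act_h[OF that(1)])
    show "\<exists>k. k \<noteq> 0 \<and> maction (half_spin R) (e_so i) (Poly_Mapping.single I 1) = Poly_Mapping.single J k"
      if "i \<in> N" "I \<in> Q" "J \<in> Q" "pic_form c (Dv I) (\<alpha> i) = -1" "Dv J = reflect_div i (Dv I)" for i I J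
    proof -
      have J: "J = move i I" using Qiff[OF that(2,3,1)] that(5) by simp
      have p: "pair I i = -1" using that(4) pairing_Dv[OF that(2,1)] by simp
      note i3i = i3[OF that(1)]
      consider "1 \<le> i" "i \<le> c" | "i = Suc c" | "i = Suc (Suc c)" using i3i by blast
      then show ?thesis
      proof cases
        case 1
        then have I: "i \<in> I" "Suc i \<notin> I" using p by (auto simp: pair_def of_bool_def split: if_splits)
        then have "J = insert (Suc i) (I - {i})" unfolding J using 1 by (auto simp: move_def Transposition.transpose_def split: if_splits)
        then show ?thesis unfolding M act_e[OF that(1)] using wedge_contract_single_ex[of i I "Suc i"] I 1 by simp
      next
        case 2
        then have I: "0 \<in> I" "Suc c \<in> I" using p by (auto simp: pair_def of_bool_def split: if_splits)
        then have "J = I - {0} - {Suc c}" unfolding J using 2 by (auto simp: move_def split: if_splits)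
        then show ?thesis unfolding M act_e[OF that(1)] using cc[of 0 I "Suc c"] I 2 by simp
      next
        case 3
        then have I: "0 \<notin> I" "Suc c \<in> I" using p by (auto simp: pair_def of_bool_def split: if_splits)
        then have "J = insert 0 (I - {Suc c})" unfolding J using 3 by (auto simp: move_def Transposition.transpose_def split: if_splits)
        then show ?thesis unfolding M act_e[OF that(1)] using wedge_contract_single_ex[of "Suc c" I 0] I 3 by simp
      qed
    qed
    show "\<exists>k. k \<noteq> 0 \<and> maction (half_spin R) (f_so i) (Poly_Mapping.single I 1) = Poly_Mapping.single J k"
      if "i \<in> N" "I \<in> Q" "J \<in> Q" "pic_form c (Dv I) (\<alpha> i) = 1" "Dv J = reflect_div i (Dv I)" for i I J
    proof -
      have J: "J = move i I" using Qiff[OF that(2,3,1)] that(5) by simp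
      have p: "pair I i = 1" using that(4) pairing_Dv[OF that(2,1)] by simp
      note i3i = i3[OF that(1)]
      consider "1 \<le> i" "i \<le> c" | "i = Suc c" | "i = Suc (Suc c)" using i3i by blast
      then show ?thesis
      proof cases
        case 1
        then have I: "i \<notin> I" "Suc i \<in> I" using p by (auto simp: pair_def of_bool_def split: if_splits)
        then have "J = insert i (I - {Suc i})" unfolding J using 1 by (auto simp: move_def Transposition.transpose_def split: if_splits)
        then show ?thesis unfolding M act_f[OF that(1)] using wedge_contract_single_ex[of "Suc i" I i] I 1 by simp
      next
        case 2
        then have I: "0 \<notin> I" "Suc c \<notin> I" using p by (auto simp: pair_def of_bool_def split: if_splits)
        then have "J = insert 0 (insert (Suc c) I)" unfolding J using 2 by (auto simp: move_def split: if_splits)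
        then show ?thesis unfolding M act_f[OF that(1)] using ww[of "Suc c" I 0] I 2 by simp
      next
        case 3
        then have I: "0 \<in> I" "Suc c \<notin> I" using p by (auto simp: pair_def of_bool_def split: if_splits)
        then have "J = insert (Suc c) (I - {0})" unfolding J using 3 by (auto simp: move_def Transposition.transpose_def split: if_splits)
        then show ?thesis unfolding M act_f[OF that(1)] using wedge_contract_single_ex[of 0 I "Suc c"] I 3 by simp
      qed
    qed
    show "maction (half_spin R) (e_so i) (Poly_Mapping.single I 1) = 0" if "i \<in> N" "I \<in> Q" "Dv I = Ediv r" for i I
    proof -
      have "{} \<in> Q" by (simp add: Q_def)
      then have "I = {}" using inj_on_eq_iff[OF inj_Dv that(2), of "{}"] that(3) Dv_empty by simp
      then show ?thesis unfolding M act_e[OF that(1)] by (simp add: contract_single)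
    qed
  qed (use M g so_relations minuscule finite_orbit in auto)
qed

end

section \<open>The four families\<close>

lemma nodes_paired:
  "r \<in> {6, 7} \<Longrightarrow> list_all (\<lambda>i. list_ex (\<lambda>xs. pair_list r i xs \<noteq> 0) (exc_list r)) [1..<Suc r]"
  by (elim insertE emptyE; hypsubst; code_simp)

text \<open>So no \<open>h\<^sub>i\<close> acts by zero on the module spanned by the orbit.\<close>

lemma (in del_pezzo) exists_nonzero_pairing:
  assumes "i \<in> N" "b + c \<in> {6, 7}"
  shows "\<exists>D\<in>\<O>. pic_form c D (\<alpha> i) \<noteq> 0"
proof -
  obtain xs where "xs \<in> set (exc_list (b + c))" "pair_list (b + c) i xs \<noteq> 0"
    using bspec[OF nodes_paired[OF assms(2), unfolded list.pred_set], of i] assms(1)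
    unfolding set_upt list_ex_iff by (auto simp: N_eq)
  then show ?thesis using pairing_Dv[OF assms(1), of xs] unfolding orbit by force
qed

lemma hypersimplex_exterior_power:
  fixes n s r :: nat
  assumes "n \<ge> 2" "1 \<le> s" "s \<le> n" and r: "r = n + 2"
  shows "images_are_vertices_of (s + 1) 1 (n + 1) (hypersimplex (r - 1) (r + s))"
    "\<exists>e f h. labelled_module (s + 1) 1 (n + 1) (sl (r + s)) (exterior_power (r - 1) (r + s)) e f h"
    "labelled_module (s + 1) 1 (n + 1) g M e f h \<Longrightarrow> canonical_weight_bijection (s + 1) 1 (n + 1) g M h"
proof -
  have "s * n \<ge> 1 * 2" using assms by (intro mult_le_mono) auto
  then interpret type_A "s + 1" 1 "n + 1"
    using assms by unfold_locales (simp_all add: pic_delta_def algebra_simps)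
  have ra: "r - 1 = n + 1" "r + s = n + 1 + (s + 1)" using r by auto
  show "images_are_vertices_of (s + 1) 1 (n + 1) (hypersimplex (r - 1) (r + s))"
    using polytope_A(1) unfolding hypersimplex_def ra Q_def .
  show "\<exists>e f h. labelled_module (s + 1) 1 (n + 1) (sl (r + s)) (exterior_power (r - 1) (r + s)) e f h"
    unfolding ra by (intro exI) (rule labelled_module_sl)
  show "canonical_weight_bijection (s + 1) 1 (n + 1) g M h" if "labelled_module (s + 1) 1 (n + 1) g M e f h"
    by (rule minuscule_canonical_weight_bijection[OF minuscule polytope_A(2) that])
qed

lemma demicube_half_spin:
  fixes n r :: nat
  assumes "n \<ge> 3" and r: "r = n + 2"
  shows "images_are_vertices_of 2 2 n (demicube r)"
    "\<exists>e f h. labelled_module 2 2 n (so_even r) (half_spin r) e f h"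
    "labelled_module 2 2 n g M e f h \<Longrightarrow> canonical_weight_bijection 2 2 n g M h"
proof -
  interpret type_D 2 2 n
    using assms by unfold_locales (simp_all add: pic_delta_def algebra_simps)
  have r': "r = Suc (Suc n)" using r by simp
  show "images_are_vertices_of 2 2 n (demicube r)"
    using polytope_D(1) unfolding demicube_def r Q_def .
  show "\<exists>e f h. labelled_module 2 2 n (so_even r) (half_spin r) e f h"
    unfolding r' by (intro exI) (rule labelled_module_so)
  show "canonical_weight_bijection 2 2 n g M h" if "labelled_module 2 2 n g M e f h"
    by (rule minuscule_canonical_weight_bijection[OF minuscule polytope_D(2) that])
qed

lemma gosset_2_21_minuscule:
  shows "images_are_vertices_of 2 3 3 gosset_2_21"
    "\<exists>(g :: cmatrix lie_algebra) (M :: (cmatrix, nat \<Rightarrow>\<^sub>0 complex) lie_module) e f h.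
       labelled_module 2 3 3 g M e f h \<and> module_dim M = 27"
    "labelled_module 2 3 3 g' M' e' f' h' \<Longrightarrow> canonical_weight_bijection 2 3 3 g' M' h'"
proof -
  note mins = E6.minuscule and fin = polytope_E6(2)
  show "images_are_vertices_of 2 3 3 gosset_2_21"
    unfolding gosset_2_21_hull by (rule polytope_E6(1))
  have "card (minus_one_divisors 2 3 3) = 27" using E6.card_O card_6 by simp
  moreover have "\<exists>D\<in>minus_one_divisors 2 3 3. pic_form 3 D (simple_root 2 3 3 i) \<noteq> 0" if "i \<in> nodes 2 3 3" for i
    using E6.exists_nonzero_pairing[OF that] by simp
  ultimately show "\<exists>(g :: cmatrix lie_algebra) (M :: (cmatrix, nat \<Rightarrow>\<^sub>0 complex) lie_module) e f h.
       labelled_module 2 3 3 g M e f h \<and> module_dim M = 27"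
    using picard.minuscule_module_exists[OF E6.picard_axioms mins fin] by metis
  show "canonical_weight_bijection 2 3 3 g' M' h'" if "labelled_module 2 3 3 g' M' e' f' h'"
    by (rule E6.minuscule_canonical_weight_bijection[OF mins fin that])
qed

lemma gosset_3_21_minuscule:
  shows "images_are_vertices_of 2 4 3 gosset_3_21"
    "\<exists>(g :: cmatrix lie_algebra) (M :: (cmatrix, nat \<Rightarrow>\<^sub>0 complex) lie_module) e f h.
       labelled_module 2 4 3 g M e f h \<and> module_dim M = 56"
    "labelled_module 2 4 3 g' M' e' f' h' \<Longrightarrow> canonical_weight_bijection 2 4 3 g' M' h'"
proof -
  note mins = E7.minuscule and fin = polytope_E7(2)
  show "images_are_vertices_of 2 4 3 gosset_3_21"
    unfolding gosset_3_21_hull by (rule polytope_E7(1))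
  have "card (minus_one_divisors 2 4 3) = 56" using E7.card_O card_7 by simp
  moreover have "\<exists>D\<in>minus_one_divisors 2 4 3. pic_form 3 D (simple_root 2 4 3 i) \<noteq> 0" if "i \<in> nodes 2 4 3" for i
    using E7.exists_nonzero_pairing[OF that] by simp
  ultimately show "\<exists>(g :: cmatrix lie_algebra) (M :: (cmatrix, nat \<Rightarrow>\<^sub>0 complex) lie_module) e f h.
       labelled_module 2 4 3 g M e f h \<and> module_dim M = 56"
    using picard.minuscule_module_exists[OF E7.picard_axioms mins fin] by metis
  show "canonical_weight_bijection 2 4 3 g' M' h'" if "labelled_module 2 4 3 g' M' e' f' h'"
    by (rule E7.minuscule_canonical_weight_bijection[OF mins fin that])
qed

theorem lemma5p2:
  shows
    "(\<forall>n s r :: nat. n \<ge> 2 \<and> 1 \<le> s \<and> s \<le> n \<and> r = n + 2 \<longrightarrow>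
        images_are_vertices_of (s + 1) 1 (n + 1) (hypersimplex (r - 1) (r + s)) \<and>
        (\<exists>e f h. labelled_module (s + 1) 1 (n + 1) (sl (r + s)) (exterior_power (r - 1) (r + s)) e f h) \<and>
        (\<forall>e f h. labelled_module (s + 1) 1 (n + 1) (sl (r + s)) (exterior_power (r - 1) (r + s)) e f h \<longrightarrow>
           canonical_weight_bijection (s + 1) 1 (n + 1)
             (sl (r + s)) (exterior_power (r - 1) (r + s)) h))
     \<and>
     (\<forall>n r :: nat. n \<ge> 3 \<and> r = n + 2 \<longrightarrow>
        images_are_vertices_of 2 2 n (demicube r) \<and>
        (\<exists>e f h. labelled_module 2 2 n (so_even r) (half_spin r) e f h) \<and>
        (\<forall>e f h. labelled_module 2 2 n (so_even r) (half_spin r) e f h \<longrightarrow>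
           canonical_weight_bijection 2 2 n (so_even r) (half_spin r) h))
     \<and>
     (images_are_vertices_of 2 3 3 gosset_2_21 \<and>
        (\<exists>(e6 :: cmatrix lie_algebra) (J :: (cmatrix, nat \<Rightarrow>\<^sub>0 complex) lie_module) e f h.
           labelled_module 2 3 3 e6 J e f h \<and> module_dim J = 27) \<and>
        (\<forall>(e6 :: 'g::ab_group_add lie_algebra) (J :: ('g, 'v::ab_group_add) lie_module) e f h.
           labelled_module 2 3 3 e6 J e f h \<and> module_dim J = 27 \<longrightarrow>
           canonical_weight_bijection 2 3 3 e6 J h))
     \<and>
     (images_are_vertices_of 2 4 3 gosset_3_21 \<and>
        (\<exists>(e7 :: cmatrix lie_algebra) (W :: (cmatrix, nat \<Rightarrow>\<^sub>0 complex) lie_module) e f h.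
           labelled_module 2 4 3 e7 W e f h \<and> module_dim W = 56) \<and>
        (\<forall>(e7 :: 'g lie_algebra) (W :: ('g, 'v) lie_module) e f h.
           labelled_module 2 4 3 e7 W e f h \<and> module_dim W = 56 \<longrightarrow>
           canonical_weight_bijection 2 4 3 e7 W h))"
  by (intro conjI allI impI; (elim conjE)?; (assumption | rule hypersimplex_exterior_power demicube_half_spin gosset_2_21_minuscule gosset_3_21_minuscule)+)

end
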